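(* Let $0<T_0<1$, $R_0>0$, $\rho_0>0$, and let $F(t,x,z_1,z_2)$ be a complex-valued function on $\Omega=[0,T_0]\times D_{R_0}\times D_{\rho_0}\times D_{\rho_0}$ such that A1) $F$ is continuous on $\Omega$ and holomorphic in $(x,z_1,z_2)\in D_{R_0}\times D_{\rho_0}\times D_{\rho_0}$ for each fixed $t$; A2) $F(0,x,0,0)=0$ on $D_{R_0}$; A3) $\dfrac{\partial F}{\partial z_2}(0,x,0,0)=0$ on $D_{R_0}$. Put $a(t,x)=F(t,x,0,0)$, $\lambda(t,x)=\frac{\partial F}{\partial z_1}(t,x,0,0)$, $b(t,x)=\frac{\partial F}{\partial z_2}(t,x,0,0)$, and consider the equation $$(E)\qquad t\frac{\partial u}{\partial t}=F\Bigl(t,x,u,\frac{\partial u}{\partial x}\Bigr).$$ Suppose that $\mathrm{Re}\,\lambda(0,0)>0$ and that, for some constants $A>0$, $\mu>0$, $\Lambda>0$, $B>0$ and some weight function $\mu(t)$ on $(0,T_0]$, c1) $|a(t,x)|\le A t^{\mu}$ on $(0,T_0]\times D_{R_0}$; c2) $|\lambda(t,x)-\lambda(0,x)|\le \Lambda\,\mu(t)$ on $(0,T_0]\times D_{R_0}$; c3) $|b(t,x)|\le \dfrac{B\,\mu(t)}{|\log t|}$ on $(0,T_0]\times D_{R_0}$. Then: (1) $\mathcal S((E),X_1^{(\mu)})\neq\emptyset$. (2) Fix any $u_0(t,x)\in\mathcal S((E),X_1^{(\mu)})$. Then for any $\psi(x)\in\mathcal O_0$ the equation $(E)$ has a unique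 solution $u(t,x)\in X_1^+$ which is expressed in the form $u(t,x)=u_0(t,x)+w(t,x)$ for some $w(t,x)\in X_1^+$ satisfying $$\lim_{t\to+0}\bigl(t^{-\lambda(0,x)}w(t,x)\bigr)=\psi(x)\quad\text{uniformly near } x=0 .$$ Denote this solution by $U(\psi)(t,x)$. (3) With $u_0(t,x)$ fixed as in (2), $$\mathcal S((E),\mathscr X_1)=\mathcal S((E),X_1^+)=\{U(\psi)\,;\,\psi(x)\in\mathcal O_0\}.$$
   Context: Here $t$ is a real variable and $x,z_1,z_2$ are complex variables; $D_r=\{y\in\mathbb C\,;\,|y|<r\}$; $t^{c}=\exp(c\log t)$ for $t>0$, $c\in\mathbb C$. A weight function on $(0,T_0]$ is an increasing, continuous, positive-valued function $\mu(t)$ on $(0,T_0]$ with $\int_0^{T_0}\frac{\mu(\tau)}{\tau}\,d\tau<\infty$ (so $\mu(t)\to0$ as $t\to+0$). The exponent $\mu>0$ in $t^\mu$ is a number, unrelated to the function $\mu(t)$. For $W=[0,T]\times D_R$ or $W=(0,T]\times D_R$: $X_0(W)$ is the set of all $f(t,x)\in C^0(W)$ holomorphic in $x$ for each fixed $t$; $X_1(W)$ is the set of all $f\in C^1(W\cap\{0<t<T\})$ with $f\in X_0(W)$ and $t\,\partial f/\partial t\in X_0(W)$ (understood by continuous extension to the endpoints in $t$). For $d>0$, $X_1^d([0,T]\times D_R)$ is the set of all $u\in X_1([0,T]\times D_R)$ with $\max\{|u(t,x)|,|(\partial u/\partial x)(t,x)|\}\le Ct^d$ on $[0,T]\times D_R$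 for some $C>0$. $X_1^d=\varinjlim_{(T,R)\to(0,0)}X_1^d([0,T]\times D_R)$ is the set of germs of such functions: two functions are identified if they agree on $[0,\epsilon]\times D_\delta$ for some $\epsilon,\delta>0$. $X_1^+=\bigcup_{d>0}X_1^d$, and for $d>0$, $X_1^{(d)}=\bigcap_{0<a<d}X_1^a$. $\mathscr X_1([0,T]\times D_R)$ is the set of all $u\in X_1([0,T]\times D_R)$ satisfying $$\varlimsup_{\rho\to+0}\Bigl[\lim_{\sigma\to+0}\Bigl(\frac1{\rho^2}\sup_{(0,\sigma)\times D_\rho}|u(t,x)|\Bigr)\Bigr]=0,$$ and $\mathscr X_1=\varinjlim_{(T,R)\to(0,0)}\mathscr X_1([0,T]\times D_R)$ (germs, with the same identification). $\mathcal O_0$ is the set of germs of holomorphic functions of $x$ at $x=0$. For $X=X_1^{(\mu)}$, $X_1^+$ or $\mathscr X_1$, $\mathcal S((E),X)$ is the set of all (germs of) solutions of $(E)$ belonging to $X$, i.e. $u\in X$ satisfying the equation for $t>0$ small and $x$ near $0$. *)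

theory Defs
  imports "HOL-Complex_Analysis.Complex_Analysis"
begin

text \<open>Functions on subsets of \<open>\<real> \<times> \<complex>\<close> are total curried functions; the definitions below only
  inspect their values on the stated domains.\<close>

type_synonym txfun = "real \<Rightarrow> complex \<Rightarrow> complex"

definition dt :: "txfun \<Rightarrow> txfun" where
  "dt u t x = vector_derivative (\<lambda>s. u s x) (at t)"

definition dx :: "txfun \<Rightarrow> txfun" where
  "dx u t x = deriv (u t) x"

text \<open>Joint holomorphy in three variables: complex Frechet differentiability, i.e. the derivative
  is complex linear.\<close>

definition holomorphic3_on ::
  "(complex \<Rightarrow> complex \<Rightarrow> complex \<Rightarrow> complex) \<Rightarrow> (complex \<times> complex \<times> complex) set \<Rightarrow> bool" where
  "holomorphic3_on f S \<longleftrightarrow>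
     (\<forall>p\<in>S. \<exists>a b c. ((\<lambda>(x, y, z). f x y z) has_derivative (\<lambda>(h, k, l). a * h + b * k + c * l))
                      (at p within S))"

text \<open>\<open>increasing\<close> is read as \<open>nondecreasing\<close>.\<close>

definition weight_function :: "real \<Rightarrow> (real \<Rightarrow> real) \<Rightarrow> bool" where
  "weight_function T0 m \<longleftrightarrow>
     mono_on {0<..T0} m \<and> continuous_on {0<..T0} m \<and> (\<forall>t\<in>{0<..T0}. 0 < m t) \<and>
     set_integrable lborel {0<..T0} (\<lambda>\<tau>. m \<tau> / \<tau>)"

text \<open>Continuous differentiability in the real sense on the open set \<open>S\<close>.\<close>

definition C1_on :: "(real \<times> complex) set \<Rightarrow> txfun \<Rightarrow> bool" where
  "C1_on S f \<longleftrightarrow>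
     (\<exists>f' :: real \<times> complex \<Rightarrow> (real \<times> complex) \<Rightarrow>\<^sub>L complex.
        (\<forall>p\<in>S. ((\<lambda>(t, x). f t x) has_derivative blinfun_apply (f' p)) (at p)) \<and>
        continuous_on S f')"

definition X0 :: "real \<Rightarrow> real \<Rightarrow> txfun set" where
  "X0 T R = {f. continuous_on ({0..T} \<times> ball 0 R) (\<lambda>(t, x). f t x) \<and>
                (\<forall>t\<in>{0..T}. f t holomorphic_on ball 0 R)}"

text \<open>The function \<open>g\<close> is the (unique) continuous extension of \<open>t \<partial>f/\<partial>t\<close> to the endpoints in \<open>t\<close>.\<close>

definition X1 :: "real \<Rightarrow> real \<Rightarrow> txfun set" where
  "X1 T R = {f \<in> X0 T R. C1_on ({0<..<T} \<times> ball 0 R) f \<and>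
               (\<exists>g \<in> X0 T R. \<forall>t\<in>{0<..<T}. \<forall>x\<in>ball 0 R. g t x = of_real t * dt f t x)}"

text \<open>Note that \<open>0 powr d = 0\<close>, so that the bound includes vanishing at \<open>t = 0\<close>.\<close>

definition X1_pow :: "real \<Rightarrow> real \<Rightarrow> real \<Rightarrow> txfun set" where
  "X1_pow d T R = {u \<in> X1 T R. \<exists>C>0. \<forall>t\<in>{0..T}. \<forall>x\<in>ball 0 R.
                      max (cmod (u t x)) (cmod (dx u t x)) \<le> C * t powr d}"

text \<open>The supremum is taken in the extended reals, where the inner limit always exists by
  monotonicity in \<open>\<sigma>\<close>.  Only small \<open>\<sigma>\<close> and \<open>\<rho>\<close> matter, so values of \<open>u\<close> outside
  \<open>[0,T] \<times> D_R\<close> are irrelevant.\<close>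

definition scrX1 :: "real \<Rightarrow> real \<Rightarrow> txfun set" where
  "scrX1 T R = {u \<in> X1 T R.
     Limsup (at_right 0) (\<lambda>\<rho>::real.
       Lim (at_right 0) (\<lambda>\<sigma>::real.
         ereal (1 / \<rho>\<^sup>2) * (SUP (t, x) \<in> {0<..<\<sigma>} \<times> ball 0 \<rho>. ereal (cmod (u t x))))) = 0}"

subsection \<open>Germs\<close>

definition tx_eq :: "txfun \<Rightarrow> txfun \<Rightarrow> bool" where
  "tx_eq u v \<longleftrightarrow> (\<exists>\<epsilon>>0. \<exists>\<delta>>0. \<forall>t\<in>{0..\<epsilon>}. \<forall>x\<in>ball 0 \<delta>. u t x = v t x)"

lemma tx_eq_combine:
  assumes "tx_eq u u'" and "tx_eq v v'"
  shows "\<exists>\<epsilon>>0. \<exists>\<delta>>0. \<forall>t\<in>{0..\<epsilon>}. \<forall>x\<in>ball 0 \<delta>. u t x = u' t x \<and> v t x = v' t x"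
proof -
  obtain e1 d1 where 1: "e1 > 0" "d1 > 0" "\<forall>t\<in>{0..e1}. \<forall>x\<in>ball 0 d1. u t x = u' t x"
    using assms(1) unfolding tx_eq_def by blast
  obtain e2 d2 where 2: "e2 > 0" "d2 > 0" "\<forall>t\<in>{0..e2}. \<forall>x\<in>ball 0 d2. v t x = v' t x"
    using assms(2) unfolding tx_eq_def by blast
  show ?thesis
    by (rule exI[of _ "min e1 e2"], intro conjI, use 1 2 in simp,
        rule exI[of _ "min d1 d2"]) (use 1 2 in auto)
qed

quotient_type txgerm = txfun / tx_eq
proof (rule equivpI)
  show "reflp tx_eq"
    by (rule reflpI) (auto simp: tx_eq_def intro!: exI[of _ 1])
  show "symp tx_eq"
    by (rule sympI) (unfold tx_eq_def, metis)
  show "transp tx_eq"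
  proof (rule transpI)
    fix u v w assume "tx_eq u v" "tx_eq v w"
    from tx_eq_combine[OF this] show "tx_eq u w"
      unfolding tx_eq_def by metis
  qed
qed

abbreviation germ :: "txfun \<Rightarrow> txgerm" where
  "germ \<equiv> abs_txgerm"

instantiation txgerm :: plus
begin

lift_definition plus_txgerm :: "txgerm \<Rightarrow> txgerm \<Rightarrow> txgerm" is "\<lambda>u v t x. u t x + v t x"
proof -
  fix u u' v v' assume "tx_eq u u'" "tx_eq v v'"
  from tx_eq_combine[OF this] show "tx_eq (\<lambda>t x. u t x + v t x) (\<lambda>t x. u' t x + v' t x)"
    unfolding tx_eq_def by metis
qed

instance ..

end

definition x_eq :: "(complex \<Rightarrow> complex) \<Rightarrow> (complex \<Rightarrow> complex) \<Rightarrow> bool" where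
  "x_eq \<phi> \<psi> \<longleftrightarrow> (\<exists>\<delta>>0. \<forall>x\<in>ball 0 \<delta>. \<phi> x = \<psi> x)"

quotient_type xgerm = "complex \<Rightarrow> complex" / x_eq
proof (rule equivpI)
  show "reflp x_eq"
    by (rule reflpI) (auto simp: x_eq_def intro!: exI[of _ 1])
  show "symp x_eq"
    by (rule sympI) (unfold x_eq_def, metis)
  show "transp x_eq"
  proof (rule transpI)
    fix u v w assume "x_eq u v" "x_eq v w"
    then obtain d1 d2 where "d1 > 0" "d2 > 0"
      "\<forall>x\<in>ball 0 d1. u x = v x" "\<forall>x\<in>ball 0 d2. v x = w x"
      unfolding x_eq_def by blast
    then show "x_eq u w"
      unfolding x_eq_def by (intro exI[of _ "min d1 d2"]) auto
  qed
qed

definition O0 :: "xgerm set" where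
  "O0 = {abs_xgerm \<psi> |\<psi>. \<exists>r>0. \<psi> holomorphic_on ball 0 r}"

definition X1_germs :: "real \<Rightarrow> txgerm set" where
  "X1_germs d = {germ u |u. \<exists>T>0. \<exists>R>0. u \<in> X1_pow d T R}"

definition X1_plus :: "txgerm set" where
  "X1_plus = (\<Union>d\<in>{0<..}. X1_germs d)"

definition X1_paren :: "real \<Rightarrow> txgerm set" where
  "X1_paren d = (\<Inter>a\<in>{0<..<d}. X1_germs a)"

definition scrX1_germs :: "txgerm set" where
  "scrX1_germs = {germ u |u. \<exists>T>0. \<exists>R>0. u \<in> scrX1 T R}"

subsection \<open>The equation\<close>

type_synonym rhs = "real \<Rightarrow> complex \<Rightarrow> complex \<Rightarrow> complex \<Rightarrow> complex"

definition Omega :: "real \<Rightarrow> real \<Rightarrow> real \<Rightarrow> (real \<times> complex \<times> complex \<times> complex) set" where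
  "Omega T0 R0 \<rho>0 = {0..T0} \<times> ball 0 R0 \<times> ball 0 \<rho>0 \<times> ball 0 \<rho>0"

definition coeff_a :: "rhs \<Rightarrow> txfun" where
  "coeff_a F t x = F t x 0 0"

definition coeff_lambda :: "rhs \<Rightarrow> txfun" where
  "coeff_lambda F t x = deriv (\<lambda>z. F t x z 0) 0"

definition coeff_b :: "rhs \<Rightarrow> txfun" where
  "coeff_b F t x = deriv (\<lambda>z. F t x 0 z) 0"

text \<open>Since \<open>F\<close> is only meaningful on \<open>Omega T0 R0 \<rho>0\<close>, being a solution includes that the arguments
  of \<open>F\<close> lie there.  In \<open>solutions\<close>, membership in \<open>X\<close> provides the differentiability which
  makes \<open>dt\<close> and \<open>dx\<close> meaningful.\<close>

definition solves :: "rhs \<Rightarrow> real \<Rightarrow> real \<Rightarrow> real \<Rightarrow> txfun \<Rightarrow> bool" where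
  "solves F T0 R0 \<rho>0 u \<longleftrightarrow>
     (\<exists>\<epsilon>>0. \<exists>\<delta>>0. \<forall>t\<in>{0<..<\<epsilon>}. \<forall>x\<in>ball 0 \<delta>.
        (t, x, u t x, dx u t x) \<in> Omega T0 R0 \<rho>0 \<and>
        of_real t * dt u t x = F t x (u t x) (dx u t x))"

definition solutions :: "rhs \<Rightarrow> real \<Rightarrow> real \<Rightarrow> real \<Rightarrow> txgerm set \<Rightarrow> txgerm set" where
  "solutions F T0 R0 \<rho>0 X = {g \<in> X. \<exists>u. g = germ u \<and> solves F T0 R0 \<rho>0 u}"

definition has_leading_term :: "rhs \<Rightarrow> txgerm \<Rightarrow> xgerm \<Rightarrow> bool" where
  "has_leading_term F w \<psi> \<longleftrightarrow>
     (\<exists>w' \<psi>'. w = germ w' \<and> \<psi> = abs_xgerm \<psi>' \<and>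
        (\<exists>\<delta>>0. uniform_limit (ball 0 \<delta>)
           (\<lambda>t x. complex_of_real t powr (- coeff_lambda F 0 x) * w' t x) \<psi>' (at_right 0)))"

definition is_U :: "rhs \<Rightarrow> real \<Rightarrow> real \<Rightarrow> real \<Rightarrow> txgerm \<Rightarrow> xgerm \<Rightarrow> txgerm \<Rightarrow> bool" where
  "is_U F T0 R0 \<rho>0 u0 \<psi> u \<longleftrightarrow>
     u \<in> solutions F T0 R0 \<rho>0 X1_plus \<and>
     (\<exists>w\<in>X1_plus. u = u0 + w \<and> has_leading_term F w \<psi>)"

definition U :: "rhs \<Rightarrow> real \<Rightarrow> real \<Rightarrow> real \<Rightarrow> txgerm \<Rightarrow> xgerm \<Rightarrow> txgerm" where
  "U F T0 R0 \<rho>0 u0 \<psi> = (THE u. is_U F T0 R0 \<rho>0 u0 \<psi> u)"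

end

theory Submission
  imports Defs
begin

text \<open>Solutions are sought as \<open>u = u\<^sub>0 + t\<^sup>\<nu> v\<close>.  Dividing by \<open>t\<^sup>\<nu>\<close> turns the equation into an integral
  equation for \<open>v\<close> whose right-hand side is Lipschitz in \<open>(v, \<partial>v/\<partial>x)\<close> with a constant integrable in \<open>t\<close>:
  the logarithm produced by \<open>\<partial>(t\<^sup>\<nu>)/\<partial>x\<close> is compensated by the factor \<open>1/\<bar>log t\<bar>\<close> in hypothesis (c3).
  It is solved by Picard iteration on shrinking domains.  A constant \<open>\<nu> = a < \<mu>\<close> and \<open>v(0) = 0\<close> give a first
  solution, \<open>\<nu> = \<lambda>(0,x)\<close> and \<open>v(0) = \<psi>\<close> all the others.  Conversely, for two solutions \<open>u\<close>, \<open>u'\<close> the function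
  \<open>t\<^sup>-\<^sup>\<lambda> (u - u')\<close> satisfies a linear differential inequality with integrable coefficient; hence it has a
  holomorphic limit at \<open>t = 0\<close> and vanishes if this limit does.  A solution in the class with vanishing
  \<open>limsup\<close> has initial value \<open>\<phi> = o(x\<^sup>2)\<close> solving \<open>F(0,x,\<phi>,\<phi>') = 0\<close>, so \<open>\<phi> = 0\<close> by comparing orders of
  vanishing; integration along characteristics then shows that it decays like a power of \<open>t\<close>.\<close>

subsection \<open>Functions evolving in time, holomorphic in space\<close>

text \<open>The right-hand side contains the x-derivative of the unknown, so iteration in a space
  over a fixed disc loses a derivative at each step. Holomorphy repays it at the price of a
  shrinking disc, and the total shrinkage is finite because the Lipschitz rate is integrable at t =
  0. The linear part (\<lambda> - \<nu>)/t is not integrable; it is removed by the integrating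
  factor t^(\<lambda> - \<nu>), which is harmless only if its modulus does not increase in the
  direction of integration. For \<nu> = a the sign of Re \<lambda> - a decides this direction:
  forwards from t = 0 if negative, backwards from a positive time if positive. Hence a must differ
  from Re \<lambda>(0,0). A single solution must serve all exponents below \<mu>: if \<mu> \<le> Re
  \<lambda>(0,0), decay along characteristics gives this; otherwise it follows from uniqueness among
  solutions decaying faster than t to the power Re \<lambda>(0,0). No characteristic curve is ever
  integrated: a first-contact argument needs one direction at one point only.\<close>

lemma Cauchy_deriv_bound:
  assumes hol: "f holomorphic_on ball x d" and d: "0 < d"
    and bd: "\<And>y. y \<in> ball x d \<Longrightarrow> cmod (f y) \<le> M"
  shows "cmod (deriv f x) \<le> M / d"
proof -
  \<comment> \<open>Only the open disc is given, so Cauchy's inequality is used on circles of radius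
    r < d, and r tends to d at the end.\<close>
  have "cmod (deriv f x) * r \<le> M" if r: "0 < r" "r < d" for r
  proof -
    have sub: "cball x r \<subseteq> ball x d" using r by auto
    have "cmod ((deriv ^^ 1) f x) \<le> fact 1 * M / r ^ 1"
    proof (rule Cauchy_inequality)
      show "f holomorphic_on ball x r"
        using hol by (rule holomorphic_on_subset) (use r in auto)
      show "continuous_on (cball x r) f"
        using hol sub by (meson holomorphic_on_imp_continuous_on holomorphic_on_subset)
      show "\<And>y. cmod (x - y) = r \<Longrightarrow> cmod (f y) \<le> M"
        using bd r by (auto simp: dist_norm)
    qed (use r in auto)
    then show ?thesis using r by (simp add: field_simps)
  qed
  moreover have "0 \<le> M" using bd[of x] d by (meson centre_in_ball norm_ge_zero order_trans)
  ultimately have "cmod (deriv f x) * d \<le> M"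
  proof -
    assume *: "\<And>r. 0 < r \<Longrightarrow> r < d \<Longrightarrow> cmod (deriv f x) * r \<le> M"
    have "((\<lambda>r. cmod (deriv f x) * r) \<longlongrightarrow> cmod (deriv f x) * d) (at_left d)"
      by (intro tendsto_intros)
    moreover have "eventually (\<lambda>r. cmod (deriv f x) * r \<le> M) (at_left d)"
      using * d by (auto simp: eventually_at_left_field intro!: exI[of _ 0])
    ultimately show ?thesis
      by (intro tendsto_upperbound) (auto simp: trivial_limit_at_left_real)
  qed
  then show ?thesis using d by (simp add: field_simps)
qed

text \<open>For nearby parameters the functions are uniformly close on a compact disc, and Cauchy's
  estimate applied to their difference carries this closeness over to the derivatives.\<close>

lemma continuous_on_deriv_param:
  fixes g :: "'p::metric_space \<Rightarrow> complex \<Rightarrow> complex"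
  assumes S: "open S" and cont: "continuous_on (P \<times> S) (\<lambda>(p,x). g p x)"
    and hol: "\<And>p. p \<in> P \<Longrightarrow> g p holomorphic_on S"
  shows "continuous_on (P \<times> S) (\<lambda>(p,x). deriv (g p) x)"
proof (clarsimp simp: continuous_on_iff)
  fix p x and e :: real
  assume p: "p \<in> P" and x: "x \<in> S" and e: "0 < e"
  obtain r' where "0 < r'" "cball x r' \<subseteq> S"
    using S x by (auto simp: open_contains_cball)
  then obtain r where r: "0 < r" "cball x (2*r) \<subseteq> S"
    using that[of "r'/2"] by simp
  have "continuous_on S (deriv (g p))"
    using hol[OF p] S by (intro holomorphic_on_imp_continuous_on holomorphic_deriv)
  then obtain d1 where d1: "d1 > 0" "\<And>y. y \<in> S \<Longrightarrow> dist y x < d1 \<Longrightarrow> dist (deriv (g p) y) (deriv (g p) x) < e/2"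
    using e x unfolding continuous_on_iff by (metis half_gt_zero)
  \<comment> \<open>The parameter set is an arbitrary metric space, so compactness is available only
    in x. A failing sequence has parameters tending to p, and its points in the closed disc have a
    convergent subsequence; joint continuity at the limit gives the contradiction.\<close>
  have "\<exists>d>0. \<forall>q\<in>P. dist q p < d \<longrightarrow> (\<forall>y\<in>cball x (2*r). cmod (g q y - g p y) < e/4 * r)"
  proof (rule ccontr)
    assume "\<not> ?thesis"
    then have "\<forall>n. \<exists>q y. q \<in> P \<and> dist q p < inverse (real (Suc n)) \<and> y \<in> cball x (2*r) \<and> cmod (g q y - g p y) \<ge> e/4*r"
      by (metis inverse_positive_iff_positive not_less of_nat_0_less_iff zero_less_Suc)
    then obtain q y where q: "\<And>n. q n \<in> P" "\<And>n. dist (q n) p < inverse (real (Suc n))"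
      and y: "\<And>n. y n \<in> cball x (2*r)" and big: "\<And>n. cmod (g (q n) (y n) - g p (y n)) \<ge> e/4*r"
      by metis
    obtain l s where l: "l \<in> cball x (2*r)" "strict_mono s" "(y \<circ> s) \<longlonglongrightarrow> l"
      using compact_cball[of x "2*r"] y unfolding compact_def by meson
    have qs: "(q \<circ> s) \<longlonglongrightarrow> p"
    proof (rule metric_LIMSEQ_I)
      fix \<epsilon> :: real assume "0 < \<epsilon>"
      then obtain N where N: "inverse (real (Suc N)) < \<epsilon>" using reals_Archimedean by blast
      show "\<exists>no. \<forall>n\<ge>no. dist ((q \<circ> s) n) p < \<epsilon>"
      proof (intro exI allI impI)
        fix n assume "n \<ge> N"
        then have "s n \<ge> N" using seq_suble[OF l(2), of n] by linarith
        then have "inverse (real (Suc (s n))) \<le> inverse (real (Suc N))" by (simp add: le_imp_inverse_le)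
        then show "dist ((q \<circ> s) n) p < \<epsilon>" using q(2)[of "s n"] N by (simp; linarith)
      qed
    qed
    have lS: "l \<in> S" using l r by auto
    have yS: "y n \<in> S" for n using y r by auto
    have 1: "(\<lambda>n. g (q (s n)) (y (s n))) \<longlonglongrightarrow> g p l"
      using continuous_on_tendsto_compose[OF cont tendsto_Pair[OF qs l(3)]] p lS q yS
      by (auto simp: o_def)
    have 2: "(\<lambda>n. g p (y (s n))) \<longlonglongrightarrow> g p l"
      using continuous_on_tendsto_compose[OF cont tendsto_Pair[OF tendsto_const l(3)], of p] p lS q yS
      by (auto simp: o_def)
    have "(\<lambda>n. cmod (g (q (s n)) (y (s n)) - g p (y (s n)))) \<longlonglongrightarrow> cmod (g p l - g p l)"
      by (intro tendsto_norm tendsto_diff 1 2)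
    then have "e/4*r \<le> cmod (g p l - g p l)"
      by (rule LIMSEQ_le_const) (use big in auto)
    then show False using e r by (simp add: mult_le_0_iff)
  qed
  then obtain d2 where d2: "d2 > 0"
    "\<And>q y. q \<in> P \<Longrightarrow> dist q p < d2 \<Longrightarrow> y \<in> cball x (2*r) \<Longrightarrow> cmod (g q y - g p y) < e/4*r" by blast
  show "\<exists>d>0. \<forall>a\<in>P. \<forall>b\<in>S. dist (a, b) (p, x) < d \<longrightarrow> dist (deriv (g a) b) (deriv (g p) x) < e"
  proof (intro exI[of _ "min (min d1 d2) r"] conjI ballI impI)
    show "0 < min (min d1 d2) r" using d1 d2 r by auto
    fix a b assume a: "a \<in> P" and b: "b \<in> S" and ab: "dist (a, b) (p, x) < min (min d1 d2) r"
    have da: "dist a p < d2" "dist b x < d1" "dist b x < r"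
      using ab dist_fst_le[of "(a,b)" "(p,x)"] dist_snd_le[of "(a,b)" "(p,x)"] by auto
    have sub: "ball b r \<subseteq> cball x (2*r)"
    proof
      fix z assume "z \<in> ball b r"
      then show "z \<in> cball x (2*r)"
        using da(3) dist_triangle[of x z b] by (auto simp: dist_commute)
    qed
    have hd: "(\<lambda>y. g a y - g p y) holomorphic_on ball b r"
      using hol[OF a] hol[OF p] sub r by (intro holomorphic_intros) (auto elim!: holomorphic_on_subset)
    have "cmod (deriv (\<lambda>y. g a y - g p y) b) \<le> (e/4*r) / r"
      using d2(2)[OF a da(1)] sub by (intro Cauchy_deriv_bound[OF hd] r less_imp_le) auto
    moreover have "deriv (\<lambda>y. g a y - g p y) b = deriv (g a) b - deriv (g p) b"
      using hol[OF a] hol[OF p] b S by (intro deriv_diff) (auto simp: holomorphic_on_imp_differentiable_at)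
    ultimately have "dist (deriv (g a) b) (deriv (g p) b) \<le> e/4"
      using r by (simp add: dist_norm)
    moreover have "dist (deriv (g p) b) (deriv (g p) x) < e/2" using d1(2)[OF b da(2)] .
    ultimately show "dist (deriv (g a) b) (deriv (g p) x) < e"
      using dist_triangle[of "deriv (g a) b" "deriv (g p) x" "deriv (g p) b"] e by linarith
  qed
qed

lemma continuous_on_slice:
  assumes "continuous_on (A \<times> S) (\<lambda>(t,x). g t x)" "x \<in> S" "B \<subseteq> A"
  shows "continuous_on B (\<lambda>t. g t x)"
proof -
  have "continuous_on B (\<lambda>t. case (t,x) of (t,x) \<Rightarrow> g t x)"
    by (rule continuous_on_compose2[OF assms(1)]) (use assms in \<open>auto intro!: continuous_intros\<close>)
  then show ?thesis by simp
qed

lemma continuous_on_swap: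
  assumes "continuous_on (A \<times> S) (\<lambda>(t,x). g t x)" "B \<subseteq> A" "T \<subseteq> S"
  shows "continuous_on (T \<times> B) (\<lambda>(x,t). g t x)"
proof -
  have "continuous_on (T \<times> B) (\<lambda>p. case (snd p, fst p) of (t,x) \<Rightarrow> g t x)"
    by (rule continuous_on_compose2[OF assms(1)]) (use assms in \<open>auto intro!: continuous_intros\<close>)
  then show ?thesis by (simp add: split_beta')
qed

text \<open>The time derivative \<open>g\<close> is an argument, so that a differential equation is
  stated by putting its right-hand side in place of \<open>g\<close>; joint continuity and
  holomorphy of that right-hand side are then part of the claim. The time interval is arbitrary,
  which admits reflected time.\<close>

definition evolves :: "real \<Rightarrow> real \<Rightarrow> real \<Rightarrow> txfun \<Rightarrow> txfun \<Rightarrow> bool" where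
  "evolves a b R u g \<longleftrightarrow>
     continuous_on ({a<..<b} \<times> ball 0 R) (\<lambda>(t, x). u t x) \<and>
     (\<forall>t\<in>{a<..<b}. u t holomorphic_on ball 0 R) \<and>
     continuous_on ({a<..<b} \<times> ball 0 R) (\<lambda>(t, x). g t x) \<and>
     (\<forall>t\<in>{a<..<b}. g t holomorphic_on ball 0 R) \<and>
     (\<forall>t\<in>{a<..<b}. \<forall>x\<in>ball 0 R. ((\<lambda>s. u s x) has_vector_derivative g t x) (at t))"

text \<open>Existence of the t-derivative at the one point suffices, because the other partial
  derivative, the one in x, is jointly continuous.\<close>

lemma has_derivative_tx:
  assumes t: "t \<in> {a<..<b}" and x: "x \<in> ball 0 R"
    and hol: "\<And>t. t \<in> {a<..<b} \<Longrightarrow> u t holomorphic_on ball 0 R"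
    and cont: "continuous_on ({a<..<b} \<times> ball 0 R) (\<lambda>(t, x). u t x)"
    and der: "((\<lambda>s. u s x) has_vector_derivative g t x) (at t)"
  shows "((\<lambda>(t,x). u t x) has_derivative (\<lambda>(h,k). h *\<^sub>R g t x + deriv (u t) x * k)) (at (t,x))"
proof -
  have "((\<lambda>(t,x). u t x) has_derivative (\<lambda>(h,k). h *\<^sub>R g t x + blinfun_mult_right (deriv (u t) x) k))
    (at (t,x) within {a<..<b} \<times> ball 0 R)"
  proof (rule has_derivative_partialsI[where fy="\<lambda>t x. blinfun_mult_right (deriv (u t) x)"])
    show "((\<lambda>s. u s x) has_derivative (\<lambda>h. h *\<^sub>R g t x)) (at t within {a<..<b})"
      using der by (auto simp: has_vector_derivative_def intro: has_derivative_at_withinI)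
    show "((\<lambda>y. u s y) has_derivative blinfun_apply (blinfun_mult_right (deriv (u s) y))) (at y within ball 0 R)"
      if "s \<in> {a<..<b}" "y \<in> ball 0 R" for s y
      using holomorphic_derivI[OF hol[OF that(1)] open_ball that(2)]
      by (auto simp: has_field_derivative_def)
    have "continuous_on ({a<..<b} \<times> ball 0 R) (\<lambda>(t, x). deriv (u t) x)"
      by (rule continuous_on_deriv_param[OF open_ball cont hol])
    then have "continuous_on ({a<..<b} \<times> ball 0 R) (\<lambda>p. blinfun_mult_right (case p of (t, x) \<Rightarrow> deriv (u t) x))"
      by (intro bounded_linear.continuous_on[OF bounded_linear_blinfun_mult_right])
    then show "continuous (at (t,x) within {a<..<b} \<times> ball 0 R) (\<lambda>(t, x). blinfun_mult_right (deriv (u t) x))"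
      using t x by (simp add: continuous_on_eq_continuous_within split_beta')
  qed (use x in auto)
  moreover have "at (t,x) within {a<..<b} \<times> ball 0 R = at (t,x)"
    using t x by (intro at_within_open) (auto intro: open_Times)
  ultimately show ?thesis by simp
qed

text \<open>Differentiation along a segment with velocity (s, c) in space-time. To first order this
  segment replaces a characteristic curve in the comparison arguments.\<close>

lemma evolves_path:
  assumes ev: "evolves a b R u g" and t: "t \<in> {a<..<b}" and x: "x \<in> ball 0 R"
  shows "((\<lambda>h. u (t + s * h) (x + of_real h * c)) has_vector_derivative
           (of_real s * g t x + c * deriv (u t) x)) (at 0 within X)"
proof -
  have D: "((\<lambda>(t,x). u t x) has_derivative (\<lambda>(h,k). h *\<^sub>R g t x + deriv (u t) x * k)) (at (t,x))"
    using ev t x by (intro has_derivative_tx[of t a b x R]) (auto simp: evolves_def)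
  have "((\<lambda>h. (t + s*h, x + of_real h * c)) has_derivative (\<lambda>h. (s*h, of_real h * c))) (at 0 within X)"
    by (auto intro!: derivative_eq_intros)
  moreover have "((\<lambda>(t,x). u t x) has_derivative (\<lambda>(h,k). h *\<^sub>R g t x + deriv (u t) x * k)) 
     (at ((\<lambda>h. (t + s*h, x + of_real h * c)) 0))"
    using D by simp
  ultimately have "((\<lambda>h. case (t + s*h, x + of_real h * c) of (t,x) \<Rightarrow> u t x) has_derivative
     (\<lambda>h. case (s*h, of_real h * c) of (h,k) \<Rightarrow> h *\<^sub>R g t x + deriv (u t) x * k)) (at 0 within X)"
    by (rule has_derivative_compose)
  then show ?thesis
    unfolding has_vector_derivative_def prod.case
    by (rule has_derivative_eq_rhs) (simp add: fun_eq_iff scaleR_conv_of_real distrib_left mult_ac)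
qed

text \<open>The mixed derivatives commute because the identity \<open>u b - u a = \<integral> g\<close> may be differentiated
  in \<open>x\<close> under the integral sign.\<close>

lemma evolves_deriv:
  assumes ev: "evolves a b R u g"
  shows "evolves a b R (\<lambda>t. deriv (u t)) (\<lambda>t. deriv (g t))"
proof -
  have cu: "continuous_on ({a<..<b} \<times> ball 0 R) (\<lambda>(t, x). u t x)"
    and hu: "\<And>t. t \<in> {a<..<b} \<Longrightarrow> u t holomorphic_on ball 0 R"
    and cg: "continuous_on ({a<..<b} \<times> ball 0 R) (\<lambda>(t, x). g t x)"
    and hg: "\<And>t. t \<in> {a<..<b} \<Longrightarrow> g t holomorphic_on ball 0 R"
    and der: "\<And>t x. t \<in> {a<..<b} \<Longrightarrow> x \<in> ball 0 R \<Longrightarrow> ((\<lambda>s. u s x) has_vector_derivative g t x) (at t)"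
    using ev by (auto simp: evolves_def)
  have cdg: "continuous_on ({a<..<b} \<times> ball 0 R) (\<lambda>(t, x). deriv (g t) x)"
    by (rule continuous_on_deriv_param[OF open_ball cg hg])
  have "((\<lambda>s. deriv (u s) x) has_vector_derivative deriv (g t) x) (at t)"
    if t: "t \<in> {a<..<b}" and x: "x \<in> ball 0 R" for t x
  proof -
    obtain c d where cd: "a < c" "c < t" "t < d" "d < b" using t by (meson dense greaterThanLessThan_iff)
    have sub: "{c..d} \<subseteq> {a<..<b}" using cd by auto
    have ig: "(\<lambda>s. g s y) integrable_on {c..s}" if "s \<in> {c..d}" "y \<in> ball 0 R" for s y
    proof (rule integrable_continuous_real, rule continuous_on_slice[OF cg that(2)])
      show "{c..s} \<subseteq> {a<..<b}" using that(1) cd by (simp add: subset_iff)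
    qed
    have eq: "deriv (u s) x = deriv (u c) x + integral {c..s} (\<lambda>\<tau>. deriv (g \<tau>) x)" if s: "s \<in> {c..d}" for s
    proof -
      have u: "u s y = u c y + integral {c..s} (\<lambda>\<tau>. g \<tau> y)" if "y \<in> ball 0 R" for y
      proof -
        have "((\<lambda>\<tau>. g \<tau> y) has_integral u s y - u c y) {c..s}"
        proof (rule fundamental_theorem_of_calculus)
          show "((\<lambda>\<tau>. u \<tau> y) has_vector_derivative g \<tau> y) (at \<tau> within {c..s})" if "\<tau> \<in> {c..s}" for \<tau>
            by (rule has_vector_derivative_at_within[OF der]) (use that s cd \<open>y \<in> ball 0 R\<close> in auto)
        qed (use s in simp)
        then show ?thesis by (simp add: integral_unique)
      qed
      have "((\<lambda>y. integral (cbox c s) (\<lambda>\<tau>. g \<tau> y)) has_field_derivative integral (cbox c s) (\<lambda>\<tau>. deriv (g \<tau>) x)) (at x within ball 0 R)"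
      proof (rule leibniz_rule_field_derivative)
        show "((\<lambda>y. g \<tau> y) has_field_derivative deriv (g \<tau>) y) (at y within ball 0 R)" if "y \<in> ball 0 R" "\<tau> \<in> cbox c s" for y \<tau>
          by (rule has_field_derivative_at_within, rule holomorphic_derivI[OF hg]) (use that s cd in auto)
        show "(\<lambda>\<tau>. g \<tau> y) integrable_on cbox c s" if "y \<in> ball 0 R" for y
          using ig s that by simp
        show "continuous_on (ball 0 R \<times> cbox c s) (\<lambda>(x, t). deriv (g t) x)"
          by (rule continuous_on_swap[OF cdg]) (use s cd in auto)
      qed (use x in auto)
      then have I: "((\<lambda>y. integral {c..s} (\<lambda>\<tau>. g \<tau> y)) has_field_derivative integral {c..s} (\<lambda>\<tau>. deriv (g \<tau>) x)) (at x)"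
        using x by (simp add: at_within_open[OF x open_ball])
      have "((\<lambda>y. u c y + integral {c..s} (\<lambda>\<tau>. g \<tau> y)) has_field_derivative deriv (u c) x + integral {c..s} (\<lambda>\<tau>. deriv (g \<tau>) x)) (at x)"
        by (rule DERIV_add[OF holomorphic_derivI[OF hu] I]) (use cd x in auto)
      then have "(u s has_field_derivative deriv (u c) x + integral {c..s} (\<lambda>\<tau>. deriv (g \<tau>) x)) (at x)"
        by (rule has_field_derivative_transform_within_open[OF _ open_ball x]) (use u in auto)
      then show ?thesis by (rule DERIV_imp_deriv)
    qed
    have "continuous_on {c..d} (\<lambda>\<tau>. deriv (g \<tau>) x)"
      by (rule continuous_on_slice[OF cdg]) (use cd x in auto)
    then have "((\<lambda>s. integral {c..s} (\<lambda>\<tau>. deriv (g \<tau>) x)) has_vector_derivative deriv (g t) x) (at t within {c..d})"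
      using cd by (intro integral_has_vector_derivative) auto
    then have "((\<lambda>s. deriv (u c) x + integral {c..s} (\<lambda>\<tau>. deriv (g \<tau>) x)) has_vector_derivative 0 + deriv (g t) x) (at t within {c..d})"
      by (intro derivative_intros)
    then have "((\<lambda>s. deriv (u c) x + integral {c..s} (\<lambda>\<tau>. deriv (g \<tau>) x)) has_vector_derivative deriv (g t) x) (at t)"
      using cd by (simp add: at_within_Icc_at)
    then show ?thesis
      by (rule has_vector_derivative_transform_within_open[of _ _ _ "{c<..<d}"]) (use cd in \<open>auto simp: eq[symmetric]\<close>)
  qed
  then show ?thesis
    unfolding evolves_def using cdg continuous_on_deriv_param[OF open_ball cu hu] hu hg
    by (auto intro!: holomorphic_deriv)
qed

section \<open>Comparison principle for transport inequalities\<close>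

text \<open>First contact: at the earliest time at which some |q_i| reaches its barrier, a short
  step backwards in time with velocity \<open>c\<close> stays inside the region, since |c| is below
  the speed at which the region shrinks, and |q_i|^2 - y_i^2 grows along this step. So the barrier
  was already violated earlier. The direction \<open>c\<close> may depend on the point of contact,
  hence no characteristic flow is required. A family is treated at once because the estimate for one
  member at contact may use the bounds on the others.\<close>

lemma transport_barrier:
  fixes q :: "'i \<Rightarrow> real \<Rightarrow> complex \<Rightarrow> complex" and y :: "'i \<Rightarrow> real \<Rightarrow> real" and \<rho> :: "real \<Rightarrow> real"
  assumes fin: "finite I"
    and cq: "\<And>i. i \<in> I \<Longrightarrow> continuous_on {(s,x). s \<in> {a..b} \<and> cmod x \<le> \<rho> s} (\<lambda>(s,x). q i s x)"
    and cy: "\<And>i. i \<in> I \<Longrightarrow> continuous_on {a..b} (y i)"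
    and ypos: "\<And>i s. i \<in> I \<Longrightarrow> s \<in> {a..b} \<Longrightarrow> 0 \<le> y i s"
    and c\<rho>: "continuous_on {a..b} \<rho>" and mono: "antimono_on {a..b} \<rho>"
    and init: "\<And>i x. i \<in> I \<Longrightarrow> cmod x \<le> \<rho> a \<Longrightarrow> cmod (q i a x) < y i a"
    and step: "\<And>s x i. s \<in> {a<..b} \<Longrightarrow> cmod x \<le> \<rho> s \<Longrightarrow> i \<in> I \<Longrightarrow> (\<And>j. j \<in> I \<Longrightarrow> cmod (q j s x) \<le> y j s) \<Longrightarrow>
      cmod (q i s x) = y i s \<Longrightarrow>
      \<exists>c D \<rho>' y'. ((\<lambda>h. q i (s - h) (x + of_real h * c)) has_vector_derivative D) (at 0 within {0..}) \<and>
        (\<rho> has_real_derivative \<rho>') (at s within {..s}) \<and> (y i has_real_derivative y') (at s within {..s}) \<and>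
        cmod c < - \<rho>' \<and> 0 < Re (cnj (q i s x) * D) + y i s * y'"
    and i: "i \<in> I" and s: "s \<in> {a..b}" and x: "cmod x \<le> \<rho> s"
  shows "cmod (q i s x) < y i s"
proof (rule ccontr)
  assume contra: "\<not> ?thesis"
  define K where "K = {(s,x::complex). s \<in> {a..b} \<and> cmod x \<le> \<rho> s}"
  have "closed K"
  proof -
    have "closed {z \<in> {a..b} \<times> UNIV. cmod (snd z) - \<rho> (fst z) \<le> 0}"
      by (intro continuous_on_closed_Collect_le
          continuous_intros continuous_on_compose2[OF c\<rho>] closed_Times) auto
    moreover have "{z \<in> {a..b} \<times> UNIV. cmod (snd z) - \<rho> (fst z) \<le> 0} = K"
      by (auto simp: K_def)
    ultimately show ?thesis by simp
  qed
  moreover have "bounded K"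
  proof -
    have "K \<subseteq> {a..b} \<times> cball 0 (\<rho> a)"
    proof
      fix z assume "z \<in> K"
      then obtain t w where z: "z = (t,w)" "t \<in> {a..b}" "cmod w \<le> \<rho> t" by (auto simp: K_def)
      then have "\<rho> t \<le> \<rho> a" using mono by (auto simp: monotone_on_def)
      then show "z \<in> {a..b} \<times> cball 0 (\<rho> a)" using z by auto
    qed
    then show ?thesis
      by (rule bounded_subset[rotated]) (intro bounded_Times bounded_cball bounded_closed_interval)
  qed
  ultimately have cK: "compact K" by (simp add: compact_eq_bounded_closed)
  define Z where "Z = (\<Union>i\<in>I. {z \<in> K. y i (fst z) \<le> cmod (q i (fst z) (snd z))})"
  have "closed {z \<in> K. y i (fst z) \<le> cmod (q i (fst z) (snd z))}" if "i \<in> I" for i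
  proof (rule continuous_on_closed_Collect_le)
    show "continuous_on K (\<lambda>z. y i (fst z))"
      by (rule continuous_on_compose2[OF cy[OF that]]) (auto simp: K_def intro!: continuous_intros)
    show "continuous_on K (\<lambda>z. cmod (q i (fst z) (snd z)))"
      using cq[OF that] by (intro continuous_intros) (simp add: K_def split_beta)
  qed (rule \<open>closed K\<close>)
  then have "closed Z" unfolding Z_def using fin by (intro closed_UN) auto
  then have "compact Z"
    using cK by (metis (no_types, lifting) UN_least Z_def compact_Int_closed inf.absorb_iff2 mem_Collect_eq subsetI)
  moreover have "(s,x) \<in> Z" using contra i s x by (auto simp: Z_def K_def not_less intro!: bexI[of _ i])
  \<comment> \<open>The contact set is compact, so its time coordinate attains a minimum.\<close>
  ultimately obtain z where z: "z \<in> Z" and zmin: "\<And>w. w \<in> Z \<Longrightarrow> fst z \<le> fst w"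
    using continuous_attains_inf[of Z fst, OF _ _ continuous_on_fst[OF continuous_on_id]] by blast
  obtain s1 x1 where z_def: "z = (s1,x1)" by (cases z)
  from z obtain i where iI: "i \<in> I" and zK: "s1 \<in> {a..b}" "cmod x1 \<le> \<rho> s1" and big: "y i s1 \<le> cmod (q i s1 x1)"
    by (auto simp: Z_def K_def z_def)
  have small: "cmod (q j s x) < y j s" if "s \<in> {a..b}" "s < s1" "cmod x \<le> \<rho> s" "j \<in> I" for s x j
    using zmin[of "(s,x)"] that by (force simp: Z_def K_def z_def)
  have "s1 \<noteq> a" using init[OF iI] zK big by force
  then have s1: "s1 \<in> {a<..b}" using zK by auto
  \<comment> \<open>The region is larger at earlier times, so x1 belongs to it all along; the strict
    inequalities before s1 pass to the limit from the left for every member of the family.\<close>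
  have le: "cmod (q j s1 x1) \<le> y j s1" if "j \<in> I" for j
  proof -
    have sub: "s \<in> {a..s1} \<Longrightarrow> (s,x1) \<in> K" for s
    proof -
      assume "s \<in> {a..s1}"
      then have "\<rho> s1 \<le> \<rho> s" "s \<in> {a..b}" using mono zK by (auto simp: monotone_on_def)
      then show "(s,x1) \<in> K" using zK by (auto simp: K_def)
    qed
    have "continuous_on {a..s1} (\<lambda>s. y j s - cmod (q j s x1))"
      using s1 sub cq[OF that, folded K_def]
      by (intro continuous_intros continuous_on_subset[OF cy[OF that]]
          continuous_on_compose2[OF cq[OF that, folded K_def], of _ "\<lambda>s. (s,x1)", unfolded prod.case]) auto
    then have "((\<lambda>s. y j s - cmod (q j s x1)) \<longlongrightarrow> y j s1 - cmod (q j s1 x1)) (at s1 within {a..s1})"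
      using s1 by (auto simp: continuous_on_def)
    then have "((\<lambda>s. y j s - cmod (q j s x1)) \<longlongrightarrow> y j s1 - cmod (q j s1 x1)) (at_left s1)"
      using s1 by (simp add: at_within_Icc_at_left)
    moreover have "eventually (\<lambda>s. 0 \<le> y j s - cmod (q j s x1)) (at_left s1)"
    proof -
      have "0 \<le> y j s - cmod (q j s x1)" if "a < s" "s < s1" for s
        using small[of s x1 j] sub[of s] that \<open>j \<in> I\<close> s1 by (auto simp: K_def)
      then show ?thesis using s1 by (auto simp: eventually_at_left_field intro!: exI[of _ a])
    qed
    ultimately have "0 \<le> y j s1 - cmod (q j s1 x1)"
      by (intro tendsto_lowerbound) (auto simp: trivial_limit_at_left_real)
    then show ?thesis by simp
  qed
  then have eq: "cmod (q i s1 x1) = y i s1" using big iI by force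
  obtain c D \<rho>' y' where D: "((\<lambda>h. q i (s1 - h) (x1 + of_real h * c)) has_vector_derivative D) (at 0 within {0..})"
    and d\<rho>: "(\<rho> has_real_derivative \<rho>') (at s1 within {..s1})" and dy: "(y i has_real_derivative y') (at s1 within {..s1})"
    and c: "cmod c < - \<rho>'" and pos: "0 < Re (cnj (q i s1 x1) * D) + y i s1 * y'"
    using step[OF s1 zK(2) iI le eq] by blast
  have aux: "((\<lambda>h. f (s1 - h)) has_real_derivative - l) (at 0 within {0..})"
    if "(f has_real_derivative l) (at s1 within {..s1})" for f :: "real \<Rightarrow> real" and l
  proof -
    have "(f has_real_derivative l) (at (s1 - 0) within (\<lambda>h. s1 - h) ` {0..})"
      using that by (rule_tac DERIV_subset[of _ _ _ "{..s1}"]) auto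
    moreover have "((\<lambda>h. s1 - h) has_real_derivative -1) (at 0 within {0..})"
      by (auto intro!: derivative_eq_intros)
    ultimately show ?thesis
      using DERIV_image_chain by (fastforce simp: o_def)
  qed
  \<comment> \<open>Going back by h, the radius grows by more than h |c|, so the displaced point
    remains in the region.\<close>
  have "((\<lambda>h. \<rho> (s1 - h) - h * cmod c) has_real_derivative - \<rho>' - cmod c) (at 0 within {0..})"
    by (rule derivative_eq_intros aux[OF d\<rho>] refl | simp)+
  from has_real_derivative_pos_inc_right[OF this] c obtain d1 where d1: "d1 > 0"
    "\<And>h. 0 < h \<Longrightarrow> h < d1 \<Longrightarrow> \<rho> s1 < \<rho> (s1 - h) - h * cmod c" by auto
  let ?q = "\<lambda>h. q i (s1 - h) (x1 + of_real h * c)"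
  have DR: "((\<lambda>h. Re (?q h)) has_real_derivative Re D) (at 0 within {0..})"
    and DI: "((\<lambda>h. Im (?q h)) has_real_derivative Im D) (at 0 within {0..})"
    using D by (auto simp: has_real_derivative_iff_has_vector_derivative
       intro: bounded_linear.has_vector_derivative[OF bounded_linear_Re] bounded_linear.has_vector_derivative[OF bounded_linear_Im])
  \<comment> \<open>Squares are compared because the modulus itself need not be differentiable. The
    sign of the \<open>y'\<close> term is positive since the barrier is evaluated at s1 - h.\<close>
  have "((\<lambda>h. (Re (?q h))\<^sup>2 + (Im (?q h))\<^sup>2 - (y i (s1 - h))\<^sup>2) has_real_derivative
     2 * (Re (cnj (q i s1 x1) * D) + y i s1 * y')) (at 0 within {0..})"
    by (rule derivative_eq_intros DR DI aux[OF dy] refl | simp add: algebra_simps)+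
  from has_real_derivative_pos_inc_right[OF this] pos obtain d2 where d2: "d2 > 0"
    "\<And>h. 0 < h \<Longrightarrow> h < d2 \<Longrightarrow> (Re (?q 0))\<^sup>2 + (Im (?q 0))\<^sup>2 - (y i s1)\<^sup>2 < (Re (?q h))\<^sup>2 + (Im (?q h))\<^sup>2 - (y i (s1 - h))\<^sup>2"
    by auto
  define h where "h = min (min d1 d2) (s1 - a) / 2"
  have h: "0 < h" "h < d1" "h < d2" "a \<le> s1 - h" using d1 d2 s1 by (auto simp: h_def min_def field_simps)
  have "cmod (x1 + of_real h * c) \<le> \<rho> s1 + h * cmod c"
    using zK(2) h(1) norm_triangle_ineq[of x1 "of_real h * c"] by (simp add: norm_mult)
  also have "\<dots> \<le> \<rho> (s1 - h)" using d1(2)[OF h(1,2)] by linarith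
  finally have in_K: "cmod (x1 + of_real h * c) \<le> \<rho> (s1 - h)" .
  have "(y i (s1 - h))\<^sup>2 < (cmod (?q h))\<^sup>2"
    using d2(2)[OF h(1,3)] eq by (simp add: cmod_power2[symmetric])
  then have "y i (s1 - h) < cmod (?q h)" by (meson norm_ge_zero power2_less_imp_less)
  moreover have "cmod (?q h) < y i (s1 - h)"
    using small[OF _ _ in_K iI] h s1 by auto
  ultimately show False by simp
qed

lemma evolves_reflect:
  assumes "evolves a b R u g"
  shows "evolves (-b) (-a) R (\<lambda>s. u (-s)) (\<lambda>s x. - g (-s) x)"
proof -
  have c: "continuous_on ({- b<..<- a} \<times> ball 0 R) (\<lambda>(t, x). f (- t) x)"
    if "continuous_on ({a<..<b} \<times> ball 0 R) (\<lambda>(t, x). f t x)" for f :: txfun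
  proof -
    have "continuous_on ({- b<..<- a} \<times> ball 0 R) (\<lambda>p. case (- fst p, snd p) of (t, x) \<Rightarrow> f t x)"
      by (rule continuous_on_compose2[OF that]) (auto intro!: continuous_intros)
    then show ?thesis by (simp add: split_beta')
  qed
  have d: "((\<lambda>s. u (- s) x) has_vector_derivative - g (- t) x) (at t)"
    if "t \<in> {-b<..<-a}" "x \<in> ball 0 R" for t x
  proof -
    have "((\<lambda>s. u s x) has_vector_derivative g (- t) x) (at (- t))"
      using assms that by (auto simp: evolves_def)
    then have "((\<lambda>s. u s x) \<circ> uminus has_vector_derivative (-1) *\<^sub>R g (- t) x) (at t)"
      by (intro vector_diff_chain_at) (auto intro!: derivative_eq_intros)
    then show ?thesis by (simp add: o_def)
  qed
  have "continuous_on ({- b<..<- a} \<times> ball 0 R) (\<lambda>p. - (case p of (t, x) \<Rightarrow> g (- t) x))"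
    using assms by (intro continuous_on_minus c) (auto simp: evolves_def)
  then show ?thesis
    using assms d by (auto simp: evolves_def split_beta' intro!: c[unfolded split_beta'] holomorphic_intros)
qed

text \<open>A is split into a multiple of B, to be read as transport with speed at most
  \<open>k\<close>, and a remainder of size at most \<open>k\<close> |q|, to be read as growth. Only
  the excess of |A| over \<open>k\<close> |q| is given to the transport term, which is why its speed
  does not exceed \<open>k\<close>.\<close>

lemma align_direction:
  fixes A B q :: complex
  assumes "cmod A \<le> k * (cmod q + cmod B)" and "0 \<le> k"
  obtains c where "cmod c \<le> k" "cmod (A - c * B) \<le> k * cmod q"
proof (cases "cmod A \<le> k * cmod q")
  case True
  then show ?thesis using that[of 0] assms by simp
next
  case False
  then have B: "B \<noteq> 0" and A: "A \<noteq> 0" using assms by auto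
  define r where "r = k * cmod q / cmod A"
  have r: "0 \<le> r" "r < 1" using False A assms by (auto simp: r_def field_simps)
  show ?thesis
  proof (rule that[of "(1 - of_real r) * A / B"])
    have "cmod ((1 - of_real r) * A / B) = (1 - r) * cmod A / cmod B"
    proof -
      have "cmod (1 - of_real r) = \<bar>1 - r\<bar>" by (metis norm_of_real of_real_1 of_real_diff)
      then show ?thesis using r by (simp add: norm_mult norm_divide)
    qed
    also have "(1 - r) * cmod A = cmod A - k * cmod q" using A by (simp add: r_def field_simps)
    also have "(cmod A - k * cmod q) / cmod B \<le> k" using assms B by (simp add: field_simps)
    finally show "cmod ((1 - of_real r) * A / B) \<le> k" .
    have "A - (1 - of_real r) * A / B * B = of_real r * A" using B by (simp add: field_simps)
    then show "cmod (A - (1 - of_real r) * A / B * B) \<le> k * cmod q"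
    proof -
      have "cmod (of_real r * A) = r * cmod A" using r(1) by (simp add: norm_mult)
      also have "\<dots> = k * cmod q" using A by (simp add: r_def)
      finally show ?thesis using \<open>A - (1 - of_real r) * A / B * B = of_real r * A\<close> by simp
    qed
  qed
qed

text \<open>Gronwall's inequality with a domain of dependence. The inequality for \<open>g\<close>
  acts like transport of speed at most \<open>k\<close> combined with growth of rate at most
  \<open>k\<close>, so up to the final time the disc loses the integral of \<open>k\<close> from its
  radius and the bound gains the exponential of that integral.\<close>

lemma transport_bound:
  assumes ev: "evolves a0 b0 R q g" and ab: "a0 < a" "a \<le> b" "b < b0"
    and ck: "continuous_on {a..b} k" and k0: "\<And>s. s \<in> {a..b} \<Longrightarrow> 0 \<le> k s"
    and gb: "\<And>s x. s \<in> {a..b} \<Longrightarrow> x \<in> ball 0 R \<Longrightarrow> cmod (g s x) \<le> k s * (cmod (q s x) + cmod (deriv (q s) x))"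
    and init: "\<And>x. x \<in> ball 0 R \<Longrightarrow> cmod (q a x) \<le> N" and \<Theta>: "integral {a..b} k \<le> \<Theta>"
    and s: "s \<in> {a..b}" and x: "cmod x < R - \<Theta>"
  shows "cmod (q s x) \<le> N * exp \<Theta>"
proof -
  have \<Theta>0: "0 \<le> integral {a..b} k" using k0 ck by (intro integral_nonneg integrable_continuous_real) auto
  then have "0 < R" using x \<Theta> norm_ge_zero[of x] by linarith
  then have N0: "0 \<le> N" using init[of 0] order_trans[OF norm_ge_zero] by auto
  \<comment> \<open>The barrier argument needs strict inequalities. The radius, the initial bound
    and the rate are therefore all relaxed by \<epsilon>, which tends to 0 afterwards.\<close>
  have main: "cmod (q s x) \<le> (N + \<epsilon>) * exp (\<Theta> + \<epsilon> * (b - a))"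
    if \<epsilon>: "0 < \<epsilon>" "cmod x \<le> R - \<epsilon> - (\<Theta> + \<epsilon> * (b - a))" for \<epsilon>
  proof -
    define P where "P = (\<lambda>s. integral {a..s} (\<lambda>s. k s + \<epsilon>))"
    define \<rho> where "\<rho> = (\<lambda>s. R - \<epsilon> - P s)"
    define y where "y = (\<lambda>s. (N + \<epsilon>) * exp (P s))"
    have ck': "continuous_on {a..b} (\<lambda>s. k s + \<epsilon>)" using ck by (intro continuous_intros)
    have dP: "(P has_real_derivative (k s + \<epsilon>)) (at s within {a..b})" if "s \<in> {a..b}" for s
      unfolding P_def using integral_has_real_derivative[OF ck' that] .
    have cP: "continuous_on {a..b} P"
      using dP by (meson DERIV_continuous continuous_on_eq_continuous_within)
    have Pmono: "P s \<le> P s'" if "a \<le> s" "s \<le> s'" "s' \<le> b" for s s'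
      unfolding P_def
      using that \<epsilon> k0 by (intro integral_subset_le integrable_continuous_real continuous_on_subset[OF ck'])
         (auto intro!: add_nonneg_nonneg)
    have Pb: "P b = integral {a..b} k + \<epsilon> * (b - a)"
      unfolding P_def using ab by (subst integral_add) (auto intro!: integrable_continuous_real ck)
    have Pa: "P a = 0" unfolding P_def by simp
    have left: "(f has_real_derivative l) (at s within {..s})"
      if "(f has_real_derivative l) (at s within {a..b})" "s \<in> {a<..b}" for f l s
    proof -
      have "(f has_real_derivative l) (at s within {a..s})"
        using DERIV_subset[OF that(1)] that(2) by auto
      moreover have "at s within {a..s} = at s within {..s}"
        using that(2) by (intro at_within_nhd[of s "{a<..}"]) auto
      ultimately show ?thesis by simp
    qed
    have ball: "x \<in> ball 0 R" if "s \<in> {a..b}" "cmod x \<le> \<rho> s" for s x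
      using that Pmono[of a s] Pa \<epsilon> by (auto simp: \<rho>_def)
    have "cmod (q s x) < y s"
    proof (rule transport_barrier[where I="{()}" and q="\<lambda>_. q" and y="\<lambda>_. y" and \<rho>=\<rho> and a=a and b=b and i="()"])
      show "continuous_on {(s, x). s \<in> {a..b} \<and> cmod x \<le> \<rho> s} (\<lambda>(s, x). q s x)"
      proof (rule continuous_on_subset)
        show "continuous_on ({a0<..<b0} \<times> ball 0 R) (\<lambda>(s,x). q s x)" using ev by (simp add: evolves_def)
        show "{(s, x). s \<in> {a..b} \<and> cmod x \<le> \<rho> s} \<subseteq> {a0<..<b0} \<times> ball 0 R"
          using ab ball by auto
      qed
      show "continuous_on {a..b} y" unfolding y_def by (intro continuous_intros cP)
      show "0 \<le> y s" for s unfolding y_def using N0 \<epsilon> by simp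
      show "continuous_on {a..b} \<rho>" unfolding \<rho>_def by (intro continuous_intros cP)
      show "antimono_on {a..b} \<rho>" unfolding \<rho>_def using Pmono by (auto simp: monotone_on_def)
      show "cmod (q a x) < y a" if "cmod x \<le> \<rho> a" for x
        using init[OF ball[OF _ that]] ab \<epsilon> by (simp add: y_def Pa)
      show "s \<in> {a..b}" by (rule s)
      show "cmod x \<le> \<rho> s" using \<epsilon>(2) Pmono[of s b] s Pb \<Theta> by (simp add: \<rho>_def)
      fix s x assume sx: "s \<in> {a<..b}" "cmod x \<le> \<rho> s" "cmod (q s x) = y s"
      have s': "s \<in> {a..b}" and xb: "x \<in> ball 0 R" using sx ball[of s x] by auto
      have "cmod (- g s x) \<le> k s * (cmod (q s x) + cmod (deriv (q s) x))"
        using gb[OF s' xb] by simp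
      \<comment> \<open>With A = -g and B the x-derivative of q, the derivative along the backward
        direction -c is at most \<open>k\<close> |q|.\<close>
      then obtain c where c: "cmod c \<le> k s" "cmod (- g s x - c * deriv (q s) x) \<le> k s * cmod (q s x)"
        using align_direction k0[OF s'] by metis
      have ypos: "0 < y s" using N0 \<epsilon> by (simp add: y_def add_nonneg_pos)
      show "\<exists>c D \<rho>' y'. ((\<lambda>h. q (s - h) (x + complex_of_real h * c)) has_vector_derivative D) (at 0 within {0..}) \<and>
         (\<rho> has_real_derivative \<rho>') (at s within {..s}) \<and> (y has_real_derivative y') (at s within {..s}) \<and>
            cmod c < - \<rho>' \<and> 0 < Re (cnj (q s x) * D) + y s * y'"
      proof (intro exI conjI)
        show "((\<lambda>h. q (s - h) (x + complex_of_real h * (- c))) has_vector_derivative (- g s x + (- c) * deriv (q s) x)) (at 0 within {0..})"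
          using evolves_path[OF ev _ xb, of s "-1" "-c"] s' ab by simp
        have dP': "(P has_real_derivative (k s + \<epsilon>)) (at s within {..s})"
          by (rule left[OF dP]) (use sx in auto)
        show "(\<rho> has_real_derivative - (k s + \<epsilon>)) (at s within {..s})"
          unfolding \<rho>_def by (rule derivative_eq_intros dP' refl | simp)+
        show "(y has_real_derivative (k s + \<epsilon>) * y s) (at s within {..s})"
          unfolding y_def by (rule derivative_eq_intros dP' refl | simp)+
        show "cmod (- c) < - (- (k s + \<epsilon>))" using c \<epsilon> by simp
        let ?E = "- g s x + - c * deriv (q s) x"
        have "- Re (cnj (q s x) * ?E) \<le> cmod (cnj (q s x) * ?E)"
          using abs_Re_le_cmod[of "cnj (q s x) * ?E"] by linarith
        also have "\<dots> \<le> y s * (k s * y s)"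
          using c(2) sx(3) ypos by (simp add: norm_mult)
        also have "\<dots> < y s * ((k s + \<epsilon>) * y s)" using ypos \<epsilon> by simp
        finally show "0 < Re (cnj (q s x) * ?E) + y s * ((k s + \<epsilon>) * y s)" by linarith
      qed
    qed simp_all
    also have "y s \<le> (N + \<epsilon>) * exp (\<Theta> + \<epsilon> * (b - a))"
      unfolding y_def using Pmono[of s b] s Pb \<Theta> N0 \<epsilon> by (intro mult_left_mono) auto
    finally show ?thesis by simp
  qed
  have "((\<lambda>\<epsilon>. (N + \<epsilon>) * exp (\<Theta> + \<epsilon> * (b - a))) \<longlongrightarrow> (N + 0) * exp (\<Theta> + 0 * (b - a))) (at_right 0)"
    by (intro tendsto_intros)
  moreover have "\<forall>\<^sub>F \<epsilon> in at_right 0. cmod (q s x) \<le> (N + \<epsilon>) * exp (\<Theta> + \<epsilon> * (b - a))"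
  proof -
    have "((\<lambda>\<epsilon>. R - \<epsilon> - (\<Theta> + \<epsilon> * (b - a))) \<longlongrightarrow> R - 0 - (\<Theta> + 0 * (b - a))) (at_right 0)"
      by (intro tendsto_intros)
    then have "\<forall>\<^sub>F \<epsilon> in at_right 0. cmod x < R - \<epsilon> - (\<Theta> + \<epsilon> * (b - a))"
      using x by (intro order_tendstoD(1)) auto
    then show ?thesis
      using eventually_at_right_less[of 0] by eventually_elim (use main in auto)
  qed
  ultimately have "cmod (q s x) \<le> (N + 0) * exp (\<Theta> + 0 * (b - a))"
    by (rule tendsto_lowerbound) (rule trivial_limit_at_right_real)
  then show ?thesis by simp
qed

lemma transport_bound_reverse:
  assumes ev: "evolves a0 b0 R q g" and ab: "a0 < a" "a \<le> b" "b < b0"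
    and ck: "continuous_on {a..b} k" and k0: "\<And>s. s \<in> {a..b} \<Longrightarrow> 0 \<le> k s"
    and gb: "\<And>s x. s \<in> {a..b} \<Longrightarrow> x \<in> ball 0 R \<Longrightarrow> cmod (g s x) \<le> k s * (cmod (q s x) + cmod (deriv (q s) x))"
    and init: "\<And>x. x \<in> ball 0 R \<Longrightarrow> cmod (q b x) \<le> N" and \<Theta>: "integral {a..b} k \<le> \<Theta>"
    and s: "s \<in> {a..b}" and x: "cmod x < R - \<Theta>"
  shows "cmod (q s x) \<le> N * exp \<Theta>"
proof -
  have ck': "continuous_on {-b..-a} (\<lambda>s. k (-s))"
    by (rule continuous_on_compose2[OF ck]) (auto intro!: continuous_intros)
  have "cmod (q (- (- s)) x) \<le> N * exp \<Theta>"
    by (rule transport_bound[OF evolves_reflect[OF ev], of "-b" "-a" "\<lambda>s. k (-s)"])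
      (use ab ck' k0 gb init \<Theta> s x in auto)
  then show ?thesis by simp
qed

lemma integral_tendsto_0:
  assumes "k integrable_on {0..T::real}" "0 < T"
  shows "((\<lambda>t. integral {0..t} k :: real) \<longlongrightarrow> 0) (at_right 0)"
proof -
  have "continuous_on {0..T} (\<lambda>t. integral {0..t} k)"
    by (rule indefinite_integral_continuous_1[OF assms(1)])
  then have "((\<lambda>t. integral {0..t} k) \<longlongrightarrow> integral {0..0} k) (at 0 within {0..T})"
    using assms(2) unfolding continuous_on_def by (metis atLeastAtMost_iff less_imp_le order_refl)
  then show ?thesis using assms by (simp add: at_within_Icc_at_right)
qed

text \<open>The bound is propagated from a starting time a where |q| < \<epsilon>. Both the loss of
  radius and the exponential factor are controlled by the integral over the whole interval, hence
  independently of a and \<epsilon>.\<close>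

lemma evolves_zero:
  assumes ev: "evolves 0 T R q g" 
    and ck: "continuous_on {0<..<T} k" and k0: "\<And>s. s \<in> {0<..<T} \<Longrightarrow> 0 \<le> k s" and ik: "k integrable_on {0..T}"
    and gb: "\<And>s x. s \<in> {0<..<T} \<Longrightarrow> x \<in> ball 0 R \<Longrightarrow> cmod (g s x) \<le> k s * (cmod (q s x) + cmod (deriv (q s) x))"
    and lim: "uniform_limit (ball 0 R) q (\<lambda>_. 0) (at_right 0)"
    and t: "t \<in> {0<..<T}" and x: "cmod x < R - integral {0<..<T} k"
  shows "q t x = 0"
proof -
  have ik': "k integrable_on {0<..<T}" using ik by (simp add: integrable_on_open_interval_real)
  have bd: "cmod (q t x) \<le> \<epsilon> * exp (integral {0<..<T} k)" if \<epsilon>: "0 < \<epsilon>" for \<epsilon>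
  proof -
    have "\<forall>\<^sub>F a in at_right 0. \<forall>x\<in>ball 0 R. dist (q a x) 0 < \<epsilon>"
      using lim \<epsilon> by (auto simp: uniform_limit_iff)
    moreover have "\<forall>\<^sub>F a in at_right 0. a < t"
      using t by (auto simp: eventually_at_right_field)
    ultimately have "\<forall>\<^sub>F a in at_right 0. (\<forall>x\<in>ball 0 R. dist (q a x) 0 < \<epsilon>) \<and> a < t \<and> 0 < a"
      using eventually_at_right_less[of 0] by eventually_elim auto
    then obtain a where a: "0 < a" "a < t" "\<forall>x\<in>ball 0 R. cmod (q a x) < \<epsilon>"
      using eventually_happens'[OF trivial_limit_at_right_real[of 0]] by force
    have sub: "{a..t} \<subseteq> {0<..<T}" using a t by auto
    have "integral {a..t} k \<le> integral {0<..<T} k"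
      using k0 sub by (intro integral_subset_le integrable_on_subinterval[OF ik'] ik') auto
    with a sub t x show ?thesis
      by (intro transport_bound[OF ev, of a t k]) (auto intro!: continuous_on_subset[OF ck] k0 gb intro: less_imp_le)
  qed
  have "cmod (q t x) \<le> 0"
  proof (rule field_le_epsilon)
    fix e :: real assume "0 < e"
    then show "cmod (q t x) \<le> 0 + e" using bd[of "e / exp (integral {0<..<T} k)"] by simp
  qed
  then show ?thesis by simp
qed

text \<open>A bound at one positive time is propagated down to t = 0. Cauchy's estimate then bounds
  the x-derivative, so that |g| \<le> C k with \<open>k\<close> integrable, and the increments of q
  are controlled by the integral of \<open>k\<close> over (0,t). Thus q is uniformly Cauchy as t
  tends to 0.\<close>

lemma evolves_limit:
  assumes ev: "evolves 0 T R q g" and T: "0 < T" and R: "0 < R"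
    and ck: "continuous_on {0<..<T} k" and k0: "\<And>s. s \<in> {0<..<T} \<Longrightarrow> 0 \<le> k s" and ik: "k integrable_on {0..T}"
    and gb: "\<And>s x. s \<in> {0<..<T} \<Longrightarrow> x \<in> ball 0 R \<Longrightarrow> cmod (g s x) \<le> k s * (cmod (q s x) + cmod (deriv (q s) x))"
    and small: "integral {0<..<T} k \<le> R / 8"
  obtains \<psi> where "\<psi> holomorphic_on ball 0 (R/4)" "uniform_limit (ball 0 (R/4)) q \<psi> (at_right 0)"
proof -
  have ik': "k integrable_on {0<..<T}" using ik by (simp add: integrable_on_open_interval_real)
  have ki: "integral {a..b} k \<le> integral {0<..<T} k" if "0 < a" "b < T" for a b
    using k0 that by (intro integral_subset_le integrable_on_subinterval[OF ik'] ik') auto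
  have evc: "continuous_on ({0<..<T} \<times> ball 0 R) (\<lambda>(t, x). q t x)"
    and evh: "\<And>t. t \<in> {0<..<T} \<Longrightarrow> q t holomorphic_on ball 0 R" 
    and cg: "continuous_on ({0<..<T} \<times> ball 0 R) (\<lambda>(t, x). g t x)"
    and der: "\<And>t x. t \<in> {0<..<T} \<Longrightarrow> x \<in> ball 0 R \<Longrightarrow> ((\<lambda>s. q s x) has_vector_derivative g t x) (at t)"
    using ev by (auto simp: evolves_def)
  define b where "b = T / 2"
  have b: "0 < b" "b < T" using T by (auto simp: b_def)
  have "continuous_on (cball 0 (R/2)) (q b)"
    using evh[of b] b R by (intro holomorphic_on_imp_continuous_on holomorphic_on_subset[OF evh]) auto
  then have "bounded (q b ` cball 0 (R/2))"
    by (intro compact_imp_bounded compact_continuous_image) auto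
  then obtain N where N: "\<And>x. x \<in> cball 0 (R/2) \<Longrightarrow> cmod (q b x) \<le> N"
    unfolding bounded_iff by blast
  \<comment> \<open>The radii are: R/2 for a compact disc on which q is bounded at time b, 3R/8
    after the loss of at most R/8 in the propagation, and R/4 after a Cauchy estimate with radius
    R/8.\<close>
  have ev2: "evolves 0 T (R/2) q g"
    using ev R unfolding evolves_def
    by (intro conjI) (auto elim!: continuous_on_subset holomorphic_on_subset)
  define M where "M = N * exp (R/8)"
  have bq: "cmod (q s x) \<le> M" if "s \<in> {0<..b}" "x \<in> ball 0 (3*R/8)" for s x
    unfolding M_def
    using ki[of s b] b small that R
    by (intro transport_bound_reverse[OF ev2, of s b k])
       (auto intro!: continuous_on_subset[OF ck] k0 gb N)
  have M0: "0 \<le> M" using order_trans[OF norm_ge_zero bq[of b 0]] b R by auto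
  have dq: "cmod (deriv (q s) x) \<le> 8 * M / R" if "s \<in> {0<..b}" "x \<in> ball 0 (R/4)" for s x
  proof -
    have sub: "ball x (R/8) \<subseteq> ball 0 (3*R/8)"
    proof
      fix z assume "z \<in> ball x (R/8)"
      then show "z \<in> ball 0 (3*R/8)" using that(2) norm_triangle_ineq2[of z x] R
        by (auto simp: dist_norm norm_minus_commute)
    qed
    have "cmod (deriv (q s) x) \<le> M / (R/8)"
      using that b R sub by (intro Cauchy_deriv_bound bq holomorphic_on_subset[OF evh]) auto
    then show ?thesis by (simp add: mult.commute)
  qed
  define C where "C = M + 8 * M / R"
  have C0: "0 \<le> C" using M0 R by (simp add: C_def)
  have gC: "cmod (g s x) \<le> C * k s" if "s \<in> {0<..b}" "x \<in> ball 0 (R/4)" for s x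
  proof -
    have "cmod (g s x) \<le> k s * (cmod (q s x) + cmod (deriv (q s) x))"
      using that b R by (intro gb) auto
    also have "\<dots> \<le> k s * C"
      unfolding C_def using that b R k0[of s] by (intro mult_left_mono add_mono bq dq) auto
    finally show ?thesis by (simp add: mult.commute)
  qed
  have i0: "k integrable_on {0..t}" if "t \<in> {0..T}" for t
    using that by (intro integrable_on_subinterval[OF ik]) auto
  have k0': "integral {a..t} k \<le> integral {0..t} k" if "0 < a" "a \<le> t" "t \<le> b" for a t
  proof -
    have "integral {a..t} k \<le> integral {0<..<t} k + integral {t..t} k"
    proof -
      have "integral {a..t} k = integral {a<..<t} k" by (simp add: integral_open_interval_real)
      also have "\<dots> \<le> integral {0<..<t} k"
        using that b k0 i0[of t] by (intro integral_subset_le) (auto simp: integrable_on_open_interval_real intro: integrable_on_subinterval)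
      finally show ?thesis by simp
    qed
    then show ?thesis by (simp add: integral_open_interval_real)
  qed
  have diff: "cmod (q t x - q a x) \<le> C * integral {0..t} k" if "0 < a" "a \<le> t" "t \<le> b" "x \<in> ball 0 (R/4)" for a t x
  proof -
    have sub: "{a..t} \<subseteq> {0<..b}" using that by auto
    have "((\<lambda>s. g s x) has_integral (q t x - q a x)) {a..t}"
    proof (rule fundamental_theorem_of_calculus)
      show "((\<lambda>s. q s x) has_vector_derivative g s x) (at s within {a..t})" if "s \<in> {a..t}" for s
        by (rule has_vector_derivative_at_within[OF der]) (use that \<open>0 < a\<close> \<open>t \<le> b\<close> b \<open>x \<in> ball 0 (R/4)\<close> R in auto)
    qed (use that in simp)
    then have eq: "q t x - q a x = integral {a..t} (\<lambda>s. g s x)" and ig: "(\<lambda>s. g s x) integrable_on {a..t}"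
      by (auto simp: integral_unique)
    have "cmod (integral {a..t} (\<lambda>s. g s x)) \<le> integral {a..t} (\<lambda>s. C * k s)"
    proof (rule integral_norm_bound_integral[OF ig])
      show "(\<lambda>s. C * k s) integrable_on {a..t}"
        using that b by (intro integrable_on_mult_right integrable_on_subinterval[OF ik]) auto
      show "cmod (g s x) \<le> C * k s" if "s \<in> {a..t}" for s
        by (rule gC) (use that sub \<open>x \<in> ball 0 (R/4)\<close> in auto)
    qed
    also have "\<dots> = C * integral {a..t} k" by simp
    also have "\<dots> \<le> C * integral {0..t} k" using k0' that C0 by (intro mult_left_mono) auto
    finally show ?thesis using eq by simp
  qed
  have lim0: "((\<lambda>t. C * integral {0..t} k) \<longlongrightarrow> 0) (at_right 0)"
    using tendsto_mult_left[OF integral_tendsto_0[OF ik T], of C] by simp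
  \<comment> \<open>The limit is constructed along a sequence, where uniform Cauchy convergence
    yields a holomorphic limit; the estimate \<open>diff\<close> then extends the convergence to all
    t.\<close>
  define \<tau> where "\<tau> = (\<lambda>n. b / real (Suc n))"
  have \<tau>: "0 < \<tau> n" "\<tau> n \<le> b" for n using b by (auto simp: \<tau>_def field_simps)
  have \<tau>mono: "\<tau> n \<le> \<tau> m" if "m \<le> n" for m n
    using b that by (auto simp: \<tau>_def intro!: divide_left_mono)
  have "(\<lambda>n. b * inverse (real (Suc n))) \<longlonglongrightarrow> b * 0" by (intro tendsto_intros LIMSEQ_inverse_real_of_nat)
  then have \<tau>lim: "\<tau> \<longlonglongrightarrow> 0" by (simp add: \<tau>_def divide_inverse)
  then have \<tau>0: "filterlim \<tau> (at_right 0) sequentially"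
    by (rule tendsto_imp_filterlim_at_right) (use \<tau>(1) in simp)
  have "uniformly_Cauchy_on (ball 0 (R/4)) (\<lambda>n. q (\<tau> n))"
  proof (rule uniformly_Cauchy_onI')
    fix e :: real assume e: "0 < e"
    have "\<forall>\<^sub>F n in sequentially. C * integral {0..\<tau> n} k < e"
      using order_tendstoD(2)[OF filterlim_compose[OF lim0 \<tau>0]] e by auto
    then obtain m where "\<And>n. n \<ge> m \<Longrightarrow> C * integral {0..\<tau> n} k < e" by (auto simp: eventually_sequentially)
    then have "dist (q (\<tau> n) x) (q (\<tau> n') x) < e" if "x \<in> ball 0 (R/4)" "n \<ge> m" "n' > n" for x n n'
      using diff[OF \<tau>(1) \<tau>mono \<tau>(2) that(1), of n n'] that by (force simp: dist_norm)
    then show "\<exists>M. \<forall>x\<in>ball 0 (R/4). \<forall>m\<ge>M. \<forall>n>m. dist (q (\<tau> m) x) (q (\<tau> n) x) < e" by blast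
  qed
  then obtain \<psi> where ul: "uniform_limit (ball 0 (R/4)) (\<lambda>n. q (\<tau> n)) \<psi> sequentially"
    using Cauchy_uniformly_convergent uniformly_convergent_on_def by blast
  have "\<psi> holomorphic_on ball 0 (R/4)"
  proof (rule holomorphic_uniform_sequence[OF open_ball])
    show "q (\<tau> n) holomorphic_on ball 0 (R/4)" for n
      using \<tau>[of n] b R by (intro holomorphic_on_subset[OF evh]) auto
    show "\<exists>d>0. cball x d \<subseteq> ball 0 (R/4) \<and> uniform_limit (cball x d) (\<lambda>n. q (\<tau> n)) \<psi> sequentially" if "x \<in> ball 0 (R/4)" for x
      using open_contains_cball[of "ball 0 (R/4)"] that ul by (meson open_ball uniform_limit_on_subset)
  qed
  moreover have "uniform_limit (ball 0 (R/4)) q \<psi> (at_right 0)"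
  proof (rule uniform_limitI)
    fix e :: real assume e: "0 < e"
    have ptw: "(\<lambda>n. q (\<tau> n) x) \<longlonglongrightarrow> \<psi> x" if "x \<in> ball 0 (R/4)" for x
      using tendsto_uniform_limitI[OF ul that] .
    have bd: "cmod (q t x - \<psi> x) \<le> C * integral {0..t} k" if "0 < t" "t \<le> b" "x \<in> ball 0 (R/4)" for t x
    proof (rule tendsto_upperbound)
      show "(\<lambda>n. cmod (q t x - q (\<tau> n) x)) \<longlonglongrightarrow> cmod (q t x - \<psi> x)" by (intro tendsto_intros ptw that)
      have "\<forall>\<^sub>F n in sequentially. \<tau> n < t"
        using order_tendstoD(2)[OF \<tau>lim that(1)] .
      then show "\<forall>\<^sub>F n in sequentially. cmod (q t x - q (\<tau> n) x) \<le> C * integral {0..t} k"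
        by eventually_elim (rule diff, use \<tau> that in auto)
    qed simp
    have "\<forall>\<^sub>F t in at_right 0. C * integral {0..t} k < e" using order_tendstoD(2)[OF lim0] e by auto
    moreover have "\<forall>\<^sub>F t in at_right 0. 0 < t \<and> t \<le> b" using b by (auto simp: eventually_at_right_field intro!: exI[of _ b])
    ultimately show "\<forall>\<^sub>F t in at_right 0. \<forall>x\<in>ball 0 (R/4). dist (q t x) (\<psi> x) < e"
      by eventually_elim (use bd in \<open>fastforce simp: dist_norm\<close>)
  qed
  ultimately show ?thesis using that by blast
qed

section \<open>Integrals of functions singular at time 0\<close>

text \<open>The integrands below are controlled only for t > 0, while integrals of the rate are most
  conveniently taken over closed intervals. The single point 0 is negligible.\<close>

lemma has_integral_half_open:
  fixes f :: "real \<Rightarrow> 'a::banach"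
  shows "(f has_integral i) {0<..t} \<longleftrightarrow> (f has_integral i) {0..t}"
  by (rule has_integral_spike_set_eq) (auto intro: negligible_subset[of "{0}"])

lemma integrable_half_open:
  fixes f :: "real \<Rightarrow> 'a::banach"
  shows "f integrable_on {0<..t} \<longleftrightarrow> f integrable_on {0..t}"
  by (simp add: integrable_on_def has_integral_half_open)

lemma integral_half_open:
  fixes f :: "real \<Rightarrow> 'a::banach"
  shows "integral {0<..t} f = integral {0..t} f"
  by (simp add: integral_def integrable_half_open has_integral_half_open)

text \<open>Continuity on (0,t] gives measurability, and the dominating function controls the
  singularity at 0.\<close>

lemma integrable_dominated:
  fixes f :: "real \<Rightarrow> complex"
  assumes "continuous_on {0<..t} f" "\<phi> integrable_on {0..t}" "\<And>s. s \<in> {0<..t} \<Longrightarrow> cmod (f s) \<le> \<phi> s"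
  shows "f integrable_on {0<..t}"
proof (rule measurable_bounded_by_integrable_imp_integrable)
  show "f \<in> borel_measurable (lebesgue_on {0<..t})"
    using assms(1) by (rule continuous_imp_measurable_on_sets_lebesgue) simp
  show "\<phi> integrable_on {0<..t}" using assms(2) by (simp add: integrable_half_open)
qed (use assms in auto)

lemma integral_split_half_open:
  fixes f :: "real \<Rightarrow> 'a::banach"
  assumes "f integrable_on {0<..t}" "0 \<le> a" "a \<le> t"
  shows "integral {0<..t} f = integral {0<..a} f + integral {a..t} f"
  using Henstock_Kurzweil_Integration.integral_combine[of 0 a t f] assms
  by (simp add: integral_half_open integrable_half_open)

text \<open>The part of the integral near 0 is bounded by the integral of \<open>k\<close>,
  uniformly in x. Hence Y t is a uniform limit of integrals over compact intervals, for which
  differentiation under the integral is legitimate, and Y depends on t equicontinuously in x, which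
  gives joint continuity.\<close>

lemma indefinite_integral_regular:
  fixes H :: txfun
  assumes S: "open S" and cH: "continuous_on ({0<..T} \<times> S) (\<lambda>(t,x). H t x)"
    and hH: "\<And>t. t \<in> {0<..T} \<Longrightarrow> H t holomorphic_on S"
    and ik: "k integrable_on {0..T}" and bd: "\<And>t x. t \<in> {0<..T} \<Longrightarrow> x \<in> S \<Longrightarrow> cmod (H t x) \<le> k t"
  defines "Y \<equiv> \<lambda>t x. integral {0<..t} (\<lambda>s. H s x)"
  shows "\<And>t. t \<in> {0<..T} \<Longrightarrow> Y t holomorphic_on S"
    and "continuous_on ({0<..T} \<times> S) (\<lambda>(t,x). Y t x)"
    and "\<And>t x. t \<in> {0<..<T} \<Longrightarrow> x \<in> S \<Longrightarrow> ((\<lambda>s. Y s x) has_vector_derivative H t x) (at t)"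
proof -
  define \<Theta> where "\<Theta> = (\<lambda>t. integral {0<..t} k)"
  have ik': "k integrable_on {0<..t}" if "t \<le> T" for t
    unfolding integrable_half_open by (rule integrable_on_subinterval[OF ik]) (use that in auto)
  have cHx: "continuous_on A (\<lambda>s. H s x)" if "x \<in> S" "A \<subseteq> {0<..T}" for x A
    by (rule continuous_on_slice[OF cH that])
  have int: "(\<lambda>s. H s x) integrable_on {0<..t}" if "t \<le> T" "x \<in> S" for t x
  proof (rule integrable_dominated)
    show "continuous_on {0<..t} (\<lambda>s. H s x)" by (rule cHx) (use that in auto)
    show "k integrable_on {0..t}" using ik'[OF that(1)] by (simp add: integrable_half_open)
    show "cmod (H s x) \<le> k s" if "s \<in> {0<..t}" for s
      by (rule bd) (use that \<open>t \<le> T\<close> \<open>x \<in> S\<close> in auto)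
  qed
  have kint: "k integrable_on {a..t}" if "0 \<le> a" "t \<le> T" for a t
    by (rule integrable_on_subinterval[OF ik]) (use that in auto)
  have diff: "cmod (Y t x - Y a x) \<le> \<Theta> t - \<Theta> a" if "0 < a" "a \<le> t" "t \<le> T" "x \<in> S" for a t x
  proof -
    have "Y t x - Y a x = integral {a..t} (\<lambda>s. H s x)"
      unfolding Y_def using integral_split_half_open[OF int[of t x], of a] that by simp
    moreover have "cmod (integral {a..t} (\<lambda>s. H s x)) \<le> integral {a..t} k"
      by (rule integral_norm_bound_integral)
        (use that kint bd in \<open>auto intro!: integrable_continuous_real cHx\<close>)
    moreover have "\<Theta> t - \<Theta> a = integral {a..t} k"
      unfolding \<Theta>_def using integral_split_half_open[OF ik'[of t], of a] that by simp
    ultimately show ?thesis by simp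
  qed
  have c\<Theta>: "continuous_on {0..T} \<Theta>"
    unfolding \<Theta>_def integral_half_open by (rule indefinite_integral_continuous_1[OF ik])
  show hol: "Y t holomorphic_on S" if t: "t \<in> {0<..T}" for t
  proof (rule holomorphic_uniform_sequence[OF S])
    let ?f = "\<lambda>n x. integral (cbox (t / real (Suc n)) t) (\<lambda>s. H s x)"
    show "?f n holomorphic_on S" for n
    proof -
      have tn: "0 < t / real (Suc n)" "t / real (Suc n) \<le> t" using t by (auto simp: field_simps)
      have sub: "cbox (t / real (Suc n)) t \<subseteq> {0<..T}" 
      proof
        fix s assume "s \<in> cbox (t / real (Suc n)) t"
        then have "t / real (Suc n) \<le> s" "s \<le> t" by auto
        then show "s \<in> {0<..T}" using tn t by auto
      qed
      have "?f n field_differentiable at x" if x: "x \<in> S" for x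
      proof -
        obtain d where d: "d > 0" "ball x d \<subseteq> S" using S x by (meson open_contains_ball)
        have "?f n holomorphic_on ball x d"
        proof (rule leibniz_rule_holomorphic[where fx="\<lambda>x s. deriv (H s) x"])
          show "((\<lambda>x. H s x) has_field_derivative deriv (H s) y) (at y within ball x d)"
            if "y \<in> ball x d" "s \<in> cbox (t / real (Suc n)) t" for y s
            by (rule has_field_derivative_at_within, rule holomorphic_derivI[OF hH S])
              (use that d(2) sub in auto)
          show "(\<lambda>s. H s y) integrable_on cbox (t / real (Suc n)) t" if "y \<in> ball x d" for y
            by (rule integrable_continuous, rule cHx) (use that d(2) sub in auto)
          show "continuous_on (ball x d \<times> cbox (t / real (Suc n)) t) (\<lambda>(x, s). deriv (H s) x)"
            by (rule continuous_on_swap[OF continuous_on_deriv_param[OF S cH hH]]) (use d sub in auto)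
        qed auto
        then show ?thesis
          using d(1) holomorphic_on_imp_differentiable_at[of _ "ball x d" x] by simp
      qed
      then show ?thesis by (simp add: holomorphic_on_def field_differentiable_at_within)
    qed
    have "uniform_limit S ?f (Y t) sequentially"
    proof (rule uniform_limitI)
      fix e :: real assume e: "0 < e"
      have "(\<Theta> \<longlongrightarrow> \<Theta> 0) (at 0 within {0..T})" using c\<Theta> t unfolding continuous_on_def by force
      then have "(\<Theta> \<longlongrightarrow> 0) (at_right 0)" using t by (simp add: at_within_Icc_at_right \<Theta>_def)
      moreover have "filterlim (\<lambda>n. t / real (Suc n)) (at_right 0) sequentially"
      proof (rule tendsto_imp_filterlim_at_right)
        have "(\<lambda>n. t * inverse (real (Suc n))) \<longlonglongrightarrow> t * 0" by (intro tendsto_intros LIMSEQ_inverse_real_of_nat)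
        then show "(\<lambda>n. t / real (Suc n)) \<longlonglongrightarrow> 0" by (simp add: divide_inverse)
      qed (use t in auto)
      ultimately have "(\<lambda>n. \<Theta> (t / real (Suc n))) \<longlonglongrightarrow> 0" by (rule filterlim_compose)
      then have "\<forall>\<^sub>F n in sequentially. \<Theta> (t / real (Suc n)) < e" using order_tendstoD(2) e by blast
      moreover have "dist (?f n x) (Y t x) \<le> \<Theta> (t / real (Suc n))" if "x \<in> S" for n x
      proof -
        have tn: "0 \<le> t / real (Suc n)" "t / real (Suc n) \<le> t" "t / real (Suc n) \<le> T" using t by (auto simp: field_simps intro: order_trans)
        have "Y t x - ?f n x = integral {0<..t / real (Suc n)} (\<lambda>s. H s x)"
          unfolding Y_def using integral_split_half_open[OF int[of t x] tn(1,2)] t that by simp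
        moreover have "cmod (integral {0<..t / real (Suc n)} (\<lambda>s. H s x)) \<le> \<Theta> (t / real (Suc n))"
          unfolding \<Theta>_def by (rule integral_norm_bound_integral[OF int[OF tn(3) that] ik'[OF tn(3)]])
            (use bd tn(3) that in auto)
        ultimately show ?thesis by (simp add: dist_norm norm_minus_commute)
      qed
      ultimately show "\<forall>\<^sub>F n in sequentially. \<forall>x\<in>S. dist (?f n x) (Y t x) < e"
        by (auto elim!: eventually_mono intro: le_less_trans)
    qed
    then show "\<exists>d>0. cball x d \<subseteq> S \<and> uniform_limit (cball x d) ?f (Y t) sequentially" if "x \<in> S" for x
      using S that unfolding open_contains_cball by (meson uniform_limit_on_subset)
  qed
  show "continuous_on ({0<..T} \<times> S) (\<lambda>(t,x). Y t x)"
    unfolding continuous_on_def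
  proof clarify
    fix t x assume t: "t \<in> {0<..T}" and x: "x \<in> S"
    let ?F = "at (t,x) within {0<..T} \<times> S"
    have ev: "\<forall>\<^sub>F p in ?F. p \<in> {0<..T} \<times> S" by (simp add: eventually_at_filter)
    have "(Y t \<longlongrightarrow> Y t x) (at x within S)"
      using holomorphic_on_imp_continuous_on[OF hol[OF t]] x by (auto simp: continuous_on_def)
    have 1: "((\<lambda>p. Y t (snd p)) \<longlongrightarrow> Y t x) ?F"
    proof -
      have "continuous_on ({0<..T} \<times> S) (\<lambda>p. Y t (snd p))"
        by (rule continuous_on_compose2[OF holomorphic_on_imp_continuous_on[OF hol[OF t]]]) (auto intro!: continuous_intros)
      then show ?thesis using t x by (auto simp: continuous_on_def)
    qed
    have 2: "((\<lambda>p. \<bar>\<Theta> (fst p) - \<Theta> t\<bar>) \<longlongrightarrow> \<bar>\<Theta> t - \<Theta> t\<bar>) ?F"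
    proof -
      have "continuous_on ({0<..T} \<times> S) (\<lambda>p. \<Theta> (fst p))"
        by (rule continuous_on_compose2[OF c\<Theta>]) (auto intro!: continuous_intros)
      then have "((\<lambda>p. \<Theta> (fst p)) \<longlongrightarrow> \<Theta> t) ?F" using t x by (auto simp: continuous_on_def)
      then show ?thesis by (intro tendsto_intros)
    qed
    have 3: "((\<lambda>p. Y (fst p) (snd p) - Y t (snd p)) \<longlongrightarrow> 0) ?F"
    proof (rule Lim_null_comparison)
      show "\<forall>\<^sub>F p in ?F. cmod (Y (fst p) (snd p) - Y t (snd p)) \<le> \<bar>\<Theta> (fst p) - \<Theta> t\<bar>"
        using ev
      proof eventually_elim
        case (elim p)
        then have p: "fst p \<in> {0<..T}" "snd p \<in> S" by auto
        show ?case
        proof (cases "t \<le> fst p")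
          case True
          then show ?thesis using diff[of t "fst p" "snd p"] p t by simp
        next
          case False
          then show ?thesis using diff[of "fst p" t "snd p"] p t by (simp add: norm_minus_commute)
        qed
      qed
      show "((\<lambda>p. \<bar>\<Theta> (fst p) - \<Theta> t\<bar>) \<longlongrightarrow> 0) ?F" using 2 by simp
    qed
    have "((\<lambda>p. Y (fst p) (snd p)) \<longlongrightarrow> Y t x) ?F"
      using tendsto_add[OF 3 1] by simp
    then show "((\<lambda>(t,x). Y t x) \<longlongrightarrow> Y t x) ?F" by (simp add: split_beta')
  qed
  show "((\<lambda>s. Y s x) has_vector_derivative H t x) (at t)" if t: "t \<in> {0<..<T}" and x: "x \<in> S" for t x
  proof -
    obtain a where a: "0 < a" "a < t" using t dense[of 0 t] by auto
    obtain b where b: "t < b" "b < T" using t dense[of t T] by auto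
    have "((\<lambda>s. integral {a..s} (\<lambda>s. H s x)) has_vector_derivative H t x) (at t within {a..b})"
      by (rule integral_has_vector_derivative[OF cHx[OF x]]) (use a b in auto)
    then have "((\<lambda>s. Y a x + integral {a..s} (\<lambda>s. H s x)) has_vector_derivative 0 + H t x) (at t within {a..b})"
      by (intro has_vector_derivative_add has_vector_derivative_const)
    then have "((\<lambda>s. Y a x + integral {a..s} (\<lambda>s. H s x)) has_vector_derivative H t x) (at t)"
      using a b by (simp add: at_within_Icc_at)
    then show ?thesis
    proof (rule has_vector_derivative_transform_within_open[of _ _ _ "{a<..<b}"])
      show "Y a x + integral {a..s} (\<lambda>s. H s x) = Y s x" if "s \<in> {a<..<b}" for s
        unfolding Y_def using integral_split_half_open[OF int[of s x], of a] that a b x by simp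
    qed (use a b in auto)
  qed
qed

text \<open>The regions of the iteration are not products of an interval and a disc, so the product
  version is applied in a box around each point.\<close>

lemma continuous_on_deriv_open:
  assumes W: "open W" and cont: "continuous_on W (\<lambda>(t,x). f t x)"
    and hol: "\<And>t. f t holomorphic_on {x. (t,x) \<in> W}"
  shows "continuous_on W (\<lambda>(t::real,x). deriv (f t) x)"
proof -
  have "isCont (\<lambda>(t,x). deriv (f t) x) p" if p: "p \<in> W" for p
  proof -
    obtain A B where AB: "open A" "open B" "p \<in> A \<times> B" "A \<times> B \<subseteq> W"
      using open_prod_elim[OF W p] by auto
    have "continuous_on (A \<times> B) (\<lambda>(t,x). deriv (f t) x)"
    proof (rule continuous_on_deriv_param[OF AB(2)])
      show "continuous_on (A \<times> B) (\<lambda>(t,x). f t x)" by (rule continuous_on_subset[OF cont AB(4)])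
      show "f t holomorphic_on B" if "t \<in> A" for t
        by (rule holomorphic_on_subset[OF hol]) (use that AB(4) in auto)
    qed
    then show ?thesis using AB(3) open_Times[OF AB(1,2)] by (auto simp: continuous_on_eq_continuous_at simp del: mem_Times_iff)
  qed
  then show ?thesis using W by (simp add: continuous_on_eq_continuous_at)
qed

subsection \<open>Picard iteration on shrinking domains\<close>

text \<open>The explicit error matters besides the convergence: at n = 0 it bounds the distance of
  the limit from the first iterate, which keeps the limit in the domain of the nonlinearity.\<close>

lemma geometric_limit:
  fixes a :: "nat \<Rightarrow> complex"
  assumes "\<And>n. cmod (a (Suc n) - a n) \<le> C / 2^Suc n"
  obtains l where "a \<longlonglongrightarrow> l" "\<And>n. cmod (a n - l) \<le> C / 2^n"
proof -
  have *: "cmod (a (n + m) - a n) \<le> C / 2^n - C / 2^(n+m)" for n m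
  proof (induction m)
    case (Suc m)
    have "cmod (a (n + Suc m) - a n) \<le> cmod (a (Suc (n + m)) - a (n + m)) + cmod (a (n + m) - a n)"
      using norm_triangle_ineq[of "a (Suc (n + m)) - a (n + m)" "a (n + m) - a n"] by simp
    also have "\<dots> \<le> C / 2^Suc (n+m) + (C / 2^n - C / 2^(n+m))"
      by (intro add_mono assms Suc)
    finally show ?case by simp
  qed simp
  have C: "0 \<le> C" using order_trans[OF norm_ge_zero assms[of 0]] by simp
  have "summable (\<lambda>n. a (Suc n) - a n)"
  proof (rule summable_comparison_test')
    show "summable (\<lambda>n. C / 2 * (1/2)^n)" by (intro summable_mult summable_geometric) simp
    show "norm (a (Suc n) - a n) \<le> C / 2 * (1/2)^n" for n
      using assms[of n] by (simp add: power_divide)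
  qed
  then have "convergent (\<lambda>n. \<Sum>i<n. a (Suc i) - a i)" by (simp add: summable_iff_convergent)
  then have "convergent (\<lambda>n. a n - a 0)" by (simp add: sum_lessThan_telescope)
  then obtain l' where "(\<lambda>n. a n - a 0) \<longlonglongrightarrow> l'" by (auto simp: convergent_def)
  then have "(\<lambda>n. a n - a 0 + a 0) \<longlonglongrightarrow> l' + a 0" by (intro tendsto_intros)
  then have l: "a \<longlonglongrightarrow> l' + a 0" by simp
  have "cmod (a n - (l' + a 0)) \<le> C / 2^n" for n
  proof (rule tendsto_upperbound)
    show "(\<lambda>m. cmod (a n - a (m + n))) \<longlonglongrightarrow> cmod (a n - (l' + a 0))"
      by (intro tendsto_intros LIMSEQ_ignore_initial_segment l)
    have "cmod (a n - a (m + n)) \<le> C / 2^n" for m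
    proof -
      have "0 \<le> C / 2^(n+m)" using C by simp
      then show ?thesis using *[of n m] by (simp only: norm_minus_commute[of "a n"] add.commute[of m])
    qed
    then show "\<forall>\<^sub>F m in sequentially. cmod (a n - a (m + n)) \<le> C / 2^n" by simp
  qed simp
  with l show ?thesis using that by blast
qed

lemma integral_from_0_deriv:
  fixes k :: "real \<Rightarrow> real"
  assumes ck: "continuous_on {0<..<L} k" and ik: "k integrable_on {0..L}" and t: "t \<in> {0<..<L}"
  shows "((\<lambda>t. integral {0..t} k) has_real_derivative k t) (at t)"
proof -
  obtain a where a: "0 < a" "a < t" using t dense[of 0 t] by auto
  obtain b where b: "t < b" "b < L" using t dense[of t L] by auto
  have "((\<lambda>s. integral {a..s} k) has_vector_derivative k t) (at t within {a..b})"
    by (rule integral_has_vector_derivative[OF continuous_on_subset[OF ck]]) (use a b in auto)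
  then have "((\<lambda>s. integral {0..a} k + integral {a..s} k) has_vector_derivative 0 + k t) (at t within {a..b})"
    by (intro has_vector_derivative_add has_vector_derivative_const)
  then have "((\<lambda>s. integral {0..a} k + integral {a..s} k) has_vector_derivative k t) (at t)"
    using a b by (simp add: at_within_Icc_at)
  then have "((\<lambda>t. integral {0..t} k) has_vector_derivative k t) (at t)"
  proof (rule has_vector_derivative_transform_within_open[of _ _ _ "{a<..<b}"])
    show "integral {0..a} k + integral {a..s} k = integral {0..s} k" if "s \<in> {a<..<b}" for s
      by (rule Henstock_Kurzweil_Integration.integral_combine) (use that a b in \<open>auto intro: integrable_on_subinterval[OF ik]\<close>)
  qed (use a b in auto)
  then show ?thesis by (simp add: has_real_derivative_iff_has_vector_derivative)
qed

text \<open>The integral equation \<open>V = V0 + e(t,x) \<integral>\<^sub>0\<^sup>t G(s,x,V,\<partial>\<^sub>xV) / e(s,x) ds\<close>.  The domains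
  \<open>nagumo c\<close> shrink at speed proportional to \<open>k\<close>, which compensates the loss of a derivative in the
  Picard iteration; the radii \<open>c n\<close> decrease as well so that the iterates keep values in the
  domain of \<open>G\<close>.\<close>

locale singular_picard =
  fixes L R r :: real and k :: "real \<Rightarrow> real" and G :: rhs and e e' :: txfun and V0 :: "complex \<Rightarrow> complex"
  assumes L: "0 < L" and R: "0 < R" and r: "0 < r"
    and ck: "continuous_on {0<..<L} k" and k0: "\<And>t. t \<in> {0<..<L} \<Longrightarrow> 0 \<le> k t" and ik: "k integrable_on {0..L}"
    and e_ev: "evolves 0 L R e e'" and e0: "\<And>t x. t \<in> {0<..<L} \<Longrightarrow> x \<in> ball 0 R \<Longrightarrow> e t x \<noteq> 0"
    and e_mono: "\<And>s t x. 0 < s \<Longrightarrow> s \<le> t \<Longrightarrow> t < L \<Longrightarrow> x \<in> ball 0 R \<Longrightarrow> cmod (e t x) \<le> cmod (e s x)"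
    and V0_hol: "V0 holomorphic_on ball 0 R"
    and V0_bd: "\<And>x. x \<in> ball 0 R \<Longrightarrow> cmod (V0 x) < r/2" "\<And>x. x \<in> ball 0 R \<Longrightarrow> cmod (deriv V0 x) < r/2"
    and G_cont: "continuous_on ({0<..<L} \<times> ball 0 R \<times> ball 0 r \<times> ball 0 r) (\<lambda>(t,x,v,p). G t x v p)"
    and G_hol: "\<And>t S f g. t \<in> {0<..<L} \<Longrightarrow> open S \<Longrightarrow> S \<subseteq> ball 0 R \<Longrightarrow> f holomorphic_on S \<Longrightarrow> g holomorphic_on S \<Longrightarrow>
        (\<And>x. x \<in> S \<Longrightarrow> f x \<in> ball 0 r) \<Longrightarrow> (\<And>x. x \<in> S \<Longrightarrow> g x \<in> ball 0 r) \<Longrightarrow> (\<lambda>x. G t x (f x) (g x)) holomorphic_on S"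
    and G_lip: "\<And>t x v p v' p'. t \<in> {0<..<L} \<Longrightarrow> x \<in> ball 0 R \<Longrightarrow> v \<in> ball 0 r \<Longrightarrow> p \<in> ball 0 r \<Longrightarrow> v' \<in> ball 0 r \<Longrightarrow> p' \<in> ball 0 r \<Longrightarrow>
        cmod (G t x v p - G t x v' p') \<le> k t * (cmod (v - v') + cmod (p - p'))"
    and G_0: "\<And>t x. t \<in> {0<..<L} \<Longrightarrow> x \<in> ball 0 R \<Longrightarrow> cmod (G t x (V0 x) (deriv V0 x)) \<le> k t"
    and small1: "8 * (R + 4) * integral {0..L} k \<le> R / 4"
    and small2: "16 * integral {0..L} k \<le> r"
    and small3: "256 * integral {0..L} k \<le> r * R"
begin

definition \<Theta> :: "real \<Rightarrow> real" where "\<Theta> t = integral {0..t} k"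
text \<open>If an increment is at most M/d, with d \<le> R the distance to the boundary, then it and
  its x-derivative together are at most M (R + 4)/d^2. Integration along the shrinking domain
  returns M (R + 4)/(K d). The choice of \<open>K\<close> makes each iteration gain a factor 1/8,
  which outweighs the factor 4^n caused by the decreasing radii.\<close>

definition K :: real where "K = 8 * (R + 4)"
definition nagumo :: "real \<Rightarrow> (real \<times> complex) set" where
  "nagumo c = {(t,x). 0 < t \<and> t < L \<and> cmod x < c - K * \<Theta> t}"
text \<open>Duhamel's operator: \<open>S h\<close> is the solution of w' = (e'/e) w + h with zero
  value at t = 0. The factor \<open>e\<close> absorbs a linear term that is too singular to be part
  of the Lipschitz rate.\<close>

definition S :: "txfun \<Rightarrow> txfun" where
  "S h t x = e t x * integral {0<..t} (\<lambda>s. h s x / e s x)"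
definition adm :: "(real \<times> complex) set \<Rightarrow> txfun \<Rightarrow> real \<Rightarrow> bool" where
  "adm W h B \<longleftrightarrow> continuous_on W (\<lambda>(t,x). h t x) \<and> (\<forall>t. h t holomorphic_on {x. (t,x) \<in> W}) \<and>
     (\<forall>(t,x)\<in>W. cmod (h t x) \<le> B * k t)"
text \<open>The value of \<open>S h\<close> at (t,x) involves h at (s,x) for all s in (0,t]; these
  are the regions on which the operator is well defined.\<close>

definition dclosed :: "(real \<times> complex) set \<Rightarrow> bool" where
  "dclosed W \<longleftrightarrow> open W \<and> W \<subseteq> {0<..<L} \<times> ball 0 R \<and> (\<forall>t x s. (t,x) \<in> W \<longrightarrow> 0 < s \<longrightarrow> s \<le> t \<longrightarrow> (s,x) \<in> W)"

lemma K: "0 < K" using R by (simp add: K_def)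

lemma ikt: "k integrable_on {a..t}" if "0 \<le> a" "t \<le> L" for a t
  by (rule integrable_on_subinterval[OF ik]) (use that in auto)

lemma k_open: "k integrable_on {0<..<t}" if "t \<le> L" for t
  using ikt[of 0 t] that by (simp add: integrable_on_open_interval_real)

lemma \<Theta>_nonneg: "0 \<le> \<Theta> t" if "t \<le> L"
proof -
  have "0 \<le> integral {0<..<t} k" by (rule integral_nonneg[OF k_open]) (use that k0 in auto)
  then show ?thesis by (simp add: \<Theta>_def integral_open_interval_real)
qed

lemma \<Theta>_mono: "\<Theta> s \<le> \<Theta> t" if "0 < s" "s \<le> t" "t \<le> L"
proof -
  have "integral {0<..<s} k \<le> integral {0<..<t} k"
    by (rule integral_subset_le) (use that k_open k0 in auto)
  then show ?thesis by (simp add: \<Theta>_def integral_open_interval_real)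
qed

lemma \<Theta>_cont: "continuous_on {0..L} \<Theta>"
  unfolding \<Theta>_def by (rule indefinite_integral_continuous_1[OF ik])

lemma \<Theta>_deriv: "t \<in> {0<..<L} \<Longrightarrow> (\<Theta> has_real_derivative k t) (at t)"
  unfolding \<Theta>_def by (rule integral_from_0_deriv[OF ck ik])

lemma K\<Theta>: "0 \<le> K * \<Theta> t \<and> K * \<Theta> t \<le> R / 4" if "t \<in> {0<..<L}"
proof -
  have "K * \<Theta> t \<le> K * \<Theta> L" by (rule mult_left_mono) (use that K \<Theta>_mono[of t L] in auto)
  moreover have "K * \<Theta> L \<le> R / 4" using small1 by (simp add: K_def \<Theta>_def)
  moreover have "0 \<le> K * \<Theta> t" using \<Theta>_nonneg[of t] K that by auto
  ultimately show ?thesis by linarith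
qed

lemma dclosed_nagumo: "dclosed (nagumo c)" if "c \<le> R"
proof -
  have "continuous_on ({0<..<L} \<times> UNIV) (\<lambda>z::real \<times> complex. c - K * \<Theta> (fst z) - cmod (snd z))"
    by (intro continuous_intros continuous_on_compose2[OF \<Theta>_cont]) auto
  from continuous_open_preimage[OF this, of "{0<..}"]
  have "open (({0<..<L} \<times> UNIV) \<inter> (\<lambda>z::real \<times> complex. c - K * \<Theta> (fst z) - cmod (snd z)) -` {0<..})"
    by (simp add: open_Times)
  moreover have e: "({0<..<L} \<times> UNIV) \<inter> (\<lambda>z::real \<times> complex. c - K * \<Theta> (fst z) - cmod (snd z)) -` {0<..} = nagumo c"
    by (auto simp: nagumo_def)
  ultimately have o: "open (nagumo c)" by simp
  have 1: "(t,x) \<in> {0<..<L} \<times> ball 0 R" if "(t,x) \<in> nagumo c" for t x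
    using that K\<Theta>[of t] \<open>c \<le> R\<close> by (auto simp: nagumo_def)
  have 2: "(s,x) \<in> nagumo c" if "(t,x) \<in> nagumo c" "0 < s" "s \<le> t" for s t x
  proof -
    have "K * \<Theta> s \<le> K * \<Theta> t" using that \<Theta>_mono[of s t] K by (auto simp: nagumo_def)
    then show ?thesis using that by (auto simp: nagumo_def)
  qed
  have 3: "nagumo c \<subseteq> {0<..<L} \<times> ball 0 R"
    by (rule subrelI) (rule 1)
  show ?thesis unfolding dclosed_def by (intro conjI allI impI o 3; rule 2)
qed

lemma eE: "continuous_on ({0<..<L} \<times> ball 0 R) (\<lambda>(t, x). e t x)"
  "t \<in> {0<..<L} \<Longrightarrow> e t holomorphic_on ball 0 R"
  "t \<in> {0<..<L} \<Longrightarrow> x \<in> ball 0 R \<Longrightarrow> ((\<lambda>s. e s x) has_vector_derivative e' t x) (at t)"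
  using e_ev by (auto simp: evolves_def)

text \<open>For x near x0 and a time t1 slightly after t0, |e(t1,x)| exceeds a positive constant m.
  Since |e| does not increase with time, the same lower bound holds for all earlier times, so h/e is
  dominated by (B/m) k down to t = 0, however \<open>e\<close> behaves there.\<close>

lemma S_local:
  assumes W: "dclosed W" and h: "adm W h B" and p: "(t0,x0) \<in> W"
  defines "Y \<equiv> \<lambda>t x. integral {0<..t} (\<lambda>s. h s x / e s x)"
  obtains t1 B1 where "open B1" "x0 \<in> B1" "t0 < t1" "0 < t0" "{0<..t1} \<times> B1 \<subseteq> W" 
    "Y t0 holomorphic_on B1" "continuous_on ({0<..t1} \<times> B1) (\<lambda>(t,x). Y t x)"
    "((\<lambda>s. Y s x0) has_vector_derivative h t0 x0 / e t0 x0) (at t0)"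
    "\<forall>t\<in>{0<..t1}. (\<lambda>s. h s x0 / e s x0) integrable_on {0<..t}"
proof -
  have W': "open W" "W \<subseteq> {0<..<L} \<times> ball 0 R" and dc: "\<And>t x s. (t,x) \<in> W \<Longrightarrow> 0 < s \<Longrightarrow> s \<le> t \<Longrightarrow> (s,x) \<in> W"
    using W by (auto simp: dclosed_def)
  have ch: "continuous_on W (\<lambda>(t,x). h t x)" and hh: "\<And>t. h t holomorphic_on {x. (t,x) \<in> W}"
    and bh: "\<And>t x. (t,x) \<in> W \<Longrightarrow> cmod (h t x) \<le> B * k t"
    using h by (auto simp: adm_def)
  obtain A B0 where AB: "open A" "open B0" "(t0,x0) \<in> A \<times> B0" "A \<times> B0 \<subseteq> W"
    using open_prod_elim[OF W'(1) p] by auto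
  obtain d where d: "d > 0" "ball t0 d \<subseteq> A" using AB open_contains_ball by blast
  define t1 where "t1 = t0 + d/2"
  have t1: "t0 < t1" "t1 \<in> A" using d by (auto simp: t1_def dist_real_def subset_iff)
  have t0: "0 < t0" using p W' by auto
  have "(t1,x0) \<in> W" using AB t1 by auto
  then have t1L: "t1 < L" using W' by auto
  have inW: "(s,x) \<in> W" if "s \<in> {0<..t1}" "x \<in> B0" for s x
    using dc[of t1 x s] that AB t1 by auto
  have B0R: "B0 \<subseteq> ball 0 R" using inW[of t0] t0 t1 W' by auto
  have et1: "continuous_on B0 (\<lambda>x. cmod (e t1 x))"
    using eE(2)[of t1] t0 t1 t1L B0R
    by (intro continuous_on_norm holomorphic_on_imp_continuous_on holomorphic_on_subset[OF eE(2)]) auto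
  define m where "m = cmod (e t1 x0) / 2"
  have x0: "x0 \<in> B0" "x0 \<in> ball 0 R" using AB B0R by auto
  have m: "0 < m" using e0[of t1 x0] t0 t1 t1L x0 by (simp add: m_def)
  define B1 where "B1 = B0 \<inter> (\<lambda>x. cmod (e t1 x)) -` {m<..}"
  have oB1: "open B1" unfolding B1_def by (rule continuous_open_preimage[OF et1 AB(2)]) simp
  have x0B1: "x0 \<in> B1" using x0 m by (simp add: B1_def m_def)
  have B1: "B1 \<subseteq> B0" "\<And>x. x \<in> B1 \<Longrightarrow> m < cmod (e t1 x)" by (auto simp: B1_def)
  have sub: "{0<..t1} \<times> B1 \<subseteq> W" using inW B1 by auto
  have sub2: "{0<..t1} \<times> B1 \<subseteq> {0<..<L} \<times> ball 0 R" using sub W' by blast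
  define H where "H = (\<lambda>s x. h s x / e s x)"
  have e_nz: "e s x \<noteq> 0" if "s \<in> {0<..t1}" "x \<in> B1" for s x
    by (rule e0) (use subsetD[OF sub2, of "(s,x)"] that in auto)
  have cH: "continuous_on ({0<..t1} \<times> B1) (\<lambda>(t,x). H t x)"
  proof -
    have "continuous_on ({0<..t1} \<times> B1) (\<lambda>p. (case p of (t,x) \<Rightarrow> h t x) / (case p of (t,x) \<Rightarrow> e t x))"
      by (intro continuous_on_divide continuous_on_subset[OF ch sub] continuous_on_subset[OF eE(1) sub2])
         (use e_nz in auto)
    then show ?thesis by (simp add: H_def split_beta')
  qed
  have hH: "H t holomorphic_on B1" if t: "t \<in> {0<..t1}" for t
    unfolding H_def
  proof (intro holomorphic_on_divide)
    show "h t holomorphic_on B1" by (rule holomorphic_on_subset[OF hh]) (use sub t in auto)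
    show "e t holomorphic_on B1"
    proof (rule holomorphic_on_subset[OF eE(2)])
      show "B1 \<subseteq> ball 0 R" using B1(1) B0R by (rule subset_trans)
    qed (use t t1L in auto)
  qed (use e_nz t in auto)
  have ikk: "(\<lambda>s. B / m * k s) integrable_on {0..t1}"
    by (intro integrable_on_mult_right ikt) (use t1L in auto)
  have bH: "cmod (H s x) \<le> B / m * k s" if s: "s \<in> {0<..t1}" and x: "x \<in> B1" for s x
  proof -
    have "cmod (e t1 x) \<le> cmod (e s x)" using e_mono[of s t1 x] s x subsetD[OF B1(1) x] subsetD[OF B0R] t1L by auto
    then have "m \<le> cmod (e s x)" using B1(2)[OF x] by linarith
    moreover have "cmod (h s x) \<le> B * k s" by (rule bh[OF subsetD[OF sub]]) (use s x in simp)
    moreover have "0 \<le> B * k s" using calculation(2) norm_ge_zero order_trans by blast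
    ultimately have "cmod (h s x) / cmod (e s x) \<le> B * k s / m"
      using m by (intro frac_le) auto
    then show ?thesis by (simp add: H_def norm_divide)
  qed
  note reg = indefinite_integral_regular[OF oB1 cH hH ikk bH]
  have Y: "Y = (\<lambda>t x. integral {0<..t} (\<lambda>s. H s x))" by (simp add: Y_def H_def)
  show ?thesis
  proof (rule that[OF oB1 x0B1 t1(1) t0 sub])
    show "Y t0 holomorphic_on B1" unfolding Y by (rule reg(1)) (use t0 t1 in auto)
    show "continuous_on ({0<..t1} \<times> B1) (\<lambda>(t,x). Y t x)" unfolding Y by (rule reg(2)) auto
    show "((\<lambda>s. Y s x0) has_vector_derivative h t0 x0 / e t0 x0) (at t0)"
      using reg(3)[of t0 x0] t0 t1 x0B1 unfolding Y by (simp add: H_def)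
    show "\<forall>t\<in>{0<..t1}. (\<lambda>s. h s x0 / e s x0) integrable_on {0<..t}"
    proof
      fix t assume t: "t \<in> {0<..t1}"
      have "(\<lambda>s. H s x0) integrable_on {0<..t}"
      proof (rule integrable_dominated)
        show "continuous_on {0<..t} (\<lambda>s. H s x0)"
          by (rule continuous_on_slice[OF cH x0B1]) (use t in auto)
        show "(\<lambda>s. B / m * k s) integrable_on {0..t}"
          by (intro integrable_on_mult_right ikt) (use t t1L in auto)
        show "cmod (H s x0) \<le> B / m * k s" if "s \<in> {0<..t}" for s
          by (rule bH) (use that t x0B1 in auto)
      qed
      then show "(\<lambda>s. h s x0 / e s x0) integrable_on {0<..t}" by (simp add: H_def)
    qed
  qed
qed

lemma S_reg:
  assumes W: "dclosed W" and h: "adm W h B"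
  shows "continuous_on W (\<lambda>(t,x). S h t x)" and "\<And>t. S h t holomorphic_on {x. (t,x) \<in> W}"
    and "\<And>t x. (t,x) \<in> W \<Longrightarrow> ((\<lambda>s. S h s x) has_vector_derivative e' t x / e t x * S h t x + h t x) (at t)"
    and "\<And>t x. (t,x) \<in> W \<Longrightarrow> (\<lambda>s. h s x / e s x) integrable_on {0<..t}"
proof -
  have W': "open W" "W \<subseteq> {0<..<L} \<times> ball 0 R" using W by (auto simp: dclosed_def)
  define Y where "Y = (\<lambda>t x. integral {0<..t} (\<lambda>s. h s x / e s x))"
  have ex: "\<exists>t1 B1. open B1 \<and> x \<in> B1 \<and> t < t1 \<and> 0 < t \<and> {0<..t1} \<times> B1 \<subseteq> W \<and>
      Y t holomorphic_on B1 \<and> continuous_on ({0<..t1} \<times> B1) (\<lambda>(t,x). Y t x) \<and>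
      ((\<lambda>s. Y s x) has_vector_derivative h t x / e t x) (at t) \<and>
      (\<forall>t\<in>{0<..t1}. (\<lambda>s. h s x / e s x) integrable_on {0<..t})" if p: "(t,x) \<in> W" for t x
    unfolding Y_def by (rule S_local[OF W h p]) (intro exI conjI; assumption)
  have SY: "S h = (\<lambda>t x. e t x * Y t x)" by (simp add: S_def Y_def fun_eq_iff)
  have "isCont (\<lambda>(t,x). S h t x) (t,x)" if p: "(t,x) \<in> W" for t x
  proof -
    obtain t1 B1 where l: "open B1" "x \<in> B1" "t < t1" "0 < t" "{0<..t1} \<times> B1 \<subseteq> W" 
      "continuous_on ({0<..t1} \<times> B1) (\<lambda>(t,x). Y t x)"
      using ex[OF p] by blast
    have "continuous_on ({0<..<t1} \<times> B1) (\<lambda>p. (case p of (t,x) \<Rightarrow> e t x) * (case p of (t,x) \<Rightarrow> Y t x))"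
    proof (intro continuous_on_mult)
      show "continuous_on ({0<..<t1} \<times> B1) (\<lambda>(t,x). e t x)"
        by (rule continuous_on_subset[OF eE(1)]) (use l W' in fastforce)
      show "continuous_on ({0<..<t1} \<times> B1) (\<lambda>(t,x). Y t x)"
        by (rule continuous_on_subset[OF l(6)]) auto
    qed
    then have "continuous_on ({0<..<t1} \<times> B1) (\<lambda>(t,x). S h t x)" by (simp add: SY split_beta')
    moreover have "open ({0<..<t1} \<times> B1)" using l by (intro open_Times) auto
    moreover have "(t,x) \<in> {0<..<t1} \<times> B1" using l by auto
    ultimately show ?thesis by (simp add: continuous_on_eq_continuous_at)
  qed
  then show "continuous_on W (\<lambda>(t,x). S h t x)"
    using W' by (auto simp: continuous_on_eq_continuous_at)
  show "S h t holomorphic_on {x. (t,x) \<in> W}" for t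
  proof -
    have "S h t field_differentiable (at x)" if p: "(t,x) \<in> W" for x
    proof -
      obtain t1 B1 where l: "open B1" "x \<in> B1" "t < t1" "0 < t" "{0<..t1} \<times> B1 \<subseteq> W" "Y t holomorphic_on B1"
        using ex[OF p] by blast
      have "e t holomorphic_on B1"
        by (rule holomorphic_on_subset[OF eE(2)]) (use l W' p in fastforce)+
      then have "S h t holomorphic_on B1" unfolding SY by (intro holomorphic_on_mult l(6))
      then show ?thesis using l holomorphic_on_imp_differentiable_at by blast
    qed
    then show ?thesis by (auto simp: holomorphic_on_def field_differentiable_at_within)
  qed
  show "((\<lambda>s. S h s x) has_vector_derivative e' t x / e t x * S h t x + h t x) (at t)" if p: "(t,x) \<in> W" for t x
  proof -
    have tx: "t \<in> {0<..<L}" "x \<in> ball 0 R" using p W' by auto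
    have "((\<lambda>s. Y s x) has_vector_derivative h t x / e t x) (at t)"
      using ex[OF p] by blast
    from has_vector_derivative_mult[OF eE(3)[OF tx] this]
    have "((\<lambda>s. S h s x) has_vector_derivative e t x * (h t x / e t x) + e' t x * Y t x) (at t)"
      by (simp add: SY)
    then show ?thesis using e0[OF tx] by (simp add: SY add.commute)
  qed
  show "(\<lambda>s. h s x / e s x) integrable_on {0<..t}" if p: "(t,x) \<in> W" for t x
  proof -
    obtain t1 where "t < t1" "0 < t" "\<forall>t\<in>{0<..t1}. (\<lambda>s. h s x / e s x) integrable_on {0<..t}"
      using ex[OF p] by blast
    then show ?thesis by auto
  qed
qed

text \<open>Monotonicity of |e| gives |e(t,x)/e(s,x)| \<le> 1 for s \<le> t: the integrating factor
  costs nothing in the estimates.\<close>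

lemma S_bound:
  assumes i: "(\<lambda>s. h s x / e s x) integrable_on {0<..t}" and \<phi>: "\<phi> integrable_on {0..t}"
    and le: "\<And>s. s \<in> {0<..t} \<Longrightarrow> cmod (h s x) \<le> \<phi> s" and tx: "t \<in> {0<..<L}" "x \<in> ball 0 R"
  shows "cmod (S h t x) \<le> integral {0..t} \<phi>"
proof -
  have "S h t x = integral {0<..t} (\<lambda>s. e t x * (h s x / e s x))"
    unfolding S_def by (rule integral_mult_right[symmetric])
  moreover have "cmod (integral {0<..t} (\<lambda>s. e t x * (h s x / e s x))) \<le> integral {0<..t} \<phi>"
  proof (rule integral_norm_bound_integral)
    show "(\<lambda>s. e t x * (h s x / e s x)) integrable_on {0<..t}" using i by (rule integrable_on_mult_right)
    show "\<phi> integrable_on {0<..t}" using \<phi> by (simp add: integrable_half_open)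
    fix s assume s: "s \<in> {0<..t}"
    have "cmod (e t x) \<le> cmod (e s x)" "e s x \<noteq> 0" using e_mono[of s t x] e0[of s x] s tx by auto
    then have "cmod (e t x) / cmod (e s x) * cmod (h s x) \<le> 1 * cmod (h s x)"
      by (intro mult_right_mono) (auto simp: divide_le_eq)
    then show "cmod (e t x * (h s x / e s x)) \<le> \<phi> s"
      using le[OF s] by (simp add: norm_mult norm_divide)
  qed
  ultimately show ?thesis by (simp add: integral_half_open)
qed

lemma S_bound_k:
  assumes "(\<lambda>s. h s x / e s x) integrable_on {0<..t}" 
    and "\<And>s. s \<in> {0<..t} \<Longrightarrow> cmod (h s x) \<le> N * k s" and tx: "t \<in> {0<..<L}" "x \<in> ball 0 R"
  shows "cmod (S h t x) \<le> N * \<Theta> t"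
proof -
  have "cmod (S h t x) \<le> integral {0..t} (\<lambda>s. N * k s)"
    by (rule S_bound[where h=h, OF assms(1) integrable_on_mult_right[OF ikt] assms(2) tx]) (use tx in auto)
  then show ?thesis by (simp add: \<Theta>_def)
qed

text \<open>The distance d(s) = c - K \<Theta>(s) - |x| has derivative -K k(s), so k N/d^2 is the
  derivative of N/(K d). Integration thus recovers one power of the distance to the boundary, the
  one that Cauchy's estimate had spent.\<close>

lemma S_bound_nagumo:
  assumes i: "(\<lambda>s. h s x / e s x) integrable_on {0<..t}" and c: "c \<le> R" and N: "0 \<le> N"
    and le: "\<And>s. s \<in> {0<..t} \<Longrightarrow> cmod (h s x) \<le> k s * N / (c - K * \<Theta> s - cmod x)\<^sup>2" and tx: "(t,x) \<in> nagumo c"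
  shows "cmod (S h t x) \<le> N / K / (c - K * \<Theta> t - cmod x)"
proof -
  have t: "t \<in> {0<..<L}" and x: "x \<in> ball 0 R" 
    using dclosed_nagumo[OF c] tx by (auto simp: dclosed_def)
  have pos: "0 < c - K * \<Theta> s - cmod x" if "s \<in> {0..t}" for s
  proof (cases "s = 0")
    case True
    then show ?thesis using tx K\<Theta>[OF t] by (auto simp: nagumo_def \<Theta>_def)
  next
    case False
    then have "K * \<Theta> s \<le> K * \<Theta> t" using that t K by (auto intro!: \<Theta>_mono)
    then show ?thesis using tx by (auto simp: nagumo_def)
  qed
  let ?f = "\<lambda>s. N / K / (c - K * \<Theta> s - cmod x)" and ?\<phi> = "\<lambda>s. k s * N / (c - K * \<Theta> s - cmod x)\<^sup>2"
  have "(?\<phi> has_integral ?f t - ?f 0) {0..t}"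
  proof (rule fundamental_theorem_of_calculus_interior)
    have "continuous_on {0..t} \<Theta>" by (rule continuous_on_subset[OF \<Theta>_cont]) (use t in auto)
    then show "continuous_on {0..t} ?f"
      using pos by (intro continuous_intros) (auto simp: less_imp_neq[THEN not_sym])
    show "(?f has_vector_derivative ?\<phi> s) (at s)" if s: "s \<in> {0<..<t}" for s
    proof -
      have d: "(\<Theta> has_real_derivative k s) (at s)" by (rule \<Theta>_deriv) (use s t in auto)
      have nz: "c - K * \<Theta> s - cmod x \<noteq> 0" using pos[of s] s by auto
      have "((\<lambda>s. c - K * \<Theta> s - cmod x) has_real_derivative - (K * k s)) (at s)"
        by (auto intro!: derivative_eq_intros d)
      from DERIV_divide[OF DERIV_const this nz]
      have "(?f has_real_derivative (0 * (c - K * \<Theta> s - cmod x) - N / K * - (K * k s)) / 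
          ((c - K * \<Theta> s - cmod x) * (c - K * \<Theta> s - cmod x))) (at s)" .
      moreover have "(0 * (c - K * \<Theta> s - cmod x) - N / K * - (K * k s)) = k s * N" using K by simp
      ultimately have "(?f has_real_derivative ?\<phi> s) (at s)"
        by (simp only: power2_eq_square)
      then show ?thesis by (simp add: has_real_derivative_iff_has_vector_derivative)
    qed
  qed (use t in auto)
  then have "?\<phi> integrable_on {0..t}" "integral {0..t} ?\<phi> = ?f t - ?f 0"
    by (auto simp: integral_unique)
  moreover have "cmod (S h t x) \<le> integral {0..t} ?\<phi>"
    by (rule S_bound[where h=h, OF i calculation(1) le t x])
  moreover have "0 \<le> ?f 0" using pos[of 0] t K N by simp
  ultimately show ?thesis by linarith
qed

lemma S_diff:
  assumes "(\<lambda>s. h s x / e s x) integrable_on {0<..t}" "(\<lambda>s. h' s x / e s x) integrable_on {0<..t}"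
  shows "S h t x - S h' t x = S (\<lambda>s x. h s x - h' s x) t x"
    "(\<lambda>s. (h s x - h' s x) / e s x) integrable_on {0<..t}"
  using integral_diff[OF assms] integrable_diff[OF assms]
  by (simp_all add: S_def diff_divide_distrib right_diff_distrib)

section \<open>The Picard iterates and their convergence\<close>

primrec V :: "nat \<Rightarrow> txfun" where
  "V 0 = (\<lambda>t x. V0 x)"
| "V (Suc n) = (\<lambda>t x. V0 x + S (\<lambda>s y. G s y (V n s y) (deriv (V n s) y)) t x)"

abbreviation H :: "nat \<Rightarrow> txfun" where
  "H n \<equiv> \<lambda>s y. G s y (V n s y) (deriv (V n s) y)"

text \<open>These radii decrease from R towards R/2. As K \<Theta> never exceeds R/4, all the
  regions contain the strip of radius R/4, where the limit will live.\<close>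

definition c :: "nat \<Rightarrow> real" where "c n = R * (1/2 + (1/2)^Suc n)"

lemma c: "c n \<le> R" "c (Suc n) \<le> c n" "c n - c (Suc n) = R / 2^(n+2)" "R/2 < c n"
proof -
  have "(1/2::real)^n \<le> 1" by (simp add: power_le_one)
  then show "c n \<le> R" "c (Suc n) \<le> c n" "c n - c (Suc n) = R / 2^(n+2)" "R/2 < c n"
    using R by (auto simp: c_def power_divide field_simps)
qed

lemma nagumo_mono: "nagumo a \<subseteq> nagumo b" if "a \<le> b"
  using that by (auto simp: nagumo_def)

lemma slice: "{x. (t,x) \<in> nagumo a} = (if 0 < t \<and> t < L then ball 0 (a - K * \<Theta> t) else {})"
  by (auto simp: nagumo_def)

text \<open>V0 and its derivative are below r/2, so staying within r/2 of them keeps the arguments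
  of G in the ball of radius r. The constant 1 + r is the bound at V0 plus the Lipschitz rate times
  r/2 + r/2.\<close>

lemma G_comp:
  assumes W: "dclosed W" and cv: "continuous_on W (\<lambda>(t,x). v t x)" and hv: "\<And>t. v t holomorphic_on {x. (t,x) \<in> W}"
    and bv: "\<And>t x. (t,x) \<in> W \<Longrightarrow> cmod (v t x - V0 x) \<le> r/2" "\<And>t x. (t,x) \<in> W \<Longrightarrow> cmod (deriv (v t) x - deriv V0 x) \<le> r/2"
  shows "adm W (\<lambda>t x. G t x (v t x) (deriv (v t) x)) (1 + r)"
    "\<And>t x. (t,x) \<in> W \<Longrightarrow> v t x \<in> ball 0 r" "\<And>t x. (t,x) \<in> W \<Longrightarrow> deriv (v t) x \<in> ball 0 r"
proof -
  have W': "open W" "W \<subseteq> {0<..<L} \<times> ball 0 R" using W by (auto simp: dclosed_def)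
  have tx: "t \<in> {0<..<L}" "x \<in> ball 0 R" if "(t,x) \<in> W" for t x using W' that by auto
  show b1: "v t x \<in> ball 0 r" if "(t,x) \<in> W" for t x
    using bv(1)[OF that] V0_bd(1)[OF tx(2)[OF that]] norm_triangle_sub[of "v t x" "V0 x"] by simp
  show b2: "deriv (v t) x \<in> ball 0 r" if "(t,x) \<in> W" for t x
    using bv(2)[OF that] V0_bd(2)[OF tx(2)[OF that]] norm_triangle_sub[of "deriv (v t) x" "deriv V0 x"] by simp
  have cd: "continuous_on W (\<lambda>(t,x). deriv (v t) x)" by (rule continuous_on_deriv_open[OF W'(1) cv hv])
  have "continuous_on W (\<lambda>p. (\<lambda>(t,x,v,p). G t x v p) (fst p, snd p, (\<lambda>(t,x). v t x) p, (\<lambda>(t,x). deriv (v t) x) p))"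
  proof (rule continuous_on_compose2[OF G_cont])
    show "continuous_on W (\<lambda>p. (fst p, snd p, (\<lambda>(t,x). v t x) p, (\<lambda>(t,x). deriv (v t) x) p))"
      by (intro continuous_intros cv cd)
    show "(\<lambda>p. (fst p, snd p, (\<lambda>(t,x). v t x) p, (\<lambda>(t,x). deriv (v t) x) p)) ` W \<subseteq> {0<..<L} \<times> ball 0 R \<times> ball 0 r \<times> ball 0 r"
    proof (rule image_subsetI)
      fix p assume "p \<in> W"
      then show "(fst p, snd p, (\<lambda>(t,x). v t x) p, (\<lambda>(t,x). deriv (v t) x) p) \<in> {0<..<L} \<times> ball 0 R \<times> ball 0 r \<times> ball 0 r"
        using tx[of "fst p" "snd p"] b1[of "fst p" "snd p"] b2[of "fst p" "snd p"] by (simp add: split_beta)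
    qed
  qed
  then have 1: "continuous_on W (\<lambda>(t,x). G t x (v t x) (deriv (v t) x))" by (simp add: split_beta')
  have 2: "(\<lambda>x. G t x (v t x) (deriv (v t) x)) holomorphic_on {x. (t,x) \<in> W}" for t
  proof (cases "t \<in> {0<..<L}")
    case True
    have o: "open {x. (t,x) \<in> W}"
      using open_vimage[OF W'(1) continuous_on_Pair[OF continuous_on_const continuous_on_id], of t]
      by (simp add: vimage_def)
    show ?thesis
      by (rule G_hol[OF True o _ hv holomorphic_deriv[OF hv o]]) (use b1 b2 W' in auto)
  next
    case False
    then have "{x. (t,x) \<in> W} = {}" using W' by auto
    then show ?thesis by (auto simp: holomorphic_on_def)
  qed
  have 3: "cmod (G t x (v t x) (deriv (v t) x)) \<le> (1 + r) * k t" if p: "(t,x) \<in> W" for t x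
  proof -
    have b0: "V0 x \<in> ball 0 r" "deriv V0 x \<in> ball 0 r"
      using V0_bd[OF tx(2)[OF p]] r by auto
    have "cmod (G t x (v t x) (deriv (v t) x) - G t x (V0 x) (deriv V0 x))
        \<le> k t * (cmod (v t x - V0 x) + cmod (deriv (v t) x - deriv V0 x))"
      by (rule G_lip[OF tx[OF p] b1[OF p] b2[OF p] b0])
    also have "\<dots> \<le> k t * (r/2 + r/2)"
      by (intro mult_left_mono add_mono bv p k0 tx[OF p])
    finally have "cmod (G t x (v t x) (deriv (v t) x) - G t x (V0 x) (deriv V0 x)) \<le> k t * r" by simp
    then show ?thesis
      using G_0[OF tx[OF p]] norm_triangle_sub[of "G t x (v t x) (deriv (v t) x)" "G t x (V0 x) (deriv V0 x)"]
      by (simp add: algebra_simps)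
  qed
  show "adm W (\<lambda>t x. G t x (v t x) (deriv (v t) x)) (1 + r)"
    unfolding adm_def using 1 2 3 by auto
qed

text \<open>The first increment is at most \<Theta>(L), and the distance to the boundary is at most
  R; so M divided by the distance bounds it.\<close>

definition M :: real where "M = R * \<Theta> L"

text \<open>On the region with radius \<open>c (Suc n)\<close> the distance to the boundary of the
  preceding region is at least R/2^(n+2). The two inequalities turn the bounds M/8^n over the
  distance, and 4 M/8^n over its square, into terms of a geometric series with sum r/2. They account
  for the smallness conditions \<open>small2\<close> and \<open>small3\<close>.\<close>

lemma M: "0 \<le> M" "M / 8^n * 2^(n+2) / R \<le> r/2/2^Suc n" "4 * (M / 8^n) * (2^(n+2) / R)\<^sup>2 \<le> r/2/2^Suc n"
proof -
  show "0 \<le> M" using \<Theta>_nonneg[of L] R by (simp add: M_def)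
  have "M / 8^n * 2^(n+2) / R = 4 * \<Theta> L / 4^n"
    using R by (simp add: M_def field_simps flip: power_mult_distrib)
  also have "\<dots> \<le> 4 * \<Theta> L / 2^n"
    using \<Theta>_nonneg[of L] by (intro divide_left_mono) (auto intro: power_mono)
  also have "\<dots> \<le> r/2/2^Suc n" using small2 by (simp add: \<Theta>_def field_simps)
  finally show "M / 8^n * 2^(n+2) / R \<le> r/2/2^Suc n" .
  have "(2::real)^(n+2) * 2^(n+2) = 16 * 4^n" by (simp add: flip: power_mult_distrib)
  then have "4 * (M / 8^n) * (2^(n+2) / R)\<^sup>2 = 4 * (R * \<Theta> L / (2^n * 4^n)) * (16 * 4^n / (R * R))"
    by (simp add: M_def power2_eq_square flip: power_mult_distrib)
  also have "\<dots> = 64 * \<Theta> L / (2^n * R)" using R by (simp add: field_simps)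
  also have "\<dots> \<le> r/2/2^Suc n" using small3 R by (simp add: \<Theta>_def field_simps)
  finally show "4 * (M / 8^n) * (2^(n+2) / R)\<^sup>2 \<le> r/2/2^Suc n" .
qed

text \<open>The number r/2 (1 - 2^(-n)) is the sum of the first n permitted increments r/2^(j+2), so
  the iterates never leave the domain of G.\<close>

definition inv :: "nat \<Rightarrow> bool" where
  "inv n \<longleftrightarrow> continuous_on (nagumo (c n)) (\<lambda>(t,x). V n t x) \<and> (\<forall>t. V n t holomorphic_on {x. (t,x) \<in> nagumo (c n)}) \<and>
    (\<forall>(t,x)\<in>nagumo (c n). cmod (V n t x - V0 x) \<le> r/2 * (1 - 1/2^n) \<and> cmod (deriv (V n t) x - deriv V0 x) \<le> r/2 * (1 - 1/2^n))"

text \<open>Nagumo's weighted norm: the increment may blow up like the inverse distance to the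
  boundary of the slice. This form, unlike a uniform bound, reproduces itself under the
  iteration.\<close>

definition step :: "nat \<Rightarrow> bool" where
  "step n \<longleftrightarrow> (\<forall>(t,x)\<in>nagumo (c n). cmod (V (Suc n) t x - V n t x) \<le> M / 8^n / (c n - K * \<Theta> t - cmod x))"

lemma inv_adm:
  assumes "inv n"
  shows "adm (nagumo (c n)) (H n) (1 + r)"
    "\<And>t x. (t,x) \<in> nagumo (c n) \<Longrightarrow> V n t x \<in> ball 0 r" "\<And>t x. (t,x) \<in> nagumo (c n) \<Longrightarrow> deriv (V n t) x \<in> ball 0 r"
proof -
  have *: "r/2 * (1 - 1/2^n) \<le> r/2" using r by (simp add: mult_le_cancel_left)
  note a = assms[unfolded inv_def]
  have 1: "cmod (V n t x - V0 x) \<le> r/2" "cmod (deriv (V n t) x - deriv V0 x) \<le> r/2"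
    if "(t,x) \<in> nagumo (c n)" for t x
    using a that * by (force intro: order_trans)+
  note g = G_comp[OF dclosed_nagumo[OF c(1)], of n "V n"]
  show "adm (nagumo (c n)) (H n) (1 + r)"
    "\<And>t x. (t,x) \<in> nagumo (c n) \<Longrightarrow> V n t x \<in> ball 0 r" "\<And>t x. (t,x) \<in> nagumo (c n) \<Longrightarrow> deriv (V n t) x \<in> ball 0 r"
    using g a 1 by blast+
qed

lemma V_Suc_regular:
  assumes "inv n"
  shows "continuous_on (nagumo (c n)) (\<lambda>(t,x). V (Suc n) t x)"
    "\<And>t. V (Suc n) t holomorphic_on {x. (t,x) \<in> nagumo (c n)}"
    "\<And>t x. (t,x) \<in> nagumo (c n) \<Longrightarrow> (\<lambda>s. H n s x / e s x) integrable_on {0<..t}"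
proof -
  note d = dclosed_nagumo[OF c(1), of n]
  note s = S_reg[OF d inv_adm(1)[OF assms]]
  have sub: "nagumo (c n) \<subseteq> {0<..<L} \<times> ball 0 R" using d by (simp add: dclosed_def)
  have "continuous_on (nagumo (c n)) (\<lambda>p. V0 (snd p) + (\<lambda>(t,x). S (H n) t x) p)"
    by (intro continuous_on_add s(1) continuous_on_compose2[OF holomorphic_on_imp_continuous_on[OF V0_hol]] continuous_intros)
      (use sub in auto)
  then show "continuous_on (nagumo (c n)) (\<lambda>(t,x). V (Suc n) t x)" by (simp add: split_beta')
  show "V (Suc n) t holomorphic_on {x. (t,x) \<in> nagumo (c n)}" for t
    unfolding V.simps by (intro holomorphic_on_add s(2) holomorphic_on_subset[OF V0_hol]) (use sub in auto)
  show "\<And>t x. (t,x) \<in> nagumo (c n) \<Longrightarrow> (\<lambda>s. H n s x / e s x) integrable_on {0<..t}" by (rule s(4))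
qed

text \<open>Cauchy's estimate with radius half the distance to the boundary of the slice.\<close>

lemma step_deriv:
  assumes i: "inv n" and st: "step n" and p: "(t,x) \<in> nagumo (c n)"
  shows "cmod (deriv (V (Suc n) t) x - deriv (V n t) x) \<le> 4 * (M / 8^n) / (c n - K * \<Theta> t - cmod x)\<^sup>2"
proof -
  define d where "d = c n - K * \<Theta> t - cmod x"
  have d: "0 < d" using p by (simp add: nagumo_def d_def)
  have t: "0 < t" "t < L" using p by (auto simp: nagumo_def)
  have sl: "{y. (t,y) \<in> nagumo (c n)} = ball 0 (c n - K * \<Theta> t)" using t by (simp add: slice)
  have sub: "(t,y) \<in> nagumo (c n) \<and> d/2 \<le> c n - K * \<Theta> t - cmod y" if "y \<in> ball x (d/2)" for y
  proof -
    have "cmod y \<le> cmod x + d/2" using that norm_triangle_ineq2[of y x] by (auto simp: dist_norm norm_minus_commute)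
    then show ?thesis using t d unfolding nagumo_def d_def by (auto simp: field_simps)
  qed
  have h: "V n t holomorphic_on {y. (t,y) \<in> nagumo (c n)}" "V (Suc n) t holomorphic_on {y. (t,y) \<in> nagumo (c n)}"
    using i V_Suc_regular(2)[OF i] by (auto simp: inv_def)
  have "cmod (deriv (\<lambda>y. V (Suc n) t y - V n t y) x) \<le> (M / 8^n / (d/2)) / (d/2)"
  proof (rule Cauchy_deriv_bound)
    show "(\<lambda>y. V (Suc n) t y - V n t y) holomorphic_on ball x (d/2)"
      by (intro holomorphic_on_diff holomorphic_on_subset[OF h(1)] holomorphic_on_subset[OF h(2)]) (use sub in auto)
    show "cmod (V (Suc n) t y - V n t y) \<le> M / 8^n / (d/2)" if "y \<in> ball x (d/2)" for y
    proof -
      have "cmod (V (Suc n) t y - V n t y) \<le> M / 8^n / (c n - K * \<Theta> t - cmod y)"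
        using st sub[OF that] by (auto simp: step_def)
      also have "\<dots> \<le> M / 8^n / (d/2)" using sub[OF that] d M(1) by (intro divide_left_mono) auto
      finally show ?thesis .
    qed
  qed (use d in auto)
  moreover have "deriv (\<lambda>y. V (Suc n) t y - V n t y) x = deriv (V (Suc n) t) x - deriv (V n t) x"
  proof -
    have xb: "x \<in> ball 0 (c n - K * \<Theta> t)" using p by (simp add: nagumo_def)
    show ?thesis
      by (rule deriv_diff; rule holomorphic_on_imp_differentiable_at[OF _ open_ball xb]) (use h in \<open>simp_all only: sl\<close>)
  qed
  ultimately have "cmod (deriv (V (Suc n) t) x - deriv (V n t) x) \<le> (M / 8^n / (d/2)) / (d/2)" by simp
  also have "\<dots> = 4 * (M / 8^n) / d\<^sup>2" by (simp add: power2_eq_square)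
  finally show ?thesis by (simp only: d_def)
qed

lemma step_bounds:
  assumes i: "inv n" and st: "step n" and p: "(t,x) \<in> nagumo (c (Suc n))"
  shows "cmod (V (Suc n) t x - V n t x) \<le> r/2/2^Suc n" 
    "cmod (deriv (V (Suc n) t) x - deriv (V n t) x) \<le> r/2/2^Suc n"
proof -
  have p': "(t,x) \<in> nagumo (c n)" using p nagumo_mono[OF c(2)] by auto
  define d where "d = c n - K * \<Theta> t - cmod x"
  have d: "R / 2^(n+2) \<le> d" "0 < R / 2^(n+2)" using p c(3)[of n] R by (auto simp: nagumo_def d_def)
  have "0 < d" using d by linarith
  moreover have "1 / d \<le> 1 / (R / 2^(n+2))"
    using d calculation R by (intro divide_left_mono) (auto intro!: mult_pos_pos divide_pos_pos)
  ultimately have i': "1 / d \<le> 2^(n+2) / R" "0 < d" by simp_all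
  have "cmod (V (Suc n) t x - V n t x) \<le> M / 8^n * (1/d)"
    using st p' by (auto simp: step_def d_def)
  also have "\<dots> \<le> M / 8^n * (2^(n+2) / R)" using i' M(1) by (intro mult_left_mono) auto
  also have "\<dots> \<le> r/2/2^Suc n" using M(2)[of n] by simp
  finally show "cmod (V (Suc n) t x - V n t x) \<le> r/2/2^Suc n" .
  have "cmod (deriv (V (Suc n) t) x - deriv (V n t) x) \<le> 4 * (M / 8^n) * (1/d)\<^sup>2"
    using step_deriv[OF i st p'] by (simp add: d_def power_divide)
  also have "\<dots> \<le> 4 * (M / 8^n) * (2^(n+2) / R)\<^sup>2"
    using i' M(1) by (intro mult_left_mono power_mono) auto
  also have "\<dots> \<le> r/2/2^Suc n" by (rule M(3))
  finally show "cmod (deriv (V (Suc n) t) x - deriv (V n t) x) \<le> r/2/2^Suc n" .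
qed

lemma inv_Suc:
  assumes i: "inv n" and st: "step n"
  shows "inv (Suc n)"
proof -
  have sub: "nagumo (c (Suc n)) \<subseteq> nagumo (c n)" by (rule nagumo_mono[OF c(2)])
  have e: "r/2 * (1 - 1/2^Suc n) = r/2 * (1 - 1/2^n) + r/2/2^Suc n" by (simp add: field_simps)
  have "cmod (V (Suc n) t x - V0 x) \<le> r/2 * (1 - 1/2^Suc n) \<and> cmod (deriv (V (Suc n) t) x - deriv V0 x) \<le> r/2 * (1 - 1/2^Suc n)"
    if p: "(t,x) \<in> nagumo (c (Suc n))" for t x
  proof -
    have "cmod (V n t x - V0 x) \<le> r/2 * (1 - 1/2^n)" "cmod (deriv (V n t) x - deriv V0 x) \<le> r/2 * (1 - 1/2^n)"
      using i p sub by (auto simp: inv_def)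
    then show ?thesis
      unfolding e using step_bounds[OF i st p] norm_triangle_ineq[of "V (Suc n) t x - V n t x" "V n t x - V0 x"]
        norm_triangle_ineq[of "deriv (V (Suc n) t) x - deriv (V n t) x" "deriv (V n t) x - deriv V0 x"]
      unfolding diff_add_cancel add_diff_eq by linarith
  qed
  moreover have "V (Suc n) t holomorphic_on {x. (t, x) \<in> nagumo (c (Suc n))}" for t
    by (rule holomorphic_on_subset[OF V_Suc_regular(2)[OF i]]) (use sub in auto)
  ultimately show ?thesis
    unfolding inv_def using continuous_on_subset[OF V_Suc_regular(1)[OF i] sub] by blast
qed

lemma step_Suc:
  assumes i: "inv n" and st: "step n"
  shows "step (Suc n)"
  unfolding step_def
proof clarify
  fix t x assume p: "(t,x) \<in> nagumo (c (Suc n))"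
  note i' = inv_Suc[OF i st]
  have sub: "nagumo (c (Suc n)) \<subseteq> nagumo (c n)" by (rule nagumo_mono[OF c(2)])
  note I1 = V_Suc_regular(3)[OF i'  p] and I0 = V_Suc_regular(3)[OF i, of t x]
  have p0: "(t,x) \<in> nagumo (c n)" using p sub by auto
  note D = S_diff[where h="H (Suc n)" and h'="H n", OF I1 I0[OF p0]]
  have "V (Suc (Suc n)) t x - V (Suc n) t x = S (\<lambda>s y. H (Suc n) s y - H n s y) t x"
    using D(1) by simp
  moreover have "cmod (S (\<lambda>s y. H (Suc n) s y - H n s y) t x) \<le> M / 8^n * (R + 4) / K / (c (Suc n) - K * \<Theta> t - cmod x)"
  proof (rule S_bound_nagumo[where h="\<lambda>s y. H (Suc n) s y - H n s y", OF D(2) c(1) _ _ p])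
    show "0 \<le> M / 8^n * (R + 4)" using M(1) R by auto
    fix s assume s: "s \<in> {0<..t}"
    have ps: "(s,x) \<in> nagumo (c (Suc n))" using dclosed_nagumo[OF c(1), of "Suc n"] p s by (auto simp: dclosed_def)
    then have ps0: "(s,x) \<in> nagumo (c n)" using sub by auto
    have sx: "s \<in> {0<..<L}" "x \<in> ball 0 R" using dclosed_nagumo[OF c(1), of n] ps0 by (auto simp: dclosed_def)
    define d where "d = c n - K * \<Theta> s - cmod x"
    define d' where "d' = c (Suc n) - K * \<Theta> s - cmod x"
    have d: "0 < d'" "d' \<le> d" using ps c(2)[of n] by (auto simp: nagumo_def d_def d'_def)
    have dR: "d \<le> R" 
      unfolding d_def using c(1)[of n] K\<Theta>[OF sx(1), THEN conjunct1] norm_ge_zero[of x] by linarith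
    have "cmod (H (Suc n) s x - H n s x) \<le> k s * (cmod (V (Suc n) s x - V n s x) + cmod (deriv (V (Suc n) s) x - deriv (V n s) x))"
      by (rule G_lip[OF sx inv_adm(2,3)[OF i' ps] inv_adm(2,3)[OF i ps0]])
    also have "\<dots> \<le> k s * (M / 8^n / d + 4 * (M / 8^n) / d\<^sup>2)"
      using st ps0 step_deriv[OF i st ps0] k0[OF sx(1)] by (intro mult_left_mono add_mono) (auto simp: step_def d_def)
    also have "M / 8^n / d + 4 * (M / 8^n) / d\<^sup>2 = M / 8^n * (d + 4) / d\<^sup>2"
      using d by (simp add: field_simps power2_eq_square)
    also have "\<dots> \<le> M / 8^n * (R + 4) / d'\<^sup>2"
      using d dR M(1) by (intro frac_le mult_left_mono power_mono mult_nonneg_nonneg) auto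
    finally show "cmod (H (Suc n) s x - H n s x) \<le> k s * (M / 8^n * (R + 4)) / (c (Suc n) - K * \<Theta> s - cmod x)\<^sup>2"
      using k0[OF sx(1)] by (simp add: mult_left_mono d'_def)
  qed
  \<comment> \<open>Here the value of \<open>K\<close> produces the gain of 1/8 per
    iteration.\<close>
  moreover have "M / 8^n * (R + 4) / K = M / 8^Suc n" 
  proof -
    have "a * b / (8 * b) = a / 8" if "b \<noteq> 0" for a b :: real using that by simp
    from this[of "R + 4" "M / 8^n"] show ?thesis using R by (simp only: K_def) simp
  qed
  ultimately show "cmod (V (Suc (Suc n)) t x - V (Suc n) t x) \<le> M / 8^Suc n / (c (Suc n) - K * \<Theta> t - cmod x)"
    by (simp only:)
qed

lemma inv_step: "inv n \<and> step n"
proof (induction n)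
  case 0
  have sub: "nagumo (c 0) \<subseteq> {0<..<L} \<times> ball 0 R" using dclosed_nagumo[OF c(1), of 0] by (simp add: dclosed_def)
  have "continuous_on (nagumo (c 0)) (\<lambda>p. V0 (snd p))"
    by (intro continuous_on_compose2[OF holomorphic_on_imp_continuous_on[OF V0_hol]] continuous_intros) (use sub in auto)
  then have i: "inv 0"
    unfolding inv_def using sub by (auto simp: split_beta' intro!: holomorphic_on_subset[OF V0_hol])
  have "step 0"
    unfolding step_def
  proof clarify
    fix t x assume p: "(t,x) \<in> nagumo (c 0)"
    have tx: "t \<in> {0<..<L}" "x \<in> ball 0 R" using sub p by auto
    have "cmod (S (H 0) t x) \<le> 1 * \<Theta> t"
    proof (rule S_bound_k[where h="H 0", OF V_Suc_regular(3)[OF i p] _ tx])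
      fix s assume "s \<in> {0<..t}"
      then show "cmod (H 0 s x) \<le> 1 * k s" using G_0[of s x] tx by simp
    qed
    also have "\<dots> \<le> \<Theta> L" using \<Theta>_mono[of t L] tx by simp
    also have "\<Theta> L \<le> M / (c 0 - K * \<Theta> t - cmod x)"
    proof -
      have D: "0 < c 0 - K * \<Theta> t - cmod x" using p by (simp add: nagumo_def)
      have "c 0 - K * \<Theta> t - cmod x \<le> R"
        using c(1)[of 0] K\<Theta>[OF tx(1), THEN conjunct1] norm_ge_zero[of x] by linarith
      then have "\<Theta> L * (c 0 - K * \<Theta> t - cmod x) \<le> M"
        using mult_left_mono[OF _ \<Theta>_nonneg[of L], of "c 0 - K * \<Theta> t - cmod x" R]
        by (simp only: M_def mult.commute order_refl)
      then show ?thesis using D by (simp only: pos_le_divide_eq)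
    qed
    finally show "cmod (V (Suc 0) t x - V 0 t x) \<le> M / 8^0 / (c 0 - K * \<Theta> t - cmod x)" by simp
  qed
  with i show ?case by simp
next
  case (Suc n)
  then show ?case using inv_Suc step_Suc by blast
qed

text \<open>On the strip of radius R/4 the iterates and their x-derivatives converge geometrically,
  so the limit may be taken inside the Lipschitz nonlinearity and then inside the integral. The last
  bound shows how the value V0 is assumed at t = 0: the source is at most (1 + r) k.\<close>

lemma solution_exists:
  "\<exists>v. evolves 0 L (R/4) v (\<lambda>t x. e' t x / e t x * (v t x - V0 x) + G t x (v t x) (deriv (v t) x)) \<and>
     (\<forall>t\<in>{0<..<L}. \<forall>x\<in>ball 0 (R/4). v t x \<in> ball 0 r \<and> deriv (v t) x \<in> ball 0 r \<and>
        cmod (v t x - V0 x) \<le> (1 + r) * integral {0..t} k)"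
proof -
  define W where "W = {0<..<L} \<times> ball (0::complex) (R/4)"
  have dW: "dclosed W" using R by (auto simp: dclosed_def W_def intro!: open_Times)
  have Wn: "W \<subseteq> nagumo (c n)" for n
  proof (rule subrelI)
    fix t x assume "(t,x) \<in> W"
    then show "(t,x) \<in> nagumo (c n)" using K\<Theta>[of t] c(4)[of n] by (auto simp: W_def nagumo_def)
  qed
  have sl: "{x. (t,x) \<in> W} = (if t \<in> {0<..<L} then ball 0 (R/4) else {})" for t by (auto simp: W_def)
  have i: "inv n" and st: "step n" for n using inv_step by auto
  define v where "v = (\<lambda>t x. lim (\<lambda>n. V n t x))"
  have lim: "(\<lambda>n. V n t x) \<longlonglongrightarrow> v t x \<and> (\<forall>n. cmod (V n t x - v t x) \<le> r/2/2^n)" if p: "(t,x) \<in> W" for t x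
  proof -
    obtain l where l: "(\<lambda>n. V n t x) \<longlonglongrightarrow> l" "\<And>n. cmod (V n t x - l) \<le> r/2/2^n"
      using geometric_limit[of "\<lambda>n. V n t x" "r/2"] step_bounds(1)[OF i st subsetD[OF Wn p]] by blast
    then have "v t x = l" by (simp add: v_def limI)
    with l show ?thesis by simp
  qed
  have unif: "uniform_limit W (\<lambda>n (t,x). V n t x) (\<lambda>(t,x). v t x) sequentially"
  proof (rule uniform_limitI)
    fix \<epsilon> :: real assume "0 < \<epsilon>"
    have "(\<lambda>n. r/2 * (1/2)^n) \<longlonglongrightarrow> r/2 * 0" by (intro tendsto_intros LIMSEQ_realpow_zero) auto
    then have "\<forall>\<^sub>F n in sequentially. r/2 * (1/2)^n < \<epsilon>" using \<open>0 < \<epsilon>\<close> by (intro order_tendstoD(2)) auto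
    then show "\<forall>\<^sub>F n in sequentially. \<forall>p\<in>W. dist (case p of (t,x) \<Rightarrow> V n t x) (case p of (t,x) \<Rightarrow> v t x) < \<epsilon>"
    proof eventually_elim
      case (elim n)
      show ?case
      proof
        fix p assume "p \<in> W"
        then have "cmod (V n (fst p) (snd p) - v (fst p) (snd p)) \<le> r/2/2^n" using lim[of "fst p" "snd p"] by simp
        then show "dist (case p of (t,x) \<Rightarrow> V n t x) (case p of (t,x) \<Rightarrow> v t x) < \<epsilon>"
          using elim by (simp add: dist_norm split_beta power_divide)
      qed
    qed
  qed
  have cv: "continuous_on W (\<lambda>(t,x). v t x)"
  proof (rule uniform_limit_theorem[OF _ unif])
    show "\<forall>\<^sub>F n in sequentially. continuous_on W (\<lambda>(t,x). V n t x)"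
    proof (intro always_eventually allI)
      fix n show "continuous_on W (\<lambda>(t,x). V n t x)"
        by (rule continuous_on_subset[OF _ Wn[of n]]) (use i[of n] in \<open>simp add: inv_def\<close>)
    qed
  qed simp
  have hVn: "V n t holomorphic_on ball 0 (R/4)" if t: "t \<in> {0<..<L}" for n t
  proof (rule holomorphic_on_subset)
    show "V n t holomorphic_on {x. (t,x) \<in> nagumo (c n)}" using i[of n] by (simp add: inv_def)
    show "ball 0 (R/4) \<subseteq> {x. (t,x) \<in> nagumo (c n)}" using t Wn[of n] by (auto simp: W_def)
  qed
  have ul: "uniform_limit (ball 0 (R/4)) (\<lambda>n. V n t) (v t) sequentially" if t: "t \<in> {0<..<L}" for t
  proof -
    have "uniform_limit (Pair t ` ball 0 (R/4)) (\<lambda>n (t,x). V n t x) (\<lambda>(t,x). v t x) sequentially"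
      by (rule uniform_limit_on_subset[OF unif]) (use t in \<open>auto simp: W_def\<close>)
    then show ?thesis by (simp add: uniform_limit_iff)
  qed
  have hv: "v t holomorphic_on ball 0 (R/4)" and dlim: "\<And>x. x \<in> ball 0 (R/4) \<Longrightarrow> (\<lambda>n. deriv (V n t) x) \<longlonglongrightarrow> deriv (v t) x"
    if t: "t \<in> {0<..<L}" for t
  proof -
    have u: "\<exists>d>0. cball x d \<subseteq> ball 0 (R/4) \<and> uniform_limit (cball x d) (\<lambda>n. V n t) (v t) sequentially" if "x \<in> ball 0 (R/4)" for x
      using that open_contains_cball[of "ball 0 (R/4)"] ul[OF t] by (meson open_ball uniform_limit_on_subset)
    show "v t holomorphic_on ball 0 (R/4)"
      by (rule holomorphic_uniform_sequence[OF open_ball hVn[OF t] u])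
    obtain g' where g': "\<forall>x\<in>ball 0 (R/4). (v t has_field_derivative g' x) (at x) \<and> (\<lambda>n. deriv (V n t) x) \<longlonglongrightarrow> g' x"
      using has_complex_derivative_uniform_sequence[OF open_ball holomorphic_derivI[OF hVn[OF t] open_ball] u] by blast
    show "(\<lambda>n. deriv (V n t) x) \<longlonglongrightarrow> deriv (v t) x" if x: "x \<in> ball 0 (R/4)" for x
    proof -
      have "deriv (v t) x = g' x" by (rule DERIV_imp_deriv) (use g' x in blast)
      then show ?thesis using g' x by simp
    qed
  qed
  have dbd: "cmod (deriv (V n t) x - deriv (v t) x) \<le> r/2/2^n" if p: "(t,x) \<in> W" for n t x
  proof -
    obtain l where l: "(\<lambda>n. deriv (V n t) x) \<longlonglongrightarrow> l" "\<And>n. cmod (deriv (V n t) x - l) \<le> r/2/2^n"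
      using geometric_limit[of "\<lambda>n. deriv (V n t) x" "r/2"] step_bounds(2)[OF i st subsetD[OF Wn p]] by blast
    then have "deriv (v t) x = l" using dlim[of t x] p LIMSEQ_unique by (auto simp: W_def)
    with l show ?thesis by simp
  qed
  have hv': "v t holomorphic_on {x. (t,x) \<in> W}" for t
    using hv[of t] holomorphic_on_empty by (auto simp: sl)
  \<comment> \<open>The geometric error estimates at n = 0, where the iterate is V0 itself.\<close>
  have b: "cmod (v t x - V0 x) \<le> r/2" "cmod (deriv (v t) x - deriv V0 x) \<le> r/2" if p: "(t,x) \<in> W" for t x
    using lim[OF p, THEN conjunct2, rule_format, of 0] dbd[OF p, of 0] by (simp_all add: norm_minus_commute)
  define h where "h = (\<lambda>t x. G t x (v t x) (deriv (v t) x))"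
  note comp = G_comp[where v=v, OF dW cv hv' b]
  have ah: "adm W h (1 + r)" using comp(1) by (simp add: h_def)
  have vb: "v t x \<in> ball 0 r" "deriv (v t) x \<in> ball 0 r" if "(t,x) \<in> W" for t x
    using comp(2,3) that by blast+
  note s = S_reg[OF dW ah]
  have eq: "v t x = V0 x + S h t x" if p: "(t,x) \<in> W" for t x
  proof -
    have tx: "t \<in> {0<..<L}" "x \<in> ball 0 R" using p R by (auto simp: W_def)
    \<comment> \<open>The sources differ by at most k times the sum of the two errors r/2/2^n; the
      operator \<open>S\<close> does not enlarge this beyond integrating \<open>k\<close>.\<close>
    have le: "cmod (S (H n) t x - S h t x) \<le> r / 2^n * \<Theta> t" for n
    proof -
      note D = S_diff[where h="H n" and h'=h, OF V_Suc_regular(3)[OF i subsetD[OF Wn p]] s(4)[OF p]]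
      have "cmod (S (\<lambda>s y. H n s y - h s y) t x) \<le> r / 2^n * \<Theta> t"
      proof (rule S_bound_k[where h="\<lambda>s y. H n s y - h s y", OF D(2) _ tx])
        fix s assume s: "s \<in> {0<..t}"
        have ps: "(s,x) \<in> W" using p s by (auto simp: W_def)
        have sx: "s \<in> {0<..<L}" using ps by (auto simp: W_def)
        have "cmod (H n s x - h s x) \<le> k s * (cmod (V n s x - v s x) + cmod (deriv (V n s) x - deriv (v s) x))"
          unfolding h_def by (rule G_lip[OF sx tx(2) inv_adm(2,3)[OF i subsetD[OF Wn ps]] vb[OF ps]])
        also have "\<dots> \<le> k s * (r/2/2^n + r/2/2^n)"
          by (intro mult_left_mono add_mono dbd ps k0 sx) (use lim[OF ps] in simp)
        finally show "cmod (H n s x - h s x) \<le> r / 2^n * k s" by (simp add: mult.commute)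
      qed
      then show ?thesis using D(1) by simp
    qed
    have lim0: "(\<lambda>n. r / 2^n * \<Theta> t) \<longlonglongrightarrow> 0"
    proof -
      have "(\<lambda>n. r * \<Theta> t * (1/2)^n) \<longlonglongrightarrow> r * \<Theta> t * 0" by (intro tendsto_intros LIMSEQ_realpow_zero) auto
      then show ?thesis by (simp add: power_divide)
    qed
    have "(\<lambda>n. S (H n) t x - S h t x) \<longlonglongrightarrow> 0"
      by (rule Lim_null_comparison[OF _ lim0], rule always_eventually, rule allI, rule le)
    then have "(\<lambda>n. V0 x + S h t x + (S (H n) t x - S h t x)) \<longlonglongrightarrow> V0 x + S h t x + 0" by (intro tendsto_intros)
    then have "(\<lambda>n. V (Suc n) t x) \<longlonglongrightarrow> V0 x + S h t x" by simp
    moreover have "(\<lambda>n. V (Suc n) t x) \<longlonglongrightarrow> v t x" using lim[OF p] by (intro LIMSEQ_Suc) auto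
    ultimately show ?thesis using LIMSEQ_unique by blast
  qed
  show ?thesis
  proof (intro exI[of _ v] conjI ballI)
    fix t and x :: complex assume tx: "t \<in> {0<..<L}" "x \<in> ball 0 (R/4)"
    then have p: "(t,x) \<in> W" by (simp add: W_def)
    show "v t x \<in> ball 0 r" "deriv (v t) x \<in> ball 0 r" using vb[OF p] .
    have xR: "x \<in> ball 0 R" using tx R by auto
    have "cmod (S h t x) \<le> (1 + r) * \<Theta> t"
    proof (rule S_bound_k[where h=h, OF s(4)[OF p] _ tx(1) xR])
      fix s assume "s \<in> {0<..t}"
      then have "(s,x) \<in> W" using p by (auto simp: W_def)
      then show "cmod (h s x) \<le> (1 + r) * k s" using ah by (auto simp: adm_def)
    qed
    then show "cmod (v t x - V0 x) \<le> (1 + r) * integral {0..t} k" using eq[OF p] by (simp add: \<Theta>_def)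
  next
    let ?g = "\<lambda>t x. e' t x / e t x * (v t x - V0 x) + G t x (v t x) (deriv (v t) x)"
    have R4: "ball (0::complex) (R/4) \<subseteq> ball 0 R" using R by auto
    have enz: "e t x \<noteq> 0" if "t \<in> {0<..<L}" "x \<in> ball 0 (R/4)" for t x using e0 that R4 by blast
    have ev: "continuous_on ({0<..<L} \<times> ball 0 R) (\<lambda>(t,x). e' t x)" "\<And>t. t \<in> {0<..<L} \<Longrightarrow> e' t holomorphic_on ball 0 R"
      using e_ev by (auto simp: evolves_def)
    have WR: "W \<subseteq> {0<..<L} \<times> ball 0 R" using dW by (simp add: dclosed_def)
    have "continuous_on W (\<lambda>p. (\<lambda>(t,x). e' t x) p / (\<lambda>(t,x). e t x) p * ((\<lambda>(t,x). v t x) p - V0 (snd p)) + (\<lambda>(t,x). h t x) p)"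
    proof (intro continuous_intros cv continuous_on_subset[OF ev(1) WR] continuous_on_subset[OF eE(1) WR])
      show "continuous_on W (\<lambda>p. V0 (snd p))"
        by (rule continuous_on_compose2[OF holomorphic_on_imp_continuous_on[OF V0_hol]]) (use WR in \<open>auto intro!: continuous_intros\<close>)
      show "continuous_on W (\<lambda>(t,x). h t x)" using ah by (simp add: adm_def)
    qed (use enz in \<open>auto simp: W_def\<close>)
    then have cg: "continuous_on ({0<..<L} \<times> ball 0 (R/4)) (\<lambda>(t,x). ?g t x)"
      by (simp add: W_def h_def split_beta')
    have hg: "?g t holomorphic_on ball 0 (R/4)" if t: "t \<in> {0<..<L}" for t
    proof (intro holomorphic_intros)
      have "h t holomorphic_on {x. (t,x) \<in> W}" using ah by (simp add: adm_def)
      then show "(\<lambda>x. G t x (v t x) (deriv (v t) x)) holomorphic_on ball 0 (R/4)" using t by (simp add: sl h_def)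
    qed (use t enz hv holomorphic_on_subset[OF _ R4] ev(2) eE(2) V0_hol in auto)
    have dg: "((\<lambda>s. v s x) has_vector_derivative ?g t x) (at t)" if tx: "t \<in> {0<..<L}" "x \<in> ball 0 (R/4)" for t x
    proof -
      have p: "(t,x) \<in> W" using tx by (simp add: W_def)
      have "((\<lambda>s. V0 x + S h s x) has_vector_derivative 0 + (e' t x / e t x * S h t x + h t x)) (at t)"
        by (intro has_vector_derivative_add has_vector_derivative_const s(3)[OF p])
      then have "((\<lambda>s. V0 x + S h s x) has_vector_derivative ?g t x) (at t)"
        using eq[OF p] by (simp add: h_def)
      then show ?thesis
        by (rule has_vector_derivative_transform_within_open[of _ _ _ "{0<..<L}"])
          (use tx eq[symmetric] in \<open>auto simp: W_def\<close>)
    qed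
    show "evolves 0 L (R/4) v ?g"
      unfolding evolves_def using cv cg hv hg dg by (auto simp: W_def)
  qed
qed

end

subsection \<open>The Briot--Bouquet equation\<close>

lemma deriv_bound_ball:
  assumes "f holomorphic_on ball 0 (2*\<rho>)" "0 < \<rho>" "\<And>y. y \<in> ball 0 (2*\<rho>) \<Longrightarrow> cmod (f y) \<le> M" "z \<in> ball 0 \<rho>"
  shows "cmod (deriv f z) \<le> M / \<rho>"
proof -
  have sub: "ball z \<rho> \<subseteq> ball 0 (2*\<rho>)"
  proof
    fix y assume "y \<in> ball z \<rho>"
    then show "y \<in> ball 0 (2*\<rho>)" using assms(4) norm_triangle_ineq2[of y z] by (auto simp: dist_norm norm_minus_commute)
  qed
  show ?thesis
    by (rule Cauchy_deriv_bound[OF holomorphic_on_subset[OF assms(1) sub] assms(2)]) (use assms(3) sub in blast)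
qed

lemma lipschitz_ball:
  assumes "f holomorphic_on ball 0 (2*\<rho>)" "0 < \<rho>" "\<And>y. y \<in> ball 0 (2*\<rho>) \<Longrightarrow> cmod (f y) \<le> M" "z \<in> ball 0 \<rho>" "z' \<in> ball 0 \<rho>"
  shows "cmod (f z - f z') \<le> M / \<rho> * cmod (z - z')"
proof (rule field_differentiable_bound[OF convex_ball])
  show "(f has_field_derivative deriv f y) (at y within ball 0 \<rho>)" if "y \<in> ball 0 \<rho>" for y
    by (rule has_field_derivative_at_within, rule holomorphic_derivI[OF assms(1) open_ball]) (use that assms(2) in auto)
  show "cmod (deriv f y) \<le> M / \<rho>" if "y \<in> ball 0 \<rho>" for y
    by (rule deriv_bound_ball[OF assms(1-3) that])
qed (use assms in auto)

lemma deriv_diff_ball: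
  assumes "f holomorphic_on ball 0 (2*\<rho>)" "g holomorphic_on ball 0 (2*\<rho>)" "0 < \<rho>"
    "\<And>y. y \<in> ball 0 (2*\<rho>) \<Longrightarrow> cmod (f y - g y) \<le> M" "z \<in> ball 0 \<rho>"
  shows "cmod (deriv f z - deriv g z) \<le> M / \<rho>"
proof -
  have z: "z \<in> ball 0 (2*\<rho>)" using assms(3,5) by auto
  have "deriv (\<lambda>y. f y - g y) z = deriv f z - deriv g z"
    by (rule deriv_diff; rule holomorphic_on_imp_differentiable_at[OF _ open_ball z]) (use assms in auto)
  moreover have "cmod (deriv (\<lambda>y. f y - g y) z) \<le> M / \<rho>"
    by (rule deriv_bound_ball[OF holomorphic_on_diff[OF assms(1,2)] assms(3,4,5)])
  ultimately show ?thesis by simp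
qed

locale briot_bouquet =
  fixes T0 R0 \<rho>0 A \<mu> \<Lambda> B :: real and F :: rhs and m :: "real \<Rightarrow> real"
  assumes T0: "0 < T0" "T0 < 1" and R0: "0 < R0" and \<rho>0: "0 < \<rho>0"
    and A1_cont: "continuous_on (Omega T0 R0 \<rho>0) (\<lambda>(t, x, z1, z2). F t x z1 z2)"
    and A1_hol: "\<And>t. t \<in> {0..T0} \<Longrightarrow> holomorphic3_on (F t) (ball 0 R0 \<times> ball 0 \<rho>0 \<times> ball 0 \<rho>0)"
    and A2: "\<And>x. x \<in> ball 0 R0 \<Longrightarrow> F 0 x 0 0 = 0"
    and A3: "\<And>x. x \<in> ball 0 R0 \<Longrightarrow> coeff_b F 0 x = 0"
    and Re_lambda: "0 < Re (coeff_lambda F 0 0)"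
    and A: "0 < A" and \<mu>: "0 < \<mu>" and \<Lambda>: "0 < \<Lambda>" and B: "0 < B"
    and weight: "weight_function T0 m"
    and c1: "\<And>t x. t \<in> {0<..T0} \<Longrightarrow> x \<in> ball 0 R0 \<Longrightarrow> cmod (coeff_a F t x) \<le> A * t powr \<mu>"
    and c2: "\<And>t x. t \<in> {0<..T0} \<Longrightarrow> x \<in> ball 0 R0 \<Longrightarrow>
               cmod (coeff_lambda F t x - coeff_lambda F 0 x) \<le> \<Lambda> * m t"
    and c3: "\<And>t x. t \<in> {0<..T0} \<Longrightarrow> x \<in> ball 0 R0 \<Longrightarrow>
               cmod (coeff_b F t x) \<le> B * m t / \<bar>ln t\<bar>"
begin

definition lam :: "complex \<Rightarrow> complex" where "lam x = coeff_lambda F 0 x"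
text \<open>The radii leave room for successive Cauchy estimates: F is bounded on the closed
  polydisc of radii R0/2 and \<rho>0/2, its first partial derivatives are bounded for arguments
  below \<rho>0/4, and they are Lipschitz for arguments below \<rho>0/8.\<close>

definition R1 :: real where "R1 = R0 / 2"
definition r1 :: real where "r1 = \<rho>0 / 8"
definition F1 where "F1 t x z1 z2 = deriv (\<lambda>z. F t x z z2) z1"
definition F2 where "F2 t x z1 z2 = deriv (\<lambda>z. F t x z1 z) z2"
definition Fx where "Fx t x z1 z2 = deriv (\<lambda>y. F t y z1 z2) x"

lemma pos: "0 < R1" "R1 < R0" "0 < r1" "r1 < \<rho>0" using R0 \<rho>0 by (auto simp: R1_def r1_def)

text \<open>The complex Frechet derivative has three unknown coefficients. Curves that vary only one
  of the arguments identify them with the one-variable derivatives \<open>Fx\<close>,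
  \<open>F1\<close>, \<open>F2\<close>.\<close>

lemma chain:
  assumes t: "t \<in> {0..T0}" and p: "f x \<in> ball 0 R0" "g x \<in> ball 0 \<rho>0" "h x \<in> ball 0 \<rho>0"
    and d: "(f has_field_derivative f') (at x)" "(g has_field_derivative g') (at x)" "(h has_field_derivative h') (at x)"
  shows "((\<lambda>x. F t (f x) (g x) (h x)) has_field_derivative
     Fx t (f x) (g x) (h x) * f' + F1 t (f x) (g x) (h x) * g' + F2 t (f x) (g x) (h x) * h') (at x)"
proof -
  let ?D = "ball (0::complex) R0 \<times> ball (0::complex) \<rho>0 \<times> ball (0::complex) \<rho>0"
  have pD: "(f x, g x, h x) \<in> ?D" using p by auto
  obtain a b c where "((\<lambda>(x, y, z). F t x y z) has_derivative (\<lambda>(h, k, l). a * h + b * k + c * l)) (at (f x, g x, h x) within ?D)"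
    using A1_hol[OF t] pD unfolding holomorphic3_on_def by blast
  moreover have "at (f x, g x, h x) within ?D = at (f x, g x, h x)"
    by (rule at_within_open[OF pD]) (intro open_Times open_ball)
  ultimately have D: "((\<lambda>(x, y, z). F t x y z) has_derivative (\<lambda>(h, k, l). a * h + b * k + c * l)) (at (f x, g x, h x))"
    by simp
  have gen: "((\<lambda>y. F t (f1 y) (g1 y) (h1 y)) has_field_derivative a * f1' + b * g1' + c * h1') (at y)"
    if v: "f1 y = f x" "g1 y = g x" "h1 y = h x"
      and d1: "(f1 has_field_derivative f1') (at y)" "(g1 has_field_derivative g1') (at y)" "(h1 has_field_derivative h1') (at y)"
    for f1 g1 h1 :: "complex \<Rightarrow> complex" and f1' g1' h1' y
  proof -
    have "((\<lambda>y. (f1 y, g1 y, h1 y)) has_derivative (\<lambda>k. (f1' * k, g1' * k, h1' * k))) (at y)"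
      using d1 unfolding has_field_derivative_def by (intro has_derivative_Pair)
    moreover have "((\<lambda>(x, y, z). F t x y z) has_derivative (\<lambda>(h, k, l). a * h + b * k + c * l)) (at ((\<lambda>y. (f1 y, g1 y, h1 y)) y))"
      using D v by simp
    ultimately have "((\<lambda>y. case (f1 y, g1 y, h1 y) of (x, y, z) \<Rightarrow> F t x y z) has_derivative
       (\<lambda>k. case (f1' * k, g1' * k, h1' * k) of (h, k, l) \<Rightarrow> a * h + b * k + c * l)) (at y)"
      by (rule has_derivative_compose)
    then show ?thesis
      unfolding has_field_derivative_def prod.case
      by (rule has_derivative_eq_rhs) (simp add: fun_eq_iff algebra_simps)
  qed
  have "((\<lambda>y. F t y (g x) (h x)) has_field_derivative a * 1 + b * 0 + c * 0) (at (f x))"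
    by (rule gen) (auto intro: derivative_intros)
  then have a: "Fx t (f x) (g x) (h x) = a" by (simp add: Fx_def DERIV_imp_deriv)
  have "((\<lambda>y. F t (f x) y (h x)) has_field_derivative a * 0 + b * 1 + c * 0) (at (g x))"
    by (rule gen) (auto intro: derivative_intros)
  then have b: "F1 t (f x) (g x) (h x) = b" by (simp add: F1_def DERIV_imp_deriv)
  have "((\<lambda>y. F t (f x) (g x) y) has_field_derivative a * 0 + b * 0 + c * 1) (at (h x))"
    by (rule gen) (auto intro: derivative_intros)
  then have c: "F2 t (f x) (g x) (h x) = c" by (simp add: F2_def DERIV_imp_deriv)
  show ?thesis unfolding a b c by (rule gen[OF refl refl refl d])
qed

lemma F_hol:
  assumes "t \<in> {0..T0}" "open S" "f holomorphic_on S" "g holomorphic_on S" "h holomorphic_on S"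
    "\<And>x. x \<in> S \<Longrightarrow> f x \<in> ball 0 R0" "\<And>x. x \<in> S \<Longrightarrow> g x \<in> ball 0 \<rho>0" "\<And>x. x \<in> S \<Longrightarrow> h x \<in> ball 0 \<rho>0"
  shows "(\<lambda>x. F t (f x) (g x) (h x)) holomorphic_on S"
  using chain[OF assms(1) assms(6-8) holomorphic_derivI[OF assms(3,2)] holomorphic_derivI[OF assms(4,2)] holomorphic_derivI[OF assms(5,2)]]
  by (auto simp: holomorphic_on_open[OF assms(2)])

definition M0 :: real where
  "M0 = (SOME M. 0 \<le> M \<and> (\<forall>t\<in>{0..T0}. \<forall>x\<in>cball 0 R1. \<forall>z1\<in>cball 0 (\<rho>0/2). \<forall>z2\<in>cball 0 (\<rho>0/2). cmod (F t x z1 z2) \<le> M))"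

lemma M0: "0 \<le> M0" "\<And>t x z1 z2. t \<in> {0..T0} \<Longrightarrow> x \<in> cball 0 R1 \<Longrightarrow> z1 \<in> cball 0 (\<rho>0/2) \<Longrightarrow> z2 \<in> cball 0 (\<rho>0/2) \<Longrightarrow> cmod (F t x z1 z2) \<le> M0"
proof -
  let ?K = "{0..T0} \<times> cball (0::complex) R1 \<times> cball (0::complex) (\<rho>0/2) \<times> cball (0::complex) (\<rho>0/2)"
  have "?K \<subseteq> Omega T0 R0 \<rho>0" using \<rho>0 pos unfolding Omega_def by (intro Sigma_mono) auto
  then have "compact ((\<lambda>(t, x, z1, z2). F t x z1 z2) ` ?K)"
    by (intro compact_continuous_image continuous_on_subset[OF A1_cont] compact_Times compact_cball) auto
  then obtain M where M: "\<forall>y\<in>(\<lambda>(t, x, z1, z2). F t x z1 z2) ` ?K. cmod y \<le> M"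
    using compact_imp_bounded bounded_iff by metis
  have "cmod (F t x z1 z2) \<le> M" if "t \<in> {0..T0}" "x \<in> cball 0 R1" "z1 \<in> cball 0 (\<rho>0/2)" "z2 \<in> cball 0 (\<rho>0/2)" for t x z1 z2
    using M[rule_format, OF imageI[of "(t,x,z1,z2)"]] that by simp
  moreover have "0 \<le> M"
    using calculation[of 0 0 0 0] T0 pos \<rho>0 order_trans[OF norm_ge_zero] by auto
  ultimately have "\<exists>M. 0 \<le> M \<and> (\<forall>t\<in>{0..T0}. \<forall>x\<in>cball 0 R1. \<forall>z1\<in>cball 0 (\<rho>0/2). \<forall>z2\<in>cball 0 (\<rho>0/2). cmod (F t x z1 z2) \<le> M)"
    by blast
  from someI_ex[OF this, folded M0_def]
  show "0 \<le> M0" "\<And>t x z1 z2. t \<in> {0..T0} \<Longrightarrow> x \<in> cball 0 R1 \<Longrightarrow> z1 \<in> cball 0 (\<rho>0/2) \<Longrightarrow> z2 \<in> cball 0 (\<rho>0/2) \<Longrightarrow> cmod (F t x z1 z2) \<le> M0"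
    by blast+
qed

text \<open>Two Cauchy estimates in succession: the bound M0/(\<rho>0/4) for a first derivative,
  divided by the next margin \<open>r1\<close>.\<close>

definition Lz :: real where "Lz = M0 / (\<rho>0/4) / r1"

lemma Lz: "0 \<le> Lz" using M0(1) \<rho>0 pos by (simp add: Lz_def)

text \<open>Both partial derivatives are handled at once: \<open>f\<close> is \<open>F t x\<close> with its two arguments in
  either order.\<close>

lemma partial_lipschitz:
  assumes h1: "\<And>w. w \<in> ball 0 \<rho>0 \<Longrightarrow> (\<lambda>z. f z w) holomorphic_on ball 0 \<rho>0"
    and h2: "\<And>z. z \<in> ball 0 \<rho>0 \<Longrightarrow> (\<lambda>w. f z w) holomorphic_on ball 0 \<rho>0"
    and bd: "\<And>z w. z \<in> cball 0 (\<rho>0/2) \<Longrightarrow> w \<in> cball 0 (\<rho>0/2) \<Longrightarrow> cmod (f z w) \<le> M0"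
    and z: "z \<in> ball 0 r1" and w: "w \<in> ball 0 r1"
  shows "cmod (deriv (\<lambda>z. f z w) z - deriv (\<lambda>z. f z 0) 0) \<le> Lz * (cmod z + cmod w)"
proof -
  have e: "2 * (\<rho>0/4) = \<rho>0/2" "2 * r1 = \<rho>0/4" by (auto simp: r1_def)
  have hol1: "(\<lambda>z. f z w) holomorphic_on ball 0 r" "f w holomorphic_on ball 0 r"
    if "w \<in> ball 0 \<rho>0" "r \<le> \<rho>0" for w r
    using that by (auto intro: holomorphic_on_subset[OF h1] holomorphic_on_subset[OF h2])
  have w4: "w \<in> ball 0 (\<rho>0/4)" "w \<in> ball 0 \<rho>0" "w \<in> cball 0 (\<rho>0/2)" "(0::complex) \<in> ball 0 (\<rho>0/4)" "(0::complex) \<in> ball 0 r1"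
    using w \<rho>0 by (auto simp: r1_def)
  have d1: "cmod (deriv (\<lambda>z. f z w) y) \<le> M0 / (\<rho>0/4)" if "y \<in> ball 0 (\<rho>0/4)" for y
  proof (rule deriv_bound_ball[OF _ _ _ that])
    show "(\<lambda>z. f z w) holomorphic_on ball 0 (2 * (\<rho>0/4))" unfolding e by (rule hol1(1)) (use w4 \<rho>0 in auto)
    show "cmod (f y w) \<le> M0" if "y \<in> ball 0 (2 * (\<rho>0/4))" for y
      by (rule bd) (use that w4 in \<open>auto simp: e\<close>)
  qed (use \<rho>0 in auto)
  have 1: "cmod (deriv (\<lambda>z. f z w) z - deriv (\<lambda>z. f z w) 0) \<le> M0 / (\<rho>0/4) / r1 * cmod (z - 0)"
  proof (rule lipschitz_ball[OF _ _ _ z w4(5)])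
    show "deriv (\<lambda>z. f z w) holomorphic_on ball 0 (2 * r1)"
      unfolding e by (intro holomorphic_deriv hol1(1)) (use w4 \<rho>0 in auto)
    show "cmod (deriv (\<lambda>z. f z w) y) \<le> M0 / (\<rho>0/4)" if "y \<in> ball 0 (2 * r1)" for y
      by (rule d1) (use that in \<open>simp only: e\<close>)
  qed (use pos in auto)
  have 2: "cmod (deriv (\<lambda>z. f z w) 0 - deriv (\<lambda>z. f z 0) 0) \<le> (M0 / (\<rho>0/4) * cmod w) / r1"
  proof (rule deriv_diff_ball[OF _ _ _ _ w4(5)])
    show "(\<lambda>z. f z w) holomorphic_on ball 0 (2 * r1)" "(\<lambda>z. f z 0) holomorphic_on ball 0 (2 * r1)"
      unfolding e by (rule hol1(1); use w4 \<rho>0 in auto)+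
    show "cmod (f y w - f y 0) \<le> M0 / (\<rho>0/4) * cmod w" if y: "y \<in> ball 0 (2 * r1)" for y
    proof -
      have y': "y \<in> ball 0 \<rho>0" "y \<in> cball 0 (\<rho>0/2)" using y \<rho>0 by (auto simp: e)
      have "cmod (f y w - f y 0) \<le> M0 / (\<rho>0/4) * cmod (w - 0)"
      proof (rule lipschitz_ball[OF _ _ _ w4(1,4)])
        show "f y holomorphic_on ball 0 (2 * (\<rho>0/4))" unfolding e by (rule hol1(2)) (use y' \<rho>0 in auto)
        show "cmod (f y v) \<le> M0" if "v \<in> ball 0 (2 * (\<rho>0/4))" for v
          by (rule bd[OF y'(2)]) (use that in \<open>auto simp: e\<close>)
      qed (use \<rho>0 in auto)
      then show ?thesis by simp
    qed
  qed (use pos in auto)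
  have "cmod (deriv (\<lambda>z. f z w) z - deriv (\<lambda>z. f z 0) 0) \<le> M0 / (\<rho>0/4) / r1 * cmod z + M0 / (\<rho>0/4) * cmod w / r1"
    using norm_triangle_ineq[of "deriv (\<lambda>z. f z w) z - deriv (\<lambda>z. f z w) 0" "deriv (\<lambda>z. f z w) 0 - deriv (\<lambda>z. f z 0) 0"] 1 2
    by simp
  also have "\<dots> = Lz * (cmod z + cmod w)" by (simp add: Lz_def distrib_left)
  finally show ?thesis .
qed

context
  fixes t :: real and x :: complex assumes t: "t \<in> {0..T0}" and x: "x \<in> ball 0 R1"
begin

lemma xs: "x \<in> ball 0 R0" "x \<in> cball 0 R1" using x pos by auto

lemma F_hol1: "w \<in> ball 0 \<rho>0 \<Longrightarrow> (\<lambda>z. F t x z w) holomorphic_on ball 0 \<rho>0"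
  by (rule F_hol[OF t open_ball]) (use xs in \<open>auto intro: holomorphic_intros\<close>)

lemma F_hol2: "w \<in> ball 0 \<rho>0 \<Longrightarrow> (\<lambda>z. F t x w z) holomorphic_on ball 0 \<rho>0"
  by (rule F_hol[OF t open_ball]) (use xs in \<open>auto intro: holomorphic_intros\<close>)

lemma F1_lip: "z1 \<in> ball 0 r1 \<Longrightarrow> z2 \<in> ball 0 r1 \<Longrightarrow> cmod (F1 t x z1 z2 - coeff_lambda F t x) \<le> Lz * (cmod z1 + cmod z2)"
  unfolding F1_def coeff_lambda_def
  by (rule partial_lipschitz[where f="F t x"]) (use F_hol1 F_hol2 M0(2)[OF t xs(2)] in auto)

lemma F2_lip: "z1 \<in> ball 0 r1 \<Longrightarrow> z2 \<in> ball 0 r1 \<Longrightarrow> cmod (F2 t x z1 z2 - coeff_b F t x) \<le> Lz * (cmod z1 + cmod z2)"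
  unfolding F2_def coeff_b_def add.commute[of "cmod z1"]
  by (rule partial_lipschitz[where f="\<lambda>z w. F t x w z"]) (use F_hol1 F_hol2 M0(2)[OF t xs(2)] in auto)

lemma lambda_bound: "cmod (coeff_lambda F t x) \<le> M0 / (\<rho>0/4)"
  unfolding coeff_lambda_def
proof (rule deriv_bound_ball)
  show "(\<lambda>z. F t x z 0) holomorphic_on ball 0 (2 * (\<rho>0/4))"
    by (rule holomorphic_on_subset[OF F_hol1]) (use \<rho>0 in auto)
  show "cmod (F t x y 0) \<le> M0" if "y \<in> ball 0 (2 * (\<rho>0/4))" for y
    by (rule M0(2)[OF t xs(2)]) (use that \<rho>0 in auto)
qed (use \<rho>0 in auto)

text \<open>The path from (w1,w2) to (z1,z2) is taken in two segments parallel to the axes. On them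
  the partial derivatives differ from \<lambda> and b by at most \<open>Lz\<close> times the sizes
  of the arguments. The form for differences, rather than for a single point, is what Lipschitz and
  uniqueness estimates need.\<close>

lemma F_taylor:
  assumes z: "z1 \<in> ball 0 r1" "z2 \<in> ball 0 r1" "w1 \<in> ball 0 r1" "w2 \<in> ball 0 r1"
  shows "cmod (F t x z1 z2 - F t x w1 w2 - coeff_lambda F t x * (z1 - w1) - coeff_b F t x * (z2 - w2))
    \<le> Lz * (cmod z1 + cmod z2 + cmod w1 + cmod w2) * (cmod (z1 - w1) + cmod (z2 - w2))"
proof -
  have seg: "y \<in> ball 0 r1 \<and> cmod y \<le> cmod a + cmod b" if ys: "y \<in> closed_segment a b" "a \<in> ball 0 r1" "b \<in> ball 0 r1" for a b y :: complex
  proof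
    show "y \<in> ball 0 r1" by (rule subsetD[OF closed_segment_subset[OF that(2,3) convex_ball] that(1)])
    obtain u where u: "0 \<le> u" "u \<le> 1" "y = (1 - u) *\<^sub>R a + u *\<^sub>R b" using ys(1) unfolding closed_segment_def by blast
    have "cmod y \<le> (1 - u) * cmod a + u * cmod b"
      unfolding u(3) using u norm_triangle_ineq[of "(1 - u) *\<^sub>R a" "u *\<^sub>R b"] by simp
    also have "\<dots> \<le> 1 * cmod a + 1 * cmod b" using u by (intro add_mono mult_right_mono) auto
    finally show "cmod y \<le> cmod a + cmod b" by simp
  qed
  have sub: "ball (0::complex) r1 \<subseteq> ball 0 \<rho>0" using pos by auto
  have 1: "cmod ((F t x z1 z2 - coeff_lambda F t x * z1) - (F t x w1 z2 - coeff_lambda F t x * w1))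
     \<le> (Lz * (cmod z1 + cmod w1 + cmod z2)) * cmod (z1 - w1)"
  proof (rule field_differentiable_bound[of "closed_segment z1 w1" "\<lambda>z. F t x z z2 - coeff_lambda F t x * z"])
    fix y assume y: "y \<in> closed_segment z1 w1"
    note sy = seg[OF y z(1,3)]
    have "((\<lambda>z. F t x z z2) has_field_derivative F1 t x y z2) (at y)"
      unfolding F1_def by (rule holomorphic_derivI[OF F_hol1 open_ball]) (use z sy sub in auto)
    then show "((\<lambda>z. F t x z z2 - coeff_lambda F t x * z) has_field_derivative F1 t x y z2 - coeff_lambda F t x) (at y within closed_segment z1 w1)"
      by (auto intro!: derivative_eq_intros intro: has_field_derivative_at_within)
    have "cmod (F1 t x y z2 - coeff_lambda F t x) \<le> Lz * (cmod y + cmod z2)" by (rule F1_lip) (use sy z in auto)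
    also have "\<dots> \<le> Lz * (cmod z1 + cmod w1 + cmod z2)" using sy Lz by (intro mult_left_mono) auto
    finally show "cmod (F1 t x y z2 - coeff_lambda F t x) \<le> Lz * (cmod z1 + cmod w1 + cmod z2)" .
  qed auto
  have 2: "cmod ((F t x w1 z2 - coeff_b F t x * z2) - (F t x w1 w2 - coeff_b F t x * w2))
     \<le> (Lz * (cmod w1 + cmod z2 + cmod w2)) * cmod (z2 - w2)"
  proof (rule field_differentiable_bound[of "closed_segment z2 w2" "\<lambda>z. F t x w1 z - coeff_b F t x * z"])
    fix y assume y: "y \<in> closed_segment z2 w2"
    note sy = seg[OF y z(2,4)]
    have "((\<lambda>z. F t x w1 z) has_field_derivative F2 t x w1 y) (at y)"
      unfolding F2_def by (rule holomorphic_derivI[OF F_hol2 open_ball]) (use z sy sub in auto)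
    then show "((\<lambda>z. F t x w1 z - coeff_b F t x * z) has_field_derivative F2 t x w1 y - coeff_b F t x) (at y within closed_segment z2 w2)"
      by (auto intro!: derivative_eq_intros intro: has_field_derivative_at_within)
    have "cmod (F2 t x w1 y - coeff_b F t x) \<le> Lz * (cmod w1 + cmod y)" by (rule F2_lip) (use sy z in auto)
    also have "\<dots> \<le> Lz * (cmod w1 + cmod z2 + cmod w2)" using sy Lz by (intro mult_left_mono) auto
    finally show "cmod (F2 t x w1 y - coeff_b F t x) \<le> Lz * (cmod w1 + cmod z2 + cmod w2)" .
  qed auto
  have "F t x z1 z2 - F t x w1 w2 - coeff_lambda F t x * (z1 - w1) - coeff_b F t x * (z2 - w2)
    = ((F t x z1 z2 - coeff_lambda F t x * z1) - (F t x w1 z2 - coeff_lambda F t x * w1))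
    + ((F t x w1 z2 - coeff_b F t x * z2) - (F t x w1 w2 - coeff_b F t x * w2))"
    by (simp add: algebra_simps)
  then have "cmod (F t x z1 z2 - F t x w1 w2 - coeff_lambda F t x * (z1 - w1) - coeff_b F t x * (z2 - w2))
    \<le> (Lz * (cmod z1 + cmod w1 + cmod z2)) * cmod (z1 - w1) + (Lz * (cmod w1 + cmod z2 + cmod w2)) * cmod (z2 - w2)"
    using norm_triangle_mono[OF 1 2] by (simp only:)
  also have "\<dots> \<le> (Lz * (cmod z1 + cmod z2 + cmod w1 + cmod w2)) * cmod (z1 - w1) + (Lz * (cmod z1 + cmod z2 + cmod w1 + cmod w2)) * cmod (z2 - w2)"
    by (rule add_mono; rule mult_right_mono; (rule mult_left_mono)?) (use Lz in auto)
  finally show ?thesis by (simp add: distrib_left)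
qed

end

definition \<beta> :: "real \<Rightarrow> real" where "\<beta> t = B * m t / \<bar>ln t\<bar>"

lemma F_size:
  assumes t: "t \<in> {0<..T0}" and x: "x \<in> ball 0 R1" and z: "z1 \<in> ball 0 r1" "z2 \<in> ball 0 r1"
  shows "cmod (F t x z1 z2) \<le> A * t powr \<mu> + M0 / (\<rho>0/4) * cmod z1 + \<beta> t * cmod z2 + Lz * (cmod z1 + cmod z2)\<^sup>2"
proof -
  have t': "t \<in> {0..T0}" and x': "x \<in> ball 0 R0" using t x pos by auto
  have 0: "(0::complex) \<in> ball 0 r1" using pos by auto
  let ?a = "F t x 0 0" and ?l = "coeff_lambda F t x * z1" and ?b = "coeff_b F t x * z2"
  have "cmod (F t x z1 z2 - ?a - ?l - ?b) \<le> Lz * (cmod z1 + cmod z2)\<^sup>2"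
    using F_taylor[OF t' x z 0 0] by (simp add: power2_eq_square)
  moreover have "cmod ?a \<le> A * t powr \<mu>" using c1[OF t x'] by (simp add: coeff_a_def)
  moreover have "cmod ?l \<le> M0 / (\<rho>0/4) * cmod z1" 
    unfolding norm_mult using lambda_bound[OF t' x] by (rule mult_right_mono) simp
  moreover have "cmod ?b \<le> \<beta> t * cmod z2"
    unfolding norm_mult using c3[OF t x', folded \<beta>_def] by (rule mult_right_mono) simp
  moreover have "cmod (F t x z1 z2) \<le> cmod (F t x z1 z2 - ?a - ?l - ?b) + cmod ?a + cmod ?l + cmod ?b"
  proof -
    have "F t x z1 z2 = (F t x z1 z2 - ?a - ?l - ?b) + ?a + ?l + ?b" by simp
    then show ?thesis by (metis (no_types, lifting) norm_add_leD norm_triangle_mono order_refl)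
  qed
  ultimately show ?thesis by linarith
qed

text \<open>Nothing is assumed about the x-derivative of F. Cauchy's estimate in x, with the
  z-arguments frozen, bounds it by the size of F on a disc twice as large.\<close>

lemma Fx_bound:
  assumes t: "t \<in> {0<..T0}" and x: "x \<in> ball 0 (R1/2)" and z: "z1 \<in> ball 0 r1" "z2 \<in> ball 0 r1"
  shows "cmod (Fx t x z1 z2) \<le> (A * t powr \<mu> + M0 / (\<rho>0/4) * cmod z1 + \<beta> t * cmod z2 + Lz * (cmod z1 + cmod z2)\<^sup>2) / (R1/2)"
  unfolding Fx_def
proof (rule deriv_bound_ball[OF _ _ _ x])
  have zz: "z1 \<in> ball 0 \<rho>0" "z2 \<in> ball 0 \<rho>0" using z pos by auto
  show "(\<lambda>y. F t y z1 z2) holomorphic_on ball 0 (2 * (R1/2))"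
    by (rule F_hol[OF _ open_ball]) (use t zz pos in \<open>auto intro: holomorphic_intros\<close>)
qed (use F_size[OF t _ z] pos in auto)

text \<open>Joint holomorphy is given only through first derivatives, so holomorphy in x of a
  z1-derivative is not immediate. The difference quotients in z1 are holomorphic in x and, by the
  Taylor estimate, converge uniformly.\<close>

lemma lam_hol: "lam holomorphic_on ball 0 R1"
proof (rule holomorphic_uniform_sequence[OF open_ball])
  define s where "s = (\<lambda>n. r1 / (real n + 2))"
  have s: "0 < s n" "s n < r1" for n using pos by (auto simp: s_def divide_less_eq)
  let ?f = "\<lambda>n x. (F 0 x (of_real (s n)) 0 - F 0 x 0 0) / of_real (s n)"
  have t0: "0 \<in> {0..T0}" using T0 by auto
  show "?f n holomorphic_on ball 0 R1" for n
    using s[of n] pos by (intro holomorphic_intros F_hol[OF t0 open_ball]) auto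
  have bd: "cmod (?f n x - lam x) \<le> Lz * s n" if x: "x \<in> ball 0 R1" for n x
  proof -
    have "cmod (F 0 x (of_real (s n)) 0 - F 0 x 0 0 - lam x * of_real (s n)) \<le> Lz * s n * s n"
      using F_taylor[OF t0 x, of "of_real (s n)" 0 0 0] s[of n] pos by (simp add: lam_def)
    moreover have "?f n x - lam x = (F 0 x (of_real (s n)) 0 - F 0 x 0 0 - lam x * of_real (s n)) / of_real (s n)"
      using s[of n] by (simp add: field_simps)
    ultimately show ?thesis using s[of n] by (simp only: norm_divide norm_of_real) (simp add: field_simps)
  qed
  have ul: "uniform_limit (ball 0 R1) ?f lam sequentially"
  proof (rule uniform_limitI)
    fix e :: real assume e: "0 < e"
    have "(\<lambda>n. Lz * r1 * inverse (real (Suc n))) \<longlonglongrightarrow> Lz * r1 * 0" by (intro tendsto_intros LIMSEQ_inverse_real_of_nat)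
    then have "\<forall>\<^sub>F n in sequentially. Lz * r1 * inverse (real (Suc n)) < e" using e by (intro order_tendstoD(2)) auto
    then show "\<forall>\<^sub>F n in sequentially. \<forall>x\<in>ball 0 R1. dist (?f n x) (lam x) < e"
    proof eventually_elim
      case (elim n)
      have "s n \<le> r1 * inverse (real (Suc n))" using pos by (simp add: s_def field_simps)
      then have "Lz * s n < e" using elim mult_left_mono[OF _ Lz] by fastforce
      then show ?case unfolding dist_norm by (intro ballI le_less_trans[OF bd])
    qed
  qed
  show "\<exists>d>0. cball x d \<subseteq> ball 0 R1 \<and> uniform_limit (cball x d) ?f lam sequentially" if x: "x \<in> ball 0 R1" for x
  proof -
    obtain d where d: "d > 0" "cball x d \<subseteq> ball 0 R1" using x open_contains_cball[of "ball 0 R1"] by blast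
    then show ?thesis using uniform_limit_on_subset[OF ul] by blast
  qed
qed

text \<open>The powers t^\<lambda> require an exponent independent of t, so \<lambda>(t,x) is
  replaced by \<lambda>(0,x); by (c2) this costs \<Lambda> m(t). The term \<sigma> collects the
  nonlinear part.\<close>

lemma F_diff:
  assumes t: "t \<in> {0<..T0}" and x: "x \<in> ball 0 R1" and z: "z1 \<in> ball 0 r1" "z2 \<in> ball 0 r1" "w1 \<in> ball 0 r1" "w2 \<in> ball 0 r1"
  defines "\<sigma> \<equiv> Lz * (cmod z1 + cmod z2 + cmod w1 + cmod w2)"
  shows "cmod (F t x z1 z2 - F t x w1 w2 - lam x * (z1 - w1)) \<le> (\<Lambda> * m t + \<sigma>) * cmod (z1 - w1) + (\<beta> t + \<sigma>) * cmod (z2 - w2)"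
proof -
  have t': "t \<in> {0..T0}" and x': "x \<in> ball 0 R0" using t x pos by auto
  let ?l = "coeff_lambda F t x" and ?b = "coeff_b F t x"
  have 1: "cmod (F t x z1 z2 - F t x w1 w2 - ?l * (z1 - w1) - ?b * (z2 - w2)) \<le> \<sigma> * (cmod (z1 - w1) + cmod (z2 - w2))"
    unfolding \<sigma>_def by (rule F_taylor[OF t' x z])
  have 2: "cmod ((?l - lam x) * (z1 - w1)) \<le> \<Lambda> * m t * cmod (z1 - w1)"
    unfolding norm_mult lam_def by (rule mult_right_mono[OF c2[OF t x']]) simp
  have 3: "cmod (?b * (z2 - w2)) \<le> \<beta> t * cmod (z2 - w2)"
    unfolding norm_mult using c3[OF t x', folded \<beta>_def] by (rule mult_right_mono) simp
  have "F t x z1 z2 - F t x w1 w2 - lam x * (z1 - w1) = (F t x z1 z2 - F t x w1 w2 - ?l * (z1 - w1) - ?b * (z2 - w2))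
    + ((?l - lam x) * (z1 - w1) + ?b * (z2 - w2))" by (simp add: algebra_simps)
  then have "cmod (F t x z1 z2 - F t x w1 w2 - lam x * (z1 - w1)) \<le> \<sigma> * (cmod (z1 - w1) + cmod (z2 - w2)) + (\<Lambda> * m t * cmod (z1 - w1) + \<beta> t * cmod (z2 - w2))"
    using norm_triangle_mono[OF 1 norm_triangle_mono[OF 2 3]] by (simp only:)
  then show ?thesis by (simp add: algebra_simps)
qed

end

section \<open>Integrable rates in time\<close>

text \<open>Half of the exponent pays for the logarithm.\<close>

lemma powr_ln_bound:
  fixes t d :: real
  assumes "0 < t" "t < 1" "0 < d"
  shows "t powr d * \<bar>ln t\<bar> \<le> 2/d * t powr (d/2)"
proof -
  have "ln (1/t) \<le> (1/t) powr (d/2) / (d/2)" by (rule ln_powr_bound) (use assms in auto)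
  moreover have "\<bar>ln t\<bar> = ln (1/t)" using assms by (simp add: ln_div)
  ultimately have "t powr d * \<bar>ln t\<bar> \<le> t powr d * ((1/t) powr (d/2) / (d/2))"
    using assms by (intro mult_left_mono) auto
  also have "\<dots> = 2/d * (t powr d * t powr (- (d/2)))"
    using assms by (simp add: powr_divide powr_minus field_simps)
  also have "t powr d * t powr (- (d/2)) = t powr (d/2)" by (simp add: powr_add[symmetric])
  finally show ?thesis .
qed

context briot_bouquet
begin

lemma m: "continuous_on {0<..T0} m" "t \<in> {0<..T0} \<Longrightarrow> 0 < m t" "t \<in> {0<..T0} \<Longrightarrow> m t \<le> m T0"
  "(\<lambda>t. m t / t) integrable_on {0..T0}"
  using weight T0
  by (auto simp: weight_function_def monotone_on_def integrable_half_open[symmetric] intro: set_borel_integral_eq_integral(1))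

text \<open>The common shape of all rates in the proof, after division of the equation by t: m(t)/t
  stems from (c2) and (c3), and t^(d-1) from the nonlinear terms and from (c1). Both are integrable
  at 0.\<close>

definition \<kappa> :: "real \<Rightarrow> real \<Rightarrow> real" where "\<kappa> d t = (m t + t powr d) / t"

lemma \<kappa>: assumes "0 < d"
  shows "continuous_on {0<..T0} (\<kappa> d)" "t \<in> {0<..T0} \<Longrightarrow> 0 < \<kappa> d t" "\<kappa> d integrable_on {0..T0}"
proof -
  show "continuous_on {0<..T0} (\<kappa> d)"
    unfolding \<kappa>_def by (intro continuous_intros m) auto
  show "t \<in> {0<..T0} \<Longrightarrow> 0 < \<kappa> d t" using m(2)[of t] by (simp add: \<kappa>_def add_pos_nonneg)
  have "(\<lambda>t. t powr (d - 1)) integrable_on {0..T0}"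
    using integrable_on_powr_from_0[of "d - 1" T0] assms T0 by simp
  then have "(\<lambda>t. m t / t + t powr (d - 1)) integrable_on {0<..T0}"
    unfolding integrable_half_open by (intro integrable_add m(4))
  then have "\<kappa> d integrable_on {0<..T0}"
    by (rule integrable_eq) (auto simp: \<kappa>_def add_divide_distrib powr_diff)
  then show "\<kappa> d integrable_on {0..T0}" by (simp add: integrable_half_open)
qed

lemma \<kappa>_small:
  assumes "0 < d" "0 < \<epsilon>"
  shows "\<forall>\<^sub>F T in at_right 0. integral {0..T} (\<lambda>t. C * \<kappa> d t) < \<epsilon>"
proof -
  have "((\<lambda>T. C * integral {0..T} (\<kappa> d)) \<longlongrightarrow> C * 0) (at_right 0)"
    by (intro tendsto_mult tendsto_const integral_tendsto_0[OF \<kappa>(3)] assms T0)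
  then show ?thesis using assms(2) by (intro order_tendstoD(2)) auto
qed

text \<open>Since T0 < 1, |ln t| stays above |ln T0| > 0 on (0,T0], so the logarithm in (c3) may
  also be traded for a constant when it is not wanted.\<close>

definition C\<beta> :: real where "C\<beta> = B / \<bar>ln T0\<bar>"

lemma \<beta>: assumes "t \<in> {0<..T0}" shows "0 \<le> \<beta> t" "\<beta> t \<le> C\<beta> * m t" "\<beta> t \<le> B * m T0 / \<bar>ln t\<bar>"
proof -
  have l: "ln T0 < 0" "ln t \<le> ln T0" using assms T0 by auto
  have mp: "0 < m t" "m t \<le> m T0" using m(2,3)[OF assms] .
  show "0 \<le> \<beta> t" unfolding \<beta>_def using B mp by (intro divide_nonneg_nonneg mult_nonneg_nonneg) auto
  have "B * m t / \<bar>ln t\<bar> \<le> B * m t / \<bar>ln T0\<bar>"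
    using l B mp by (intro divide_left_mono mult_pos_pos) auto
  then show "\<beta> t \<le> C\<beta> * m t" by (simp add: \<beta>_def C\<beta>_def)
  show "\<beta> t \<le> B * m T0 / \<bar>ln t\<bar>" unfolding \<beta>_def using B mp l by (intro divide_right_mono mult_left_mono) auto
qed

lemma C\<beta>: "0 < C\<beta>" 
proof -
  have "0 < \<bar>ln T0\<bar>" using T0 by simp
  then show ?thesis unfolding C\<beta>_def using B by (intro divide_pos_pos)
qed

text \<open>The weight is bounded by its value at T0, and |ln t| tends to infinity.\<close>

lemma \<beta>_0: "0 < \<epsilon> \<Longrightarrow> \<forall>\<^sub>F t in at_right 0. \<beta> t \<le> \<epsilon>"
proof -
  assume e: "0 < \<epsilon>"
  have "\<forall>\<^sub>F t in at_right (0::real). ln t \<le> - (B * m T0 / \<epsilon>)"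
    using ln_at_0 by (auto simp: filterlim_at_bot)
  moreover have "\<forall>\<^sub>F t in at_right (0::real). t < T0" using T0 by (auto simp: eventually_at_right_field)
  ultimately show ?thesis using eventually_at_right_less[of 0]
  proof eventually_elim
    case (elim t)
    have t: "t \<in> {0<..T0}" using elim by auto
    have mp: "0 < m T0" using m(2)[of T0] T0 by auto
    have "0 < B * m T0 / \<epsilon>" using B mp e by simp
    then have "B * m T0 / \<epsilon> \<le> \<bar>ln t\<bar>" "0 < \<bar>ln t\<bar>" using elim by auto
    then have "B * m T0 / \<bar>ln t\<bar> \<le> \<epsilon>" using e by (simp add: field_simps)
    then show ?case using \<beta>(3)[OF t] by linarith
  qed
qed

lemma lambda_cont: "continuous_on ({0..T0} \<times> ball 0 R1) (\<lambda>(t,x). coeff_lambda F t x)"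
proof -
  let ?P = "{0..T0} \<times> ball (0::complex) R1"
  have "continuous_on (?P \<times> ball 0 \<rho>0) (\<lambda>q. (\<lambda>(t, x, z1, z2). F t x z1 z2) (fst (fst q), snd (fst q), snd q, 0))"
    by (rule continuous_on_compose2[OF A1_cont], intro continuous_intros)
      (use pos \<rho>0 in \<open>auto simp: Omega_def\<close>)
  then have c: "continuous_on (?P \<times> ball 0 \<rho>0) (\<lambda>(p,z). F (fst p) (snd p) z 0)" by (simp add: split_beta')
  have "continuous_on (?P \<times> ball 0 \<rho>0) (\<lambda>(p,z). deriv (\<lambda>z. F (fst p) (snd p) z 0) z)"
    by (rule continuous_on_deriv_param[OF open_ball c]) (use F_hol1[of _ _ 0] \<rho>0 in auto)
  from continuous_on_slice[OF this, of 0 ?P]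
  show ?thesis using \<rho>0 by (simp add: coeff_lambda_def split_beta')
qed

text \<open>Along the characteristics \<open>t x' = -\<partial>F/\<partial>z2\<close> both \<open>u\<close> and \<open>p = \<partial>u/\<partial>x\<close> are damped at rate
  almost \<open>Re \<lambda>\<close>, and this damping in turn makes the characteristics short.  No rate of decay of
  \<open>u\<close> is needed beforehand.\<close>

lemma decay:
  assumes ev: "evolves 0 T R u g" and T: "0 < T" "T \<le> T0" and R: "0 < R" "R \<le> R1/2"
    and ub: "\<And>t x. t \<in> {0<..<T} \<Longrightarrow> x \<in> ball 0 R \<Longrightarrow> u t x \<in> ball 0 r1 \<and> deriv (u t) x \<in> ball 0 r1"
    and eq: "\<And>t x. t \<in> {0<..<T} \<Longrightarrow> x \<in> ball 0 R \<Longrightarrow> of_real t * g t x = F t x (u t x) (deriv (u t) x)"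
    and u0: "uniform_limit (ball 0 R) u (\<lambda>_. 0) (at_right 0)"
    and p0: "uniform_limit (ball 0 R) (\<lambda>t. deriv (u t)) (\<lambda>_. 0) (at_right 0)"
    and a: "0 < a" "a < \<mu>" "a < Re (lam 0)"
  obtains T' R' C where "0 < T'" "T' < T" "0 < R'" "R' \<le> R" "0 < C"
    "\<And>t x. t \<in> {0<..T'} \<Longrightarrow> x \<in> ball 0 R' \<Longrightarrow> cmod (u t x) \<le> C * t powr a \<and> cmod (deriv (u t) x) \<le> C * t powr a"
proof -
  \<comment> \<open>The gap between Re \<lambda>(0,0) and a is cut into four: one part is spent on
    the continuity of \<lambda>, so that Re \<lambda>(t,x) > a + 3\<epsilon> nearby, and the
    remaining 3\<epsilon> must absorb all error terms.\<close>
  define \<epsilon> where "\<epsilon> = (Re (lam 0) - a) / 4"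
  have \<epsilon>: "0 < \<epsilon>" using a by (simp add: \<epsilon>_def)
  have "\<exists>d>0. \<forall>t\<in>{0..T0}. \<forall>x\<in>ball 0 R1. dist (t,x) (0,0) < d \<longrightarrow> a + 3 * \<epsilon> < Re (coeff_lambda F t x)"
  proof -
    obtain d where d: "d > 0" "\<forall>p\<in>{0..T0} \<times> ball 0 R1. dist p (0,0) < d \<longrightarrow> 
        dist ((\<lambda>(t,x). coeff_lambda F t x) p) ((\<lambda>(t,x). coeff_lambda F t x) (0,0)) < \<epsilon>"
      using lambda_cont[unfolded continuous_on_iff, rule_format, of "(0,0)" \<epsilon>] \<epsilon> T0 pos by force
    have "a + 3 * \<epsilon> < Re (coeff_lambda F t x)" if "t \<in> {0..T0}" "x \<in> ball 0 R1" "dist (t,x) (0,0) < d" for t x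
    proof -
      have "cmod (coeff_lambda F t x - lam 0) < \<epsilon>" using d(2) that by (auto simp: dist_norm lam_def)
      then have "\<bar>Re (coeff_lambda F t x - lam 0)\<bar> < \<epsilon>" using abs_Re_le_cmod le_less_trans by blast
      then have "Re (lam 0) - \<epsilon> < Re (coeff_lambda F t x)" unfolding minus_complex.sel by linarith
      moreover have "Re (lam 0) - \<epsilon> = a + 3 * \<epsilon>" by (simp add: \<epsilon>_def field_simps)
      ultimately show ?thesis by simp
    qed
    then show ?thesis using d(1) by blast
  qed
  then obtain d where d: "d > 0" "\<And>t x. t \<in> {0..T0} \<Longrightarrow> x \<in> ball 0 R1 \<Longrightarrow> dist (t,x) (0,0) < d \<Longrightarrow> a + 3 * \<epsilon> < Re (coeff_lambda F t x)"
    by blast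
  define R2 where "R2 = min (R/2) (d/2)"
  have R2: "0 < R2" "R2 < R" "R2 \<le> d/2" using R d by (auto simp: R2_def)
  define \<Lambda>1 where "\<Lambda>1 = M0 / (\<rho>0/4)"
  have \<Lambda>1: "0 \<le> \<Lambda>1" using M0(1) \<rho>0 by (simp add: \<Lambda>1_def)
  \<comment> \<open>The equation for p contains the x-derivative of F, hence a term proportional to
    |u| with the fixed factor \<Lambda>1/(R1/2), which no choice of small t reduces. Giving p a
    barrier \<open>Kp\<close> times higher than that of u makes this term small relative to the
    barrier of p.\<close>
  define Kp where "Kp = 1 + 4 * \<Lambda>1 / (R1 * \<epsilon>) + 4 / R1"
  have Kp: "1 \<le> Kp" "4 * \<Lambda>1 / (R1 * \<epsilon>) \<le> Kp" "4 / R1 \<le> Kp" using \<Lambda>1 pos \<epsilon> by (auto simp: Kp_def)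
  \<comment> \<open>The first entry makes the quadratic terms at most a fraction of \<epsilon> times
    the barrier; the second limits the part of the loss of radius that comes from the size of u and
    p to R2/4.\<close>
  define \<delta> where "\<delta> = min (\<epsilon> / (2 * Lz * (1 + Kp)^2 + 1)) (a * R2 / (4 * (Lz * (1 + Kp) + 1)))"
  have q1: "0 < 2 * Lz * (1 + Kp)^2 + 1" using Lz Kp by (intro add_nonneg_pos mult_nonneg_nonneg) auto
  have q2: "0 < Lz * (1 + Kp) + 1" using Lz Kp by (intro add_nonneg_pos mult_nonneg_nonneg) auto
  have \<delta>: "0 < \<delta>" using \<epsilon> q1 q2 a R2 by (simp add: \<delta>_def)
  have \<delta>1: "2 * Lz * (1 + Kp)^2 * \<delta> < \<epsilon>"
  proof -
    have "(2 * Lz * (1 + Kp)^2 + 1) * \<delta> \<le> \<epsilon>"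
    proof -
      have "\<delta> \<le> \<epsilon> / (2 * Lz * (1 + Kp)^2 + 1)" unfolding \<delta>_def by (rule min.cobounded1)
      then have "\<delta> * (2 * Lz * (1 + Kp)^2 + 1) \<le> \<epsilon>" using q1 by (simp only: pos_le_divide_eq)
      then show ?thesis by (simp only: mult.commute)
    qed
    then show ?thesis using \<delta> by (simp add: distrib_right)
  qed
  have \<delta>2: "(Lz * (1 + Kp) + 1) * \<delta> / a \<le> R2 / 4"
  proof -
    have "\<delta> \<le> a * R2 / (4 * (Lz * (1 + Kp) + 1))" unfolding \<delta>_def by (rule min.cobounded2)
    then have "\<delta> * (4 * (Lz * (1 + Kp) + 1)) \<le> a * R2" using q2 by (subst (asm) pos_le_divide_eq) auto
    then have "(Lz * (1 + Kp) + 1) * \<delta> \<le> R2 / 4 * a" by (simp add: algebra_simps)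
    then show ?thesis using a(1) by (simp only: pos_divide_le_eq)
  qed
  have "\<forall>\<^sub>F t in at_right 0. A * t powr \<mu> < \<epsilon> * \<delta>"
  proof -
    have "((\<lambda>t. A * t powr \<mu>) \<longlongrightarrow> A * 0 powr \<mu>) (at_right 0)"
      using \<mu> by (intro tendsto_intros) (auto simp: eventually_at_right_field intro: exI[of _ 1])
    then show ?thesis using \<epsilon> \<delta> by (intro order_tendstoD(2)) auto
  qed
  moreover have "\<forall>\<^sub>F t in at_right 0. \<beta> t \<le> \<epsilon> * R1 / 4" using \<beta>_0[of "\<epsilon> * R1 / 4"] \<epsilon> pos by simp
  ultimately have "\<forall>\<^sub>F t in at_right 0. A * t powr \<mu> < \<epsilon> * \<delta> \<and> \<beta> t \<le> \<epsilon> * R1 / 4" by (rule eventually_conj)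
  then obtain b1 where b1: "b1 > 0" "\<And>t. 0 < t \<Longrightarrow> t < b1 \<Longrightarrow> A * t powr \<mu> < \<epsilon> * \<delta> \<and> \<beta> t \<le> \<epsilon> * R1 / 4"
    by (auto simp: eventually_at_right_field)
  have "\<forall>\<^sub>F t in at_right 0. t < b1 \<and> t < d/2 \<and> t < T"
    using b1 d T by (auto simp: eventually_at_right_field intro!: exI[of _ "min b1 (min (d/2) T)"])
  moreover have "\<forall>\<^sub>F T1 in at_right 0. integral {0..T1} (\<lambda>t. C\<beta> * \<kappa> a t) < R2 / 4" using \<kappa>_small[OF a(1), of "R2 / 4" C\<beta>] R2 by simp
  moreover have "\<forall>\<^sub>F t in at_right 0. \<forall>x\<in>ball 0 R. dist (u t x) 0 < \<delta>" using u0 \<delta> by (simp add: uniform_limit_iff)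
  moreover have "\<forall>\<^sub>F t in at_right 0. \<forall>x\<in>ball 0 R. dist (deriv (u t) x) 0 < \<delta>" using p0 \<delta> by (simp add: uniform_limit_iff)
  ultimately have "\<forall>\<^sub>F T1 in at_right 0. 0 < T1 \<and> (T1 < b1 \<and> T1 < d/2 \<and> T1 < T) \<and> integral {0..T1} (\<lambda>t. C\<beta> * \<kappa> a t) < R2 / 4 \<and>
      (\<forall>x\<in>ball 0 R. dist (u T1 x) 0 < \<delta>) \<and> (\<forall>x\<in>ball 0 R. dist (deriv (u T1) x) 0 < \<delta>)"
    using eventually_at_right_less[of 0] by eventually_elim simp
  then obtain T1 where T1: "0 < T1" "T1 < b1" "T1 < d/2" "T1 < T" "integral {0..T1} (\<lambda>t. C\<beta> * \<kappa> a t) < R2 / 4"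
      "\<And>x. x \<in> ball 0 R \<Longrightarrow> cmod (u T1 x) < \<delta>" "\<And>x. x \<in> ball 0 R \<Longrightarrow> cmod (deriv (u T1) x) < \<delta>"
    using eventually_happens'[OF trivial_limit_at_right_real[of 0]] by force
  \<comment> \<open>The barrier has the desired decay rate a and equals \<delta> at T1, where u and
    p are known to be smaller than \<delta>. The comparison runs from T1 down towards 0.\<close>
  define y where "y = (\<lambda>t. \<delta> * (t / T1) powr a)"
  have ypos: "0 < y t" if "0 < t" for t using that \<delta> T1 by (simp add: y_def)
  have yle: "y t \<le> \<delta>" if "0 < t" "t \<le> T1" for t
  proof -
    have "(t / T1) powr a \<le> 1 powr a" using that T1 a by (intro powr_mono2) auto
    then show ?thesis using \<delta> by (simp add: y_def)
  qed
  have dy: "(y has_real_derivative a / t * y t) (at t)" if "0 < t" for t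
  proof -
    have "((\<lambda>t. (t / T1) powr a) has_real_derivative a * (t / T1) powr (a - 1) * (1 / T1)) (at t)"
      using that T1 by (auto intro!: derivative_eq_intros DERIV_powr simp: powr_diff field_simps)
    then have "(y has_real_derivative \<delta> * (a * (t / T1) powr (a - 1) * (1 / T1))) (at t)"
      unfolding y_def by (rule DERIV_cmult)
    moreover have "\<delta> * (a * (t / T1) powr (a - 1) * (1 / T1)) = a / t * y t"
      using that T1 by (simp add: y_def powr_diff)
    ultimately show ?thesis by simp
  qed
  have Atm: "A * t powr \<mu> < \<epsilon> * y t" if t: "0 < t" "t \<le> T1" for t
  proof -
    have "A * t powr \<mu> = A * T1 powr \<mu> * (t / T1) powr \<mu>" using t T1 by (simp add: powr_divide)
    also have "\<dots> \<le> A * T1 powr \<mu> * (t / T1) powr a"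
      using t T1 a A by (intro mult_left_mono powr_mono') auto
    also have "\<dots> < \<epsilon> * \<delta> * (t / T1) powr a" using b1(2)[OF T1(1,2)] t T1 by (intro mult_strict_right_mono) auto
    finally show ?thesis by (simp add: y_def)
  qed
  \<comment> \<open>A bound for the speed |F2|/t of the characteristics as long as the barriers
    hold. It is integrable because y(t)/t is a times a power of t integrable at 0, with integral
    y/a: the decay being proved is what keeps the characteristics short.\<close>
  define k where "k = (\<lambda>t. (Lz * (1 + Kp) + 1) * (y t / t) + C\<beta> * \<kappa> a t)"
  have cy: "continuous_on {0<..T0} y"
    unfolding y_def using T1 by (intro continuous_intros) auto
  have ck: "continuous_on {0<..T0} k" unfolding k_def by (intro continuous_intros cy \<kappa>(1) a) auto
  have yint: "((\<lambda>t. y t / t) has_integral (y t / a - y 0 / a)) {0..t}" if t: "0 \<le> t" for t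
  proof (rule fundamental_theorem_of_calculus_interior[OF t])
    show "continuous_on {0..t} (\<lambda>t. y t / a)"
      unfolding y_def using T1 a by (intro continuous_intros continuous_on_powr') auto
    show "((\<lambda>t. y t / a) has_vector_derivative y s / s) (at s)" if "s \<in> {0<..<t}" for s
      using that a unfolding has_real_derivative_iff_has_vector_derivative[symmetric]
      by (auto intro!: derivative_eq_intros dy)
  qed
  have y0: "y 0 = 0" by (simp add: y_def)
  have iy: "(\<lambda>t. (Lz * (1 + Kp) + 1) * (y t / t)) integrable_on {0..t}" if "0 \<le> t" for t
    using yint[OF that] by (intro integrable_on_mult_right) (auto simp: integrable_on_def)
  have ik2: "(\<lambda>t. C\<beta> * \<kappa> a t) integrable_on {0..t}" if "0 \<le> t" "t \<le> T0" for t
    by (intro integrable_on_mult_right integrable_on_subinterval[OF \<kappa>(3)[OF a(1)]]) (use that in auto)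
  have ik: "k integrable_on {0..t}" if "0 \<le> t" "t \<le> T0" for t
    unfolding k_def by (intro integrable_add iy ik2 that)
  have kpos: "0 < k t" if "t \<in> {0<..T0}" for t
    unfolding k_def
    by (rule add_pos_pos[OF mult_pos_pos[OF q2 divide_pos_pos] mult_pos_pos[OF C\<beta> \<kappa>(2)[OF a(1) that]]])
      (use that ypos[of t] in auto)
  \<comment> \<open>The disc shrinks as t decreases, with speed k, but its radius never falls below
    R2/2; this is why the conclusion holds on one disc for all small t.\<close>
  define \<rho> where "\<rho> = (\<lambda>t. R2 / 2 + integral {0..t} k)"
  have \<rho>T1: "\<rho> T1 \<le> R2"
  proof -
    have "integral {0..T1} k = integral {0..T1} (\<lambda>t. (Lz * (1 + Kp) + 1) * (y t / t)) + integral {0..T1} (\<lambda>t. C\<beta> * \<kappa> a t)"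
      unfolding k_def by (rule integral_add[OF iy ik2]) (use T1 T in auto)
    also have "integral {0..T1} (\<lambda>t. (Lz * (1 + Kp) + 1) * (y t / t)) = (Lz * (1 + Kp) + 1) * integral {0..T1} (\<lambda>t. y t / t)"
      by (rule integral_mult_right)
    also have "(Lz * (1 + Kp) + 1) * integral {0..T1} (\<lambda>t. y t / t) = (Lz * (1 + Kp) + 1) * (y T1 / a)"
      using integral_unique[OF yint[of T1]] T1 y0 by simp
    also have "y T1 = \<delta>" using T1 by (simp add: y_def)
    finally show ?thesis unfolding \<rho>_def times_divide_eq_right using \<delta>2 T1(5) by linarith
  qed
  have \<rho>mono: "\<rho> s \<le> \<rho> t" if "0 < s" "s \<le> t" "t \<le> T1" for s t
  proof -
    have "integral {0..t} k = integral {0..s} k + integral {s..t} k"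
      by (rule Henstock_Kurzweil_Integration.integral_combine[symmetric]) (use that T1 T ik in auto)
    moreover have "0 \<le> integral {s..t} k"
    proof (rule integral_nonneg)
      show "k integrable_on {s..t}" by (rule integrable_on_subinterval[OF ik[of t]]) (use that T1 T in auto)
      show "0 \<le> k r" if "r \<in> {s..t}" for r using kpos[of r] that \<open>0 < s\<close> \<open>t \<le> T1\<close> T1 T by auto
    qed
    ultimately show ?thesis by (simp add: \<rho>_def)
  qed
  have \<rho>ge: "R2 / 2 \<le> \<rho> t" if "0 < t" "t \<le> T1" for t
  proof -
    have "0 \<le> integral {0<..t} k"
    proof (rule integral_nonneg)
      show "k integrable_on {0<..t}" unfolding integrable_half_open by (rule ik) (use that T1 T in auto)
      show "0 \<le> k r" if "r \<in> {0<..t}" for r using kpos[of r] that \<open>t \<le> T1\<close> T1 T by auto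
    qed
    then show ?thesis by (simp add: \<rho>_def integral_half_open)
  qed
  have d\<rho>: "(\<rho> has_real_derivative k t) (at t)" if "t \<in> {0<..<T0}" for t
  proof -
    have "continuous_on {0<..<T0} k" by (rule continuous_on_subset[OF ck]) auto
    from integral_from_0_deriv[OF this ik that] T0 show ?thesis
      unfolding \<rho>_def by (auto intro!: derivative_eq_intros)
  qed
  have inR: "x \<in> ball 0 R \<and> cmod x \<le> R2" if "cmod x \<le> \<rho> t" "0 < t" "t \<le> T1" for x :: complex and t
    using \<rho>mono[of t T1] \<rho>T1 R2 that by auto

  \<comment> \<open>Only the real part of the linear coefficient acts on the modulus; E gathers the
    errors.\<close>
  have damp: "Re L * (cmod q)\<^sup>2 - cmod q * cmod E \<le> Re (cnj q * (L * q + E))" for L q E :: complex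
  proof -
    have "cnj q * (L * q + E) = L * of_real ((cmod q)\<^sup>2) + cnj q * E"
      by (simp add: algebra_simps complex_norm_square del: of_real_power)
    moreover have "- (cmod q * cmod E) \<le> Re (cnj q * E)"
      using abs_Re_le_cmod[of "cnj q * E"] by (simp add: norm_mult)
    ultimately show ?thesis by simp
  qed
  \<comment> \<open>Each disjunction is an implication: the inequality holds when the quantity
    touches its barrier. It says that u, respectively p, decreases faster than its barrier when t
    decreases along the characteristic.\<close>
  have step_facts: "0 < Re (cnj U * (F t x U P - F2 t x U P * P)) - a * (y t)\<^sup>2 \<or> cmod U \<noteq> y t"
      "0 < Re (cnj P * (Fx t x U P + F1 t x U P * P)) - a * (Kp * y t)\<^sup>2 \<or> cmod P \<noteq> Kp * y t"
      "cmod (F2 t x U P) < t * k t"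
    if t: "0 < t" "t < T1" and x: "cmod x \<le> \<rho> t" and UP: "cmod U \<le> y t" "cmod P \<le> Kp * y t" "U \<in> ball 0 r1" "P \<in> ball 0 r1" for t x U P
  proof -
    have t0: "t \<in> {0..T0}" "t \<in> {0<..T0}" using t T1 T by auto
    have xR: "x \<in> ball 0 R" "cmod x \<le> R2" using inR[OF x] t by auto
    have x1: "x \<in> ball 0 R1" "x \<in> ball 0 (R1/2)" "x \<in> ball 0 R0" using xR R pos by auto
    have z0: "(0::complex) \<in> ball 0 r1" using pos by auto
    let ?L = "coeff_lambda F t x" and ?b = "coeff_b F t x"
    have L: "a + 3 * \<epsilon> < Re ?L"
    proof (rule d(2)[OF t0(1) x1(1)])
      have "norm (t, x) \<le> norm t + norm x" by (rule norm_Pair_le)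
      then show "dist (t,x) (0,0) < d" using t T1 xR R2 by (simp add: dist_norm flip: zero_prod_def)
    qed
    have yt: "0 < y t" "y t \<le> \<delta>" using ypos yle t by auto
    define N where "N = cmod U + cmod P"
    have N: "0 \<le> N" "N \<le> (1 + Kp) * y t" using UP by (auto simp: N_def algebra_simps)
    have LN: "Lz * (1 + Kp)^2 * y t \<le> \<epsilon> / 2"
    proof -
      have "Lz * (1 + Kp)^2 * y t \<le> Lz * (1 + Kp)^2 * \<delta>" using yt Lz by (intro mult_left_mono) auto
      then show ?thesis using \<delta>1 by linarith
    qed
    have N2: "Lz * N\<^sup>2 \<le> \<epsilon> / 2 * y t"
    proof -
      have "Lz * N\<^sup>2 \<le> Lz * ((1 + Kp) * y t)\<^sup>2" using N Lz by (intro mult_left_mono power_mono) auto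
      also have "\<dots> = (Lz * (1 + Kp)^2 * y t) * y t" by (simp add: power2_eq_square)
      also have "\<dots> \<le> \<epsilon> / 2 * y t" using LN yt by (intro mult_right_mono) auto
      finally show ?thesis .
    qed
    have N1: "Lz * N \<le> \<epsilon> / 2"
    proof -
      have "Lz * N \<le> Lz * ((1 + Kp) * y t)" using N Lz by (intro mult_left_mono) auto
      also have "\<dots> \<le> Lz * ((1 + Kp)^2 * y t)"
        using Lz yt Kp by (intro mult_left_mono mult_right_mono) (auto simp: power2_eq_square)
      finally show ?thesis using LN by simp
    qed
    note At = Atm[OF t(1) less_imp_le[OF t(2)]]
    have bt: "\<beta> t \<le> \<epsilon> * R1 / 4" using b1(2)[of t] t T1 by auto
    have F2b: "cmod (F2 t x U P - ?b) \<le> Lz * N" unfolding N_def by (rule F2_lip[OF t0(1) x1(1) UP(3,4)])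
    show "0 < Re (cnj U * (F t x U P - F2 t x U P * P)) - a * (y t)\<^sup>2 \<or> cmod U \<noteq> y t"
    proof (cases "cmod U = y t")
      case True
      \<comment> \<open>Along the characteristic the equation for u has the right-hand side F - F2
        p. The linear term b p of F cancels against that of F2 p, so that the error consists of
        a(t,x) and quadratic terms only.\<close>
      define E where "E = (F t x U P - F t x 0 0 - ?L * U - ?b * P) + (F t x 0 0 - (F2 t x U P - ?b) * P)"
      have "cmod (F t x U P - F t x 0 0 - ?L * U - ?b * P) \<le> Lz * N\<^sup>2"
        using F_taylor[OF t0(1) x1(1) UP(3,4) z0 z0] by (simp add: N_def power2_eq_square)
      moreover have "cmod (F t x 0 0) \<le> A * t powr \<mu>" using c1[OF t0(2) x1(3)] by (simp add: coeff_a_def)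
      moreover have "cmod ((F2 t x U P - ?b) * P) \<le> Lz * N\<^sup>2"
      proof -
        have "cmod ((F2 t x U P - ?b) * P) \<le> (Lz * N) * N"
          unfolding norm_mult by (rule mult_mono[OF F2b]) (use Lz N in \<open>auto simp: N_def\<close>)
        then show ?thesis by (simp add: power2_eq_square)
      qed
      ultimately have "cmod E \<le> Lz * N\<^sup>2 + (A * t powr \<mu> + Lz * N\<^sup>2)"
        using norm_triangle_ineq[of "F t x U P - F t x 0 0 - ?L * U - ?b * P" "F t x 0 0 - (F2 t x U P - ?b) * P"]
          norm_triangle_ineq4[of "F t x 0 0" "(F2 t x U P - ?b) * P"]
        unfolding E_def by linarith
      then have "cmod E < 2 * \<epsilon> * y t" using N2 At by linarith
      then have "y t * cmod E < y t * (2 * \<epsilon> * y t)" using yt by (intro mult_strict_left_mono) auto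
      moreover have "F t x U P - F2 t x U P * P = ?L * U + E" by (simp add: E_def algebra_simps)
      moreover have "(a + 3 * \<epsilon>) * (y t)\<^sup>2 \<le> Re ?L * (y t)\<^sup>2" using L by (intro mult_right_mono) auto
      moreover have "0 < \<epsilon> * (y t)\<^sup>2" using \<epsilon> yt by simp
      ultimately show ?thesis using damp[of ?L U E] True by (simp add: power2_eq_square algebra_simps)
    qed simp
    show "0 < Re (cnj P * (Fx t x U P + F1 t x U P * P)) - a * (Kp * y t)\<^sup>2 \<or> cmod P \<noteq> Kp * y t"
    proof (cases "cmod P = Kp * y t")
      case True
      define Y where "Y = Kp * y t"
      have Y: "0 < Y" "y t \<le> Y" using yt Kp by (auto simp: Y_def)
      define E where "E = Fx t x U P + (F1 t x U P - ?L) * P"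
      have "cmod ((F1 t x U P - ?L) * P) \<le> (Lz * N) * Y"
        unfolding norm_mult True Y_def[symmetric] using F1_lip[OF t0(1) x1(1) UP(3,4)] Y
        by (intro mult_right_mono) (auto simp: N_def)
      also have "\<dots> \<le> \<epsilon> / 2 * Y" using N1 Y by (intro mult_right_mono) auto
      finally have e1: "cmod ((F1 t x U P - ?L) * P) \<le> \<epsilon> / 2 * Y" .
      have "cmod (Fx t x U P) \<le> (A * t powr \<mu> + \<Lambda>1 * cmod U + \<beta> t * cmod P + Lz * N\<^sup>2) / (R1/2)"
        unfolding \<Lambda>1_def N_def by (rule Fx_bound[OF t0(2) x1(2) UP(3,4)])
      also have "\<dots> \<le> (\<epsilon> * y t + \<Lambda>1 * y t + \<epsilon> * R1 / 4 * Y + \<epsilon> / 2 * y t) / (R1/2)"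
      proof -
        have "\<Lambda>1 * cmod U \<le> \<Lambda>1 * y t" using UP(1) \<Lambda>1 by (rule mult_left_mono)
        moreover have "\<beta> t * cmod P \<le> \<epsilon> * R1 / 4 * Y"
          unfolding True Y_def[symmetric] using bt Y by (intro mult_right_mono) auto
        ultimately have "A * t powr \<mu> + \<Lambda>1 * cmod U + \<beta> t * cmod P + Lz * N\<^sup>2 \<le> \<epsilon> * y t + \<Lambda>1 * y t + \<epsilon> * R1 / 4 * Y + \<epsilon> / 2 * y t"
          using At N2 by linarith
        then show ?thesis by (rule divide_right_mono) (use pos in simp)
      qed
      also have "\<dots> = (3/4 * \<epsilon>) * (4 / R1 * y t) + \<epsilon> / 2 * (4 * \<Lambda>1 / (R1 * \<epsilon>) * y t) + \<epsilon> / 2 * Y"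
        using pos \<epsilon> by (simp add: field_simps)
      also have "\<dots> \<le> (3/4 * \<epsilon>) * Y + \<epsilon> / 2 * Y + \<epsilon> / 2 * Y"
        unfolding Y_def using Kp yt \<epsilon> by (intro add_mono mult_left_mono mult_right_mono) auto
      finally have "cmod (Fx t x U P) \<le> 7/4 * \<epsilon> * Y" by (simp add: mult_ac)
      then have "cmod E \<le> 7/4 * \<epsilon> * Y + \<epsilon> / 2 * Y" unfolding E_def using e1 by (rule norm_triangle_mono)
      moreover have "0 < \<epsilon> * Y" using \<epsilon> Y by simp
      moreover have "7/4 * \<epsilon> * Y + \<epsilon> / 2 * Y = 9/4 * (\<epsilon> * Y)" "3 * \<epsilon> * Y = 3 * (\<epsilon> * Y)" by (simp_all add: field_simps)
      ultimately have "cmod E < 3 * \<epsilon> * Y" by linarith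
      then have "Y * cmod E < Y * (3 * \<epsilon> * Y)" using Y by (intro mult_strict_left_mono) auto
      moreover have "Fx t x U P + F1 t x U P * P = ?L * P + E" by (simp add: E_def algebra_simps)
      moreover have "(a + 3 * \<epsilon>) * Y\<^sup>2 \<le> Re ?L * Y\<^sup>2" using L by (intro mult_right_mono) auto
      ultimately show ?thesis using damp[of ?L P E] True by (simp add: power2_eq_square algebra_simps flip: Y_def)
    qed simp
    have "cmod (F2 t x U P) \<le> cmod ?b + Lz * N" using F2b norm_triangle_sub[of "F2 t x U P" ?b] by linarith
    also have "cmod ?b \<le> C\<beta> * m t" using c3[OF t0(2) x1(3), folded \<beta>_def] \<beta>(2)[OF t0(2)] by linarith
    also have "Lz * N \<le> Lz * (1 + Kp) * y t" using mult_left_mono[OF N(2) Lz] by simp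
    also have "C\<beta> * m t + Lz * (1 + Kp) * y t < t * k t"
    proof -
      have "t * k t = (Lz * (1 + Kp) + 1) * y t + C\<beta> * (m t + t powr a)"
        using t by (simp add: k_def \<kappa>_def field_simps)
      moreover have "0 < C\<beta> * t powr a" using C\<beta> t by simp
      ultimately show ?thesis using yt by (simp add: algebra_simps)
    qed
    finally show "cmod (F2 t x U P) < t * k t" by simp
  qed
  have main: "cmod (u t x) < y t \<and> cmod (deriv (u t) x) < Kp * y t"
    if t: "0 < t" "t < T1" and x: "cmod x \<le> \<rho> t" for t x
  proof -
    \<comment> \<open>The index is a truth value: \<open>True\<close> stands for u and
      \<open>False\<close> for p. Time is reflected, s = -t, because the comparison principle runs
      forwards while the estimate is to be carried down to t = 0.\<close>
    define q where "q = (\<lambda>i s x. if i then u (-s) x else deriv (u (-s)) x)"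
    define Yb where "Yb = (\<lambda>i s. if i then y (-s) else Kp * y (-s))"
    note ev' = evolves_deriv[OF ev]
    have evq: "evolves (-T) 0 R (q i) (\<lambda>s x. if i then - g (-s) x else - deriv (g (-s)) x)" for i
      using evolves_reflect[OF ev] evolves_reflect[OF ev'] by (cases i) (simp_all add: q_def)
    have sub: "(- s) \<in> {0<..<T} \<and> - s \<le> T1 \<and> 0 < - s \<and> - s \<in> {0<..<T0}" if "s \<in> {- T1..- t}" for s using that t T1 T by auto
    have neg: "((\<lambda>s. f (- s)) has_real_derivative - D) (at s within X)" if "(f has_real_derivative D) (at (- s))" for f D s X
    proof -
      have "((\<lambda>s. - s) has_real_derivative -1) (at s)" by (auto intro!: derivative_eq_intros)
      from DERIV_chain'[OF this, of f D] that
      have "((\<lambda>s. f (- s)) has_real_derivative - D) (at s)" by simp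
      then show ?thesis by (auto intro: has_field_derivative_at_within)
    qed
    have all: "cmod (q i (-t) x) < Yb i (-t)" for i
    proof (rule transport_barrier[where I=UNIV and q=q and y=Yb and \<rho>="\<lambda>s. \<rho> (-s)" and a="-T1" and b="-t"])
      show "continuous_on {(s, x). s \<in> {- T1..- t} \<and> cmod x \<le> \<rho> (- s)} (\<lambda>(s, x). q i s x)" for i
      proof (rule continuous_on_subset)
        show "continuous_on ({-T<..<0} \<times> ball 0 R) (\<lambda>(s,x). q i s x)" using evq[of i] by (simp add: evolves_def)
        show "{(s, x). s \<in> {- T1..- t} \<and> cmod x \<le> \<rho> (- s)} \<subseteq> {-T<..<0} \<times> ball 0 R"
          using sub inR by fastforce
      qed
      have cy': "continuous_on {- T1..- t} (\<lambda>s. y (- s))"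
        by (rule continuous_on_compose2[OF cy]) (use t T1 T in \<open>auto intro!: continuous_intros\<close>)
      then show "continuous_on {- T1..- t} (Yb i)" for i
        by (cases i) (auto simp: Yb_def intro!: continuous_intros)
      show "0 \<le> Yb i s" if "s \<in> {- T1..- t}" for i s
        using ypos[of "-s"] sub[OF that] Kp by (auto simp: Yb_def)
      show "continuous_on {- T1..- t} (\<lambda>s. \<rho> (- s))"
      proof (rule continuous_at_imp_continuous_on, rule ballI)
        fix s assume "s \<in> {- T1..- t}"
        then show "isCont (\<lambda>s. \<rho> (- s)) s" using neg[OF d\<rho>, of s UNIV] sub DERIV_isCont by blast
      qed
      show "antimono_on {- T1..- t} (\<lambda>s. \<rho> (- s))"
        by (rule monotone_onI) (use \<rho>mono sub in auto)
      show "cmod (q i (- T1) x) < Yb i (- T1)" if "cmod x \<le> \<rho> (- (- T1))" for i x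
      proof -
        have "x \<in> ball 0 R" using inR[of x T1] that T1 by simp
        then have "cmod (u T1 x) < \<delta>" "cmod (deriv (u T1) x) < \<delta>" using T1 by auto
        moreover have "y T1 = \<delta>" using T1 by (simp add: y_def)
        moreover have "\<delta> \<le> Kp * \<delta>" using Kp \<delta> by simp
        ultimately show ?thesis by (auto simp: q_def Yb_def)
      qed
      show "- t \<in> {- T1..- t}" using t by simp
      show "cmod x \<le> \<rho> (- (- t))" using x by simp
      fix s x i
      assume s: "s \<in> {- T1<..- t}" and x: "cmod x \<le> \<rho> (- s)" and le: "\<And>j. j \<in> UNIV \<Longrightarrow> cmod (q j s x) \<le> Yb j s" and eqy: "cmod (q i s x) = Yb i s"
      define \<tau> where "\<tau> = - s"
      have \<tau>: "0 < \<tau>" "\<tau> < T1" "\<tau> \<in> {0<..<T}" "\<tau> \<in> {0<..<T0}" "\<tau> \<in> {0..T0}" using s t T1 T by (auto simp: \<tau>_def)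
      have xR: "x \<in> ball 0 R" using inR[of x \<tau>] x \<tau> by (simp add: \<tau>_def)
      define U where "U = u \<tau> x"
      define P where "P = deriv (u \<tau>) x"
      have UP: "cmod U \<le> y \<tau>" "cmod P \<le> Kp * y \<tau>" "U \<in> ball 0 r1" "P \<in> ball 0 r1"
        using le[of True] le[of False] ub[OF \<tau>(3) xR] by (auto simp: q_def Yb_def U_def P_def \<tau>_def)
      note sf = step_facts[OF \<tau>(1,2) x[folded \<tau>_def] UP]
      \<comment> \<open>The characteristic direction: it removes the second x-derivative of u from
        the derivative of p, and leaves F - F2 p for u.\<close>
      define c where "c = - F2 \<tau> x U P / of_real \<tau>"
      have hu: "u \<tau> holomorphic_on ball 0 R" using ev \<tau> by (auto simp: evolves_def)
      have hg: "g \<tau> holomorphic_on ball 0 R" using ev \<tau> by (auto simp: evolves_def)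
      have gU: "g \<tau> x = F \<tau> x U P / of_real \<tau>" using eq[OF \<tau>(3) xR] \<tau> by (simp add: U_def P_def field_simps)
      have gP: "deriv (g \<tau>) x = (Fx \<tau> x U P + F1 \<tau> x U P * P + F2 \<tau> x U P * deriv (deriv (u \<tau>)) x) / of_real \<tau>"
      proof -
        have 1: "((\<lambda>y. F \<tau> y (u \<tau> y) (deriv (u \<tau>) y)) has_field_derivative
           Fx \<tau> x U P * 1 + F1 \<tau> x U P * P + F2 \<tau> x U P * deriv (deriv (u \<tau>)) x) (at x)"
          unfolding U_def P_def
        proof (rule chain[OF \<tau>(5)])
          show "x \<in> ball 0 R0" "u \<tau> x \<in> ball 0 \<rho>0" "deriv (u \<tau>) x \<in> ball 0 \<rho>0" 
            using xR R pos ub[OF \<tau>(3) xR] by auto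
          show "(u \<tau> has_field_derivative deriv (u \<tau>) x) (at x)" by (rule holomorphic_derivI[OF hu open_ball xR])
          show "(deriv (u \<tau>) has_field_derivative deriv (deriv (u \<tau>)) x) (at x)"
            by (rule holomorphic_derivI[OF holomorphic_deriv[OF hu open_ball] open_ball xR])
        qed (auto intro!: derivative_eq_intros)
        have "((\<lambda>y. of_real \<tau> * g \<tau> y) has_field_derivative
           Fx \<tau> x U P * 1 + F1 \<tau> x U P * P + F2 \<tau> x U P * deriv (deriv (u \<tau>)) x) (at x)"
          by (rule has_field_derivative_transform_within_open[OF 1 open_ball xR]) (use eq[OF \<tau>(3)] in auto)
        moreover have "((\<lambda>y. of_real \<tau> * g \<tau> y) has_field_derivative of_real \<tau> * deriv (g \<tau>) x) (at x)"
          by (intro DERIV_cmult holomorphic_derivI[OF hg open_ball xR])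
        ultimately have "of_real \<tau> * deriv (g \<tau>) x = Fx \<tau> x U P * 1 + F1 \<tau> x U P * P + F2 \<tau> x U P * deriv (deriv (u \<tau>)) x"
          by (rule DERIV_unique[rotated])
        then show ?thesis using \<tau> by (simp add: field_simps)
      qed
      have s': "s \<in> {-T<..<0}" using \<tau> by (auto simp: \<tau>_def)
      have dYb: "(Yb i has_real_derivative - (a / \<tau> * Yb i s)) (at s within {..s})"
      proof (cases i)
        case True
        then show ?thesis using neg[OF dy[of \<tau>, unfolded \<tau>_def], of "{..s}"] \<tau> by (simp add: Yb_def \<tau>_def)
      next
        case False
        then show ?thesis using DERIV_cmult[OF neg[OF dy[of \<tau>, unfolded \<tau>_def], of "{..s}"], of Kp] \<tau>
          by (simp add: Yb_def \<tau>_def mult_ac)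
      qed
      have d\<rho>': "((\<lambda>s. \<rho> (- s)) has_real_derivative - k \<tau>) (at s within {..s})"
        using neg[OF d\<rho>, of s "{..s}"] \<tau> by (simp add: \<tau>_def)
      have cc: "cmod c < - (- k \<tau>)" using sf(3) \<tau> by (simp add: c_def norm_divide pos_divide_less_eq mult.commute)
      define D where "D = (if i then g \<tau> x + c * P else deriv (g \<tau>) x + c * deriv (deriv (u \<tau>)) x)"
      have D1: "((\<lambda>h. q i (s - h) (x + of_real h * c)) has_vector_derivative D) (at 0 within {0..})"
        using evolves_path[OF evq[of i] s' xR, of "-1" c "{0..}"]
        by (cases i) (simp_all add: D_def q_def P_def \<tau>_def)
      have pos: "0 < Re (cnj (q i s x) * D) + Yb i s * - (a / \<tau> * Yb i s)"
      proof (cases i)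
        case True
        have "D = (F \<tau> x U P - F2 \<tau> x U P * P) / of_real \<tau>"
          using True gU by (simp add: D_def c_def diff_divide_distrib)
        then have "Re (cnj (q i s x) * D) = Re (cnj U * (F \<tau> x U P - F2 \<tau> x U P * P)) / \<tau>"
          using True by (simp add: q_def U_def \<tau>_def flip: Re_divide_of_real)
        moreover have "Yb i s * - (a / \<tau> * Yb i s) = - (a * (y \<tau>)\<^sup>2) / \<tau>"
          using True by (simp add: Yb_def \<tau>_def power2_eq_square)
        moreover have "cmod U = y \<tau>" using eqy True by (simp add: q_def Yb_def U_def \<tau>_def)
        ultimately show ?thesis using sf(1) \<tau>(1) by (simp only: add_divide_distrib[symmetric]) (intro divide_pos_pos; linarith)
      next
        case False
        have "D = (Fx \<tau> x U P + F1 \<tau> x U P * P) / of_real \<tau>"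
          using False gP by (simp add: D_def c_def add_divide_distrib)
        then have "Re (cnj (q i s x) * D) = Re (cnj P * (Fx \<tau> x U P + F1 \<tau> x U P * P)) / \<tau>"
          using False by (simp add: q_def P_def \<tau>_def flip: Re_divide_of_real)
        moreover have "Yb i s * - (a / \<tau> * Yb i s) = - (a * (Kp * y \<tau>)\<^sup>2) / \<tau>"
          using False by (simp add: Yb_def \<tau>_def power2_eq_square)
        moreover have "cmod P = Kp * y \<tau>" using eqy False by (simp add: q_def Yb_def P_def \<tau>_def)
        ultimately show ?thesis using sf(2) \<tau>(1) by (simp only: add_divide_distrib[symmetric]) (intro divide_pos_pos; linarith)
      qed
      show "\<exists>c D \<rho>' y'. ((\<lambda>h. q i (s - h) (x + complex_of_real h * c)) has_vector_derivative D) (at 0 within {0..}) \<and>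
         ((\<lambda>s. \<rho> (- s)) has_real_derivative \<rho>') (at s within {..s}) \<and> (Yb i has_real_derivative y') (at s within {..s}) \<and>
         cmod c < - \<rho>' \<and> 0 < Re (cnj (q i s x) * D) + Yb i s * y'"
        using D1 d\<rho>' dYb cc pos by blast
    qed simp_all
    show ?thesis using all[of True] all[of False] by (simp add: q_def Yb_def)
  qed
  show ?thesis
  proof (rule that[of "T1/2" "R2/2" "Kp * \<delta> / T1 powr a"])
    show "0 < T1 / 2" "T1 / 2 < T" "0 < R2 / 2" "R2 / 2 \<le> R" using T1 R2 by auto
    show "0 < Kp * \<delta> / T1 powr a" using Kp \<delta> T1 by simp
    fix t and x :: complex assume t: "t \<in> {0<..T1/2}" and x: "x \<in> ball 0 (R2/2)"
    have tt: "0 < t" "t < T1" using t T1 by auto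
    have "cmod x \<le> \<rho> t" using \<rho>ge[of t] tt x by simp
    note mm = main[OF tt this]
    have "Kp * y t = Kp * \<delta> / T1 powr a * t powr a" using tt T1 by (simp add: y_def powr_divide)
    moreover have "y t \<le> Kp * y t" using Kp ypos[OF tt(1)] by simp
    ultimately show "cmod (u t x) \<le> Kp * \<delta> / T1 powr a * t powr a \<and> cmod (deriv (u t) x) \<le> Kp * \<delta> / T1 powr a * t powr a"
      using mm by linarith
  qed
qed

end

subsection \<open>Solutions near a given function\<close>

lemma evolves_flip:
  assumes "evolves 0 L R u g"
  shows "evolves 0 L R (\<lambda>s. u (L - s)) (\<lambda>s x. - g (L - s) x)"
proof -
  have c: "continuous_on ({0<..<L} \<times> ball 0 R) (\<lambda>(t, x). f (L - t) x)"
    if "continuous_on ({0<..<L} \<times> ball 0 R) (\<lambda>(t, x). f t x)" for f :: txfun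
  proof -
    have "continuous_on ({0<..<L} \<times> ball 0 R) (\<lambda>p. case (L - fst p, snd p) of (t, x) \<Rightarrow> f t x)"
      by (rule continuous_on_compose2[OF that]) (auto intro!: continuous_intros)
    then show ?thesis by (simp add: split_beta')
  qed
  have d: "((\<lambda>s. u (L - s) x) has_vector_derivative - g (L - t) x) (at t)"
    if "t \<in> {0<..<L}" "x \<in> ball 0 R" for t x
  proof -
    have "((\<lambda>s. u s x) has_vector_derivative g (L - t) x) (at (L - t))"
      using assms that by (auto simp: evolves_def)
    then have "((\<lambda>s. u s x) \<circ> (\<lambda>s. L - s) has_vector_derivative (-1) *\<^sub>R g (L - t) x) (at t)"
      by (intro vector_diff_chain_at) (auto intro!: derivative_eq_intros)
    then show ?thesis by (simp add: o_def)
  qed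
  have "continuous_on ({0<..<L} \<times> ball 0 R) (\<lambda>p. - (case p of (t, x) \<Rightarrow> g (L - t) x))"
    using assms by (intro continuous_on_minus c) (auto simp: evolves_def)
  then show ?thesis
    using assms d by (auto simp: evolves_def split_beta' intro!: c[unfolded split_beta'] holomorphic_intros)
qed

lemma evolves_cong:
  assumes "evolves a b R u g" "\<And>t x. t \<in> {a<..<b} \<Longrightarrow> x \<in> ball 0 R \<Longrightarrow> g t x = h t x"
  shows "evolves a b R u h"
proof -
  have "continuous_on ({a<..<b} \<times> ball 0 R) (\<lambda>(t, x). g t x)" using assms(1) by (simp add: evolves_def)
  then have "continuous_on ({a<..<b} \<times> ball 0 R) (\<lambda>(t, x). h t x)"
    by (rule continuous_on_eq) (use assms(2) in auto)
  moreover have "h t holomorphic_on ball 0 R" if t: "t \<in> {a<..<b}" for t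
    using assms(1) t holomorphic_cong[of "ball 0 R" _ "g t" "h t"] assms(2)[OF t] by (auto simp: evolves_def)
  ultimately show ?thesis using assms by (auto simp: evolves_def)
qed

lemma evolves_subset:
  assumes "evolves a b R u g" "a \<le> a'" "b' \<le> b" "R' \<le> R"
  shows "evolves a' b' R' u g"
proof -
  have sub: "{a'<..<b'} \<times> ball (0::complex) R' \<subseteq> {a<..<b} \<times> ball 0 R" "{a'<..<b'} \<subseteq> {a<..<b}" "ball (0::complex) R' \<subseteq> ball 0 R"
    using assms(2-4) by (auto intro!: Sigma_mono)
  show ?thesis
    using assms(1) sub(2,3) unfolding evolves_def
    by (intro conjI ballI continuous_on_subset[OF _ sub(1)]) (blast intro: holomorphic_on_subset)+
qed

lemma evolves_mult:
  assumes u: "evolves a b R u g" and v: "evolves a b R v h"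
  shows "evolves a b R (\<lambda>t x. u t x * v t x) (\<lambda>t x. g t x * v t x + u t x * h t x)"
proof -
  have "continuous_on ({a<..<b} \<times> ball 0 R) (\<lambda>p. (\<lambda>(t,x). u t x) p * (\<lambda>(t,x). v t x) p)"
    using u v by (intro continuous_intros) (auto simp: evolves_def)
  moreover have "continuous_on ({a<..<b} \<times> ball 0 R) (\<lambda>p. (\<lambda>(t,x). g t x) p * (\<lambda>(t,x). v t x) p + (\<lambda>(t,x). u t x) p * (\<lambda>(t,x). h t x) p)"
    using u v by (intro continuous_intros) (auto simp: evolves_def)
  moreover have "((\<lambda>s. u s x * v s x) has_vector_derivative g t x * v t x + u t x * h t x) (at t)"
    if "t \<in> {a<..<b}" "x \<in> ball 0 R" for t x
    using has_vector_derivative_mult[of "\<lambda>s. u s x" "g t x" t UNIV "\<lambda>s. v s x" "h t x"] u v that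
    by (simp add: evolves_def add.commute)
  ultimately show ?thesis
    using u v by (auto simp: evolves_def split_beta' intro!: holomorphic_intros)
qed

lemma evolves_lincomb:
  assumes u: "evolves a b R u g" and v: "evolves a b R v h"
  shows "evolves a b R (\<lambda>t x. u t x + c * v t x) (\<lambda>t x. g t x + c * h t x)"
proof -
  have "continuous_on ({a<..<b} \<times> ball 0 R) (\<lambda>p. (\<lambda>(t,x). u t x) p + c * (\<lambda>(t,x). v t x) p)"
    using u v by (intro continuous_intros) (auto simp: evolves_def)
  moreover have "continuous_on ({a<..<b} \<times> ball 0 R) (\<lambda>p. (\<lambda>(t,x). g t x) p + c * (\<lambda>(t,x). h t x) p)"
    using u v by (intro continuous_intros) (auto simp: evolves_def)
  moreover have "((\<lambda>s. u s x + c * v s x) has_vector_derivative g t x + c * h t x) (at t)"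
    if "t \<in> {a<..<b}" "x \<in> ball 0 R" for t x
    using u v that by (intro derivative_intros has_vector_derivative_mult_right) (auto simp: evolves_def)
  ultimately show ?thesis
    using u v by (auto simp: evolves_def split_beta' intro!: holomorphic_intros)
qed

lemma evolves_exp:
  assumes f: "f holomorphic_on ball 0 R"
  shows "evolves 0 T R (\<lambda>t x. exp (f x * of_real (ln t))) (\<lambda>t x. f x / of_real t * exp (f x * of_real (ln t)))"
proof -
  have cf: "continuous_on ({0<..<T} \<times> ball 0 R) (\<lambda>p. f (snd p))"
    by (rule continuous_on_compose2[OF holomorphic_on_imp_continuous_on[OF f]]) (auto intro!: continuous_intros)
  have cl: "continuous_on ({0<..<T} \<times> ball (0::complex) R) (\<lambda>p. of_real (ln (fst p)) :: complex)"
    by (intro continuous_intros) auto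
  have "continuous_on ({0<..<T} \<times> ball 0 R) (\<lambda>p. exp (f (snd p) * of_real (ln (fst p))))"
    by (intro continuous_on_exp continuous_on_mult cf cl)
  moreover have "continuous_on ({0<..<T} \<times> ball 0 R) (\<lambda>p. f (snd p) / of_real (fst p) * exp (f (snd p) * of_real (ln (fst p))))"
    by (intro continuous_on_exp continuous_on_mult continuous_on_divide continuous_on_of_real continuous_on_fst continuous_on_id cf cl) auto
  moreover have "((\<lambda>s. exp (f x * of_real (ln s))) has_vector_derivative f x / of_real t * exp (f x * of_real (ln t))) (at t)"
    if "t \<in> {0<..<T}" for t x
  proof -
    have "((\<lambda>s. f x * of_real (ln s)) has_vector_derivative f x * of_real (1/t)) (at t)"
      using that by (intro has_vector_derivative_mult_right has_vector_derivative_of_real)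
        (auto intro!: derivative_eq_intros simp: field_simps)
    from field_vector_diff_chain_at[OF this DERIV_exp]
    show ?thesis by (simp add: o_def mult.commute divide_inverse)
  qed
  ultimately show ?thesis
    unfolding evolves_def by (auto simp: split_beta' intro!: holomorphic_intros f)
qed

lemma norm_exp_ln: "0 < t \<Longrightarrow> cmod (exp (a * of_real (ln t))) = t powr Re a"
  by (simp add: norm_exp_eq_Re powr_def mult.commute)

lemma powr_le_powr:
  "(t::real) powr b \<le> t powr a" if "0 < t" "t < 1" "a \<le> b"
  using that by (intro powr_mono') auto

context briot_bouquet
begin

lemma m_t_kappa: "(m t + t powr b) / t \<le> \<kappa> c t" if "0 < t" "t < 1" "c \<le> b"
  using that powr_le_powr[of t c b] by (simp add: \<kappa>_def divide_right_mono)

text \<open>Here b + N |ln t| a bounds the x-derivative of t^\<nu> v divided by |t^\<nu>|, if a and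
  b bound v and its x-derivative and N bounds that of \<nu>. By (c3), \<beta>(t) |ln t| = B m(t), so
  the logarithm disappears; the part \<sigma> |ln t| costs half of the exponent d. This leaves the
  integrable rate \<kappa> with exponent d/2.\<close>

lemma weight_estimate:
  assumes t: "t \<in> {0<..T0}" and d: "0 < d" and \<sigma>: "0 \<le> \<sigma>" "\<sigma> \<le> s * t powr d" and s: "0 \<le> s" and N: "0 \<le> N" and ab: "0 \<le> a" "0 \<le> b"
  shows "((\<Lambda> * m t + \<sigma>) * a + (\<beta> t + \<sigma>) * (b + N * \<bar>ln t\<bar> * a)) / t
     \<le> (\<Lambda> + N * B + C\<beta> + s * (1 + 2 * N / d)) * \<kappa> (d/2) t * (a + b)"
proof -
  let ?y = "t powr (d/2)" and ?C = "\<Lambda> + N * B + C\<beta> + s * (1 + 2 * N / d)"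
  define q where "q = 2 / d"
  have q: "0 < q" "2 * N / d = N * q" using d by (auto simp: q_def)
  have tt: "0 < t" "t < 1" using t T0 by auto
  have y: "t powr d \<le> ?y" "0 \<le> ?y" using powr_le_powr[OF tt, of "d/2" d] d by auto
  have \<sigma>ln: "\<sigma> * \<bar>ln t\<bar> \<le> s * (q * ?y)"
  proof -
    have "\<sigma> * \<bar>ln t\<bar> \<le> s * t powr d * \<bar>ln t\<bar>" using \<sigma> by (intro mult_right_mono) auto
    also have "\<dots> \<le> s * (q * ?y)"
      unfolding q_def using powr_ln_bound[OF tt d] s by (simp only: mult.assoc mult_left_mono)
    finally show ?thesis .
  qed
  have \<sigma>': "\<sigma> \<le> s * ?y" using \<sigma>(2) mult_left_mono[OF y(1) s] by linarith
  have \<beta>ln: "\<beta> t * \<bar>ln t\<bar> = B * m t" using tt by (simp add: \<beta>_def)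
  note mt = m(2)[OF t] and \<beta>' = \<beta>(1,2)[OF t]
  have N': "N * (\<beta> t * \<bar>ln t\<bar> + \<sigma> * \<bar>ln t\<bar>) \<le> N * (B * m t + s * (q * ?y))"
    unfolding \<beta>ln using \<sigma>ln N by (intro mult_left_mono add_left_mono) auto
  have e: "?C * (m t + ?y) = (\<Lambda> * m t + s * ?y + N * (B * m t + s * (q * ?y))) + (C\<beta> * m t + (s * (1 + N * q)) * m t + (\<Lambda> + N * B + C\<beta>) * ?y)"
    unfolding q(2) by (simp add: algebra_simps)
  have pp: "0 \<le> (s * (1 + N * q)) * m t" "0 \<le> (\<Lambda> + N * B + C\<beta>) * ?y" "0 \<le> C\<beta> * m t" "0 \<le> \<Lambda> * m t" "0 \<le> N * (B * m t + s * (q * ?y))"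
    using s N q mt \<Lambda> B C\<beta> y by (auto intro!: mult_nonneg_nonneg add_nonneg_nonneg)
  have 1: "\<Lambda> * m t + \<sigma> + N * (\<beta> t * \<bar>ln t\<bar> + \<sigma> * \<bar>ln t\<bar>) \<le> ?C * (m t + ?y)"
    unfolding e using N' \<sigma>' pp by linarith
  have 2: "\<beta> t + \<sigma> \<le> ?C * (m t + ?y)" unfolding e using \<sigma>' \<beta>' pp by linarith
  have "(\<Lambda> * m t + \<sigma>) * a + (\<beta> t + \<sigma>) * (b + N * \<bar>ln t\<bar> * a) = (\<Lambda> * m t + \<sigma> + N * (\<beta> t * \<bar>ln t\<bar> + \<sigma> * \<bar>ln t\<bar>)) * a + (\<beta> t + \<sigma>) * b"
    by (simp add: algebra_simps)
  also have "\<dots> \<le> ?C * (m t + ?y) * a + ?C * (m t + ?y) * b"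
    by (rule add_mono[OF mult_right_mono[OF 1 ab(1)] mult_right_mono[OF 2 ab(2)]])
  also have "\<dots> = ?C * (m t + ?y) * (a + b)" by (simp add: distrib_left)
  finally show ?thesis using tt by (simp add: \<kappa>_def divide_right_mono)
qed

end

text \<open>The ansatz \<open>u = g0 + t\<^sup>\<nu> v\<close> with \<open>v \<rightarrow> V0\<close>; \<open>f0\<close> stands for \<open>t \<partial>g0/\<partial>t\<close>.\<close>

locale perturbed = briot_bouquet +
  fixes T R r d0 d1 C0 N C3 d3 :: real and g0 f0 :: txfun and \<nu> V0 :: "complex \<Rightarrow> complex"
  assumes T: "0 < T" "T \<le> T0" and R: "0 < R" "R \<le> R1" and r: "0 < r"
    and cg0: "continuous_on ({0<..<T} \<times> ball 0 R) (\<lambda>(t,x). g0 t x)"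
    and hg0: "\<And>t. t \<in> {0<..<T} \<Longrightarrow> g0 t holomorphic_on ball 0 R"
    and bg0: "\<And>t x. t \<in> {0<..<T} \<Longrightarrow> x \<in> ball 0 R \<Longrightarrow> cmod (g0 t x) \<le> C0 * t powr d0 \<and> cmod (deriv (g0 t) x) \<le> C0 * t powr d0"
    and C0: "0 \<le> C0" "0 < d0"
    and cf0: "continuous_on ({0<..<T} \<times> ball 0 R) (\<lambda>(t,x). f0 t x)"
    and hf0: "\<And>t. t \<in> {0<..<T} \<Longrightarrow> f0 t holomorphic_on ball 0 R"
    and \<nu>: "\<nu> holomorphic_on ball 0 R" "\<And>x. x \<in> ball 0 R \<Longrightarrow> cmod (deriv \<nu> x) \<le> N" "\<And>x. x \<in> ball 0 R \<Longrightarrow> d1 \<le> Re (\<nu> x)" "0 < d1"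
    and V0: "V0 holomorphic_on ball 0 R" "\<And>x. x \<in> ball 0 R \<Longrightarrow> cmod (V0 x) < r/2" "\<And>x. x \<in> ball 0 R \<Longrightarrow> cmod (deriv V0 x) < r/2"
    and C3: "0 \<le> C3" "0 < d3"
begin

definition P :: txfun where "P t x = exp (\<nu> x * of_real (ln t))"
definition Z1 where "Z1 t x v = g0 t x + P t x * v"
definition Z2 where "Z2 t x v p = deriv (g0 t) x + P t x * (p + deriv \<nu> x * of_real (ln t) * v)"
text \<open>With u = g0 + P v, the equation for u becomes v' = ((\<lambda> - \<nu>)/t) v + G. The
  linear term \<lambda> P v is subtracted in \<open>G\<close> because the coefficient (\<lambda> -
  \<nu>)/t is not integrable and is treated by an integrating factor instead.\<close>

definition G :: rhs where
  "G t x v p = (F t x (Z1 t x v) (Z2 t x v p) - f0 t x - lam x * (P t x * v)) / (P t x * of_real t)"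

text \<open>The x-derivative of t^\<nu> v carries a factor log t; half of the exponent d1 is given
  up to absorb it.\<close>

definition d where "d = min d0 (d1/2)"
definition C1 where "C1 = C0 + r * (1 + 2 * N / d1)"
text \<open>The constant of \<open>weight_estimate\<close> for s = 4 Lz C1: four arguments of F
  enter the Lipschitz estimate, each of size at most C1 t^d.\<close>

definition C2 where "C2 = \<Lambda> + N * B + C\<beta> + 4 * Lz * C1 * (1 + 2 * N / d)"
text \<open>One rate must dominate both the Lipschitz rate C2 \<kappa> and the residual at (V0,
  V0'), which is at most (C2 r + C3) \<kappa>. Since t < 1, the smaller exponent gives the larger
  rate, hence the minimum.\<close>

definition k where "k = (\<lambda>t. (C2 + C3 + 1) * (2 * r + 1) * \<kappa> (min (d/2) d3) t)"

lemma N0: "0 \<le> N" using \<nu>(2)[of 0] R order_trans[OF norm_ge_zero] by auto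

lemma dC: "0 < d" "0 \<le> C1" "0 \<le> C2"
proof -
  show d: "0 < d" using C0 \<nu>(4) by (simp add: d_def)
  show C1: "0 \<le> C1" unfolding C1_def using C0 r N0 \<nu>(4) by (intro add_nonneg_nonneg mult_nonneg_nonneg) auto
  show "0 \<le> C2" unfolding C2_def using \<Lambda> N0 B C\<beta> Lz C1 d by (intro add_nonneg_nonneg mult_nonneg_nonneg) auto
qed

lemma Pnz: "P t x \<noteq> 0" by (simp add: P_def)

lemma P_bound: assumes "t \<in> {0<..<T}" "x \<in> ball 0 R" shows "cmod (P t x) \<le> t powr d1"
proof -
  have "cmod (P t x) = t powr Re (\<nu> x)" using assms(1) unfolding P_def by (intro norm_exp_ln) simp
  also have "\<dots> \<le> t powr d1" by (rule powr_le_powr) (use assms \<nu>(3)[of x] T T0 in auto)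
  finally show ?thesis .
qed

lemma P_ln_bound: assumes "t \<in> {0<..<T}" "x \<in> ball 0 R" "cmod v \<le> s" "cmod p \<le> s"
  shows "cmod (P t x * (p + deriv \<nu> x * of_real (ln t) * v)) \<le> s * (1 + 2 * N / d1) * t powr d"
    "cmod (P t x * v) \<le> s * t powr d"
proof -
  have t: "0 < t" "t < 1" using assms T T0 by auto
  have s: "0 \<le> s" using assms(3) norm_ge_zero order_trans by blast
  have td: "t powr d1 \<le> t powr d" "t powr (d1/2) \<le> t powr d" using t \<nu>(4) by (auto intro!: powr_le_powr simp: d_def)
  have "cmod (p + deriv \<nu> x * of_real (ln t) * v) \<le> s + N * \<bar>ln t\<bar> * s"
    using assms \<nu>(2)[of x] N0 s
    by (intro norm_triangle_mono) (auto simp: norm_mult intro!: mult_mono)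
  then have "cmod (P t x * (p + deriv \<nu> x * of_real (ln t) * v)) \<le> t powr d1 * (s + N * \<bar>ln t\<bar> * s)"
    unfolding norm_mult[of "P t x"] by (rule mult_mono[OF P_bound[OF assms(1,2)]]) auto
  also have "\<dots> = s * t powr d1 + s * N * (t powr d1 * \<bar>ln t\<bar>)" by (simp add: algebra_simps)
  also have "\<dots> \<le> s * t powr d + s * N * (2/d1 * t powr d)"
  proof (intro add_mono mult_left_mono)
    show "t powr d1 * \<bar>ln t\<bar> \<le> 2/d1 * t powr d"
    proof (rule order_trans[OF powr_ln_bound[OF t \<nu>(4)]], rule mult_left_mono[OF td(2)])
      show "0 \<le> 2 / d1" using \<nu>(4) by simp
    qed
  qed (use td s N0 in auto)
  finally show "cmod (P t x * (p + deriv \<nu> x * of_real (ln t) * v)) \<le> s * (1 + 2 * N / d1) * t powr d"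
    by (simp add: algebra_simps)
  have "cmod (P t x * v) \<le> t powr d1 * s"
    unfolding norm_mult by (rule mult_mono[OF P_bound[OF assms(1,2)] assms(3)]) auto
  also have "\<dots> \<le> s * t powr d" using td s by (simp add: mult.commute mult_left_mono)
  finally show "cmod (P t x * v) \<le> s * t powr d" .
qed

lemma Z_bound: assumes t: "t \<in> {0<..<T}" and x: "x \<in> ball 0 R" and v: "v \<in> ball 0 r" "p \<in> ball 0 r"
  shows "cmod (Z1 t x v) \<le> C1 * t powr d" "cmod (Z2 t x v p) \<le> C1 * t powr d"
proof -
  have td: "t powr d0 \<le> t powr d" using t T T0 by (intro powr_le_powr) (auto simp: d_def)
  have g: "cmod (g0 t x) \<le> C0 * t powr d" "cmod (deriv (g0 t) x) \<le> C0 * t powr d"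
    using bg0[OF t x] mult_left_mono[OF td C0(1)] by linarith+
  have vr: "cmod v \<le> r" "cmod p \<le> r" using v by auto
  have "cmod (Z1 t x v) \<le> C0 * t powr d + r * t powr d"
    unfolding Z1_def by (rule norm_triangle_mono[OF g(1) P_ln_bound(2)[OF t x vr]])
  also have "r * t powr d \<le> r * (1 + 2 * N / d1) * t powr d"
    using r N0 \<nu>(4) by (intro mult_right_mono) auto
  finally show "cmod (Z1 t x v) \<le> C1 * t powr d" by (simp add: C1_def algebra_simps)
  have "cmod (Z2 t x v p) \<le> C0 * t powr d + r * (1 + 2 * N / d1) * t powr d"
    unfolding Z2_def by (rule norm_triangle_mono[OF g(2) P_ln_bound(1)[OF t x vr]])
  then show "cmod (Z2 t x v p) \<le> C1 * t powr d" by (simp add: C1_def algebra_simps)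
qed

context
  fixes T1 assumes T1: "0 < T1" "T1 \<le> T" and small: "\<And>t. t \<in> {0<..<T1} \<Longrightarrow> C1 * t powr d < r1"
begin

lemma Z_ball: assumes "t \<in> {0<..<T1}" "x \<in> ball 0 R" "v \<in> ball 0 r" "p \<in> ball 0 r"
  shows "Z1 t x v \<in> ball 0 r1" "Z2 t x v p \<in> ball 0 r1"
  using Z_bound[of t x v p] small[of t] assms T1 by auto

text \<open>The factor P comes out of the differences of both arguments of F and cancels against the
  denominator of \<open>G\<close>; what remains is the left-hand side of
  \<open>weight_estimate\<close>.\<close>

lemma G_lipschitz:
  assumes t: "t \<in> {0<..<T1}" and x: "x \<in> ball 0 R" and v: "v \<in> ball 0 r" "p \<in> ball 0 r" "v' \<in> ball 0 r" "p' \<in> ball 0 r"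
  shows "cmod (G t x v p - G t x v' p') \<le> C2 * \<kappa> (min (d/2) d3) t * (cmod (v - v') + cmod (p - p'))"
proof -
  have tt: "t \<in> {0<..<T}" "t \<in> {0<..T0}" "0 < t" "t < 1" using t T1 T T0 by auto
  have x1: "x \<in> ball 0 R1" using x R by auto
  let ?z1 = "Z1 t x v" and ?z2 = "Z2 t x v p" and ?w1 = "Z1 t x v'" and ?w2 = "Z2 t x v' p'"
  define a where "a = cmod (v - v')"
  define b where "b = cmod (p - p')"
  define n where "n = cmod (P t x)"
  have n: "0 < n" using Pnz by (simp add: n_def)
  have ab: "0 \<le> a" "0 \<le> b" by (auto simp: a_def b_def)
  define \<sigma> where "\<sigma> = Lz * (cmod ?z1 + cmod ?z2 + cmod ?w1 + cmod ?w2)"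
  have z1: "?z1 - ?w1 = P t x * (v - v')" by (simp add: Z1_def algebra_simps)
  have z2: "?z2 - ?w2 = P t x * ((p - p') + deriv \<nu> x * of_real (ln t) * (v - v'))" by (simp add: Z2_def algebra_simps)
  have n1: "cmod (?z1 - ?w1) = n * a" by (simp add: z1 n_def a_def norm_mult)
  have "cmod ((p - p') + deriv \<nu> x * of_real (ln t) * (v - v')) \<le> b + N * \<bar>ln t\<bar> * a"
    unfolding a_def b_def using \<nu>(2)[OF x]
    by (intro norm_triangle_mono) (auto simp: norm_mult intro!: mult_right_mono)
  then have n2: "cmod (?z2 - ?w2) \<le> n * (b + N * \<bar>ln t\<bar> * a)" unfolding z2 n_def norm_mult by (intro mult_left_mono) auto
  have \<sigma>0: "0 \<le> \<sigma>" using Lz by (simp add: \<sigma>_def)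
  have \<sigma>: "\<sigma> \<le> 4 * Lz * C1 * t powr d"
  proof -
    have "cmod ?z1 + cmod ?z2 + cmod ?w1 + cmod ?w2 \<le> 4 * (C1 * t powr d)"
      using Z_bound[OF tt(1) x v(1,2)] Z_bound[OF tt(1) x v(3,4)] by linarith
    from mult_left_mono[OF this Lz] show ?thesis by (simp add: \<sigma>_def mult_ac)
  qed
  have s: "0 \<le> 4 * Lz * C1" using Lz dC by simp
  note \<beta>' = \<beta>(1)[OF tt(2)]
  have "cmod (F t x ?z1 ?z2 - F t x ?w1 ?w2 - lam x * (?z1 - ?w1)) \<le> (\<Lambda> * m t + \<sigma>) * cmod (?z1 - ?w1) + (\<beta> t + \<sigma>) * cmod (?z2 - ?w2)"
    unfolding \<sigma>_def by (rule F_diff[OF tt(2) x1 Z_ball[OF t x v(1,2)] Z_ball[OF t x v(3,4)]])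
  also have "\<dots> \<le> (\<Lambda> * m t + \<sigma>) * (n * a) + (\<beta> t + \<sigma>) * (n * (b + N * \<bar>ln t\<bar> * a))"
    unfolding n1 using n2 \<beta>' \<sigma>0 by (intro add_left_mono mult_left_mono) auto
  also have "\<dots> = n * ((\<Lambda> * m t + \<sigma>) * a + (\<beta> t + \<sigma>) * (b + N * \<bar>ln t\<bar> * a))"
    by (simp add: algebra_simps)
  finally have main: "cmod (F t x ?z1 ?z2 - F t x ?w1 ?w2 - lam x * (?z1 - ?w1)) \<le> n * ((\<Lambda> * m t + \<sigma>) * a + (\<beta> t + \<sigma>) * (b + N * \<bar>ln t\<bar> * a))" .
  have "G t x v p - G t x v' p' = (F t x ?z1 ?z2 - F t x ?w1 ?w2 - lam x * (?z1 - ?w1)) / (P t x * of_real t)"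
    unfolding z1 G_def by (simp add: diff_divide_distrib[symmetric] algebra_simps)
  then have "cmod (G t x v p - G t x v' p') = cmod (F t x ?z1 ?z2 - F t x ?w1 ?w2 - lam x * (?z1 - ?w1)) / (n * t)"
    using tt by (simp add: norm_divide norm_mult n_def)
  also have "\<dots> \<le> n * ((\<Lambda> * m t + \<sigma>) * a + (\<beta> t + \<sigma>) * (b + N * \<bar>ln t\<bar> * a)) / (n * t)"
    using main n tt by (intro divide_right_mono) auto
  also have "\<dots> = ((\<Lambda> * m t + \<sigma>) * a + (\<beta> t + \<sigma>) * (b + N * \<bar>ln t\<bar> * a)) / t" using n by (rule mult_divide_mult_cancel_left[OF less_imp_neq[THEN not_sym]])
  also have "\<dots> \<le> C2 * \<kappa> (d/2) t * (a + b)"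
    unfolding C2_def by (rule weight_estimate[OF tt(2) dC(1) \<sigma>0 \<sigma> s N0 ab])
  also have "\<dots> \<le> C2 * \<kappa> (min (d/2) d3) t * (a + b)"
    unfolding \<kappa>_def[of "d/2"] using ab dC tt by (intro mult_right_mono mult_left_mono m_t_kappa) auto
  finally show ?thesis by (simp add: a_def b_def)
qed

lemma P_ev: "evolves 0 T R P (\<lambda>t x. \<nu> x / of_real t * P t x)"
  using evolves_exp[OF \<nu>(1)] by (simp add: P_def[abs_def])

lemma G_continuous: "continuous_on ({0<..<T1} \<times> ball 0 R \<times> ball 0 r \<times> ball 0 r) (\<lambda>(t,x,v,p). G t x v p)"
proof -
  let ?D = "{0<..<T1} \<times> ball (0::complex) R \<times> ball (0::complex) r \<times> ball (0::complex) r"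
  have sub: "(fst q, fst (snd q)) \<in> {0<..<T} \<times> ball 0 R" if "q \<in> ?D" for q using that T1 by auto
  have lift: "continuous_on ?D (\<lambda>q. h (fst q) (fst (snd q)))" if "continuous_on ({0<..<T} \<times> ball 0 R) (\<lambda>(t,x). h t x)" for h :: txfun
  proof -
    have "continuous_on ?D (\<lambda>q. case (fst q, fst (snd q)) of (t,x) \<Rightarrow> h t x)"
      by (rule continuous_on_compose2[OF that]) (use sub in \<open>auto intro!: continuous_intros\<close>)
    then show ?thesis by simp
  qed
  have liftx: "continuous_on ?D (\<lambda>q. h (fst (snd q)))" if "h holomorphic_on ball 0 R" for h :: "complex \<Rightarrow> complex"
    by (rule continuous_on_compose2[OF holomorphic_on_imp_continuous_on[OF that]]) (auto intro!: continuous_intros)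
  have cP: "continuous_on ?D (\<lambda>q. P (fst q) (fst (snd q)))" by (rule lift) (use P_ev in \<open>simp add: evolves_def\<close>)
  have cg: "continuous_on ?D (\<lambda>q. g0 (fst q) (fst (snd q)))" by (rule lift[OF cg0])
  have cdg: "continuous_on ?D (\<lambda>q. deriv (g0 (fst q)) (fst (snd q)))"
    by (rule lift[OF continuous_on_deriv_param[OF open_ball cg0 hg0]])
  have cf: "continuous_on ?D (\<lambda>q. f0 (fst q) (fst (snd q)))" by (rule lift[OF cf0])
  have cl: "continuous_on ?D (\<lambda>q. lam (fst (snd q)))" by (rule liftx, rule holomorphic_on_subset[OF lam_hol]) (use R in auto)
  have cdn: "continuous_on ?D (\<lambda>q. deriv \<nu> (fst (snd q)))" by (rule liftx, rule holomorphic_deriv[OF \<nu>(1) open_ball])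
  have cln: "continuous_on ?D (\<lambda>q. complex_of_real (ln (fst q)))" by (intro continuous_intros) auto
  have cZ1: "continuous_on ?D (\<lambda>q. Z1 (fst q) (fst (snd q)) (fst (snd (snd q))))"
    unfolding Z1_def by (intro continuous_intros cg cP)
  have cZ2: "continuous_on ?D (\<lambda>q. Z2 (fst q) (fst (snd q)) (fst (snd (snd q))) (snd (snd (snd q))))"
    unfolding Z2_def by (intro continuous_intros cdg cP cdn cln)
  have "continuous_on ?D (\<lambda>q. (\<lambda>(t,x,z1,z2). F t x z1 z2) (fst q, fst (snd q), Z1 (fst q) (fst (snd q)) (fst (snd (snd q))), Z2 (fst q) (fst (snd q)) (fst (snd (snd q))) (snd (snd (snd q)))))"
  proof (rule continuous_on_compose2[OF A1_cont])
    show "continuous_on ?D (\<lambda>q. (fst q, fst (snd q), Z1 (fst q) (fst (snd q)) (fst (snd (snd q))), Z2 (fst q) (fst (snd q)) (fst (snd (snd q))) (snd (snd (snd q)))))"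
      by (intro continuous_intros cZ1 cZ2)
    show "(\<lambda>q. (fst q, fst (snd q), Z1 (fst q) (fst (snd q)) (fst (snd (snd q))), Z2 (fst q) (fst (snd q)) (fst (snd (snd q))) (snd (snd (snd q))))) ` ?D \<subseteq> Omega T0 R0 \<rho>0"
    proof (rule image_subsetI)
      fix q assume "q \<in> ?D"
      then have q: "fst q \<in> {0<..<T1}" "fst (snd q) \<in> ball 0 R" "fst (snd (snd q)) \<in> ball 0 r" "snd (snd (snd q)) \<in> ball 0 r" by auto
      show "(fst q, fst (snd q), Z1 (fst q) (fst (snd q)) (fst (snd (snd q))), Z2 (fst q) (fst (snd q)) (fst (snd (snd q))) (snd (snd (snd q)))) \<in> Omega T0 R0 \<rho>0"
        using Z_ball[OF q] q T1 T R pos by (auto simp: Omega_def)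
    qed
  qed
  then have cF: "continuous_on ?D (\<lambda>q. F (fst q) (fst (snd q)) (Z1 (fst q) (fst (snd q)) (fst (snd (snd q)))) (Z2 (fst q) (fst (snd q)) (fst (snd (snd q))) (snd (snd (snd q)))))"
    by simp
  have "continuous_on ?D (\<lambda>q. G (fst q) (fst (snd q)) (fst (snd (snd q))) (snd (snd (snd q))))"
    unfolding G_def by (intro continuous_intros cF cf cl cP) (auto simp: Pnz)
  then show ?thesis by (simp add: split_beta')
qed

lemma G_holomorphic:
  assumes t: "t \<in> {0<..<T1}" and S: "open S" "S \<subseteq> ball 0 R" and f: "f holomorphic_on S" "g holomorphic_on S"
    and fr: "\<And>x. x \<in> S \<Longrightarrow> f x \<in> ball 0 r" "\<And>x. x \<in> S \<Longrightarrow> g x \<in> ball 0 r"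
  shows "(\<lambda>x. G t x (f x) (g x)) holomorphic_on S"
proof -
  have tT: "t \<in> {0<..<T}" "t \<in> {0..T0}" using t T1 T by auto
  have hS: "h holomorphic_on S" if "h holomorphic_on ball 0 R" for h
    by (rule holomorphic_on_subset[OF that S(2)])
  have hP: "P t holomorphic_on S" using P_ev tT by (intro hS) (auto simp: evolves_def)
  have hl: "lam holomorphic_on S" by (rule hS, rule holomorphic_on_subset[OF lam_hol]) (use R in auto)
  have h1: "(\<lambda>x. Z1 t x (f x)) holomorphic_on S"
    unfolding Z1_def by (intro holomorphic_intros hP f hS[OF hg0[OF tT(1)]])
  have h2: "(\<lambda>x. Z2 t x (f x) (g x)) holomorphic_on S"
    unfolding Z2_def
    by (intro holomorphic_intros hP f hS[OF holomorphic_deriv[OF hg0[OF tT(1)] open_ball]] hS[OF holomorphic_deriv[OF \<nu>(1) open_ball]])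
  have "(\<lambda>x. F t x (Z1 t x (f x)) (Z2 t x (f x) (g x))) holomorphic_on S"
  proof (rule F_hol[OF tT(2) S(1) _ h1 h2])
    fix x assume x: "x \<in> S"
    then have xR: "x \<in> ball 0 R" using S by auto
    then show "x \<in> ball 0 R0" using R pos by auto
    show "Z1 t x (f x) \<in> ball 0 \<rho>0" "Z2 t x (f x) (g x) \<in> ball 0 \<rho>0"
      using Z_ball[OF t xR fr[OF x]] pos by auto
  qed (rule holomorphic_on_ident)
  then show ?thesis
    unfolding G_def using t by (intro holomorphic_intros hP hl f hS[OF hf0[OF tT(1)]]) (auto simp: Pnz)
qed

end

lemma k: "continuous_on {0<..T0} k" "t \<in> {0<..T0} \<Longrightarrow> 0 \<le> k t" "k integrable_on {0..T0}"
proof -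
  have dd: "0 < min (d/2) d3" using dC C3 by auto
  show "continuous_on {0<..T0} k" unfolding k_def by (intro continuous_intros \<kappa>(1) dd)
  show "t \<in> {0<..T0} \<Longrightarrow> 0 \<le> k t"
    unfolding k_def using \<kappa>(2)[OF dd, of t] dC C3 r by (intro mult_nonneg_nonneg) auto
  show "k integrable_on {0..T0}" unfolding k_def by (intro integrable_on_mult_right \<kappa>(3) dd)
qed

text \<open>The integrating factor is e = t^(\<lambda> - \<nu>), whose modulus is monotone in t by
  \<open>sign\<close>. If Re (\<lambda> - \<nu>) \<le> 0, integration starts at t = 0 and v tends to
  V0 there. Otherwise time is reversed and V0 becomes the value prescribed at the positive time T1;
  then no limit at 0 is asserted. The hypothesis \<open>comp\<close> covers the two uses, V0 = 0 and
  \<nu> = \<lambda>.\<close>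

lemma picard_exists:
  assumes sign: "(\<forall>x\<in>ball 0 R. Re (lam x - \<nu> x) \<le> 0) \<or> (\<forall>x\<in>ball 0 R. 0 \<le> Re (lam x - \<nu> x))"
    and comp: "\<And>x. x \<in> ball 0 R \<Longrightarrow> (lam x - \<nu> x) * V0 x = 0"
    and G0: "\<And>t x. t \<in> {0<..<T} \<Longrightarrow> x \<in> ball 0 R \<Longrightarrow> cmod (G t x 0 0) \<le> C3 * \<kappa> d3 t"
  obtains T1 v where "0 < T1" "T1 \<le> T"
    "evolves 0 T1 (R/4) v (\<lambda>t x. (lam x - \<nu> x) / of_real t * v t x + G t x (v t x) (deriv (v t) x))"
    "\<And>t x. t \<in> {0<..<T1} \<Longrightarrow> x \<in> ball 0 (R/4) \<Longrightarrow> v t x \<in> ball 0 r \<and> deriv (v t) x \<in> ball 0 r"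
    "\<And>t. t \<in> {0<..<T1} \<Longrightarrow> C1 * t powr d < r1"
    "(\<forall>x\<in>ball 0 R. Re (lam x - \<nu> x) \<le> 0) \<Longrightarrow> uniform_limit (ball 0 (R/4)) v V0 (at_right 0)"
proof -
  \<comment> \<open>The three smallness conditions of \<open>singular_picard\<close>, solved for the
    integral of k.\<close>
  define \<eta> where "\<eta> = min (R / (32 * (R + 4))) (min (r / 16) (r * R / 256))"
  have \<eta>: "0 < \<eta>" using R r by (simp add: \<eta>_def)
  have "\<forall>\<^sub>F t in at_right 0. C1 * t powr d < r1"
  proof -
    have "((\<lambda>t. C1 * t powr d) \<longlongrightarrow> C1 * 0 powr d) (at_right 0)"
      using dC by (intro tendsto_intros) (auto simp: eventually_at_right_field intro: exI[of _ 1])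
    then show ?thesis using pos by (intro order_tendstoD(2)) auto
  qed
  then obtain b1 where b1: "0 < b1" "\<And>t. 0 < t \<Longrightarrow> t < b1 \<Longrightarrow> C1 * t powr d < r1"
    by (auto simp: eventually_at_right_field)
  have "\<forall>\<^sub>F t in at_right 0. t < b1 \<and> t < T"
    using b1 T by (auto simp: eventually_at_right_field intro!: exI[of _ "min b1 T"])
  moreover have "\<forall>\<^sub>F t in at_right 0. integral {0..t} k < \<eta>"
    using \<kappa>_small[of "min (d/2) d3" \<eta> "(C2 + C3 + 1) * (2 * r + 1)"] dC C3 \<eta> by (simp add: k_def)
  ultimately have "\<forall>\<^sub>F t in at_right 0. 0 < t \<and> (t < b1 \<and> t < T) \<and> integral {0..t} k < \<eta>"
    using eventually_at_right_less[of 0] by eventually_elim simp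
  then obtain T1 where T1: "0 < T1" "T1 < b1" "T1 < T" "integral {0..T1} k < \<eta>"
    using eventually_happens'[OF trivial_limit_at_right_real[of 0]] by blast
  have small: "C1 * t powr d < r1" if "t \<in> {0<..<T1}" for t using b1(2) that T1 by auto
  have T1': "0 < T1" "T1 \<le> T" using T1 by auto
  have i1: "integral {0..T1} k \<le> R / (32 * (R + 4))" and i2: "integral {0..T1} k \<le> r / 16" and i3: "integral {0..T1} k \<le> r * R / 256"
    using T1(4) by (auto simp: \<eta>_def)
  have s1: "8 * (R + 4) * integral {0..T1} k \<le> R / 4"
  proof -
    have "8 * (R + 4) * integral {0..T1} k \<le> 8 * (R + 4) * (R / (32 * (R + 4)))"
      using i1 R by (intro mult_left_mono) auto
    also have "\<dots> = R / 4" using R by (simp add: field_simps)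
    finally show ?thesis .
  qed
  have s2: "16 * integral {0..T1} k \<le> r" using i2 by linarith
  have s3: "256 * integral {0..T1} k \<le> r * R" using i3 by linarith
  have sub: "{0<..<T1} \<subseteq> {0<..T0}" using T1 T by auto
  have ck: "continuous_on {0<..<T1} k" by (rule continuous_on_subset[OF k(1) sub])
  have k0: "0 \<le> k t" if "t \<in> {0<..<T1}" for t using k(2) that sub by blast
  have ik: "k integrable_on {0..T1}" by (rule integrable_on_subinterval[OF k(3)]) (use T1 T in auto)
  let ?\<kappa> = "\<kappa> (min (d/2) d3)"
  have lip: "cmod (G t x v p - G t x v' p') \<le> k t * (cmod (v - v') + cmod (p - p'))"
    if t: "t \<in> {0<..<T1}" and x: "x \<in> ball 0 R" and v: "v \<in> ball 0 r" "p \<in> ball 0 r" "v' \<in> ball 0 r" "p' \<in> ball 0 r" for t x v p v' p'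
  proof -
    have kt: "0 < ?\<kappa> t" using \<kappa>(2)[of "min (d/2) d3" t] dC C3 t sub by auto
    have "C2 * 1 * ?\<kappa> t \<le> (C2 + C3 + 1) * (2 * r + 1) * ?\<kappa> t"
      using dC C3 r kt by (intro mult_right_mono mult_mono) auto
    then have "C2 * ?\<kappa> t \<le> k t" by (simp add: k_def)
    then show ?thesis
      using order_trans[OF G_lipschitz[OF T1' small t x v] mult_right_mono] by fastforce
  qed
  have Gb: "cmod (G t x (V0 x) (deriv V0 x)) \<le> k t" if t: "t \<in> {0<..<T1}" and x: "x \<in> ball 0 R" for t x
  proof -
    have kt: "0 < ?\<kappa> t" using \<kappa>(2)[of "min (d/2) d3" t] dC C3 t sub by auto
    have vb: "V0 x \<in> ball 0 r" "deriv V0 x \<in> ball 0 r" "(0::complex) \<in> ball 0 r" using V0(2,3)[OF x] r by auto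
    have "cmod (G t x (V0 x) (deriv V0 x) - G t x 0 0) \<le> C2 * ?\<kappa> t * (cmod (V0 x - 0) + cmod (deriv V0 x - 0))"
      by (rule G_lipschitz[OF T1' small t x vb(1,2,3,3)])
    also have "\<dots> \<le> C2 * ?\<kappa> t * r"
      using V0(2,3)[OF x] dC kt by (intro mult_left_mono) auto
    finally have 1: "cmod (G t x (V0 x) (deriv V0 x) - G t x 0 0) \<le> C2 * ?\<kappa> t * r" .
    have tt: "0 < t" "t < 1" "t \<in> {0<..<T}" using t T1 T T0 by auto
    have "\<kappa> d3 t \<le> ?\<kappa> t" using tt powr_le_powr[of t "min (d/2) d3" d3] by (simp add: \<kappa>_def divide_right_mono)
    then have 2: "cmod (G t x 0 0) \<le> C3 * ?\<kappa> t" using G0[OF tt(3) x] mult_left_mono[OF _ C3(1)] by (meson order_trans)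
    have "cmod (G t x (V0 x) (deriv V0 x)) \<le> C2 * ?\<kappa> t * r + C3 * ?\<kappa> t"
      using 1 2 norm_triangle_sub[of "G t x (V0 x) (deriv V0 x)" "G t x 0 0"] by linarith
    also have "\<dots> = (C2 * r + C3) * ?\<kappa> t" by (simp add: algebra_simps)
    also have "\<dots> \<le> (C2 + C3 + 1) * (2 * r + 1) * ?\<kappa> t"
    proof (rule mult_right_mono)
      have "0 \<le> C2 * r" "0 \<le> C3 * r" using dC C3 r by auto
      then show "C2 * r + C3 \<le> (C2 + C3 + 1) * (2 * r + 1)" using dC C3 r by (simp add: algebra_simps)
    qed (use kt in simp)
    finally show ?thesis by (simp add: k_def)
  qed
  define \<gamma> where "\<gamma> = (\<lambda>x. lam x - \<nu> x)"
  have \<gamma>: "\<gamma> holomorphic_on ball 0 R" unfolding \<gamma>_def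
    by (intro holomorphic_intros \<nu>(1) holomorphic_on_subset[OF lam_hol]) (use R in auto)
  define e where "e = (\<lambda>t x. exp (\<gamma> x * of_real (ln t)))"
  define e' where "e' = (\<lambda>t x. \<gamma> x / of_real t * e t x)"
  have ee: "evolves 0 T1 R e e'" using evolves_exp[OF \<gamma>] by (simp add: e_def e'_def)
  have e0: "e t x \<noteq> 0" for t x by (simp add: e_def)
  have ne: "cmod (e t x) = t powr Re (\<gamma> x)" if "0 < t" for t x unfolding e_def by (rule norm_exp_ln[OF that])
  have q: "e' t x / e t x = \<gamma> x / of_real t" for t x by (simp add: e'_def e0)
  \<comment> \<open>The integral equation damps v - V0, the differential equation for v contains the
    same coefficient times v; by \<open>comp\<close> the two agree.\<close>
  have \<gamma>V: "\<gamma> x * (z - V0 x) = \<gamma> x * z" if "x \<in> ball 0 R" for x z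
    using comp[OF that] by (simp only: \<gamma>_def right_diff_distrib[of "lam x - \<nu> x"] diff_zero)
  have R4: "ball (0::complex) (R/4) \<subseteq> ball 0 R" using R by auto
  have Gcont: "continuous_on ({0<..<T1} \<times> ball 0 R \<times> ball 0 r \<times> ball 0 r) (\<lambda>(t,x,v,p). G t x v p)"
    by (rule G_continuous[OF T1' small])
  have Ghol: "(\<lambda>x. G t x (f x) (g x)) holomorphic_on S"
    if "t \<in> {0<..<T1}" "open S" "S \<subseteq> ball 0 R" "f holomorphic_on S" "g holomorphic_on S"
      "\<And>x. x \<in> S \<Longrightarrow> f x \<in> ball 0 r" "\<And>x. x \<in> S \<Longrightarrow> g x \<in> ball 0 r" for t S f g
    by (rule G_holomorphic[OF T1' small that])
  show ?thesis
  proof (cases "\<forall>x\<in>ball 0 R. Re (lam x - \<nu> x) \<le> 0")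
    case True
    interpret singular_picard T1 R r k G e e' V0
    proof
      show "cmod (e t x) \<le> cmod (e s x)" if "0 < s" "s \<le> t" "t < T1" "x \<in> ball 0 R" for s t x
        using that True ne[of s x] ne[of t x] powr_mono2'[of "Re (\<gamma> x)" s t] by (simp add: \<gamma>_def)
      show "e t x \<noteq> 0" for t x by (rule e0)
    qed (fact T1(1) R(1) r ck k0 ik ee V0 Gcont Ghol lip Gb s1 s2 s3)+
    obtain v where v: "evolves 0 T1 (R/4) v (\<lambda>t x. e' t x / e t x * (v t x - V0 x) + G t x (v t x) (deriv (v t) x))"
      "\<forall>t\<in>{0<..<T1}. \<forall>x\<in>ball 0 (R/4). v t x \<in> ball 0 r \<and> deriv (v t) x \<in> ball 0 r \<and>
        cmod (v t x - V0 x) \<le> (1 + r) * integral {0..t} k"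
      using solution_exists by (elim exE conjE)
    show ?thesis
    proof (rule that[OF T1' _ _ small])
      show "evolves 0 T1 (R/4) v (\<lambda>t x. (lam x - \<nu> x) / of_real t * v t x + G t x (v t x) (deriv (v t) x))"
      proof (rule evolves_cong[OF v(1)])
        fix t and x :: complex assume "t \<in> {0<..<T1}" "x \<in> ball 0 (R/4)"
        then show "e' t x / e t x * (v t x - V0 x) + G t x (v t x) (deriv (v t) x) = (lam x - \<nu> x) / of_real t * v t x + G t x (v t x) (deriv (v t) x)"
          using \<gamma>V[of x "v t x"] R4 by (auto simp: q \<gamma>_def)
      qed
      show "uniform_limit (ball 0 (R/4)) v V0 (at_right 0)"
      proof (rule uniform_limitI)
        fix \<epsilon> :: real assume "0 < \<epsilon>"
        have "((\<lambda>t. (1 + r) * integral {0..t} k) \<longlongrightarrow> (1 + r) * 0) (at_right 0)"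
          by (intro tendsto_mult tendsto_const integral_tendsto_0[OF ik T1(1)])
        then have "\<forall>\<^sub>F t in at_right 0. (1 + r) * integral {0..t} k < \<epsilon>" using \<open>0 < \<epsilon>\<close> by (intro order_tendstoD(2)) auto
        moreover have "\<forall>\<^sub>F t in at_right 0. t < T1" using T1 by (auto simp: eventually_at_right_field)
        ultimately show "\<forall>\<^sub>F t in at_right 0. \<forall>x\<in>ball 0 (R/4). dist (v t x) (V0 x) < \<epsilon>"
          using eventually_at_right_less[of 0]
        proof eventually_elim
          case (elim t)
          then have t: "t \<in> {0<..<T1}" by simp
          show ?case unfolding dist_norm
          proof
            fix x :: complex assume "x \<in> ball 0 (R/4)"
            then have "cmod (v t x - V0 x) \<le> (1 + r) * integral {0..t} k" using v(2) t by blast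
            then show "cmod (v t x - V0 x) < \<epsilon>" using elim(1) by linarith
          qed
        qed
      qed
      show "v t x \<in> ball 0 r \<and> deriv (v t) x \<in> ball 0 r" if "t \<in> {0<..<T1}" "x \<in> ball 0 (R/4)" for t x
        using v(2) that by blast
    qed
  next
    case False
    then have s: "\<forall>x\<in>ball 0 R. 0 \<le> Re (lam x - \<nu> x)" using sign by blast
    have flip: "(\<lambda>t. k (T1 - t)) integrable_on {0..T1} \<and> integral {0..T1} (\<lambda>t. k (T1 - t)) = integral {0..T1} k"
    proof -
      have "((\<lambda>t. k (- t)) has_integral integral {0..T1} k) {-T1..0}"
        using has_integral_reflect_real[of k "integral {0..T1} k" T1 0] integrable_integral[OF ik] by simp
      from has_integral_shift_real_ivl[OF this, of "-T1"]
      have "((\<lambda>t. k (T1 - t)) has_integral integral {0..T1} k) {0..T1}" by simp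
      then show ?thesis by (auto simp: integral_unique)
    qed
    \<comment> \<open>In the time T1 - t the modulus of the integrating factor is again
      nonincreasing, and the integral of the rate over (0,T1) is unchanged, so the same smallness
      conditions apply.\<close>
    interpret singular_picard T1 R r "\<lambda>t. k (T1 - t)" "\<lambda>t x v p. - G (T1 - t) x v p" "\<lambda>t. e (T1 - t)" "\<lambda>t x. - e' (T1 - t) x" V0
    proof
      show "continuous_on {0<..<T1} (\<lambda>t. k (T1 - t))"
        by (rule continuous_on_compose2[OF ck]) (auto intro!: continuous_intros)
      show "cmod (e (T1 - t) x) \<le> cmod (e (T1 - s) x)" if "0 < s" "s \<le> t" "t < T1" "x \<in> ball 0 R" for s t x
        using that s ne[of "T1 - s" x] ne[of "T1 - t" x] powr_mono2[of "Re (\<gamma> x)" "T1 - t" "T1 - s"] by (simp add: \<gamma>_def)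
      have "continuous_on ({0<..<T1} \<times> ball 0 R \<times> ball 0 r \<times> ball 0 r) (\<lambda>q. - (case (T1 - fst q, snd q) of (t,x,v,p) \<Rightarrow> G t x v p))"
        by (intro continuous_on_minus continuous_on_compose2[OF Gcont] continuous_intros) auto
      then show "continuous_on ({0<..<T1} \<times> ball 0 R \<times> ball 0 r \<times> ball 0 r) (\<lambda>(t, x, v, p). - G (T1 - t) x v p)"
        by (simp add: split_beta')
      show "cmod (- G (T1 - t) x v p - - G (T1 - t) x v' p') \<le> k (T1 - t) * (cmod (v - v') + cmod (p - p'))"
        if "t \<in> {0<..<T1}" "x \<in> ball 0 R" "v \<in> ball 0 r" "p \<in> ball 0 r" "v' \<in> ball 0 r" "p' \<in> ball 0 r" for t x v p v' p'
        using lip[of "T1 - t" x v p v' p'] that by (simp add: norm_minus_commute)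
      show "(\<lambda>x. - G (T1 - t) x (f x) (g x)) holomorphic_on S"
        if "t \<in> {0<..<T1}" "open S" "S \<subseteq> ball 0 R" "f holomorphic_on S" "g holomorphic_on S"
          "\<And>x. x \<in> S \<Longrightarrow> f x \<in> ball 0 r" "\<And>x. x \<in> S \<Longrightarrow> g x \<in> ball 0 r" for t S f g
        by (rule holomorphic_on_minus, rule Ghol[OF _ that(2-7)]) (use that(1) in simp)
      show "0 \<le> k (T1 - t)" if "t \<in> {0<..<T1}" for t by (rule k0) (use that in simp)
      show "(\<lambda>t. k (T1 - t)) integrable_on {0..T1}" using flip by blast
      show "evolves 0 T1 R (\<lambda>t. e (T1 - t)) (\<lambda>t x. - e' (T1 - t) x)" by (rule evolves_flip[OF ee])
      show "e (T1 - t) x \<noteq> 0" for t x by (rule e0)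
      show "cmod (- G (T1 - t) x (V0 x) (deriv V0 x)) \<le> k (T1 - t)" if "t \<in> {0<..<T1}" "x \<in> ball 0 R" for t x
        using Gb[of "T1 - t" x] that by simp
      show "8 * (R + 4) * integral {0..T1} (\<lambda>t. k (T1 - t)) \<le> R / 4" "16 * integral {0..T1} (\<lambda>t. k (T1 - t)) \<le> r"
        "256 * integral {0..T1} (\<lambda>t. k (T1 - t)) \<le> r * R"
        using s1 s2 s3 by (simp_all only: flip)
    qed (fact T1(1) R(1) r V0)+
    obtain v where v: "evolves 0 T1 (R/4) v (\<lambda>t x. - e' (T1 - t) x / e (T1 - t) x * (v t x - V0 x) + - G (T1 - t) x (v t x) (deriv (v t) x))"
      "\<forall>t\<in>{0<..<T1}. \<forall>x\<in>ball 0 (R/4). v t x \<in> ball 0 r \<and> deriv (v t) x \<in> ball 0 r \<and>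
        cmod (v t x - V0 x) \<le> (1 + r) * integral {0..t} (\<lambda>t. k (T1 - t))"
      using solution_exists by (elim exE conjE)
    show ?thesis
    proof (rule that[OF T1' _ _ small, of "\<lambda>t. v (T1 - t)"])
      show "evolves 0 T1 (R/4) (\<lambda>t. v (T1 - t)) (\<lambda>t x. (lam x - \<nu> x) / of_real t * v (T1 - t) x + G t x (v (T1 - t) x) (deriv (v (T1 - t)) x))"
      proof (rule evolves_cong[OF evolves_flip[OF v(1)]])
        fix t and x :: complex assume "t \<in> {0<..<T1}" "x \<in> ball 0 (R/4)"
        then show "- (- e' (T1 - (T1 - t)) x / e (T1 - (T1 - t)) x * (v (T1 - t) x - V0 x) + - G (T1 - (T1 - t)) x (v (T1 - t) x) (deriv (v (T1 - t)) x))
          = (lam x - \<nu> x) / of_real t * v (T1 - t) x + G t x (v (T1 - t) x) (deriv (v (T1 - t)) x)"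
          using \<gamma>V[of x "v (T1 - t) x"] R4 q[of t x] by (auto simp: \<gamma>_def)
      qed
      show "v (T1 - t) x \<in> ball 0 r \<and> deriv (v (T1 - t)) x \<in> ball 0 r" if "t \<in> {0<..<T1}" "x \<in> ball 0 (R/4)" for t x
      proof -
        have "T1 - t \<in> {0<..<T1}" using that by simp
        then show ?thesis using v(2) that(2) by blast
      qed
      show "uniform_limit (ball 0 (R/4)) (\<lambda>t. v (T1 - t)) V0 (at_right 0)" if "\<forall>x\<in>ball 0 R. Re (lam x - \<nu> x) \<le> 0"
        using False that by contradiction
    qed
  qed
qed

text \<open>Two bounds on w are kept: the sharp exponent d1 for w itself, and the common exponent
  \<open>d\<close>, reduced by the logarithm, for w together with its x-derivative.\<close>

lemma perturbation_exists:
  assumes sign: "(\<forall>x\<in>ball 0 R. Re (lam x - \<nu> x) \<le> 0) \<or> (\<forall>x\<in>ball 0 R. 0 \<le> Re (lam x - \<nu> x))"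
    and comp: "\<And>x. x \<in> ball 0 R \<Longrightarrow> (lam x - \<nu> x) * V0 x = 0"
    and G0: "\<And>t x. t \<in> {0<..<T} \<Longrightarrow> x \<in> ball 0 R \<Longrightarrow> cmod (G t x 0 0) \<le> C3 * \<kappa> d3 t"
  shows "\<exists>T1 v w C. 0 < T1 \<and> T1 \<le> T \<and> w = (\<lambda>t x. P t x * v t x) \<and>
    evolves 0 T1 (R/4) w (\<lambda>t x. (F t x (g0 t x + w t x) (deriv (g0 t) x + deriv (w t) x) - f0 t x) / of_real t) \<and>
    (\<forall>t\<in>{0<..<T1}. \<forall>x\<in>ball 0 (R/4). g0 t x + w t x \<in> ball 0 r1 \<and> deriv (g0 t) x + deriv (w t) x \<in> ball 0 r1) \<and>
    (\<forall>t\<in>{0<..<T1}. \<forall>x\<in>ball 0 (R/4). cmod (w t x) \<le> r * t powr d1) \<and>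
    (\<forall>t\<in>{0<..<T1}. \<forall>x\<in>ball 0 (R/4). cmod (w t x) \<le> C * t powr d \<and> cmod (deriv (w t) x) \<le> C * t powr d) \<and>
    ((\<forall>x\<in>ball 0 R. Re (lam x - \<nu> x) \<le> 0) \<longrightarrow> uniform_limit (ball 0 (R/4)) v V0 (at_right 0))"
proof -
  obtain T1 v where T1: "0 < T1" "T1 \<le> T"
    and ev: "evolves 0 T1 (R/4) v (\<lambda>t x. (lam x - \<nu> x) / of_real t * v t x + G t x (v t x) (deriv (v t) x))"
    and vb: "\<And>t x. t \<in> {0<..<T1} \<Longrightarrow> x \<in> ball 0 (R/4) \<Longrightarrow> v t x \<in> ball 0 r \<and> deriv (v t) x \<in> ball 0 r"
    and small: "\<And>t. t \<in> {0<..<T1} \<Longrightarrow> C1 * t powr d < r1"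
    and ul: "(\<forall>x\<in>ball 0 R. Re (lam x - \<nu> x) \<le> 0) \<Longrightarrow> uniform_limit (ball 0 (R/4)) v V0 (at_right 0)"
    using picard_exists[OF sign comp G0] by blast
  define w where "w = (\<lambda>t x. P t x * v t x)"
  have R4: "ball (0::complex) (R/4) \<subseteq> ball 0 R" using R by auto
  have dw: "deriv (w t) x = P t x * (deriv (v t) x + deriv \<nu> x * of_real (ln t) * v t x)"
    if t: "t \<in> {0<..<T1}" and x: "x \<in> ball 0 (R/4)" for t x
  proof -
    have xR: "x \<in> ball 0 R" using x R4 by auto
    have "(v t has_field_derivative deriv (v t) x) (at x)"
      using ev t by (intro holomorphic_derivI[OF _ open_ball x]) (auto simp: evolves_def)
    moreover have "(\<nu> has_field_derivative deriv \<nu> x) (at x)" by (rule holomorphic_derivI[OF \<nu>(1) open_ball xR])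
    ultimately have "(w t has_field_derivative P t x * (deriv (v t) x + deriv \<nu> x * of_real (ln t) * v t x)) (at x)"
      unfolding w_def P_def by (auto intro!: derivative_eq_intros simp: algebra_simps)
    then show ?thesis by (rule DERIV_imp_deriv)
  qed
  have Z: "g0 t x + w t x = Z1 t x (v t x)" "deriv (g0 t) x + deriv (w t) x = Z2 t x (v t x) (deriv (v t) x)"
    if "t \<in> {0<..<T1}" "x \<in> ball 0 (R/4)" for t x
    using dw[OF that] by (auto simp: Z1_def Z2_def w_def)
  have evP: "evolves 0 T1 (R/4) P (\<lambda>t x. \<nu> x / of_real t * P t x)"
    by (rule evolves_subset[OF P_ev[OF T1 small]]) (use T1 R in auto)
  have "evolves 0 T1 (R/4) w (\<lambda>t x. (F t x (g0 t x + w t x) (deriv (g0 t) x + deriv (w t) x) - f0 t x) / of_real t)"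
  proof (rule evolves_cong[OF evolves_mult[OF evP ev, folded w_def]])
    fix t and x :: complex assume tx: "t \<in> {0<..<T1}" "x \<in> ball 0 (R/4)"
    have t0: "of_real t \<noteq> (0::complex)" using tx by auto
    show "\<nu> x / of_real t * P t x * v t x + P t x * ((lam x - \<nu> x) / of_real t * v t x + G t x (v t x) (deriv (v t) x))
      = (F t x (g0 t x + w t x) (deriv (g0 t) x + deriv (w t) x) - f0 t x) / of_real t"
      unfolding Z[OF tx] G_def using t0 Pnz[of t x] by (simp add: field_simps)
  qed
  moreover have "g0 t x + w t x \<in> ball 0 r1 \<and> deriv (g0 t) x + deriv (w t) x \<in> ball 0 r1" if tx: "t \<in> {0<..<T1}" "x \<in> ball 0 (R/4)" for t x
    unfolding Z[OF tx] using Z_ball[OF T1 small tx(1), of x "v t x" "deriv (v t) x"] vb[OF tx] R4 tx(2) by auto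
  moreover have "cmod (w t x) \<le> r * t powr d1" if tx: "t \<in> {0<..<T1}" "x \<in> ball 0 (R/4)" for t x
  proof -
    have "cmod (P t x) * cmod (v t x) \<le> t powr d1 * r"
      using vb[OF tx] tx T1 R4 by (intro mult_mono P_bound) auto
    then show ?thesis by (simp add: w_def norm_mult mult.commute)
  qed
  moreover have "cmod (w t x) \<le> r * (1 + 2 * N / d1) * t powr d \<and> cmod (deriv (w t) x) \<le> r * (1 + 2 * N / d1) * t powr d"
    if tx: "t \<in> {0<..<T1}" "x \<in> ball 0 (R/4)" for t x
  proof -
    have tT: "t \<in> {0<..<T}" "x \<in> ball 0 R" using tx T1 R4 by auto
    have vr: "cmod (v t x) \<le> r" "cmod (deriv (v t) x) \<le> r" using vb[OF tx] by auto
    have "r * t powr d \<le> r * (1 + 2 * N / d1) * t powr d" using r N0 \<nu>(4) by (intro mult_right_mono) auto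
    then show ?thesis unfolding dw[OF tx] using P_ln_bound[OF tT vr] by (auto simp: w_def)
  qed
  ultimately show ?thesis using T1 w_def ul by blast
qed

end

subsection \<open>Solutions as germs\<close>

lemma uniform_limit_powr:
  fixes f :: txfun
  assumes "0 < T" "0 < c" and bd: "\<And>t x. t \<in> {0<..<T} \<Longrightarrow> x \<in> S \<Longrightarrow> cmod (f t x) \<le> C * t powr c"
  shows "uniform_limit S f (\<lambda>_. 0) (at_right 0)"
proof (rule uniform_limitI)
  fix e :: real assume e: "0 < e"
  have "((\<lambda>t. C * t powr c) \<longlongrightarrow> C * 0 powr c) (at_right 0)"
    using assms by (intro tendsto_intros) (auto simp: eventually_at_right_field intro: exI[of _ 1])
  then have "\<forall>\<^sub>F t in at_right 0. C * t powr c < e" using e by (intro order_tendstoD(2)) auto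
  moreover have "\<forall>\<^sub>F t in at_right 0. t < T" using assms by (auto simp: eventually_at_right_field)
  ultimately show "\<forall>\<^sub>F t in at_right 0. \<forall>x\<in>S. dist (f t x) 0 < e"
    using eventually_at_right_less[of 0]
  proof eventually_elim
    case (elim t)
    show ?case
    proof
      fix x assume "x \<in> S"
      then have "cmod (f t x) \<le> C * t powr c" using bd[of t x] elim by simp
      then show "dist (f t x) 0 < e" using elim(1) by simp
    qed
  qed
qed

lemma eventually_at_right_0D: "\<forall>\<^sub>F t in at_right (0::real). Q t \<Longrightarrow> \<exists>b>0. \<forall>t. 0 < t \<longrightarrow> t < b \<longrightarrow> Q t"
  by (auto simp: eventually_at_right_field)

text \<open>Continuity and holomorphy of the time derivative are read off from the extension of t
  times the derivative, divided by t.\<close>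

lemma X1_evolves:
  assumes u: "u \<in> X1 T R"
  shows "evolves 0 T R u (dt u)"
proof -
  have c: "continuous_on ({0..T} \<times> ball 0 R) (\<lambda>(t, x). u t x)" and h: "\<forall>t\<in>{0..T}. u t holomorphic_on ball 0 R"
    and C1: "C1_on ({0<..<T} \<times> ball 0 R) u" using u by (auto simp: X1_def X0_def)
  obtain g where cg: "continuous_on ({0..T} \<times> ball 0 R) (\<lambda>(t, x). g t x)" and hg: "\<forall>t\<in>{0..T}. g t holomorphic_on ball 0 R"
    and g: "\<forall>t\<in>{0<..<T}. \<forall>x\<in>ball 0 R. g t x = of_real t * dt u t x" using u by (auto simp: X1_def X0_def)
  obtain f' where f': "\<forall>p\<in>{0<..<T} \<times> ball 0 R. ((\<lambda>(t, x). u t x) has_derivative blinfun_apply (f' p)) (at p)"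
    using C1 unfolding C1_on_def by blast
  have sub: "{0<..<T} \<times> ball 0 R \<subseteq> {0..T} \<times> ball (0::complex) R" by auto
  have d: "((\<lambda>s. u s x) has_vector_derivative dt u t x) (at t)" if t: "t \<in> {0<..<T}" and x: "x \<in> ball 0 R" for t x
  proof -
    have 1: "((\<lambda>s. (s, x)) has_derivative (\<lambda>h. (h, 0))) (at t)" by (auto intro!: derivative_eq_intros)
    have 2: "((\<lambda>(t, x). u t x) has_derivative blinfun_apply (f' (t,x))) (at ((\<lambda>s. (s,x)) t))" using f' t x by auto
    have "((\<lambda>s. case (s, x) of (t, x) \<Rightarrow> u t x) has_derivative (\<lambda>h. blinfun_apply (f' (t,x)) (h, 0))) (at t)"
      by (rule has_derivative_compose[OF 1 2])
    moreover have "blinfun_apply (f' (t,x)) (h, 0) = h *\<^sub>R blinfun_apply (f' (t,x)) (1, 0)" for h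
      using blinfun.scaleR_right[of "f' (t,x)" h "(1,0)"] by simp
    then have "(\<lambda>h. blinfun_apply (f' (t,x)) (h, 0)) = (\<lambda>h. h *\<^sub>R blinfun_apply (f' (t,x)) (1, 0))" by (rule ext)
    ultimately have "((\<lambda>s. u s x) has_vector_derivative blinfun_apply (f' (t,x)) (1, 0)) (at t)"
      unfolding has_vector_derivative_def prod.case by simp
    then show ?thesis unfolding dt_def by (simp add: vector_derivative_at)
  qed
  have eq: "dt u t x = g t x / of_real t" if "t \<in> {0<..<T}" "x \<in> ball 0 R" for t x
    using g that by auto
  have "continuous_on ({0<..<T} \<times> ball 0 R) (\<lambda>p. (\<lambda>(t,x). g t x) p / of_real (fst p))"
    by (intro continuous_intros continuous_on_subset[OF cg sub]) auto
  then have cd: "continuous_on ({0<..<T} \<times> ball 0 R) (\<lambda>(t,x). dt u t x)"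
    by (rule continuous_on_eq) (use eq in auto)
  have hd: "dt u t holomorphic_on ball 0 R" if t: "t \<in> {0<..<T}" for t
  proof (rule holomorphic_transform)
    show "(\<lambda>x. g t x / of_real t) holomorphic_on ball 0 R" using hg t by (intro holomorphic_intros) auto
  qed (use eq[OF t] in auto)
  show ?thesis unfolding evolves_def
    using continuous_on_subset[OF c sub] h cd hd d by auto
qed

lemma X1_subset:
  assumes u: "u \<in> X1 T R" and T': "T' \<le> T" "R' \<le> R"
  shows "u \<in> X1 T' R'"
proof -
  have sub: "{0..T'} \<times> ball 0 R' \<subseteq> {0..T} \<times> ball (0::complex) R" "{0<..<T'} \<times> ball 0 R' \<subseteq> {0<..<T} \<times> ball (0::complex) R"
    "ball (0::complex) R' \<subseteq> ball 0 R" "{0..T'} \<subseteq> {0..T}"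
    using T' by auto
  have X0s: "f \<in> X0 T R \<Longrightarrow> f \<in> X0 T' R'" for f
    unfolding X0_def using continuous_on_subset[OF _ sub(1)] holomorphic_on_subset[OF _ sub(3)] sub(4) by blast
  have "C1_on ({0<..<T'} \<times> ball 0 R') u"
    using u continuous_on_subset[OF _ sub(2)] sub(2) unfolding X1_def C1_on_def by blast
  moreover obtain g where "g \<in> X0 T R" "\<forall>t\<in>{0<..<T}. \<forall>x\<in>ball 0 R. g t x = of_real t * dt u t x"
    using u unfolding X1_def by blast
  moreover have "\<forall>t\<in>{0<..<T'}. \<forall>x\<in>ball 0 R'. g t x = of_real t * dt u t x"
    using calculation(3) sub(3) T'(1) by auto
  moreover have "u \<in> X0 T R" using u by (simp add: X1_def)
  ultimately show ?thesis unfolding X1_def using X0s by blast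
qed

text \<open>Solutions are constructed for t > 0 only, whereas germs also compare values at t = 0.
  All the solutions in question tend to 0 there.\<close>

definition extend0 :: "txfun \<Rightarrow> txfun" where "extend0 u t x = (if t \<le> 0 then 0 else u t x)"

lemma extend0_X0:
  assumes c: "continuous_on ({0<..<T} \<times> ball 0 R) (\<lambda>(t,x). f t x)" and h: "\<And>t. t \<in> {0<..<T} \<Longrightarrow> f t holomorphic_on ball 0 R"
    and z: "uniform_limit (ball 0 R) f (\<lambda>_. 0) (at_right 0)" and T': "T' < T"
  shows "extend0 f \<in> X0 T' R"
proof -
  have "continuous_on ({0..T'} \<times> ball 0 R) (\<lambda>(t,x). extend0 f t x)"
    unfolding continuous_on_def
  proof clarify
    fix t x assume t: "t \<in> {0..T'}" and x: "x \<in> ball (0::complex) R"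
    show "((\<lambda>(t,x). extend0 f t x) \<longlongrightarrow> extend0 f t x) (at (t,x) within {0..T'} \<times> ball 0 R)"
    proof (cases "t = 0")
      case False
      then have p: "(t,x) \<in> {0<..<T} \<times> ball 0 R" using t x T' by auto
      have o: "open ({0<..<T} \<times> ball (0::complex) R)" by (intro open_Times) auto
      have "isCont (\<lambda>(t,x). f t x) (t,x)" using c p continuous_on_eq_continuous_at[OF o] by blast
      then have "((\<lambda>(t,x). f t x) \<longlongrightarrow> f t x) (at (t,x))" by (simp add: isCont_def)
      moreover have "\<forall>\<^sub>F q in at (t,x). (\<lambda>(t,x). f t x) q = (\<lambda>(t,x). extend0 f t x) q"
        by (rule eventually_mono[OF eventually_at_in_open'[OF o p]]) (auto simp: extend0_def)
      ultimately have "((\<lambda>(t,x). extend0 f t x) \<longlongrightarrow> f t x) (at (t,x))" by (rule Lim_transform_eventually)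
      then have "((\<lambda>(t,x). extend0 f t x) \<longlongrightarrow> f t x) (at (t,x) within {0..T'} \<times> ball 0 R)"
        by (rule tendsto_within_subset) simp
      moreover have "extend0 f t x = f t x" using False t by (simp add: extend0_def)
      ultimately show ?thesis by simp
    next
      case True
      show ?thesis
        unfolding True
      proof (rule tendstoI)
        fix e :: real assume e: "0 < e"
        have "\<forall>\<^sub>F t in at_right 0. \<forall>x\<in>ball 0 R. dist (f t x) 0 < e" using z e by (simp add: uniform_limit_iff)
        from eventually_at_right_0D[OF this]
        obtain b where b: "0 < b" "\<And>t. 0 < t \<Longrightarrow> t < b \<Longrightarrow> \<forall>x\<in>ball 0 R. dist (f t x) 0 < e" by blast
        show "\<forall>\<^sub>F q in at (0,x) within {0..T'} \<times> ball 0 R. dist ((\<lambda>(t,x). extend0 f t x) q) (extend0 f 0 x) < e"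
          unfolding eventually_at
        proof (intro exI[of _ b] conjI ballI impI)
          fix q assume q: "q \<in> {0..T'} \<times> ball (0::complex) R" "q \<noteq> (0,x) \<and> dist q (0,x) < b"
          have "dist (fst q) 0 < b" using q(2) dist_fst_le[of q "(0,x)"] by auto
          then show "dist ((\<lambda>(t,x). extend0 f t x) q) (extend0 f 0 x) < e"
            using q(1) b(2)[of "fst q"] e by (auto simp: extend0_def split_beta)
        qed (use b in auto)
      qed
    qed
  qed
  moreover have "extend0 f t holomorphic_on ball 0 R" if "t \<in> {0..T'}" for t
    using h[of t] that T' by (cases "t = 0") (auto simp: extend0_def[abs_def])
  ultimately show ?thesis by (auto simp: X0_def)
qed

text \<open>Continuation by zero stays continuous up to t = 0 because u tends to 0 uniformly; the
  same for t times its time derivative, assumed in \<open>th\<close>, supplies the extension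
  demanded by the class.\<close>

lemma extend0_X1_pow:
  assumes ev: "evolves 0 T R u h" and C: "0 < C" "0 < d"
    and bd: "\<And>t x. t \<in> {0<..<T} \<Longrightarrow> x \<in> ball 0 R \<Longrightarrow> cmod (u t x) \<le> C * t powr d \<and> cmod (deriv (u t) x) \<le> C * t powr d"
    and th: "uniform_limit (ball 0 R) (\<lambda>t x. of_real t * h t x) (\<lambda>_. 0) (at_right 0)" and T': "0 < T'" "T' < T"
  shows "extend0 u \<in> X1_pow d T' R" "\<And>t x. t \<in> {0<..<T} \<Longrightarrow> x \<in> ball 0 R \<Longrightarrow> dt (extend0 u) t x = h t x"
proof -
  have cu: "continuous_on ({0<..<T} \<times> ball 0 R) (\<lambda>(t,x). u t x)" and hu: "\<And>t. t \<in> {0<..<T} \<Longrightarrow> u t holomorphic_on ball 0 R"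
    and ch: "continuous_on ({0<..<T} \<times> ball 0 R) (\<lambda>(t,x). h t x)" and hh: "\<And>t. t \<in> {0<..<T} \<Longrightarrow> h t holomorphic_on ball 0 R"
    using ev by (auto simp: evolves_def)
  have ul: "uniform_limit (ball 0 R) u (\<lambda>_. 0) (at_right 0)"
    by (rule uniform_limit_powr[of T d _ _ C]) (use bd C T' in auto)
  have X0u: "extend0 u \<in> X0 T' R" by (rule extend0_X0[OF cu hu ul T'(2)])
  have dcut: "((\<lambda>s. extend0 u s x) has_vector_derivative h t x) (at t)" if t: "t \<in> {0<..<T}" and x: "x \<in> ball 0 R" for t x
  proof (rule has_vector_derivative_transform_within_open[of "\<lambda>s. u s x" _ _ "{0<..<T}"])
    show "((\<lambda>s. u s x) has_vector_derivative h t x) (at t)" using ev t x by (auto simp: evolves_def)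
  qed (use t in \<open>auto simp: extend0_def\<close>)
  then show dtc: "dt (extend0 u) t x = h t x" if "t \<in> {0<..<T}" "x \<in> ball 0 R" for t x
    using that unfolding dt_def by (simp add: vector_derivative_at)
  have evc: "extend0 u t = u t" if "0 < t" for t using that by (simp add: extend0_def[abs_def])
  have cc: "continuous_on ({0<..<T} \<times> ball 0 R) (\<lambda>(t,x). extend0 u t x)"
    by (rule continuous_on_eq[OF cu]) (auto simp: extend0_def)
  have "C1_on ({0<..<T'} \<times> ball 0 R) (extend0 u)"
    unfolding C1_on_def
  proof (intro exI conjI ballI)
    let ?f = "\<lambda>p. (blinfun_scaleR_left ((\<lambda>(t,x). h t x) p) o\<^sub>L fst_blinfun) + (blinfun_mult_right ((\<lambda>(t,x). deriv (u t) x) p) o\<^sub>L snd_blinfun)"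
    fix p assume p: "p \<in> {0<..<T'} \<times> ball (0::complex) R"
    obtain t x where tx: "p = (t,x)" "t \<in> {0<..<T}" "x \<in> ball 0 R" using p T' by auto
    have "((\<lambda>(t, x). extend0 u t x) has_derivative (\<lambda>(k, l). k *\<^sub>R h t x + deriv (extend0 u t) x * l)) (at (t, x))"
      by (rule has_derivative_tx[where u="extend0 u" and g=h, OF tx(2,3) _ cc dcut[OF tx(2,3)]]) (use hu evc in auto)
    moreover have "blinfun_apply (?f p) = (\<lambda>(k, l). k *\<^sub>R h t x + deriv (extend0 u t) x * l)"
    proof -
      have e: "extend0 u t = u t" using tx evc[of t] by simp
      show ?thesis unfolding e tx(1) by (rule ext) (simp add: blinfun.add_left split_beta)
    qed
    ultimately show "((\<lambda>(t, x). extend0 u t x) has_derivative blinfun_apply (?f p)) (at p)" using tx by simp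
  next
    have "continuous_on ({0<..<T} \<times> ball 0 R) (\<lambda>(t,x). deriv (u t) x)"
      by (rule continuous_on_deriv_param[OF open_ball cu hu])
    moreover have "{0<..<T'} \<times> ball 0 R \<subseteq> {0<..<T} \<times> ball (0::complex) R" using T' by auto
    ultimately have "continuous_on ({0<..<T'} \<times> ball 0 R) (\<lambda>(t,x). deriv (u t) x)" "continuous_on ({0<..<T'} \<times> ball 0 R) (\<lambda>(t,x). h t x)"
      using ch continuous_on_subset by blast+
    then show "continuous_on ({0<..<T'} \<times> ball 0 R) (\<lambda>p. (blinfun_scaleR_left ((\<lambda>(t,x). h t x) p) o\<^sub>L fst_blinfun) + (blinfun_mult_right ((\<lambda>(t,x). deriv (u t) x) p) o\<^sub>L snd_blinfun))"
      by (intro continuous_on_add bounded_bilinear.continuous_on[OF bounded_bilinear_blinfun_compose] continuous_on_const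
        bounded_linear.continuous_on[OF bounded_linear_blinfun_scaleR_left] bounded_linear.continuous_on[OF bounded_linear_blinfun_mult_right])
  qed
  moreover have "\<exists>g\<in>X0 T' R. \<forall>t\<in>{0<..<T'}. \<forall>x\<in>ball 0 R. g t x = of_real t * dt (extend0 u) t x"
  proof (intro bexI ballI)
    show "extend0 (\<lambda>t x. of_real t * h t x) \<in> X0 T' R"
    proof (rule extend0_X0[OF _ _ th T'(2)])
      have "continuous_on ({0<..<T} \<times> ball 0 R) (\<lambda>p. of_real (fst p) * (\<lambda>(t,x). h t x) p)"
        by (intro continuous_intros ch)
      then show "continuous_on ({0<..<T} \<times> ball 0 R) (\<lambda>(t,x). of_real t * h t x)" by (simp add: split_beta')
    qed (intro holomorphic_intros hh)
    show "extend0 (\<lambda>t x. of_real t * h t x) t x = of_real t * dt (extend0 u) t x" if "t \<in> {0<..<T'}" "x \<in> ball 0 R" for t x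
      using that dtc[of t x] T' by (simp add: extend0_def)
  qed
  ultimately have "extend0 u \<in> X1 T' R" using X0u by (simp add: X1_def)
  moreover have "max (cmod (extend0 u t x)) (cmod (dx (extend0 u) t x)) \<le> C * t powr d" if "t \<in> {0..T'}" "x \<in> ball 0 R" for t x
  proof (cases "t = 0")
    case True
    have "extend0 u 0 = (\<lambda>x. 0)" by (simp add: extend0_def[abs_def])
    then show ?thesis using True by (simp add: dx_def)
  next
    case False
    then show ?thesis using bd[of t x] evc[of t] that T' by (simp add: dx_def)
  qed
  ultimately show "extend0 u \<in> X1_pow d T' R" unfolding X1_pow_def using C by blast
qed

section \<open>Passage between functions and germs\<close>

lemma germ_eq_iff: "germ u = germ v \<longleftrightarrow> tx_eq u v"
  by (rule txgerm.abs_eq_iff)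

lemma germ_plus: "germ u + germ v = germ (\<lambda>t x. u t x + v t x)"
  by (rule plus_txgerm.abs_eq)

lemma solves_cong:
  assumes "tx_eq u v" "solves F T0 R0 \<rho>0 u"
  shows "solves F T0 R0 \<rho>0 v"
proof -
  obtain e d where ed: "e > 0" "d > 0" "\<forall>t\<in>{0..e}. \<forall>x\<in>ball 0 d. u t x = v t x" using assms(1) unfolding tx_eq_def by blast
  obtain e' d' where ed': "e' > 0" "d' > 0" "\<forall>t\<in>{0<..<e'}. \<forall>x\<in>ball 0 d'. (t, x, u t x, dx u t x) \<in> Omega T0 R0 \<rho>0 \<and>
        of_real t * dt u t x = F t x (u t x) (dx u t x)" using assms(2) unfolding solves_def by blast
  have "(t, x, v t x, dx v t x) \<in> Omega T0 R0 \<rho>0 \<and> of_real t * dt v t x = F t x (v t x) (dx v t x)"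
    if t: "t \<in> {0<..<min e e'}" and x: "x \<in> ball 0 (min d d')" for t x
  proof -
    have uv: "u t x = v t x" using ed(3) t x by auto
    have "dx u t x = dx v t x"
      unfolding dx_def
    proof (rule deriv_cong_ev)
      show "\<forall>\<^sub>F y in nhds x. u t y = v t y"
        using eventually_nhds_in_open[OF open_ball x] by eventually_elim (use ed(3) t in auto)
    qed simp
    moreover have "dt u t x = dt v t x"
      unfolding dt_def
    proof (rule vector_derivative_cong_eq)
      have "\<forall>\<^sub>F s in nhds t. s \<in> {0<..<min e e'}" by (rule eventually_nhds_in_open) (use t in auto)
      then show "\<forall>\<^sub>F s in nhds t. s \<in> UNIV \<longrightarrow> u s x = v s x" by eventually_elim (use ed(3) x in auto)
    qed (use uv in auto)
    moreover have "(t, x, u t x, dx u t x) \<in> Omega T0 R0 \<rho>0 \<and> of_real t * dt u t x = F t x (u t x) (dx u t x)"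
      using ed'(3) t x by auto
    ultimately show ?thesis using uv by simp
  qed
  then show ?thesis
    unfolding solves_def using ed ed' by (intro exI[of _ "min e e'"] conjI exI[of _ "min d d'"]) auto
qed

context briot_bouquet
begin

text \<open>A working notion of solution for t > 0. The arguments are confined to the small polydisc
  where the Taylor estimates hold, and the radius is at most R1/2 because the bound on the
  x-derivative of F is available only there.\<close>

definition sol :: "real \<Rightarrow> real \<Rightarrow> txfun \<Rightarrow> bool" where
  "sol T R u \<longleftrightarrow> 0 < T \<and> T \<le> T0 \<and> 0 < R \<and> R \<le> R1/2 \<and>
     evolves 0 T R u (\<lambda>t x. F t x (u t x) (deriv (u t) x) / of_real t) \<and>
     (\<forall>t\<in>{0<..<T}. \<forall>x\<in>ball 0 R. u t x \<in> ball 0 r1 \<and> deriv (u t) x \<in> ball 0 r1)"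

definition bnd :: "real \<Rightarrow> real \<Rightarrow> real \<Rightarrow> txfun \<Rightarrow> bool" where
  "bnd d T R u \<longleftrightarrow> (\<exists>C>0. \<forall>t\<in>{0<..<T}. \<forall>x\<in>ball 0 R. cmod (u t x) \<le> C * t powr d \<and> cmod (deriv (u t) x) \<le> C * t powr d)"

lemma sol_subset: "sol T R u \<Longrightarrow> 0 < T' \<Longrightarrow> T' \<le> T \<Longrightarrow> 0 < R' \<Longrightarrow> R' \<le> R \<Longrightarrow> sol T' R' u"
  using evolves_subset[of 0 T R u "\<lambda>t x. F t x (u t x) (deriv (u t) x) / of_real t" 0 T' R'] by (auto simp: sol_def)

lemma bnd_subset: "bnd d T R u \<Longrightarrow> T' \<le> T \<Longrightarrow> R' \<le> R \<Longrightarrow> bnd d T' R' u"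
  unfolding bnd_def
proof (elim exE conjE)
  fix C assume T: "T' \<le> T" "R' \<le> R" and C: "C > 0" "\<forall>t\<in>{0<..<T}. \<forall>x\<in>ball 0 R. cmod (u t x) \<le> C * t powr d \<and> cmod (deriv (u t) x) \<le> C * t powr d"
  show "\<exists>C>0. \<forall>t\<in>{0<..<T'}. \<forall>x\<in>ball 0 R'. cmod (u t x) \<le> C * t powr d \<and> cmod (deriv (u t) x) \<le> C * t powr d"
    by (intro exI[of _ C] conjI ballI) (use C T in auto)
qed

lemma bnd_mono: "bnd d T R u \<Longrightarrow> T \<le> T0 \<Longrightarrow> d' \<le> d \<Longrightarrow> bnd d' T R u"
proof -
  assume b: "bnd d T R u" and T: "T \<le> T0" and d: "d' \<le> d"
  obtain C where C: "C > 0" "\<forall>t\<in>{0<..<T}. \<forall>x\<in>ball 0 R. cmod (u t x) \<le> C * t powr d \<and> cmod (deriv (u t) x) \<le> C * t powr d"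
    using b unfolding bnd_def by blast
  have "C * t powr d \<le> C * t powr d'" if "t \<in> {0<..<T}" for t
    using that T T0 C(1) d by (intro mult_left_mono powr_le_powr) auto
  then have "\<forall>t\<in>{0<..<T}. \<forall>x\<in>ball 0 R. cmod (u t x) \<le> C * t powr d' \<and> cmod (deriv (u t) x) \<le> C * t powr d'"
    using C(2) by (blast intro: order_trans)
  then show ?thesis unfolding bnd_def using C(1) by blast
qed

lemma bnd_limits:
  assumes "bnd d T R u" "0 < d" "0 < T"
  shows "uniform_limit (ball 0 R) u (\<lambda>_. 0) (at_right 0)" "uniform_limit (ball 0 R) (\<lambda>t. deriv (u t)) (\<lambda>_. 0) (at_right 0)"
proof -
  obtain C where C: "C > 0" "\<And>t x. t \<in> {0<..<T} \<Longrightarrow> x \<in> ball 0 R \<Longrightarrow> cmod (u t x) \<le> C * t powr d \<and> cmod (deriv (u t) x) \<le> C * t powr d"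
    using assms unfolding bnd_def by blast
  show "uniform_limit (ball 0 R) u (\<lambda>_. 0) (at_right 0)" "uniform_limit (ball 0 R) (\<lambda>t. deriv (u t)) (\<lambda>_. 0) (at_right 0)"
    using C(2) by (auto intro!: uniform_limit_powr[OF assms(3,2), of _ _ C])
qed

text \<open>The decay of u and of its x-derivative forces the right-hand side of the equation to 0
  uniformly. Thus t times the time derivative has the continuous extension 0 that membership in the
  class requires.\<close>

lemma sol_rhs_limit:
  assumes s: "sol T R u" and b: "bnd d T R u" "0 < d"
  shows "uniform_limit (ball 0 R) (\<lambda>t x. of_real t * (F t x (u t x) (deriv (u t) x) / of_real t)) (\<lambda>_. 0) (at_right 0)"
proof (rule uniform_limitI)
  fix e :: real assume e: "0 < e"
  have T: "0 < T" "T \<le> T0" "R \<le> R1/2" using s by (auto simp: sol_def)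
  have ub: "u t x \<in> ball 0 r1" "deriv (u t) x \<in> ball 0 r1" if "t \<in> {0<..<T}" "x \<in> ball 0 R" for t x
    using s that by (auto simp: sol_def)
  obtain C where C: "C > 0" "\<And>t x. t \<in> {0<..<T} \<Longrightarrow> x \<in> ball 0 R \<Longrightarrow> cmod (u t x) \<le> C * t powr d \<and> cmod (deriv (u t) x) \<le> C * t powr d"
    using b unfolding bnd_def by blast
  let ?L = "M0 / (\<rho>0/4)"
  have L: "0 \<le> ?L" using M0(1) \<rho>0 by simp
  have "((\<lambda>t. A * t powr \<mu> + ?L * (C * t powr d) + 1 * (C * t powr d) + Lz * (2 * (C * t powr d))\<^sup>2) \<longlongrightarrow>
      A * 0 powr \<mu> + ?L * (C * 0 powr d) + 1 * (C * 0 powr d) + Lz * (2 * (C * 0 powr d))\<^sup>2) (at_right 0)"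
    using b(2) \<mu> by (intro tendsto_intros) (auto simp: eventually_at_right_field intro: exI[of _ 1])
  then have "\<forall>\<^sub>F t in at_right 0. A * t powr \<mu> + ?L * (C * t powr d) + 1 * (C * t powr d) + Lz * (2 * (C * t powr d))\<^sup>2 < e"
    using e by (intro order_tendstoD(2)) auto
  moreover have "\<forall>\<^sub>F t in at_right 0. \<beta> t \<le> 1" by (rule \<beta>_0) simp
  moreover have "\<forall>\<^sub>F t in at_right 0. t < T" using T by (auto simp: eventually_at_right_field)
  ultimately show "\<forall>\<^sub>F t in at_right 0. \<forall>x\<in>ball 0 R. dist (of_real t * (F t x (u t x) (deriv (u t) x) / of_real t)) 0 < e"
    using eventually_at_right_less[of 0]
  proof eventually_elim
    case (elim t)
    have t: "t \<in> {0<..<T}" "t \<in> {0<..T0}" using elim T by auto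
    show ?case
    proof
      fix x :: complex assume x: "x \<in> ball 0 R"
      have x1: "x \<in> ball 0 R1" using x T pos by auto
      let ?y = "C * t powr d"
      note c = C(2)[OF t(1) x]
      have "cmod (F t x (u t x) (deriv (u t) x)) \<le> A * t powr \<mu> + ?L * cmod (u t x) + \<beta> t * cmod (deriv (u t) x) + Lz * (cmod (u t x) + cmod (deriv (u t) x))\<^sup>2"
        by (rule F_size[OF t(2) x1 ub[OF t(1) x]])
      also have "\<dots> \<le> A * t powr \<mu> + ?L * ?y + 1 * ?y + Lz * (2 * ?y)\<^sup>2"
      proof (rule add_mono[OF add_mono[OF add_left_mono]])
        show "?L * cmod (u t x) \<le> ?L * ?y" using c L by (intro mult_left_mono) auto
        show "\<beta> t * cmod (deriv (u t) x) \<le> 1 * ?y" using c elim(2) by (intro mult_mono) auto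
        show "Lz * (cmod (u t x) + cmod (deriv (u t) x))\<^sup>2 \<le> Lz * (2 * ?y)\<^sup>2"
          using c Lz by (intro mult_left_mono power_mono) auto
      qed
      finally have "cmod (F t x (u t x) (deriv (u t) x)) < e" using elim(1) by linarith
      then show "dist (of_real t * (F t x (u t x) (deriv (u t) x) / of_real t)) 0 < e" using t by (simp add: dist_norm)
    qed
  qed
qed

lemma sol_germ:
  assumes s: "sol T R u" and b: "bnd d T R u" "0 < d"
  shows "germ (extend0 u) \<in> X1_germs d" "solves F T0 R0 \<rho>0 (extend0 u)" "germ (extend0 u) \<in> solutions F T0 R0 \<rho>0 X1_plus"
proof -
  have T: "0 < T" "T \<le> T0" "0 < R" "R \<le> R1/2" and ev: "evolves 0 T R u (\<lambda>t x. F t x (u t x) (deriv (u t) x) / of_real t)"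
    and ub: "\<And>t x. t \<in> {0<..<T} \<Longrightarrow> x \<in> ball 0 R \<Longrightarrow> u t x \<in> ball 0 r1 \<and> deriv (u t) x \<in> ball 0 r1"
    using s by (auto simp: sol_def)
  obtain C where C: "C > 0" "\<And>t x. t \<in> {0<..<T} \<Longrightarrow> x \<in> ball 0 R \<Longrightarrow> cmod (u t x) \<le> C * t powr d \<and> cmod (deriv (u t) x) \<le> C * t powr d"
    using b unfolding bnd_def by blast
  have T2: "0 < T/2" "T/2 < T" using T by auto
  note X = extend0_X1_pow[OF ev C(1) b(2) C(2) sol_rhs_limit[OF s b] T2]
  show g: "germ (extend0 u) \<in> X1_germs d" unfolding X1_germs_def using X(1) T T2 by blast
  have cu: "extend0 u t = u t" if "0 < t" for t using that by (simp add: extend0_def[abs_def])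
  have "(t, x, extend0 u t x, dx (extend0 u) t x) \<in> Omega T0 R0 \<rho>0 \<and> of_real t * dt (extend0 u) t x = F t x (extend0 u t x) (dx (extend0 u) t x)"
    if t: "t \<in> {0<..<T}" and x: "x \<in> ball 0 R" for t x
  proof -
    have "dt (extend0 u) t x = F t x (u t x) (deriv (u t) x) / of_real t"
      by (rule extend0_X1_pow(2)[OF ev C(1) b(2) C(2) sol_rhs_limit[OF s b] T2 t x])
    then show ?thesis using ub[OF t x] cu[of t] t x T pos by (simp add: Omega_def dx_def)
  qed
  then show sv: "solves F T0 R0 \<rho>0 (extend0 u)" unfolding solves_def using T by blast
  show "germ (extend0 u) \<in> solutions F T0 R0 \<rho>0 X1_plus"
    unfolding solutions_def X1_plus_def using g sv b(2) by blast
qed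

lemma germ_extend0: "0 < T \<Longrightarrow> 0 < R \<Longrightarrow> (\<And>x. x \<in> ball 0 R \<Longrightarrow> u 0 x = 0) \<Longrightarrow> germ (extend0 u) = germ u"
  unfolding germ_eq_iff tx_eq_def extend0_def by (intro exI[of _ T] conjI exI[of _ R]) auto

lemma germ_cong_sol: "0 < T \<Longrightarrow> 0 < R \<Longrightarrow> (\<And>t x. t \<in> {0<..<T} \<Longrightarrow> x \<in> ball 0 R \<Longrightarrow> u t x = v t x) \<Longrightarrow> germ (extend0 u) = germ (extend0 v)"
  unfolding germ_eq_iff tx_eq_def extend0_def by (intro exI[of _ "T/2"] conjI exI[of _ R]) auto

lemma solves_sol:
  assumes u: "u \<in> X1 T R" and T: "0 < T" "0 < R" and s: "solves F T0 R0 \<rho>0 u"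
    and l: "uniform_limit (ball 0 R) u (\<lambda>_. 0) (at_right 0)" "uniform_limit (ball 0 R) (\<lambda>t. deriv (u t)) (\<lambda>_. 0) (at_right 0)"
  shows "\<exists>T' R'. T' \<le> T \<and> R' \<le> R \<and> sol T' R' u"
proof -
  obtain e d where ed: "e > 0" "d > 0" "\<forall>t\<in>{0<..<e}. \<forall>x\<in>ball 0 d. (t, x, u t x, dx u t x) \<in> Omega T0 R0 \<rho>0 \<and>
        of_real t * dt u t x = F t x (u t x) (dx u t x)" using s unfolding solves_def by blast
  have "\<forall>\<^sub>F t in at_right 0. (\<forall>x\<in>ball 0 R. dist (u t x) 0 < r1) \<and> (\<forall>x\<in>ball 0 R. dist (deriv (u t) x) 0 < r1)"
    using l pos unfolding uniform_limit_iff by (intro eventually_conj) auto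
  then obtain b where b: "0 < b" "\<And>t. 0 < t \<Longrightarrow> t < b \<Longrightarrow> (\<forall>x\<in>ball 0 R. dist (u t x) 0 < r1) \<and> (\<forall>x\<in>ball 0 R. dist (deriv (u t) x) 0 < r1)"
    using eventually_at_right_0D by blast
  define T' where "T' = min (min e b) (min T T0)"
  define R' where "R' = min (min d R) (R1/2)"
  have T': "0 < T'" "T' \<le> e" "T' \<le> b" "T' \<le> T" "T' \<le> T0" "0 < R'" "R' \<le> d" "R' \<le> R" "R' \<le> R1/2"
    using ed b T T0 pos by (auto simp: T'_def R'_def)
  have "evolves 0 T' R' u (\<lambda>t x. F t x (u t x) (deriv (u t) x) / of_real t)"
  proof (rule evolves_cong[OF evolves_subset[OF X1_evolves[OF u]]])
    fix t and x :: complex assume "t \<in> {0<..<T'}" "x \<in> ball 0 R'"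
    then have "of_real t * dt u t x = F t x (u t x) (deriv (u t) x)" "t \<noteq> 0" using ed(3) T' by (auto simp: dx_def)
    then show "dt u t x = F t x (u t x) (deriv (u t) x) / of_real t" by (simp add: field_simps)
  qed (use T' in auto)
  moreover have "u t x \<in> ball 0 r1 \<and> deriv (u t) x \<in> ball 0 r1" if "t \<in> {0<..<T'}" "x \<in> ball 0 R'" for t x
    using b(2)[of t] that T' by (auto simp: dist_commute)
  ultimately have "sol T' R' u" using T' by (simp add: sol_def)
  then show ?thesis using T' by blast
qed

lemma X1_plus_sol:
  assumes g: "g \<in> solutions F T0 R0 \<rho>0 X1_plus"
  shows "\<exists>u d T R. 0 < d \<and> g = germ u \<and> sol T R u \<and> bnd d T R u \<and> (\<forall>x\<in>ball 0 R. u 0 x = 0) \<and> u \<in> X1_pow d T R"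
proof -
  obtain d u T R where d: "0 < d" and gu: "g = germ u" and TR: "0 < T" "0 < R" and u: "u \<in> X1_pow d T R"
    using g unfolding solutions_def X1_plus_def X1_germs_def by auto
  obtain v where "g = germ v" "solves F T0 R0 \<rho>0 v" using g unfolding solutions_def by blast
  then have s: "solves F T0 R0 \<rho>0 u" using solves_cong[of v u F T0 R0 \<rho>0] gu germ_eq_iff[of v u] by simp
  obtain C where C: "C > 0" "\<forall>t\<in>{0..T}. \<forall>x\<in>ball 0 R. max (cmod (u t x)) (cmod (dx u t x)) \<le> C * t powr d"
    and u1: "u \<in> X1 T R" using u unfolding X1_pow_def by blast
  have b: "bnd d T R u" unfolding bnd_def
  proof (intro exI[of _ C] conjI ballI)
    fix t x assume "t \<in> {0<..<T}" "x \<in> ball (0::complex) R"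
    then have "max (cmod (u t x)) (cmod (dx u t x)) \<le> C * t powr d" using C(2) by auto
    then show "cmod (u t x) \<le> C * t powr d" "cmod (deriv (u t) x) \<le> C * t powr d" by (auto simp: dx_def)
  qed (rule C(1))
  obtain T' R' where T': "T' \<le> T" "R' \<le> R" "sol T' R' u"
    using solves_sol[OF u1 TR s bnd_limits[OF b d TR(1)]] by blast
  have TR': "0 < T'" "0 < R'" using T' by (auto simp: sol_def)
  have z: "u 0 x = 0" if "x \<in> ball 0 R'" for x
    using C(2)[rule_format, of 0 x] that T' TR by auto
  have "u \<in> X1 T' R'" by (rule X1_subset[OF u1 T'(1,2)])
  then have "u \<in> X1_pow d T' R'" unfolding X1_pow_def using C T' by auto
  then show ?thesis using d gu T'(3) bnd_subset[OF b T'(1,2)] z by blast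
qed

section \<open>Comparison of two solutions\<close>

definition tlam :: txfun where "tlam t x = exp (- lam x * of_real (ln t))"

text \<open>\<open>t\<^sup>-\<^sup>\<lambda> (u - v)\<close> obeys a differential inequality with integrable coefficient; hypothesis (c3) with its
  factor \<open>1/\<bar>log t\<bar>\<close> absorbs the logarithm produced by \<open>\<partial>\<^sub>x t\<^sup>\<lambda>\<close>.\<close>

lemma scaled_difference:
  assumes s: "sol T R u" "sol T R v" and b: "bnd d T R u" "bnd d T R v" "0 < d"
  shows "\<exists>h C. 0 < C \<and> evolves 0 T R (\<lambda>t x. tlam t x * (u t x - v t x)) h \<and>
    (\<forall>t\<in>{0<..<T}. \<forall>x\<in>ball 0 R. cmod (h t x) \<le> C * \<kappa> (d/2) t *
       (cmod (tlam t x * (u t x - v t x)) + cmod (deriv (\<lambda>x. tlam t x * (u t x - v t x)) x)))"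
proof -
  have T: "0 < T" "T \<le> T0" "0 < R" "R \<le> R1/2" and evu: "evolves 0 T R u (\<lambda>t x. F t x (u t x) (deriv (u t) x) / of_real t)"
    and evv: "evolves 0 T R v (\<lambda>t x. F t x (v t x) (deriv (v t) x) / of_real t)"
    using s by (auto simp: sol_def)
  have ub: "u t x \<in> ball 0 r1" "deriv (u t) x \<in> ball 0 r1" "v t x \<in> ball 0 r1" "deriv (v t) x \<in> ball 0 r1"
    if "t \<in> {0<..<T}" "x \<in> ball 0 R" for t x using s that by (auto simp: sol_def)
  obtain Cu where Cu: "\<And>t x. t \<in> {0<..<T} \<Longrightarrow> x \<in> ball 0 R \<Longrightarrow> cmod (u t x) \<le> Cu * t powr d \<and> cmod (deriv (u t) x) \<le> Cu * t powr d" "Cu > 0"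
    using b unfolding bnd_def by blast
  obtain Cv where Cv: "\<And>t x. t \<in> {0<..<T} \<Longrightarrow> x \<in> ball 0 R \<Longrightarrow> cmod (v t x) \<le> Cv * t powr d \<and> cmod (deriv (v t) x) \<le> Cv * t powr d" "Cv > 0"
    using b unfolding bnd_def by blast
  have cR: "cball (0::complex) R \<subseteq> ball 0 R1" using T pos by auto
  have "continuous_on (cball 0 R) (deriv lam)"
    by (rule continuous_on_subset[OF holomorphic_on_imp_continuous_on[OF holomorphic_deriv[OF lam_hol open_ball]] cR])
  then have "bounded (deriv lam ` cball 0 R)" by (intro compact_imp_bounded compact_continuous_image) auto
  then obtain N where N: "0 < N" "\<forall>y\<in>deriv lam ` cball 0 R. cmod y \<le> N" unfolding bounded_pos by blast
  have lamR: "lam holomorphic_on ball 0 R" by (rule holomorphic_on_subset[OF lam_hol]) (use cR in auto)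
  define w where "w = (\<lambda>t x. u t x + (-1) * v t x)"
  define W where "W = (\<lambda>t x. tlam t x * (u t x - v t x))"
  have Ww: "W = (\<lambda>t x. tlam t x * w t x)" by (simp add: W_def w_def)
  have evw: "evolves 0 T R w (\<lambda>t x. F t x (u t x) (deriv (u t) x) / of_real t + (-1) * (F t x (v t x) (deriv (v t) x) / of_real t))"
    unfolding w_def by (rule evolves_lincomb[OF evu evv])
  have evE: "evolves 0 T R tlam (\<lambda>t x. - lam x / of_real t * tlam t x)"
    using evolves_exp[of "\<lambda>x. - lam x" R T] lamR by (simp add: tlam_def[abs_def] holomorphic_on_minus)
  define h where "h = (\<lambda>t x. - lam x / of_real t * tlam t x * w t x + tlam t x * 
     (F t x (u t x) (deriv (u t) x) / of_real t + (-1) * (F t x (v t x) (deriv (v t) x) / of_real t)))"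
  have evW: "evolves 0 T R W h" unfolding Ww h_def by (rule evolves_mult[OF evE evw])
  define ss where "ss = Lz * (2 * Cu + 2 * Cv)"
  have ss: "0 \<le> ss" using Lz Cu Cv by (simp add: ss_def)
  define C where "C = \<Lambda> + N * B + C\<beta> + ss * (1 + 2 * N / d)"
  have C: "0 < C" unfolding C_def using \<Lambda> N B C\<beta> ss b(3) by (intro add_pos_nonneg add_nonneg_nonneg mult_nonneg_nonneg) auto
  have "cmod (h t x) \<le> C * \<kappa> (d/2) t * (cmod (W t x) + cmod (deriv (W t) x))" if t: "t \<in> {0<..<T}" and x: "x \<in> ball 0 R" for t x
  proof -
    have t0: "t \<in> {0<..T0}" "0 < t" using t T by auto
    have x1: "x \<in> ball 0 R1" using x T pos by auto
    let ?E = "tlam t x" and ?D = "F t x (u t x) (deriv (u t) x) - F t x (v t x) (deriv (v t) x) - lam x * (u t x - v t x)"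
    have tz: "of_real t \<noteq> (0::complex)" using t0 by simp
    have hD: "h t x = ?E * ?D / of_real t" unfolding h_def w_def using tz by (simp add: field_simps)
    have du: "(u t has_field_derivative deriv (u t) x) (at x)" "(v t has_field_derivative deriv (v t) x) (at x)" "(lam has_field_derivative deriv lam x) (at x)"
      using evu evv t by (auto simp: evolves_def intro!: holomorphic_derivI[OF _ open_ball x] lamR)
    have dE: "(tlam t has_field_derivative ?E * (- deriv lam x * of_real (ln t))) (at x)"
      unfolding tlam_def[abs_def] by (auto intro!: derivative_eq_intros du(3))
    have "(W t has_field_derivative ?E * (deriv (u t) x - deriv (v t) x) + ?E * (- deriv lam x * of_real (ln t)) * (u t x - v t x)) (at x)"
      unfolding W_def by (rule DERIV_mult'[OF dE DERIV_diff[OF du(1,2)]])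
    then have dW: "deriv (W t) x = ?E * (deriv (u t) x - deriv (v t) x) + ?E * (- deriv lam x * of_real (ln t)) * (u t x - v t x)"
      by (rule DERIV_imp_deriv)
    \<comment> \<open>Differentiating t^(-\<lambda>) produces a multiple of log t; solved for the
      difference of derivatives, this has exactly the form b + N |ln t| a that
      \<open>weight_estimate\<close> accepts.\<close>
    have "?E * (deriv (u t) x - deriv (v t) x) = deriv (W t) x + deriv lam x * of_real (ln t) * W t x"
      unfolding dW by (simp add: W_def algebra_simps)
    then have n2: "cmod ?E * cmod (deriv (u t) x - deriv (v t) x) \<le> cmod (deriv (W t) x) + N * \<bar>ln t\<bar> * cmod (W t x)"
    proof -
      assume eq: "?E * (deriv (u t) x - deriv (v t) x) = deriv (W t) x + deriv lam x * of_real (ln t) * W t x"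
      have "cmod (deriv lam x * of_real (ln t) * W t x) \<le> N * \<bar>ln t\<bar> * cmod (W t x)"
        using N(2) x by (auto simp: norm_mult intro!: mult_right_mono)
      then show ?thesis unfolding norm_mult[symmetric] eq using norm_triangle_ineq[of "deriv (W t) x"] by (meson add_left_mono order_trans)
    qed
    have n1: "cmod ?E * cmod (u t x - v t x) = cmod (W t x)" by (simp add: W_def norm_mult)
    define \<sigma> where "\<sigma> = Lz * (cmod (u t x) + cmod (deriv (u t) x) + cmod (v t x) + cmod (deriv (v t) x))"
    have \<sigma>0: "0 \<le> \<sigma>" using Lz by (simp add: \<sigma>_def)
    have "cmod (u t x) + cmod (deriv (u t) x) + cmod (v t x) + cmod (deriv (v t) x) \<le> (2 * Cu + 2 * Cv) * t powr d"
      using Cu(1)[OF t x] Cv(1)[OF t x] unfolding distrib_right by linarith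
    then have \<sigma>: "\<sigma> \<le> ss * t powr d" using mult_left_mono[OF _ Lz] by (simp add: \<sigma>_def ss_def mult.assoc)
    have "cmod ?D \<le> (\<Lambda> * m t + \<sigma>) * cmod (u t x - v t x) + (\<beta> t + \<sigma>) * cmod (deriv (u t) x - deriv (v t) x)"
      unfolding \<sigma>_def by (rule F_diff[OF t0(1) x1 ub[OF t x]])
    then have "cmod ?E * cmod ?D \<le> cmod ?E * ((\<Lambda> * m t + \<sigma>) * cmod (u t x - v t x) + (\<beta> t + \<sigma>) * cmod (deriv (u t) x - deriv (v t) x))"
      by (rule mult_left_mono) simp
    also have "\<dots> = (\<Lambda> * m t + \<sigma>) * cmod (W t x) + (\<beta> t + \<sigma>) * (cmod ?E * cmod (deriv (u t) x - deriv (v t) x))"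
      unfolding n1[symmetric] by (simp add: algebra_simps)
    also have "\<dots> \<le> (\<Lambda> * m t + \<sigma>) * cmod (W t x) + (\<beta> t + \<sigma>) * (cmod (deriv (W t) x) + N * \<bar>ln t\<bar> * cmod (W t x))"
      using n2 \<beta>(1)[OF t0(1)] \<sigma>0 by (intro add_left_mono mult_left_mono) auto
    finally have "cmod ?E * cmod ?D / t \<le> ((\<Lambda> * m t + \<sigma>) * cmod (W t x) + (\<beta> t + \<sigma>) * (cmod (deriv (W t) x) + N * \<bar>ln t\<bar> * cmod (W t x))) / t"
      using t0(2) by (simp add: divide_right_mono)
    also have "\<dots> \<le> C * \<kappa> (d/2) t * (cmod (W t x) + cmod (deriv (W t) x))"
      unfolding C_def by (rule weight_estimate[OF t0(1) b(3) \<sigma>0 \<sigma> ss]) (use N in auto)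
    finally show ?thesis using t0(2) by (simp add: hD norm_mult norm_divide)
  qed
  with evW C show ?thesis unfolding W_def by blast
qed

lemma kappa_facts:
  assumes "0 < d" "0 < C" "0 < \<eta>"
  shows "\<exists>T'>0. T' \<le> T0 \<and> (\<forall>T. 0 < T \<longrightarrow> T < T' \<longrightarrow> continuous_on {0<..<T} (\<lambda>t. C * \<kappa> d t) \<and> (\<forall>s\<in>{0<..<T}. 0 \<le> C * \<kappa> d s) \<and>
    (\<lambda>t. C * \<kappa> d t) integrable_on {0..T} \<and> integral {0<..<T} (\<lambda>t. C * \<kappa> d t) < \<eta>)"
proof -
  obtain b where b: "b > 0" "\<And>T. 0 < T \<Longrightarrow> T < b \<Longrightarrow> integral {0..T} (\<lambda>t. C * \<kappa> d t) < \<eta>"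
    using eventually_at_right_0D[OF \<kappa>_small[OF assms(1,3), of C]] by blast
  have "continuous_on {0<..<T} (\<lambda>t. C * \<kappa> d t) \<and> (\<forall>s\<in>{0<..<T}. 0 \<le> C * \<kappa> d s) \<and>
    (\<lambda>t. C * \<kappa> d t) integrable_on {0..T} \<and> integral {0<..<T} (\<lambda>t. C * \<kappa> d t) < \<eta>" if T: "0 < T" "T < min b T0" for T
  proof (intro conjI ballI)
    show "continuous_on {0<..<T} (\<lambda>t. C * \<kappa> d t)"
      by (intro continuous_intros continuous_on_subset[OF \<kappa>(1)[OF assms(1)]]) (use T in auto)
    show "0 \<le> C * \<kappa> d s" if "s \<in> {0<..<T}" for s using \<kappa>(2)[OF assms(1), of s] that T assms(2) by auto
    show "(\<lambda>t. C * \<kappa> d t) integrable_on {0..T}"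
      by (intro integrable_on_mult_right integrable_on_subinterval[OF \<kappa>(3)[OF assms(1)]]) (use T in auto)
    show "integral {0<..<T} (\<lambda>t. C * \<kappa> d t) < \<eta>"
      unfolding integral_open_interval_real[symmetric] by (rule b(2)) (use T in auto)
  qed
  then show ?thesis using b(1) T0 by (intro exI[of _ "min b T0"]) auto
qed

text \<open>The scaled difference has an integrable rate, so after shortening the time interval
  until the loss of radius is below R/8 it converges as t tends to 0. The limit is the function
  \<psi> that parametrises u relative to v.\<close>

lemma leading_coefficient:
  assumes s: "sol T R u" "sol T R v" and b: "bnd d T R u" "bnd d T R v" "0 < d"
  shows "\<exists>R' \<psi>. 0 < R' \<and> \<psi> holomorphic_on ball 0 R' \<and> uniform_limit (ball 0 R') (\<lambda>t x. tlam t x * (u t x - v t x)) \<psi> (at_right 0)"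
proof -
  have T: "0 < T" "T \<le> T0" "0 < R" using s by (auto simp: sol_def)
  obtain h C where C: "0 < C" and ev: "evolves 0 T R (\<lambda>t x. tlam t x * (u t x - v t x)) h"
    and hb: "\<forall>t\<in>{0<..<T}. \<forall>x\<in>ball 0 R. cmod (h t x) \<le> C * \<kappa> (d/2) t *
       (cmod (tlam t x * (u t x - v t x)) + cmod (deriv (\<lambda>x. tlam t x * (u t x - v t x)) x))"
    using scaled_difference[OF s b] by blast
  obtain T' where T': "T' > 0" "T' \<le> T0" and k: "\<forall>T. 0 < T \<longrightarrow> T < T' \<longrightarrow> continuous_on {0<..<T} (\<lambda>t. C * \<kappa> (d/2) t) \<and> (\<forall>s\<in>{0<..<T}. 0 \<le> C * \<kappa> (d/2) s) \<and>
    (\<lambda>t. C * \<kappa> (d/2) t) integrable_on {0..T} \<and> integral {0<..<T} (\<lambda>t. C * \<kappa> (d/2) t) < R/8"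
    using kappa_facts[of "d/2" C "R/8"] b(3) C T by auto
  define S where "S = min T T' / 2"
  have S: "0 < S" "S < T'" "S \<le> T" using T T' by (auto simp: S_def)
  note kS = k[rule_format, OF S(1,2)]
  obtain \<psi> where "\<psi> holomorphic_on ball 0 (R/4)" "uniform_limit (ball 0 (R/4)) (\<lambda>t x. tlam t x * (u t x - v t x)) \<psi> (at_right 0)"
  proof (rule evolves_limit[OF evolves_subset[OF ev order_refl S(3) order_refl] S(1) T(3)])
    show "cmod (h s x) \<le> C * \<kappa> (d/2) s * (cmod (tlam s x * (u s x - v s x)) + cmod (deriv (\<lambda>x. tlam s x * (u s x - v s x)) x))"
      if "s \<in> {0<..<S}" "x \<in> ball 0 R" for s x using hb that S by auto
  qed (use kS in auto)
  then show ?thesis using T(3) by (intro exI[of _ "R/4"] exI[of _ \<psi>]) auto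
qed

text \<open>The scaled difference starts from 0 and has an integrable rate, hence it vanishes
  wherever the disc, shrunk by less than R/2, still reaches. The factor t^(-\<lambda>) has no
  zeros.\<close>

lemma sol_unique:
  assumes s: "sol T R u" "sol T R v" and b: "bnd d T R u" "bnd d T R v" "0 < d"
    and l: "uniform_limit (ball 0 R) (\<lambda>t x. tlam t x * (u t x - v t x)) (\<lambda>_. 0) (at_right 0)"
  shows "\<exists>T' R'. 0 < T' \<and> T' \<le> T \<and> 0 < R' \<and> R' \<le> R \<and> (\<forall>t\<in>{0<..<T'}. \<forall>x\<in>ball 0 R'. u t x = v t x)"
proof -
  have T: "0 < T" "T \<le> T0" "0 < R" using s by (auto simp: sol_def)
  obtain h C where C: "0 < C" and ev: "evolves 0 T R (\<lambda>t x. tlam t x * (u t x - v t x)) h"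
    and hb: "\<forall>t\<in>{0<..<T}. \<forall>x\<in>ball 0 R. cmod (h t x) \<le> C * \<kappa> (d/2) t *
       (cmod (tlam t x * (u t x - v t x)) + cmod (deriv (\<lambda>x. tlam t x * (u t x - v t x)) x))"
    using scaled_difference[OF s b] by blast
  obtain T' where T': "T' > 0" "T' \<le> T0" and k: "\<forall>T. 0 < T \<longrightarrow> T < T' \<longrightarrow> continuous_on {0<..<T} (\<lambda>t. C * \<kappa> (d/2) t) \<and> (\<forall>s\<in>{0<..<T}. 0 \<le> C * \<kappa> (d/2) s) \<and>
    (\<lambda>t. C * \<kappa> (d/2) t) integrable_on {0..T} \<and> integral {0<..<T} (\<lambda>t. C * \<kappa> (d/2) t) < R/2"
    using kappa_facts[of "d/2" C "R/2"] b(3) C T by auto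
  define S where "S = min T T' / 2"
  have S: "0 < S" "S < T'" "S \<le> T" using T T' by (auto simp: S_def)
  note kS = k[rule_format, OF S(1,2)]
  have "tlam t x * (u t x - v t x) = 0" if t: "t \<in> {0<..<S}" and x: "x \<in> ball 0 (R/2)" for t x
  proof (rule evolves_zero[OF evolves_subset[OF ev order_refl S(3) order_refl], of "\<lambda>t. C * \<kappa> (d/2) t"])
    show "cmod (h s x) \<le> C * \<kappa> (d/2) s * (cmod (tlam s x * (u s x - v s x)) + cmod (deriv (\<lambda>x. tlam s x * (u s x - v s x)) x))"
      if "s \<in> {0<..<S}" "x \<in> ball 0 R" for s x using hb that S by auto
  qed (use kS l t x in auto)
  then have "u t x = v t x" if "t \<in> {0<..<S}" "x \<in> ball 0 (R/2)" for t x
    using that by (auto simp: tlam_def)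
  then show ?thesis using S T by (intro exI[of _ S] exI[of _ "R/2"]) auto
qed

end

section \<open>Construction of solutions\<close>

lemma deriv_cong_ball: "x \<in> ball 0 R \<Longrightarrow> (\<And>y. y \<in> ball 0 R \<Longrightarrow> f y = g y) \<Longrightarrow> deriv f x = deriv g x"
  by (rule deriv_cong_ev[OF eventually_mono[OF eventually_nhds_in_open[OF open_ball, of x 0 R]]]) simp_all

context briot_bouquet
begin

lemma lam_near:
  assumes e: "0 < e"
  shows "\<exists>R>0. R \<le> R1/2 \<and> (\<forall>x\<in>ball 0 R. \<bar>Re (lam x) - Re (lam 0)\<bar> < e)"
proof -
  have "continuous_on (ball 0 R1) lam" by (rule holomorphic_on_imp_continuous_on[OF lam_hol])
  then have "isCont lam 0" using pos by (simp add: continuous_on_eq_continuous_at)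
  then obtain d where d: "d > 0" "\<And>x. dist x 0 < d \<Longrightarrow> dist (lam x) (lam 0) < e"
    using e unfolding continuous_at_eps_delta by blast
  have "\<bar>Re (lam x) - Re (lam 0)\<bar> < e" if "x \<in> ball 0 (min d (R1/2))" for x
    using d(2)[of x] that abs_Re_le_cmod[of "lam x - lam 0"] by (simp add: dist_norm)
  then show ?thesis using d(1) pos by (intro exI[of _ "min d (R1/2)"]) auto
qed

lemma decay_sol:
  assumes s: "sol T R u" and l: "uniform_limit (ball 0 R) u (\<lambda>_. 0) (at_right 0)" "uniform_limit (ball 0 R) (\<lambda>t. deriv (u t)) (\<lambda>_. 0) (at_right 0)"
    and a: "0 < a" "a < \<mu>" "a < Re (lam 0)"
  shows "\<exists>T' R'. 0 < T' \<and> T' \<le> T \<and> 0 < R' \<and> R' \<le> R \<and> bnd a T' R' u"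
proof -
  have T: "0 < T" "T \<le> T0" "0 < R" "R \<le> R1/2" and ev: "evolves 0 T R u (\<lambda>t x. F t x (u t x) (deriv (u t) x) / of_real t)"
    and ub: "\<And>t x. t \<in> {0<..<T} \<Longrightarrow> x \<in> ball 0 R \<Longrightarrow> u t x \<in> ball 0 r1 \<and> deriv (u t) x \<in> ball 0 r1"
    using s by (auto simp: sol_def)
  show ?thesis
  proof (rule decay[OF ev T(1,2,3,4) ub _ l a])
    fix T' R' C assume "0 < T'" "T' < T" "0 < R'" "R' \<le> R" "0 < C"
      "\<And>t x. t \<in> {0<..T'} \<Longrightarrow> x \<in> ball 0 R' \<Longrightarrow> cmod (u t x) \<le> C * t powr a \<and> cmod (deriv (u t) x) \<le> C * t powr a"
    then show ?thesis unfolding bnd_def by (intro exI[of _ T'] exI[of _ R'] conjI exI[of _ C] ballI) auto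
  qed auto
qed

lemma bnd_cong:
  assumes "bnd d T R v" "\<And>t x. t \<in> {0<..<T} \<Longrightarrow> x \<in> ball 0 R \<Longrightarrow> u t x = v t x"
  shows "bnd d T R u"
proof -
  have "deriv (u t) x = deriv (v t) x" if "t \<in> {0<..<T}" "x \<in> ball 0 R" for t x
    by (rule deriv_cong_ball[OF that(2)]) (use assms(2) that in auto)
  then show ?thesis using assms unfolding bnd_def by auto
qed

text \<open>The ansatz u = t^a v about the zero function: the residual is a(t,x)/t^(a+1), of size A
  t^(\<mu>-a)/t by (c1), which is integrable since a < \<mu>. As a differs from Re \<lambda>(0,0),
  Re \<lambda>(0,x) - a keeps one sign near x = 0, as the integrating factor demands.\<close>

lemma particular:
  assumes a: "0 < a" "a < \<mu>" "a \<noteq> Re (lam 0)"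
  shows "\<exists>T R u. sol T R u \<and> bnd a T R u"
proof -
  obtain R where R: "0 < R" "R \<le> R1/2" "\<forall>x\<in>ball 0 R. \<bar>Re (lam x) - Re (lam 0)\<bar> < \<bar>Re (lam 0) - a\<bar>"
    using lam_near[of "\<bar>Re (lam 0) - a\<bar>"] a by auto
  interpret p: perturbed T0 R0 \<rho>0 A \<mu> \<Lambda> B F m T0 R 1 1 a 0 0 A "\<mu> - a" "\<lambda>_ _. 0" "\<lambda>_ _. 0" "\<lambda>_. of_real a" "\<lambda>_. 0"
    by unfold_locales (use T0 R a A pos in auto)
  have sign: "(\<forall>x\<in>ball 0 R. Re (lam x - of_real a) \<le> 0) \<or> (\<forall>x\<in>ball 0 R. 0 \<le> Re (lam x - of_real a))"
  proof (cases "a < Re (lam 0)")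
    case True
    have "0 \<le> Re (lam x - of_real a)" if x: "x \<in> ball 0 R" for x using bspec[OF R(3) x] True by auto
    then show ?thesis by blast
  next
    case False
    have "Re (lam x - of_real a) \<le> 0" if x: "x \<in> ball 0 R" for x using bspec[OF R(3) x] False a(3) by auto
    then show ?thesis by blast
  qed
  have G0: "cmod (p.G t x 0 0) \<le> A * \<kappa> (\<mu> - a) t" if t: "t \<in> {0<..<T0}" and x: "x \<in> ball 0 R" for t x
  proof -
    have x0: "x \<in> ball 0 R0" using x R pos by auto
    have "cmod (F t x 0 0) \<le> A * t powr \<mu>" using c1[OF _ x0, of t] t by (auto simp: coeff_a_def)
    moreover have "cmod (p.P t x) = t powr a" unfolding p.P_def by (subst norm_exp_ln) (use t in auto)
    moreover have "p.G t x 0 0 = F t x 0 0 / (p.P t x * of_real t)" by (simp add: p.G_def p.Z1_def p.Z2_def)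
    ultimately have "cmod (p.G t x 0 0) \<le> A * t powr \<mu> / (t powr a * t)" using t by (simp add: norm_divide norm_mult divide_right_mono)
    also have "\<dots> = A * (t powr (\<mu> - a) / t)" using t by (simp add: powr_diff)
    also have "\<dots> \<le> A * \<kappa> (\<mu> - a) t" unfolding \<kappa>_def using m(2)[of t] t A by (intro mult_left_mono divide_right_mono) auto
    finally show ?thesis .
  qed
  obtain T1 v w C where T1: "0 < T1" "T1 \<le> T0"
    and ev: "evolves 0 T1 (R/4) w (\<lambda>t x. (F t x (0 + w t x) (deriv (\<lambda>_. 0) x + deriv (w t) x) - 0) / of_real t)"
    and ub: "\<forall>t\<in>{0<..<T1}. \<forall>x\<in>ball 0 (R/4). 0 + w t x \<in> ball 0 r1 \<and> deriv (\<lambda>_. 0) x + deriv (w t) x \<in> ball 0 r1"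
    and wb: "\<forall>t\<in>{0<..<T1}. \<forall>x\<in>ball 0 (R/4). cmod (w t x) \<le> 1 * t powr a"
  proof -
    have comp: "(lam x - of_real a) * 0 = 0" for x by simp
    show thesis
      by (rule exE[OF p.perturbation_exists[OF sign comp]], rule G0, assumption, assumption, elim exE conjE, rule that) assumption+
  qed
  have "evolves 0 T1 (R/8) w (\<lambda>t x. F t x (w t x) (deriv (w t) x) / of_real t)"
    by (rule evolves_subset[OF ev[simplified]]) (use R in auto)
  moreover have "w t x \<in> ball 0 r1 \<and> deriv (w t) x \<in> ball 0 r1" if "t \<in> {0<..<T1}" "x \<in> ball 0 (R/8)" for t x
    using ub[rule_format, of t x] that R(1) by simp
  ultimately have "sol T1 (R/8) w" using T1 R by (auto simp: sol_def)
  \<comment> \<open>The general bound on the x-derivative has an exponent weakened by the logarithm,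
    which is absent for constant \<nu>. The exponent a is recovered from the bound on w itself by
    Cauchy's estimate on the disc of radius R/8.\<close>
  moreover have "bnd a T1 (R/8) w" unfolding bnd_def
  proof (intro exI[of _ "1 + 8/R"] conjI ballI)
    fix t x assume t: "t \<in> {0<..<T1}" and x: "x \<in> ball (0::complex) (R/8)"
    have sub: "ball x (R/8) \<subseteq> ball 0 (R/4)"
    proof
      fix y assume "y \<in> ball x (R/8)"
      then show "y \<in> ball 0 (R/4)" using x norm_triangle_ineq2[of y x] by (auto simp: dist_norm norm_minus_commute)
    qed
    have "x \<in> ball 0 (R/4)" using x R by auto
    then have w: "cmod (w t x) \<le> t powr a" using wb t by auto
    have "w t holomorphic_on ball 0 (R/4)" using ev t by (auto simp: evolves_def)
    then have "cmod (deriv (w t) x) \<le> t powr a / (R/8)"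
      using wb t sub R(1) by (intro Cauchy_deriv_bound holomorphic_on_subset[OF _ sub]) auto
    moreover have "t powr a / (R/8) \<le> (1 + 8/R) * t powr a" using R(1) by (simp add: field_simps)
    moreover have "t powr a \<le> (1 + 8/R) * t powr a" using R(1) by (simp add: field_simps)
    ultimately show "cmod (w t x) \<le> (1 + 8/R) * t powr a" "cmod (deriv (w t) x) \<le> (1 + 8/R) * t powr a" using w by linarith+
  qed (use R(1) in \<open>simp add: add_pos_pos\<close>)
  ultimately show ?thesis by blast
qed

text \<open>A single solution must have every exponent below \<mu>. If \<mu> \<le> Re
  \<lambda>(0,0), any decaying solution has this property by \<open>decay_sol\<close>. Otherwise one
  exponent a0 above Re \<lambda>(0,0) is fixed: solutions decaying that fast are unique, so the
  solution found for a larger exponent coincides with the fixed one near the origin.\<close>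

lemma existence_decay:
  "\<exists>T R u. sol T R u \<and> (\<forall>a. 0 < a \<and> a < \<mu> \<longrightarrow> (\<exists>T' R'. 0 < T' \<and> T' \<le> T \<and> 0 < R' \<and> R' \<le> R \<and> bnd a T' R' u))"
proof (cases "\<mu> \<le> Re (lam 0)")
  case True
  obtain T R u where u: "sol T R u" "bnd (\<mu>/2) T R u" using particular[of "\<mu>/2"] \<mu> True by auto
  have T: "0 < T" using u(1) by (simp add: sol_def)
  have m2: "0 < \<mu>/2" using \<mu> by simp
  have "\<exists>T' R'. 0 < T' \<and> T' \<le> T \<and> 0 < R' \<and> R' \<le> R \<and> bnd a T' R' u" if a: "0 < a" "a < \<mu>" for a
    by (rule decay_sol[OF u(1) bnd_limits[OF u(2) m2 T] a]) (use a True in auto)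
  then show ?thesis using u(1) by blast
next
  case False
  define L where "L = Re (lam 0)"
  have L: "0 < L" "L < \<mu>" using Re_lambda False by (simp_all add: lam_def L_def)
  \<comment> \<open>Any value strictly between Re \<lambda>(0,0) and \<mu> will do.\<close>
  define a0 where "a0 = (L + \<mu>)/2"
  have a0: "0 < a0" "L < a0" "a0 < \<mu>" using L by (auto simp: a0_def)
  obtain T R u where u: "sol T R u" "bnd a0 T R u" using particular[of a0] a0 unfolding L_def by auto
  have T: "0 < T" "T \<le> T0" "0 < R" using u(1) by (auto simp: sol_def)
  have "\<exists>T' R'. 0 < T' \<and> T' \<le> T \<and> 0 < R' \<and> R' \<le> R \<and> bnd a T' R' u" if a: "0 < a" "a < \<mu>" for a
  proof (cases "a \<le> a0")
    case True
    show ?thesis using bnd_mono[OF u(2) T(2) True] T by blast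
  next
    case False
    obtain S Q v where v: "sol S Q v" "bnd a S Q v" using particular[of a] a False a0 unfolding L_def by auto
    have S: "0 < S" "S \<le> T0" "0 < Q" using v(1) by (auto simp: sol_def)
    obtain R2 where R2: "0 < R2" "\<forall>x\<in>ball 0 R2. \<bar>Re (lam x) - L\<bar> < (\<mu> - L)/8" using lam_near[of "(\<mu> - L)/8"] L unfolding L_def by auto
    define T' where "T' = min T S"
    define R' where "R' = min (min R Q) R2"
    have TR': "0 < T'" "T' \<le> T" "T' \<le> S" "0 < R'" "R' \<le> R" "R' \<le> Q" "R' \<le> R2" "T' \<le> T0"
      using T S R2(1) by (auto simp: T'_def R'_def)
    have su: "sol T' R' u" "sol T' R' v" using sol_subset[OF u(1)] sol_subset[OF v(1)] TR' by auto
    have bu: "bnd a0 T' R' u" "bnd a T' R' v" using bnd_subset[OF u(2)] bnd_subset[OF v(2)] TR' by auto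
    have bv: "bnd a0 T' R' v" using bnd_mono[OF bu(2) TR'(8)] False by simp
    obtain Cu where Cu: "\<And>t x. t \<in> {0<..<T'} \<Longrightarrow> x \<in> ball 0 R' \<Longrightarrow> cmod (u t x) \<le> Cu * t powr a0"
      using bu(1) unfolding bnd_def by blast
    obtain Cv where Cv: "\<And>t x. t \<in> {0<..<T'} \<Longrightarrow> x \<in> ball 0 R' \<Longrightarrow> cmod (v t x) \<le> Cv * t powr a0"
      using bv unfolding bnd_def by blast
    \<comment> \<open>An upper bound for Re \<lambda>(0,x) near x = 0 that is still below a0, so
      that t^(-\<lambda>) times the difference tends to 0 like a positive power of t.\<close>
    define c where "c = L + (\<mu> - L)/8"
    have lim: "uniform_limit (ball 0 R') (\<lambda>t x. tlam t x * (u t x - v t x)) (\<lambda>_. 0) (at_right 0)"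
    proof (rule uniform_limit_powr[OF TR'(1)])
      show "0 < a0 - c" using L by (simp add: a0_def c_def field_simps)
      fix t and x :: complex assume t: "t \<in> {0<..<T'}" and x: "x \<in> ball 0 R'"
      have tt: "0 < t" "t < 1" using t TR' T0 by auto
      have "x \<in> ball 0 R2" using x TR' by auto
      then have "\<bar>Re (lam x) - L\<bar> < (\<mu> - L)/8" using R2(2) by blast
      then have "Re (lam x) \<le> c" unfolding c_def by linarith
      then have "cmod (tlam t x) \<le> t powr (-c)"
        unfolding tlam_def using norm_exp_ln[OF tt(1), of "- lam x"] powr_le_powr[OF tt, of "-c" "- Re (lam x)"] by simp
      moreover have "cmod (u t x - v t x) \<le> (Cu + Cv) * t powr a0"
        using Cu[OF t x] Cv[OF t x] norm_triangle_ineq4[of "u t x" "v t x"] unfolding distrib_right by linarith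
      ultimately have "cmod (tlam t x) * cmod (u t x - v t x) \<le> t powr (-c) * ((Cu + Cv) * t powr a0)"
        by (intro mult_mono) auto
      also have "\<dots> = (Cu + Cv) * t powr (a0 - c)" using tt by (simp add: powr_diff powr_minus field_simps)
      finally show "cmod (tlam t x * (u t x - v t x)) \<le> (Cu + Cv) * t powr (a0 - c)" by (simp add: norm_mult)
    qed
    obtain T2 R2 where T2: "0 < T2" "T2 \<le> T'" "0 < R2" "R2 \<le> R'" "\<forall>t\<in>{0<..<T2}. \<forall>x\<in>ball 0 R2. u t x = v t x"
      using sol_unique[OF su bu(1) bv a0(1) lim] by blast
    have "bnd a T2 R2 u" by (rule bnd_cong[OF bnd_subset[OF bu(2) T2(2,4)]]) (use T2(5) in auto)
    moreover have "T2 \<le> T" "R2 \<le> R" using T2 TR' by auto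
    ultimately show ?thesis using T2(1,3) by blast
  qed
  then show ?thesis using u(1) by blast
qed

text \<open>With \<nu> = \<lambda> the integrating factor is constant, so the initial value \<psi>
  at t = 0 is free, and v is itself the scaled difference t^(-\<lambda>) (u - u0).\<close>

lemma existence_leading:
  assumes s: "sol T R u0" and b: "bnd d T R u0" "0 < d" and \<psi>: "\<psi> holomorphic_on ball 0 \<rho>" "0 < \<rho>"
  shows "\<exists>T' R' u d'. 0 < d' \<and> T' \<le> T \<and> R' \<le> R \<and> sol T' R' u \<and> bnd d' T' R' u \<and>
    uniform_limit (ball 0 R') (\<lambda>t x. tlam t x * (u t x - u0 t x)) \<psi> (at_right 0)"
proof -
  have T: "0 < T" "T \<le> T0" "0 < R" "R \<le> R1/2" and ev: "evolves 0 T R u0 (\<lambda>t x. F t x (u0 t x) (deriv (u0 t) x) / of_real t)"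
    using s by (auto simp: sol_def)
  obtain C0 where C0: "0 < C0" "\<And>t x. t \<in> {0<..<T} \<Longrightarrow> x \<in> ball 0 R \<Longrightarrow> cmod (u0 t x) \<le> C0 * t powr d \<and> cmod (deriv (u0 t) x) \<le> C0 * t powr d"
    using b unfolding bnd_def by blast
  have L: "0 < Re (lam 0)" using Re_lambda by (simp add: lam_def)
  obtain R2 where R2: "0 < R2" "R2 \<le> R1/2" "\<forall>x\<in>ball 0 R2. \<bar>Re (lam x) - Re (lam 0)\<bar> < Re (lam 0)/2"
    using lam_near[of "Re (lam 0)/2"] L by auto
  define Q where "Q = min (min R R2) (\<rho>/2)"
  have Q: "0 < Q" "Q \<le> R" "Q \<le> R2" "Q < \<rho>" "Q \<le> R1/2" "Q < R1" using T R2 \<psi>(2) pos by (auto simp: Q_def)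
  have cQ: "cball (0::complex) Q \<subseteq> ball 0 R1" "cball (0::complex) Q \<subseteq> ball 0 \<rho>" "ball (0::complex) Q \<subseteq> cball 0 Q" using Q by auto
  have bounded_on: "\<exists>M>0. \<forall>x\<in>cball 0 Q. cmod (f x) \<le> M" if "continuous_on (cball (0::complex) Q) f" for f :: "complex \<Rightarrow> complex"
  proof -
    have "bounded (f ` cball 0 Q)" using that by (intro compact_imp_bounded compact_continuous_image) auto
    then show ?thesis unfolding bounded_pos by auto
  qed
  obtain N where N: "N > 0" "\<forall>x\<in>cball 0 Q. cmod (deriv lam x) \<le> N"
    using bounded_on[OF continuous_on_subset[OF holomorphic_on_imp_continuous_on[OF holomorphic_deriv[OF lam_hol open_ball]] cQ(1)]] by blast
  obtain M where M: "M > 0" "\<forall>x\<in>cball 0 Q. cmod (\<psi> x) \<le> M"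
    using bounded_on[OF continuous_on_subset[OF holomorphic_on_imp_continuous_on[OF \<psi>(1)] cQ(2)]] by blast
  obtain M' where M': "M' > 0" "\<forall>x\<in>cball 0 Q. cmod (deriv \<psi> x) \<le> M'"
    using bounded_on[OF continuous_on_subset[OF holomorphic_on_imp_continuous_on[OF holomorphic_deriv[OF \<psi>(1) open_ball]] cQ(2)]] by blast
  define r where "r = 2 * (M + M' + 1)"
  let ?f0 = "\<lambda>t x. F t x (u0 t x) (deriv (u0 t) x)"
  have f0c: "continuous_on ({0<..<T} \<times> ball 0 R) (\<lambda>(t,x). ?f0 t x)"
  proof (rule continuous_on_eq)
    have "continuous_on ({0<..<T} \<times> ball 0 R) (\<lambda>(t,x). ?f0 t x / of_real t)" using ev unfolding evolves_def by blast
    then show "continuous_on ({0<..<T} \<times> ball 0 R) (\<lambda>p. of_real (fst p) * (\<lambda>(t,x). ?f0 t x / of_real t) p)"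
      by (intro continuous_on_mult continuous_on_of_real continuous_on_fst continuous_on_id)
  qed auto
  have f0h: "?f0 t holomorphic_on ball 0 R" if t: "t \<in> {0<..<T}" for t
  proof (rule holomorphic_transform)
    have "(\<lambda>x. ?f0 t x / of_real t) holomorphic_on ball 0 R" using ev t unfolding evolves_def by blast
    then show "(\<lambda>x. of_real t * (?f0 t x / of_real t)) holomorphic_on ball 0 R"
      by (rule holomorphic_on_mult[OF holomorphic_on_const])
  qed (use t in auto)
  have QR: "ball (0::complex) Q \<subseteq> ball 0 R" "{0<..<T} \<times> ball (0::complex) Q \<subseteq> {0<..<T} \<times> ball 0 R" using Q by auto
  \<comment> \<open>The given solution serves as base point, so the residual vanishes and its
    constant is 0. The lower bound Re \<lambda>(0,0)/2 for Re \<lambda>(0,x) holds by the choice of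
    R2.\<close>
  interpret p: perturbed T0 R0 \<rho>0 A \<mu> \<Lambda> B F m T Q r d "Re (lam 0)/2" C0 N 0 1 u0 ?f0 lam \<psi>
  proof unfold_locales
    show "continuous_on ({0<..<T} \<times> ball 0 Q) (\<lambda>(t,x). u0 t x)"
      using ev unfolding evolves_def by (blast intro: continuous_on_subset[OF _ QR(2)])
    show "continuous_on ({0<..<T} \<times> ball 0 Q) (\<lambda>(t,x). ?f0 t x)" by (rule continuous_on_subset[OF f0c QR(2)])
    show "u0 t holomorphic_on ball 0 Q" if "t \<in> {0<..<T}" for t
      using ev that unfolding evolves_def by (blast intro: holomorphic_on_subset[OF _ QR(1)])
    show "?f0 t holomorphic_on ball 0 Q" if "t \<in> {0<..<T}" for t
      by (rule holomorphic_on_subset[OF f0h[OF that] QR(1)])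
    show "cmod (u0 t x) \<le> C0 * t powr d \<and> cmod (deriv (u0 t) x) \<le> C0 * t powr d" if "t \<in> {0<..<T}" "x \<in> ball 0 Q" for t x
      by (rule C0(2)[OF that(1) subsetD[OF QR(1) that(2)]])
    show "lam holomorphic_on ball 0 Q" by (rule holomorphic_on_subset[OF lam_hol]) (use Q in auto)
    show "\<psi> holomorphic_on ball 0 Q" by (rule holomorphic_on_subset[OF \<psi>(1)]) (use Q in auto)
    show "cmod (deriv lam x) \<le> N" if "x \<in> ball 0 Q" for x using N(2) that cQ(3) by blast
    show "Re (lam 0)/2 \<le> Re (lam x)" if "x \<in> ball 0 Q" for x
    proof -
      have "x \<in> ball 0 R2" using that Q by auto
      then have "\<bar>Re (lam x) - Re (lam 0)\<bar> < Re (lam 0)/2" using R2(3) by blast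
      then show ?thesis by linarith
    qed
    show "cmod (\<psi> x) < r/2" "cmod (deriv \<psi> x) < r/2" if "x \<in> ball 0 Q" for x
    proof -
      have "x \<in> cball 0 Q" using that cQ(3) by blast
      then have "cmod (\<psi> x) \<le> M" "cmod (deriv \<psi> x) \<le> M'" using M(2) M'(2) by blast+
      then show "cmod (\<psi> x) < r/2" "cmod (deriv \<psi> x) < r/2" using M(1) M'(1) by (auto simp: r_def)
    qed
  qed (use T Q C0 b L M M' in \<open>auto simp: r_def\<close>)
  have "cmod (p.G t x 0 0) \<le> 0 * \<kappa> 1 t" for t x by (simp add: p.G_def p.Z1_def p.Z2_def)
  then obtain T1 v w C where T1: "0 < T1" "T1 \<le> T" and w: "w = (\<lambda>t x. p.P t x * v t x)"
    and evw: "evolves 0 T1 (Q/4) w (\<lambda>t x. (F t x (u0 t x + w t x) (deriv (u0 t) x + deriv (w t) x) - ?f0 t x) / of_real t)"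
    and ub: "\<forall>t\<in>{0<..<T1}. \<forall>x\<in>ball 0 (Q/4). u0 t x + w t x \<in> ball 0 r1 \<and> deriv (u0 t) x + deriv (w t) x \<in> ball 0 r1"
    and wb: "\<forall>t\<in>{0<..<T1}. \<forall>x\<in>ball 0 (Q/4). cmod (w t x) \<le> C * t powr p.d \<and> cmod (deriv (w t) x) \<le> C * t powr p.d"
    and ul: "(\<forall>x\<in>ball 0 Q. Re (lam x - lam x) \<le> 0) \<longrightarrow> uniform_limit (ball 0 (Q/4)) v \<psi> (at_right 0)"
  proof -
    assume G0: "\<And>t x. cmod (p.G t x 0 0) \<le> 0 * \<kappa> 1 t"
    have sign: "(\<forall>x\<in>ball 0 Q. Re (lam x - lam x) \<le> 0) \<or> (\<forall>x\<in>ball 0 Q. 0 \<le> Re (lam x - lam x))" by simp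
    have comp: "(lam x - lam x) * \<psi> x = 0" for x by simp
    show thesis using p.perturbation_exists[OF sign comp G0] by (elim exE conjE) (rule that)
  qed
  define u where "u = (\<lambda>t x. u0 t x + 1 * w t x)"
  have ev0: "evolves 0 T1 (Q/4) u0 (\<lambda>t x. ?f0 t x / of_real t)" by (rule evolves_subset[OF ev]) (use T1 Q in auto)
  have du: "deriv (u t) x = deriv (u0 t) x + deriv (w t) x" if t: "t \<in> {0<..<T1}" and x: "x \<in> ball 0 (Q/4)" for t x
  proof -
    have "(u0 t has_field_derivative deriv (u0 t) x) (at x)" "(w t has_field_derivative deriv (w t) x) (at x)"
      using ev0 evw t by (auto simp: evolves_def intro!: holomorphic_derivI[OF _ open_ball x])
    then have "(u t has_field_derivative deriv (u0 t) x + deriv (w t) x) (at x)"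
      unfolding u_def by (auto intro!: derivative_eq_intros)
    then show ?thesis by (rule DERIV_imp_deriv)
  qed
  have "evolves 0 T1 (Q/4) u (\<lambda>t x. F t x (u t x) (deriv (u t) x) / of_real t)"
  proof (rule evolves_cong[OF evolves_lincomb[OF ev0 evw, of 1, folded u_def]])
    fix t and x :: complex assume tx: "t \<in> {0<..<T1}" "x \<in> ball 0 (Q/4)"
    show "?f0 t x / of_real t + 1 * ((F t x (u0 t x + w t x) (deriv (u0 t) x + deriv (w t) x) - ?f0 t x) / of_real t) = F t x (u t x) (deriv (u t) x) / of_real t"
      unfolding du[OF tx] by (simp add: u_def diff_divide_distrib)
  qed
  moreover have "u t x \<in> ball 0 r1 \<and> deriv (u t) x \<in> ball 0 r1" if tx: "t \<in> {0<..<T1}" "x \<in> ball 0 (Q/4)" for t x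
    using ub tx du[OF tx] by (simp add: u_def)
  ultimately have sol: "sol T1 (Q/4) u" using T1 T Q by (auto simp: sol_def)
  have d': "0 < p.d" "p.d \<le> d" using b(2) L by (auto simp: p.d_def)
  have bu: "bnd p.d T1 (Q/4) u" unfolding bnd_def
  proof (intro exI[of _ "C0 + \<bar>C\<bar>"] conjI ballI)
    fix t x assume t: "t \<in> {0<..<T1}" and x: "x \<in> ball (0::complex) (Q/4)"
    have xR: "x \<in> ball 0 R" using x Q by auto
    have tT: "t \<in> {0<..<T}" "0 < t" "t < 1" using t T1 T T0 by auto
    have "C0 * t powr d \<le> C0 * t powr p.d" using C0(1) powr_le_powr[OF tT(2,3) d'(2)] by (intro mult_left_mono) auto
    moreover have "C * t powr p.d \<le> \<bar>C\<bar> * t powr p.d" by (intro mult_right_mono) auto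
    moreover have "cmod (w t x) \<le> C * t powr p.d" "cmod (deriv (w t) x) \<le> C * t powr p.d" using wb t x by auto
    ultimately show "cmod (u t x) \<le> (C0 + \<bar>C\<bar>) * t powr p.d" "cmod (deriv (u t) x) \<le> (C0 + \<bar>C\<bar>) * t powr p.d"
      unfolding du[OF t x] unfolding u_def distrib_right mult_1 using C0(2)[OF tT(1) xR] norm_triangle_ineq[of "u0 t x" "w t x"] norm_triangle_ineq[of "deriv (u0 t) x" "deriv (w t) x"]
      by linarith+
  qed (use C0 in auto)
  have "(\<lambda>t x. tlam t x * (u t x - u0 t x)) = v"
  proof (intro ext)
    fix t x
    have "tlam t x * p.P t x = 1" unfolding tlam_def p.P_def by (simp add: exp_add[symmetric])
    then show "tlam t x * (u t x - u0 t x) = v t x" by (simp add: u_def w mult.assoc[symmetric])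
  qed
  then have "uniform_limit (ball 0 (Q/4)) (\<lambda>t x. tlam t x * (u t x - u0 t x)) \<psi> (at_right 0)" using ul by simp
  moreover have "Q/4 \<le> R" using Q by simp
  ultimately show ?thesis using d'(1) T1 sol bu by blast
qed

lemma sol_diff_germ:
  assumes s: "sol T R u" "sol T R v" and b: "bnd d T R u" "bnd d T R v" "0 < d"
  shows "germ (extend0 (\<lambda>t x. u t x - v t x)) \<in> X1_germs d"
proof -
  have T: "0 < T" "0 < R" and evu: "evolves 0 T R u (\<lambda>t x. F t x (u t x) (deriv (u t) x) / of_real t)"
    and evv: "evolves 0 T R v (\<lambda>t x. F t x (v t x) (deriv (v t) x) / of_real t)"
    using s by (auto simp: sol_def)
  obtain Cu where Cu: "\<And>t x. t \<in> {0<..<T} \<Longrightarrow> x \<in> ball 0 R \<Longrightarrow> cmod (u t x) \<le> Cu * t powr d \<and> cmod (deriv (u t) x) \<le> Cu * t powr d" "Cu > 0"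
    using b unfolding bnd_def by blast
  obtain Cv where Cv: "\<And>t x. t \<in> {0<..<T} \<Longrightarrow> x \<in> ball 0 R \<Longrightarrow> cmod (v t x) \<le> Cv * t powr d \<and> cmod (deriv (v t) x) \<le> Cv * t powr d" "Cv > 0"
    using b unfolding bnd_def by blast
  have "extend0 (\<lambda>t x. u t x + (-1) * v t x) \<in> X1_pow d (T/2) R"
  proof (rule extend0_X1_pow(1)[OF evolves_lincomb[OF evu evv, of "-1"] _ b(3)])
    show "0 < Cu + Cv" using Cu Cv by simp
    fix t and x :: complex assume t: "t \<in> {0<..<T}" and x: "x \<in> ball 0 R"
    have "(u t has_field_derivative deriv (u t) x) (at x)" "(v t has_field_derivative deriv (v t) x) (at x)"
      using evu evv t by (auto simp: evolves_def intro!: holomorphic_derivI[OF _ open_ball x])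
    then have "((\<lambda>x. u t x + (-1) * v t x) has_field_derivative deriv (u t) x - deriv (v t) x) (at x)"
      by (auto intro!: derivative_eq_intros)
    then have d: "deriv (\<lambda>x. u t x + (-1) * v t x) x = deriv (u t) x - deriv (v t) x" by (rule DERIV_imp_deriv)
    show "cmod (u t x + (-1) * v t x) \<le> (Cu + Cv) * t powr d \<and> cmod (deriv (\<lambda>x. u t x + (-1) * v t x) x) \<le> (Cu + Cv) * t powr d"
      unfolding d distrib_right using Cu(1)[OF t x] Cv(1)[OF t x] norm_triangle_ineq4[of "u t x" "v t x"] norm_triangle_ineq4[of "deriv (u t) x" "deriv (v t) x"]
      by auto
  next
    have "uniform_limit (ball 0 R) (\<lambda>t x. of_real t * (F t x (u t x) (deriv (u t) x) / of_real t) - of_real t * (F t x (v t x) (deriv (v t) x) / of_real t)) (\<lambda>x. 0 - 0) (at_right 0)"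
      by (rule uniform_limit_minus[OF sol_rhs_limit[OF s(1) b(1,3)] sol_rhs_limit[OF s(2) b(2,3)]])
    then show "uniform_limit (ball 0 R) (\<lambda>t x. of_real t * (F t x (u t x) (deriv (u t) x) / of_real t + (-1) * (F t x (v t x) (deriv (v t) x) / of_real t))) (\<lambda>_. 0) (at_right 0)"
      by (simp add: algebra_simps)
  qed (use T in auto)
  then have "extend0 (\<lambda>t x. u t x - v t x) \<in> X1_pow d (T/2) R" by simp
  then show ?thesis unfolding X1_germs_def using T half_gt_zero by blast
qed

section \<open>Leading terms of germs\<close>

lemma powr_tlam: "0 < t \<Longrightarrow> complex_of_real t powr (- coeff_lambda F 0 x) = tlam t x"
  by (simp add: powr_def tlam_def lam_def Ln_of_real)

text \<open>The definition allows some representatives of both germs; here they may be prescribed,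
  since a change of representative affects neither small t nor, after shrinking the disc, the limit
  function.\<close>

lemma has_leading_term_iff:
  "has_leading_term F (germ w) (abs_xgerm \<psi>) \<longleftrightarrow> (\<exists>\<delta>>0. uniform_limit (ball 0 \<delta>) (\<lambda>t x. tlam t x * w t x) \<psi> (at_right 0))" (is "?l \<longleftrightarrow> ?r")
proof
  assume ?l
  then obtain w' \<psi>' \<delta> where w': "germ w = germ w'" "abs_xgerm \<psi> = abs_xgerm \<psi>'" "\<delta> > 0"
    and ul: "uniform_limit (ball 0 \<delta>) (\<lambda>t x. complex_of_real t powr (- coeff_lambda F 0 x) * w' t x) \<psi>' (at_right 0)"
    unfolding has_leading_term_def by blast
  obtain e d where ed: "e > 0" "d > 0" "\<forall>t\<in>{0..e}. \<forall>x\<in>ball 0 d. w t x = w' t x" using w'(1) unfolding germ_eq_iff tx_eq_def by blast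
  obtain d2 where d2: "d2 > 0" "\<forall>x\<in>ball 0 d2. \<psi> x = \<psi>' x" using w'(2) unfolding xgerm.abs_eq_iff x_eq_def by blast
  let ?d = "min \<delta> (min d d2)"
  have "\<forall>\<^sub>F t in at_right 0. t < e" using ed by (auto simp: eventually_at_right_field)
  then have "\<forall>\<^sub>F t in at_right 0. \<forall>x\<in>ball 0 ?d. complex_of_real t powr (- coeff_lambda F 0 x) * w' t x = tlam t x * w t x"
    using eventually_at_right_less[of 0] by eventually_elim (use ed(3) powr_tlam in auto)
  moreover have "\<psi>' x = \<psi> x" if "x \<in> ball 0 ?d" for x using d2(2) that by auto
  moreover have "uniform_limit (ball 0 ?d) (\<lambda>t x. complex_of_real t powr (- coeff_lambda F 0 x) * w' t x) \<psi>' (at_right 0)"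
    by (rule uniform_limit_on_subset[OF ul]) auto
  ultimately have "uniform_limit (ball 0 ?d) (\<lambda>t x. tlam t x * w t x) \<psi> (at_right 0)"
    by (rule iffD1[OF uniform_limit_cong])
  then show ?r using w'(3) ed(2) d2(1) by (intro exI[of _ ?d]) auto
next
  assume ?r
  then obtain \<delta> where \<delta>: "\<delta> > 0" "uniform_limit (ball 0 \<delta>) (\<lambda>t x. tlam t x * w t x) \<psi> (at_right 0)" by blast
  have "\<forall>\<^sub>F t in at_right 0. \<forall>x\<in>ball 0 \<delta>. tlam t x * w t x = complex_of_real t powr (- coeff_lambda F 0 x) * w t x"
    using eventually_at_right_less[of 0] by eventually_elim (use powr_tlam in auto)
  then have "uniform_limit (ball 0 \<delta>) (\<lambda>t x. complex_of_real t powr (- coeff_lambda F 0 x) * w t x) \<psi> (at_right 0)"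
    using \<delta>(2) by (rule iffD1[OF uniform_limit_cong[OF _ refl]])
  then show ?l unfolding has_leading_term_def using \<delta>(1) by blast
qed

text \<open>The germ w of the definition is the difference u - u0 continued by zero. As germs also
  compare values at t = 0, the sum is the right one only because u0 vanishes there.\<close>

lemma is_U_iff:
  assumes s: "sol T R u0" and b: "bnd d T R u0" "0 < d" and z: "\<forall>x\<in>ball 0 R. u0 0 x = 0"
  shows "is_U F T0 R0 \<rho>0 (germ u0) (abs_xgerm \<psi>) g \<longleftrightarrow>
    (\<exists>u d T R. 0 < d \<and> g = germ (extend0 u) \<and> sol T R u \<and> bnd d T R u \<and>
      uniform_limit (ball 0 R) (\<lambda>t x. tlam t x * (u t x - u0 t x)) \<psi> (at_right 0))" (is "?l \<longleftrightarrow> ?r")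
proof
  assume l: ?l
  then have g: "g \<in> solutions F T0 R0 \<rho>0 X1_plus" by (simp add: is_U_def)
  obtain w where w: "g = germ u0 + germ w" "has_leading_term F (germ w) (abs_xgerm \<psi>)"
    using l unfolding is_U_def has_leading_term_def by blast
  obtain u d' T' R' where u: "0 < d'" "g = germ u" "sol T' R' u" "bnd d' T' R' u" "\<forall>x\<in>ball 0 R'. u 0 x = 0"
    using X1_plus_sol[OF g] by blast
  have TR': "0 < T'" "0 < R'" using u(3) by (auto simp: sol_def)
  obtain \<delta> where \<delta>: "\<delta> > 0" "uniform_limit (ball 0 \<delta>) (\<lambda>t x. tlam t x * w t x) \<psi> (at_right 0)"
    using w(2) unfolding has_leading_term_iff by blast
  have "germ u = germ (\<lambda>t x. u0 t x + w t x)" using u(2) w(1) by (simp add: germ_plus)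
  then obtain e d2 where ed: "e > 0" "d2 > 0" "\<forall>t\<in>{0..e}. \<forall>x\<in>ball 0 d2. u t x = u0 t x + w t x" unfolding germ_eq_iff tx_eq_def by blast
  let ?R = "min (min R' \<delta>) d2"
  have R: "0 < ?R" "?R \<le> R'" using TR' \<delta> ed by auto
  have "\<forall>\<^sub>F t in at_right 0. t < e" using ed by (auto simp: eventually_at_right_field)
  then have "\<forall>\<^sub>F t in at_right 0. \<forall>x\<in>ball 0 ?R. tlam t x * w t x = tlam t x * (u t x - u0 t x)"
    using eventually_at_right_less[of 0] by eventually_elim (use ed(3) in auto)
  moreover have "uniform_limit (ball 0 ?R) (\<lambda>t x. tlam t x * w t x) \<psi> (at_right 0)"
    by (rule uniform_limit_on_subset[OF \<delta>(2)]) auto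
  ultimately have "uniform_limit (ball 0 ?R) (\<lambda>t x. tlam t x * (u t x - u0 t x)) \<psi> (at_right 0)"
    by (rule iffD1[OF uniform_limit_cong[OF _ refl]])
  moreover have "sol T' ?R u" "bnd d' T' ?R u" using sol_subset[OF u(3) TR'(1) order_refl R] bnd_subset[OF u(4) order_refl R(2)] by auto
  moreover have "g = germ (extend0 u)" unfolding u(2) by (rule germ_extend0[symmetric, OF TR']) (use u(5) in auto)
  ultimately show ?r using u(1) by blast
next
  assume ?r
  then obtain u d' T' R' where u: "0 < d'" "g = germ (extend0 u)" "sol T' R' u" "bnd d' T' R' u"
    and ul: "uniform_limit (ball 0 R') (\<lambda>t x. tlam t x * (u t x - u0 t x)) \<psi> (at_right 0)" by blast
  have TR: "0 < T'" "0 < R'" "0 < T" "0 < R" "T \<le> T0" "T' \<le> T0" using u(3) s by (auto simp: sol_def)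
  have g: "g \<in> solutions F T0 R0 \<rho>0 X1_plus" unfolding u(2) by (rule sol_germ(3)[OF u(3,4,1)])
  define S where "S = min T T'"
  define Q where "Q = min R R'"
  define c where "c = min d d'"
  have S: "0 < S" "S \<le> T" "S \<le> T'" "0 < Q" "Q \<le> R" "Q \<le> R'" "0 < c" "c \<le> d" "c \<le> d'" "S \<le> T0"
    using TR u(1) b(2) by (auto simp: S_def Q_def c_def)
  define w where "w = extend0 (\<lambda>t x. u t x - u0 t x)"
  have "germ w \<in> X1_germs c" unfolding w_def
    by (rule sol_diff_germ[OF sol_subset[OF u(3) S(1,3,4,6)] sol_subset[OF s S(1,2,4,5)]
        bnd_mono[OF bnd_subset[OF u(4) S(3,6)] S(10,9)] bnd_mono[OF bnd_subset[OF b(1) S(2,5)] S(10,8)] S(7)])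
  then have w: "germ w \<in> X1_plus" unfolding X1_plus_def using S(7) by blast
  have "tx_eq (extend0 u) (\<lambda>t x. u0 t x + w t x)"
    unfolding tx_eq_def
  proof (intro exI conjI ballI)
    show "0 < (1::real)" by simp
    show "0 < Q" by (rule S)
    fix t x assume t: "t \<in> {0..1::real}" and x: "x \<in> ball (0::complex) Q"
    have "x \<in> ball 0 R" using x S by auto
    then show "extend0 u t x = u0 t x + w t x" using t z by (cases "t = 0") (auto simp: w_def extend0_def)
  qed
  then have gw: "g = germ u0 + germ w" unfolding u(2) germ_plus germ_eq_iff .
  have "\<forall>\<^sub>F t in at_right 0. \<forall>x\<in>ball 0 R'. tlam t x * (u t x - u0 t x) = tlam t x * w t x"
    using eventually_at_right_less[of 0] by eventually_elim (auto simp: w_def extend0_def)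
  then have "uniform_limit (ball 0 R') (\<lambda>t x. tlam t x * w t x) \<psi> (at_right 0)"
    using ul by (rule iffD1[OF uniform_limit_cong[OF _ refl]])
  then have "has_leading_term F (germ w) (abs_xgerm \<psi>)" unfolding has_leading_term_iff using TR by blast
  then show ?l unfolding is_U_def using g w gw by blast
qed

text \<open>Subtracting the two scaled differences eliminates u0 and leaves t^(-\<lambda>) (u - v)
  with limit \<psi> - \<psi> = 0.\<close>

lemma leading_term_unique:
  assumes d: "0 < d" "0 < d'" and s: "sol T R u" "sol T' R' v" and b: "bnd d T R u" "bnd d' T' R' v"
    and ul: "uniform_limit (ball 0 R) (\<lambda>t x. tlam t x * (u t x - u0 t x)) \<psi> (at_right 0)"
      "uniform_limit (ball 0 R') (\<lambda>t x. tlam t x * (v t x - u0 t x)) \<psi> (at_right 0)"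
  shows "germ (extend0 u) = germ (extend0 v)"
proof -
  have TR: "0 < T'" "0 < R'" "0 < T" "0 < R" "T \<le> T0" "T' \<le> T0" using s by (auto simp: sol_def)
  define S where "S = min T T'"
  define Q where "Q = min R R'"
  define c where "c = min d d'"
  have S: "0 < S" "S \<le> T" "S \<le> T'" "0 < Q" "Q \<le> R" "Q \<le> R'" "0 < c" "c \<le> d" "c \<le> d'" "S \<le> T0"
    using TR d by (auto simp: S_def Q_def c_def)
  have "uniform_limit (ball 0 Q) (\<lambda>t x. tlam t x * (u t x - u0 t x) - tlam t x * (v t x - u0 t x)) (\<lambda>x. \<psi> x - \<psi> x) (at_right 0)"
    by (intro uniform_limit_minus uniform_limit_on_subset[OF ul(1)] uniform_limit_on_subset[OF ul(2)]) (use S in auto)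
  then have l: "uniform_limit (ball 0 Q) (\<lambda>t x. tlam t x * (u t x - v t x)) (\<lambda>_. 0) (at_right 0)"
    by (simp add: algebra_simps)
  obtain e r where e: "0 < e" "e \<le> S" "0 < r" "r \<le> Q" "\<forall>t\<in>{0<..<e}. \<forall>x\<in>ball 0 r. u t x = v t x"
    using sol_unique[OF sol_subset[OF s(1) S(1,2,4,5)] sol_subset[OF s(2) S(1,3,4,6)]
        bnd_mono[OF bnd_subset[OF b(1) S(2,5)] S(10,8)] bnd_mono[OF bnd_subset[OF b(2) S(3,6)] S(10,9)] S(7) l] by blast
  show ?thesis by (rule germ_cong_sol[OF e(1,3)]) (use e(5) in auto)
qed

end

subsection \<open>Initial values\<close>

lemma eventually_less_at_right_0: "0 < c \<Longrightarrow> \<forall>\<^sub>F t in at_right (0::real). t < c"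
  by (auto simp: eventually_at_right_field)

lemma tendsto_slice_0:
  fixes f :: txfun
  assumes "continuous_on ({0..T} \<times> ball 0 R) (\<lambda>(t, x). f t x)" "0 < T" "x \<in> ball 0 R"
  shows "((\<lambda>t. f t x) \<longlongrightarrow> f 0 x) (at_right 0)"
proof -
  have "continuous_on {0..T} (\<lambda>t. f t x)" by (rule continuous_on_slice[OF assms(1,3)]) simp
  then have "((\<lambda>t. f t x) \<longlongrightarrow> f 0 x) (at 0 within {0..T})" using assms(2) by (simp add: continuous_on_def)
  then show ?thesis using assms(2) by (simp add: at_within_Icc_at_right)
qed

text \<open>For each fixed small \<rho> the supremum over (0,\<sigma>) is at most C \<sigma>^d, so
  the inner limit is already 0.\<close>

lemma X1_pow_scrX1:
  assumes u: "u \<in> X1_pow d T R" and "0 < d" "0 < T" "0 < R"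
  shows "u \<in> scrX1 T R"
proof -
  obtain C where C: "C > 0" "\<forall>t\<in>{0..T}. \<forall>x\<in>ball 0 R. max (cmod (u t x)) (cmod (dx u t x)) \<le> C * t powr d"
    and u1: "u \<in> X1 T R" using u unfolding X1_pow_def by blast
  define h where "h = (\<lambda>\<rho> \<sigma>::real. ereal (1 / \<rho>\<^sup>2) * (SUP (t, x) \<in> {0<..<\<sigma>} \<times> ball 0 \<rho>. ereal (cmod (u t x))))"
  have lim: "Lim (at_right 0) (h \<rho>) = 0" if \<rho>: "0 < \<rho>" "\<rho> < R" for \<rho>
  proof (rule tendsto_Lim)
    show "(h \<rho> \<longlongrightarrow> 0) (at_right 0)"
    proof (rule tendsto_sandwich)
      show "\<forall>\<^sub>F \<sigma> in at_right 0. 0 \<le> h \<rho> \<sigma>"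
        using eventually_at_right_less[of 0]
      proof eventually_elim
        case (elim \<sigma>)
        have "0 \<le> (SUP (t, x) \<in> {0<..<\<sigma>} \<times> ball 0 \<rho>. ereal (cmod (u t x)))"
          by (rule SUP_upper2[of "(\<sigma>/2, 0)"]) (use elim \<rho> in auto)
        then show ?case unfolding h_def by simp
      qed
      have "\<forall>\<^sub>F \<sigma> in at_right 0. \<sigma> < T" using assms(3) by (auto simp: eventually_at_right_field)
      then show "\<forall>\<^sub>F \<sigma> in at_right 0. h \<rho> \<sigma> \<le> ereal (1 / \<rho>\<^sup>2 * (C * \<sigma> powr d))"
        using eventually_at_right_less[of 0]
      proof eventually_elim
        case (elim \<sigma>)
        have "(SUP (t, x) \<in> {0<..<\<sigma>} \<times> ball 0 \<rho>. ereal (cmod (u t x))) \<le> ereal (C * \<sigma> powr d)"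
        proof (rule SUP_least, clarify)
          fix t and x :: complex assume t: "t \<in> {0<..<\<sigma>}" and x: "x \<in> ball 0 \<rho>"
          have "cmod (u t x) \<le> C * t powr d" using C(2)[rule_format, of t x] t x elim \<rho> by auto
          also have "\<dots> \<le> C * \<sigma> powr d" using t C(1) assms(2) by (intro mult_left_mono powr_mono2) auto
          finally show "ereal (cmod (u t x)) \<le> ereal (C * \<sigma> powr d)" by simp
        qed
        then have "h \<rho> \<sigma> \<le> ereal (1 / \<rho>\<^sup>2) * ereal (C * \<sigma> powr d)" unfolding h_def by (rule ereal_mult_left_mono) simp
        then show ?case by simp
      qed
      have "((\<lambda>\<sigma>. 1 / \<rho>\<^sup>2 * (C * \<sigma> powr d)) \<longlongrightarrow> 1 / \<rho>\<^sup>2 * (C * 0 powr d)) (at_right 0)"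
        using assms by (intro tendsto_intros) (auto simp: eventually_at_right_field intro: exI[of _ 1])
      then have "((\<lambda>\<sigma>. ereal (1 / \<rho>\<^sup>2 * (C * \<sigma> powr d))) \<longlongrightarrow> ereal (1 / \<rho>\<^sup>2 * (C * 0 powr d))) (at_right 0)"
        by (rule tendsto_ereal)
      then show "((\<lambda>\<sigma>. ereal (1 / \<rho>\<^sup>2 * (C * \<sigma> powr d))) \<longlongrightarrow> 0) (at_right 0)" by (simp add: zero_ereal_def)
    qed simp
  qed simp
  have "\<forall>\<^sub>F \<rho> in at_right 0. \<rho> < R" using assms(4) by (auto simp: eventually_at_right_field)
  then have "\<forall>\<^sub>F \<rho> in at_right 0. Lim (at_right 0) (h \<rho>) = 0"
    using eventually_at_right_less[of 0] by eventually_elim (rule lim)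
  then have "Limsup (at_right 0) (\<lambda>\<rho>. Lim (at_right 0) (h \<rho>)) = Limsup (at_right 0) (\<lambda>\<rho>::real. 0)" by (rule Limsup_eq)
  also have "\<dots> = 0" by (rule Limsup_const) simp
  finally show ?thesis using u1 unfolding scrX1_def h_def by simp
qed

text \<open>\<open>Lim\<close> is a description operator and says something only once the limit is
  known to exist; monotonicity in \<sigma> identifies it with an infimum.\<close>

lemma tendsto_INF_at_right_0:
  fixes h :: "real \<Rightarrow> ereal"
  assumes "\<And>s t. 0 < s \<Longrightarrow> s \<le> t \<Longrightarrow> h s \<le> h t"
  shows "(h \<longlongrightarrow> (INF s\<in>{0<..}. h s)) (at_right 0)"
proof (rule order_tendstoI)
  fix a assume a: "a < (INF s\<in>{0<..}. h s)"
  show "\<forall>\<^sub>F s in at_right 0. a < h s"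
    using eventually_at_right_less[of 0]
  proof eventually_elim
    case (elim s)
    then have "(INF s\<in>{0<..}. h s) \<le> h s" by (intro INF_lower) simp
    with a show ?case by (rule less_le_trans)
  qed
next
  fix a assume "(INF s\<in>{0<..}. h s) < a"
  then obtain s0 where s0: "0 < s0" "h s0 < a" by (auto simp: INF_less_iff)
  have "\<forall>\<^sub>F s in at_right 0. s < s0" using s0 by (auto simp: eventually_at_right_field)
  then show "\<forall>\<^sub>F s in at_right 0. h s < a"
    using eventually_at_right_less[of 0]
  proof eventually_elim
    case (elim s)
    then have "h s \<le> h s0" by (intro assms) auto
    then show ?case using s0(2) by (rule le_less_trans)
  qed
qed

text \<open>For every small \<rho> some \<sigma> gives |u(t,x)| \<le> (e/4) \<rho>^2 on (0,\<sigma>)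
  \<times> D_\<rho>, and t may tend to 0. Taking \<rho> = 2|x|, which puts x into the disc, turns
  e/4 into e; at x = 0 one lets \<rho> tend to 0.\<close>

lemma scrX1_initial:
  assumes u: "u \<in> scrX1 T R" and T: "0 < T" "0 < R" and e: "0 < e"
  shows "\<exists>\<delta>>0. \<forall>x\<in>ball 0 \<delta>. cmod (u 0 x) \<le> e * (cmod x)\<^sup>2"
proof -
  define h where "h = (\<lambda>\<rho> \<sigma>::real. ereal (1 / \<rho>\<^sup>2) * (SUP (t, x) \<in> {0<..<\<sigma>} \<times> ball 0 \<rho>. ereal (cmod (u t x))))"
  have c: "continuous_on ({0..T} \<times> ball 0 R) (\<lambda>(t, x). u t x)" using u by (auto simp: scrX1_def X1_def X0_def)
  have "Limsup (at_right 0) (\<lambda>\<rho>. Lim (at_right 0) (h \<rho>)) = 0" using u unfolding scrX1_def h_def by simp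
  then have "Limsup (at_right 0) (\<lambda>\<rho>. Lim (at_right 0) (h \<rho>)) < ereal (e/4)" using e by simp
  then have "\<forall>\<^sub>F \<rho> in at_right 0. Lim (at_right 0) (h \<rho>) < ereal (e/4)" by (rule Limsup_lessD)
  from eventually_at_right_0D[OF this]
  obtain b where b: "b > 0" "\<And>\<rho>. 0 < \<rho> \<Longrightarrow> \<rho> < b \<Longrightarrow> Lim (at_right 0) (h \<rho>) < ereal (e/4)" by blast
  have bd: "cmod (u 0 x) \<le> e/4 * \<rho>\<^sup>2" if \<rho>: "0 < \<rho>" "\<rho> < b" "\<rho> < R" and x: "x \<in> ball 0 \<rho>" for \<rho> x
  proof -
    have mono: "h \<rho> s \<le> h \<rho> t" if "0 < s" "s \<le> t" for s t
      unfolding h_def by (intro ereal_mult_left_mono SUP_subset_mono) (use that in auto)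
    have "(h \<rho> \<longlongrightarrow> (INF s\<in>{0<..}. h \<rho> s)) (at_right 0)" by (rule tendsto_INF_at_right_0[OF mono])
    then have "Lim (at_right 0) (h \<rho>) = (INF s\<in>{0<..}. h \<rho> s)" by (intro tendsto_Lim) simp_all
    then have "(INF s\<in>{0<..}. h \<rho> s) < ereal (e/4)" using b(2)[OF \<rho>(1,2)] by simp
    then obtain \<sigma> where \<sigma>: "0 < \<sigma>" "h \<rho> \<sigma> < ereal (e/4)" by (auto simp: INF_less_iff)
    have le: "cmod (u t x) \<le> e/4 * \<rho>\<^sup>2" if t: "0 < t" "t < \<sigma>" for t
    proof -
      have "ereal (cmod (u t x)) \<le> (SUP (t, x) \<in> {0<..<\<sigma>} \<times> ball 0 \<rho>. ereal (cmod (u t x)))"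
        by (rule SUP_upper2[of "(t, x)"]) (use t x in auto)
      then have "ereal (1 / \<rho>\<^sup>2) * ereal (cmod (u t x)) \<le> h \<rho> \<sigma>" unfolding h_def by (rule ereal_mult_left_mono) simp
      from le_less_trans[OF this \<sigma>(2)] have "1 / \<rho>\<^sup>2 * cmod (u t x) < e/4"
        by (simp only: times_ereal.simps less_ereal.simps)
      then show ?thesis using \<rho>(1) by (simp add: field_simps)
    qed
    have xR: "x \<in> ball 0 R" using x \<rho> by auto
    have "((\<lambda>t. cmod (u t x)) \<longlongrightarrow> cmod (u 0 x)) (at_right 0)" by (rule tendsto_norm[OF tendsto_slice_0[OF c T(1) xR]])
    moreover have "\<forall>\<^sub>F t in at_right 0. cmod (u t x) \<le> e/4 * \<rho>\<^sup>2"
    proof -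
      have "\<forall>\<^sub>F t in at_right 0. t < \<sigma>" using \<sigma> by (auto simp: eventually_at_right_field)
      then show ?thesis using eventually_at_right_less[of 0] by eventually_elim (rule le)
    qed
    ultimately show ?thesis by (rule tendsto_upperbound) simp
  qed
  define \<delta> where "\<delta> = min b R / 2"
  have \<delta>: "0 < \<delta>" "2 * \<delta> \<le> b" "2 * \<delta> \<le> R" using b T by (auto simp: \<delta>_def)
  have "cmod (u 0 x) \<le> e * (cmod x)\<^sup>2" if x: "x \<in> ball 0 \<delta>" for x
  proof (cases "x = 0")
    case True
    have "((\<lambda>\<rho>. e/4 * \<rho>\<^sup>2) \<longlongrightarrow> e/4 * 0\<^sup>2) (at_right (0::real))" by (intro tendsto_intros)
    moreover have "\<forall>\<^sub>F \<rho> in at_right 0. cmod (u 0 x) \<le> e/4 * \<rho>\<^sup>2"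
    proof -
      have "\<forall>\<^sub>F \<rho> in at_right 0. \<rho> < \<delta>" using \<delta> by (auto simp: eventually_at_right_field)
      then show ?thesis using eventually_at_right_less[of 0]
        by eventually_elim (rule bd, use \<delta> True in auto)
    qed
    ultimately have "cmod (u 0 x) \<le> e/4 * 0\<^sup>2" by (rule tendsto_lowerbound) simp
    then show ?thesis using True by simp
  next
    case False
    have "cmod (u 0 x) \<le> e/4 * (2 * cmod x)\<^sup>2" by (rule bd) (use False x \<delta> in auto)
    then show ?thesis by (simp add: power_mult_distrib)
  qed
  then show ?thesis using \<delta>(1) by blast
qed

text \<open>Otherwise \<open>u\<close> would grow like \<open>log t\<close>.\<close>

lemma X0_t_dt_initial:
  fixes u g :: txfun
  assumes T: "0 < T" "x \<in> ball 0 R" and cu: "continuous_on ({0..T} \<times> ball 0 R) (\<lambda>(t, x). u t x)"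
    and cg: "continuous_on ({0..T} \<times> ball 0 R) (\<lambda>(t, x). g t x)"
    and d: "\<And>t. t \<in> {0<..<T} \<Longrightarrow> ((\<lambda>s. u s x) has_vector_derivative g t x / of_real t) (at t)"
  shows "g 0 x = 0"
proof (rule ccontr)
  assume nz: "g 0 x \<noteq> 0"
  define \<zeta> where "\<zeta> = g 0 x"
  \<comment> \<open>Projection onto the direction of the supposed nonzero limit \<zeta> gives a real
    function whose derivative is at least (c/2)/t for small t.\<close>
  define \<phi> where "\<phi> = (\<lambda>t. Re (cnj \<zeta> * u t x))"
  define c where "c = (cmod \<zeta>)\<^sup>2"
  have c: "0 < c" using nz by (simp add: c_def \<zeta>_def)
  note lim = tendsto_slice_0[OF _ T]
  have "((\<lambda>t. Re (cnj \<zeta> * g t x)) \<longlongrightarrow> Re (cnj \<zeta> * \<zeta>)) (at_right 0)"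
    using lim[OF cg] unfolding \<zeta>_def by (intro tendsto_intros)
  moreover have "Re (cnj \<zeta> * \<zeta>) = c" unfolding c_def using cmod_power2[of \<zeta>] by (simp add: power2_eq_square[of "Re \<zeta>"] power2_eq_square[of "Im \<zeta>"])
  ultimately have "\<forall>\<^sub>F t in at_right 0. c/2 < Re (cnj \<zeta> * g t x)" using c by (intro order_tendstoD(1)) auto
  moreover have "(\<phi> \<longlongrightarrow> \<phi> 0) (at_right 0)" unfolding \<phi>_def by (intro tendsto_intros lim[OF cu])
  then have "\<forall>\<^sub>F t in at_right 0. dist (\<phi> t) (\<phi> 0) < c/8" using c by (intro tendstoD) auto
  ultimately have "\<forall>\<^sub>F t in at_right 0. c/2 < Re (cnj \<zeta> * g t x) \<and> dist (\<phi> t) (\<phi> 0) < c/8" by (rule eventually_conj)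
  from eventually_at_right_0D[OF this] obtain b where b: "b > 0" "\<And>t. 0 < t \<Longrightarrow> t < b \<Longrightarrow> c/2 < Re (cnj \<zeta> * g t x) \<and> dist (\<phi> t) (\<phi> 0) < c/8" by blast
  define t where "t = min b T / 2"
  have t: "0 < t" "t < b" "t < T" using b T by (auto simp: t_def)
  have D: "(\<phi> has_real_derivative Re (cnj \<zeta> * g s x) / s) (at s)" if s: "t/2 \<le> s" "s \<le> t" for s
  proof -
    have "s \<in> {0<..<T}" using s t by auto
    from d[OF this] have "(\<phi> has_vector_derivative Re (cnj \<zeta> * (g s x / of_real s))) (at s)"
      unfolding \<phi>_def by (intro bounded_linear.has_vector_derivative[OF bounded_linear_Re] has_vector_derivative_mult_right)
    moreover have "cnj \<zeta> * (g s x / of_real s) = (cnj \<zeta> * g s x) / of_real s" by simp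
    then have "Re (cnj \<zeta> * (g s x / of_real s)) = Re (cnj \<zeta> * g s x) / s" by (simp only: Re_divide_of_real)
    ultimately show ?thesis by (simp add: has_real_derivative_iff_has_vector_derivative)
  qed
  have "t/2 < t" using t by simp
  \<comment> \<open>Over an interval [t/2, t] the logarithm grows by a fixed amount, so \<phi> gains
    at least c/4; but both values lie within c/8 of \<phi>(0).\<close>
  from MVT2[OF this D] obtain z where z: "t/2 < z" "z < t" "\<phi> t - \<phi> (t/2) = (t - t/2) * (Re (cnj \<zeta> * g z x) / z)" by blast
  have "c/2 < Re (cnj \<zeta> * g z x)" using b(2)[of z] z t by simp
  then have "c/2 / t \<le> Re (cnj \<zeta> * g z x) / z" using z t c by (intro frac_le) auto
  then have le: "t/2 * (c/2 / t) \<le> t/2 * (Re (cnj \<zeta> * g z x) / z)" using t by (intro mult_left_mono) auto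
  have eq: "t/2 * (c/2 / t) = c/4" "t - t/2 = t/2" using t by simp_all
  from le have "c/4 \<le> \<phi> t - \<phi> (t/2)" unfolding z(3) eq .
  moreover have "dist (\<phi> t) (\<phi> 0) < c/8" "dist (\<phi> (t/2)) (\<phi> 0) < c/8" using b(2)[of t] b(2)[of "t/2"] t by auto
  ultimately show False unfolding dist_real_def by linarith
qed

lemma uniform_limit_compact_initial:
  fixes u :: txfun
  assumes c: "continuous_on ({0..T} \<times> ball 0 R) (\<lambda>(t, x). u t x)" and T: "0 < T" "r < R" and z: "\<And>x. x \<in> ball 0 R \<Longrightarrow> u 0 x = 0"
  shows "uniform_limit (ball 0 r) u (\<lambda>_. 0) (at_right 0)"
proof (rule uniform_limitI)
  fix e :: real assume e: "0 < e"
  have sub: "{0..T} \<times> cball (0::complex) r \<subseteq> {0..T} \<times> ball 0 R" using T by auto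
  have "uniformly_continuous_on ({0..T} \<times> cball 0 r) (\<lambda>(t, x). u t x)"
    by (intro compact_uniformly_continuous continuous_on_subset[OF c sub] compact_Times) auto
  then obtain d where d: "d > 0" "\<forall>p\<in>{0..T} \<times> cball 0 r. \<forall>q\<in>{0..T} \<times> cball 0 r. dist q p < d \<longrightarrow> dist ((\<lambda>(t, x). u t x) q) ((\<lambda>(t, x). u t x) p) < e"
    using e unfolding uniformly_continuous_on_def by blast
  have "\<forall>\<^sub>F t in at_right 0. t < min d T" by (rule eventually_less_at_right_0) (use d T in auto)
  then show "\<forall>\<^sub>F t in at_right 0. \<forall>x\<in>ball 0 r. dist (u t x) 0 < e"
    using eventually_at_right_less[of 0]
  proof eventually_elim
    case (elim t)
    show ?case
    proof
      fix x :: complex assume x: "x \<in> ball 0 r"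
      have "dist (t, x) (0, x) < d" using elim by (simp add: dist_prod_def)
      moreover have "(t, x) \<in> {0..T} \<times> cball 0 r" "(0, x) \<in> {0..T} \<times> cball 0 r" using elim x T by auto
      ultimately have "dist (u t x) (u 0 x) < e" using d(2) by fastforce
      moreover have "u 0 x = 0" using z[of x] x T by simp
      ultimately show "dist (u t x) 0 < e" by simp
    qed
  qed
qed

context briot_bouquet
begin

text \<open>Comparison of the orders of vanishing at \<open>x = 0\<close> in \<open>\<lambda> \<phi> = O((\<bar>\<phi>\<bar> + \<bar>\<phi>'\<bar>)\<^sup>2)\<close>.\<close>

lemma stationary_zero:
  assumes \<phi>: "\<phi> holomorphic_on ball 0 R" "0 < R"
    and eq: "0 < \<delta>" "\<And>x. x \<in> ball 0 \<delta> \<Longrightarrow> \<phi> x \<in> ball 0 r1 \<Longrightarrow> deriv \<phi> x \<in> ball 0 r1 \<Longrightarrow> F 0 x (\<phi> x) (deriv \<phi> x) = 0"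
    and small: "\<And>e. 0 < e \<Longrightarrow> \<exists>\<delta>>0. \<forall>x\<in>ball 0 \<delta>. cmod (\<phi> x) \<le> e * (cmod x)\<^sup>2"
    and x: "x \<in> ball 0 R"
  shows "\<phi> x = 0"
proof (rule ccontr)
  assume nz: "\<phi> x \<noteq> 0"
  obtain b where "b > 0" "\<forall>x\<in>ball 0 b. cmod (\<phi> x) \<le> 1 * (cmod x)\<^sup>2" using small[OF zero_less_one] by blast
  then have "cmod (\<phi> 0) \<le> 1 * (cmod 0)\<^sup>2" by (meson centre_in_ball)
  then have 0: "\<phi> 0 = 0" by simp
  have nc: "\<not> \<phi> constant_on ball 0 R"
  proof
    assume "\<phi> constant_on ball 0 R"
    then have "\<phi> x = \<phi> 0" using x \<phi>(2) unfolding constant_on_def by auto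
    then show False using nz 0 by simp
  qed
  have c0: "0 \<in> ball (0::complex) R" using \<phi>(2) by simp
  obtain g r n where g: "0 < n" "0 < r" "ball (0::complex) r \<subseteq> ball 0 R" "g holomorphic_on ball 0 r"
    "\<And>w. w \<in> ball 0 r \<Longrightarrow> \<phi> w = (w - 0)^n * g w" "\<And>w. w \<in> ball 0 r \<Longrightarrow> g w \<noteq> 0"
  proof (rule holomorphic_factor_zero_nonconstant[OF \<phi>(1) open_ball connected_ball c0 0 nc])
    fix g r n assume a: "0 < n" "0 < r" "ball (0::complex) r \<subseteq> ball 0 R" "g holomorphic_on ball 0 r"
      "\<And>w. w \<in> ball 0 r \<Longrightarrow> \<phi> w = (w - 0)^n * g w" "\<And>w. w \<in> ball 0 r \<Longrightarrow> g w \<noteq> 0"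
    show thesis by (rule that[OF a])
  qed
  have z: "0 \<in> ball (0::complex) r" using g(2) by simp
  have cg: "isCont g 0" "isCont (deriv g) 0"
    using holomorphic_on_imp_continuous_on[OF g(4)] holomorphic_on_imp_continuous_on[OF holomorphic_deriv[OF g(4) open_ball]] z
    by (simp_all add: continuous_on_eq_continuous_at del: mem_ball)
  have cl: "isCont lam 0" using holomorphic_on_imp_continuous_on[OF lam_hol] pos by (simp add: continuous_on_eq_continuous_at)
  have near: "\<forall>\<^sub>F w in at 0. w \<in> ball 0 s \<and> w \<noteq> 0" if "0 < s" for s and z :: complex
    unfolding eventually_at by (intro exI[of _ s]) (auto simp: dist_commute that)
  \<comment> \<open>For n \<le> 2 the bound o(x^2) would force g(0) = 0. The case n = 2 must be
    excluded this way: the comparison of orders below yields a contradiction only if 2(n-1) >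
    n.\<close>
  have n3: "3 \<le> n"
  proof (rule ccontr)
    assume n: "\<not> 3 \<le> n"
    have "cmod (g 0) \<le> e" if e: "0 < e" for e
    proof -
      obtain s where s: "s > 0" "\<forall>x\<in>ball 0 s. cmod (\<phi> x) \<le> e * (cmod x)\<^sup>2" using small[OF e] by blast
      have "\<forall>\<^sub>F w in at 0. cmod (g w) \<le> e"
        using near[OF s(1)] near[OF g(2)] near[OF zero_less_one]
      proof eventually_elim
        case (elim w)
        have w: "0 < cmod w" "cmod w \<le> 1" using elim by auto
        have "cmod (\<phi> w) \<le> e * (cmod w)\<^sup>2" using s(2) elim by blast
        moreover have "\<phi> w = w^n * g w" using g(5)[of w] elim by simp
        ultimately have "cmod w ^ n * cmod (g w) \<le> e * (cmod w)\<^sup>2" by (simp add: norm_mult norm_power)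
        also have "\<dots> \<le> e * cmod w ^ n" using n w e by (intro mult_left_mono power_decreasing) auto
        finally have "cmod w ^ n * cmod (g w) \<le> cmod w ^ n * e" by (simp add: mult.commute)
        then show ?case using w by simp
      qed
      moreover have "((\<lambda>w. cmod (g w)) \<longlongrightarrow> cmod (g 0)) (at 0)" using cg(1) by (intro tendsto_norm) (simp add: isCont_def)
      ultimately show ?thesis by (intro tendsto_upperbound) auto
    qed
    from this[of "cmod (g 0) / 2"] show False using g(6)[OF z] by simp
  qed
  have d\<phi>: "deriv \<phi> w = of_nat n * w^(n-1) * g w + w^n * deriv g w" if w: "w \<in> ball 0 r" for w
  proof -
    have "(g has_field_derivative deriv g w) (at w)" by (rule holomorphic_derivI[OF g(4) open_ball w])
    then have "((\<lambda>w. w^n * g w) has_field_derivative of_nat n * w^(n-1) * g w + w^n * deriv g w) (at w)"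
      by (auto intro!: derivative_eq_intros)
    then have "deriv (\<lambda>w. w^n * g w) w = of_nat n * w^(n-1) * g w + w^n * deriv g w" by (rule DERIV_imp_deriv)
    moreover have "deriv \<phi> w = deriv (\<lambda>w. w^n * g w) w" by (rule deriv_cong_ball[OF w]) (use g(5) in auto)
    ultimately show ?thesis by simp
  qed
  let ?q = "\<lambda>w. cmod w * cmod (g w) + cmod (of_nat n * g w + w * deriv g w)"
  have fac: "cmod (\<phi> w) + cmod (deriv \<phi> w) = cmod w ^ (n-1) * ?q w" if w: "w \<in> ball 0 r" for w
  proof -
    have p: "w^n = w^(n-1) * w" using g(1) by (simp add: power_eq_if)
    have 1: "\<phi> w = w^(n-1) * (w * g w)" using g(5)[OF w] p by (simp add: mult.assoc)
    have 2: "deriv \<phi> w = w^(n-1) * (of_nat n * g w + w * deriv g w)" unfolding d\<phi>[OF w] p by (simp add: algebra_simps)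
    show ?thesis unfolding 1 2 norm_mult norm_power by (rule distrib_left[symmetric])
  qed
  have lg: "(g \<longlongrightarrow> g 0) (at 0)" "(deriv g \<longlongrightarrow> deriv g 0) (at 0)" "(lam \<longlongrightarrow> lam 0) (at 0)" using cg cl by (simp_all add: isCont_def)
  have lq: "(?q \<longlongrightarrow> cmod 0 * cmod (g 0) + cmod (of_nat n * g 0 + 0 * deriv g 0)) (at 0)"
    by (intro tendsto_intros lg)
  have "((\<lambda>w. cmod w ^ (n-1) * ?q w) \<longlongrightarrow> cmod 0 ^ (n-1) * (cmod 0 * cmod (g 0) + cmod (of_nat n * g 0 + 0 * deriv g 0))) (at 0)"
    by (intro tendsto_mult lq tendsto_intros)
  then have "((\<lambda>w. cmod w ^ (n-1) * ?q w) \<longlongrightarrow> 0) (at 0)" using n3 by (simp add: power_0_left)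
  then have sm: "\<forall>\<^sub>F w in at 0. cmod w ^ (n-1) * ?q w < r1" using pos by (intro order_tendstoD(2)) auto
  have "\<forall>\<^sub>F w in at 0. cmod (lam w) * cmod (g w) \<le> Lz * (cmod w ^ (n-2) * (?q w)\<^sup>2)"
    using sm near[OF g(2)] near[OF eq(1)] near[OF pos(1)]
  proof eventually_elim
    case (elim w)
    have w: "w \<in> ball 0 r" "w \<in> ball 0 \<delta>" "w \<in> ball 0 R1" "w \<noteq> 0" using elim by auto
    have w0: "w \<in> ball 0 R0" using w(3) pos by auto
    have sum: "cmod (\<phi> w) + cmod (deriv \<phi> w) < r1" using elim(1) fac[OF w(1)] by simp
    then have b: "\<phi> w \<in> ball 0 r1" "deriv \<phi> w \<in> ball 0 r1"
      using norm_ge_zero[of "\<phi> w"] norm_ge_zero[of "deriv \<phi> w"] by (auto simp del: norm_ge_zero)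
    have t0: "0 \<in> {0..T0}" using T0 by simp
    have "cmod (F 0 w (\<phi> w) (deriv \<phi> w) - F 0 w 0 0 - coeff_lambda F 0 w * (\<phi> w - 0) - coeff_b F 0 w * (deriv \<phi> w - 0))
      \<le> Lz * (cmod (\<phi> w) + cmod (deriv \<phi> w) + cmod 0 + cmod 0) * (cmod (\<phi> w - 0) + cmod (deriv \<phi> w - 0))"
      by (rule F_taylor[OF t0 w(3) b]) (use pos in auto)
    then have "cmod (lam w) * cmod (\<phi> w) \<le> Lz * (cmod (\<phi> w) + cmod (deriv \<phi> w))\<^sup>2"
      using eq(2)[OF w(2) b] A2[OF w0] A3[OF w0] by (simp add: lam_def norm_mult power2_eq_square mult.assoc)
    then have "cmod (lam w) * (cmod w ^ n * cmod (g w)) \<le> Lz * (cmod w ^ (n-1) * ?q w)\<^sup>2"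
      unfolding fac[OF w(1)] using g(5)[OF w(1)] by (simp add: norm_mult norm_power)
    \<comment> \<open>After division by |w|^n the left-hand side tends to |\<lambda>(0,0) g(0)|,
      which is not 0, while the right-hand side keeps the factor |w|^(n-2) and tends to 0.\<close>
    moreover have "(n - 1) * 2 = n + (n - 2)" using n3 by simp
    then have "(cmod w ^ (n-1))\<^sup>2 = cmod w ^ n * cmod w ^ (n-2)"
      by (simp only: power_mult[symmetric] power_add[symmetric])
    ultimately have "cmod w ^ n * (cmod (lam w) * cmod (g w)) \<le> cmod w ^ n * (Lz * (cmod w ^ (n-2) * (?q w)\<^sup>2))"
      unfolding power_mult_distrib by (simp only: ac_simps)
    then show ?case by (rule mult_left_le_imp_le) (use w(4) in simp)
  qed
  moreover have "((\<lambda>w. cmod (lam w) * cmod (g w)) \<longlongrightarrow> cmod (lam 0) * cmod (g 0)) (at 0)" by (intro tendsto_intros lg)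
  moreover have "((\<lambda>w. Lz * (cmod w ^ (n-2) * (?q w)\<^sup>2)) \<longlongrightarrow> Lz * (cmod 0 ^ (n-2) * (cmod 0 * cmod (g 0) + cmod (of_nat n * g 0 + 0 * deriv g 0))\<^sup>2)) (at 0)"
    by (intro tendsto_mult tendsto_power lq tendsto_const tendsto_norm tendsto_ident_at)
  ultimately have "cmod (lam 0) * cmod (g 0) \<le> Lz * (cmod 0 ^ (n-2) * (cmod 0 * cmod (g 0) + cmod (of_nat n * g 0 + 0 * deriv g 0))\<^sup>2)"
    by (intro tendsto_le[OF at_neq_bot])
  also have "\<dots> = 0" using n3 by (simp add: power_0_left)
  finally have "lam 0 = 0 \<or> g 0 = 0" by (auto simp: mult_le_0_iff)
  then show False using g(6)[OF z] Re_lambda by (auto simp: lam_def)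
qed

text \<open>As t tends to 0, t times the time derivative tends to 0, so the initial value of u
  solves the stationary equation and therefore vanishes. By compactness u and its x-derivative then
  tend to 0 uniformly on a smaller disc, and this qualitative fact is all that the decay argument
  asks for.\<close>

lemma scrX1_germ:
  assumes u: "u \<in> scrX1 T R" and TR: "0 < T" "0 < R" and s: "solves F T0 R0 \<rho>0 u"
  shows "germ u \<in> X1_plus"
proof -
  have u1: "u \<in> X1 T R" using u by (simp add: scrX1_def)
  have cu: "continuous_on ({0..T} \<times> ball 0 R) (\<lambda>(t, x). u t x)" and hu: "\<And>t. t \<in> {0..T} \<Longrightarrow> u t holomorphic_on ball 0 R"
    using u1 by (auto simp: X1_def X0_def)
  obtain g where cg: "continuous_on ({0..T} \<times> ball 0 R) (\<lambda>(t, x). g t x)"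
    and g: "\<forall>t\<in>{0<..<T}. \<forall>x\<in>ball 0 R. g t x = of_real t * dt u t x" using u1 by (auto simp: X1_def X0_def)
  have cd: "continuous_on ({0..T} \<times> ball 0 R) (\<lambda>(t, x). deriv (u t) x)"
    by (rule continuous_on_deriv_param[OF open_ball cu hu])
  have g0: "g 0 x = 0" if x: "x \<in> ball 0 R" for x
  proof (rule X0_t_dt_initial[OF TR(1) x cu cg])
    fix t assume t: "t \<in> {0<..<T}"
    have eq: "dt u t x = g t x / of_real t" using g t x by auto
    have "((\<lambda>s. u s x) has_vector_derivative dt u t x) (at t)"
      using X1_evolves[OF u1] t x unfolding evolves_def by blast
    then show "((\<lambda>s. u s x) has_vector_derivative g t x / of_real t) (at t)" unfolding eq .
  qed
  obtain e d where ed: "e > 0" "d > 0" "\<forall>t\<in>{0<..<e}. \<forall>x\<in>ball 0 d. (t, x, u t x, dx u t x) \<in> Omega T0 R0 \<rho>0 \<and>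
        of_real t * dt u t x = F t x (u t x) (dx u t x)" using s unfolding solves_def by blast
  define \<delta> where "\<delta> = min (min d R) R0"
  have \<delta>: "0 < \<delta>" "\<delta> \<le> d" "\<delta> \<le> R" "\<delta> \<le> R0" using ed TR R0 by (auto simp: \<delta>_def)
  \<comment> \<open>The limit of the arguments need not lie in the open polydisc where F is
    continuous, hence the extra assumptions on u(0,x) and its derivative;
    \<open>stationary_zero\<close> asks for the equation only under them.\<close>
  have stat: "F 0 x (u 0 x) (deriv (u 0) x) = 0"
    if x: "x \<in> ball 0 \<delta>" and b: "u 0 x \<in> ball 0 r1" "deriv (u 0) x \<in> ball 0 r1" for x
  proof -
    have xR: "x \<in> ball 0 R" "x \<in> ball 0 d" "x \<in> ball 0 R0" using x \<delta> by auto
    note lim = tendsto_slice_0[OF _ TR(1) xR(1)]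
    have "\<forall>\<^sub>F t in at_right 0. t < min e T" by (rule eventually_less_at_right_0) (use ed TR in auto)
    then have ev: "\<forall>\<^sub>F t in at_right 0. (t, x, u t x, deriv (u t) x) \<in> Omega T0 R0 \<rho>0 \<and> g t x = F t x (u t x) (deriv (u t) x)"
      using eventually_at_right_less[of 0]
    proof eventually_elim
      case (elim t)
      then have t: "t \<in> {0<..<e}" "t \<in> {0<..<T}" by auto
      have "(t, x, u t x, dx u t x) \<in> Omega T0 R0 \<rho>0 \<and> of_real t * dt u t x = F t x (u t x) (dx u t x)"
        using ed(3) t(1) xR(2) by blast
      moreover have "g t x = of_real t * dt u t x" using g t(2) xR(1) by blast
      ultimately show ?case by (simp add: dx_def)
    qed
    have "((\<lambda>t. (t, x, u t x, deriv (u t) x)) \<longlongrightarrow> (0, x, u 0 x, deriv (u 0) x)) (at_right 0)"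
      by (intro tendsto_Pair tendsto_const tendsto_ident_at lim[OF cu] lim[OF cd])
    moreover have "(0, x, u 0 x, deriv (u 0) x) \<in> Omega T0 R0 \<rho>0" using xR(3) b pos T0 by (simp add: Omega_def)
    moreover have "\<forall>\<^sub>F t in at_right 0. (t, x, u t x, deriv (u t) x) \<in> Omega T0 R0 \<rho>0" by (rule eventually_mono[OF ev]) blast
    ultimately have "((\<lambda>t. (\<lambda>(t, x, z1, z2). F t x z1 z2) (t, x, u t x, deriv (u t) x)) \<longlongrightarrow> (\<lambda>(t, x, z1, z2). F t x z1 z2) (0, x, u 0 x, deriv (u 0) x)) (at_right 0)"
      by (rule continuous_on_tendsto_compose[OF A1_cont])
    then have "((\<lambda>t. F t x (u t x) (deriv (u t) x)) \<longlongrightarrow> F 0 x (u 0 x) (deriv (u 0) x)) (at_right 0)" by simp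
    moreover have "((\<lambda>t. F t x (u t x) (deriv (u t) x)) \<longlongrightarrow> 0) (at_right 0)"
    proof (rule Lim_transform_eventually)
      show "((\<lambda>t. g t x) \<longlongrightarrow> 0) (at_right 0)" using lim[OF cg] g0[OF xR(1)] by simp
      show "\<forall>\<^sub>F t in at_right 0. g t x = F t x (u t x) (deriv (u t) x)" by (rule eventually_mono[OF ev]) blast
    qed
    ultimately show ?thesis by (intro tendsto_unique[OF trivial_limit_at_right_real])
  qed
  have h0: "u 0 holomorphic_on ball 0 R" using hu TR by simp
  have u0: "u 0 x = 0" if "x \<in> ball 0 R" for x
    by (rule stationary_zero[OF h0 TR(2) \<delta>(1) stat scrX1_initial[OF u TR] that])
  have du0: "deriv (u 0) x = 0" if x: "x \<in> ball 0 R" for x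
    using deriv_cong_ball[OF x, of "u 0" "\<lambda>_. 0"] u0 by simp
  have R2: "R/2 < R" "0 < R/2" using TR by auto
  have ul: "uniform_limit (ball 0 (R/2)) u (\<lambda>_. 0) (at_right 0)" "uniform_limit (ball 0 (R/2)) (\<lambda>t. deriv (u t)) (\<lambda>_. 0) (at_right 0)"
    using uniform_limit_compact_initial[OF cu TR(1) R2(1) u0] uniform_limit_compact_initial[OF cd TR(1) R2(1) du0] by auto
  obtain T' R' where T': "T' \<le> T" "R' \<le> R/2" "sol T' R' u"
    using solves_sol[OF X1_subset[OF u1 order_refl less_imp_le[OF R2(1)]] TR(1) R2(2) s ul] by blast
  \<comment> \<open>Any positive exponent below both \<mu> and Re \<lambda>(0,0) will do.\<close>
  define a where "a = min \<mu> (Re (lam 0)) / 2"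
  have a: "0 < a" "a < \<mu>" "a < Re (lam 0)" using \<mu> Re_lambda by (auto simp: a_def lam_def)
  have sub: "ball (0::complex) R' \<subseteq> ball 0 (R/2)" using T'(2) by auto
  obtain T2 R2 where T2: "0 < T2" "T2 \<le> T'" "0 < R2" "R2 \<le> R'" "bnd a T2 R2 u"
    using decay_sol[OF T'(3) uniform_limit_on_subset[OF ul(1) sub] uniform_limit_on_subset[OF ul(2) sub] a] by blast
  have "germ (extend0 u) \<in> X1_germs a" by (rule sol_germ(1)[OF sol_subset[OF T'(3) T2(1-4)] T2(5) a(1)])
  moreover have "germ (extend0 u) = germ u" by (rule germ_extend0[OF TR]) (use u0 in auto)
  ultimately show ?thesis unfolding X1_plus_def using a(1) by auto
qed

section \<open>Solution sets of germs\<close>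

lemma solutions_scrX1: "solutions F T0 R0 \<rho>0 scrX1_germs = solutions F T0 R0 \<rho>0 X1_plus"
proof (intro equalityI subsetI)
  fix g assume g: "g \<in> solutions F T0 R0 \<rho>0 scrX1_germs"
  then obtain u T R where u: "g = germ u" "0 < T" "0 < R" "u \<in> scrX1 T R" unfolding solutions_def scrX1_germs_def by blast
  obtain v where v: "g = germ v" "solves F T0 R0 \<rho>0 v" using g unfolding solutions_def by blast
  have "tx_eq v u" using u(1) v(1) germ_eq_iff[of v u] by simp
  then have "solves F T0 R0 \<rho>0 u" using v(2) by (rule solves_cong)
  then have "g \<in> X1_plus" unfolding u(1) by (rule scrX1_germ[OF u(4,2,3)])
  then show "g \<in> solutions F T0 R0 \<rho>0 X1_plus" using g unfolding solutions_def by blast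
next
  fix g assume g: "g \<in> solutions F T0 R0 \<rho>0 X1_plus"
  then obtain d u T R where "0 < d" "g = germ u" "0 < T" "0 < R" "u \<in> X1_pow d T R"
    unfolding solutions_def X1_plus_def X1_germs_def by auto
  then have "g \<in> scrX1_germs" unfolding scrX1_germs_def using X1_pow_scrX1 by blast
  then show "g \<in> solutions F T0 R0 \<rho>0 scrX1_germs" using g unfolding solutions_def by blast
qed

text \<open>The time and the radius on which the bound with exponent a holds may depend on a. This
  is harmless for germs: the same germ belongs to every class with a < \<mu>.\<close>

lemma solutions_paren_nonempty: "solutions F T0 R0 \<rho>0 (X1_paren \<mu>) \<noteq> {}"
proof -
  obtain T R u where u: "sol T R u"
    and b: "\<forall>a. 0 < a \<and> a < \<mu> \<longrightarrow> (\<exists>T' R'. 0 < T' \<and> T' \<le> T \<and> 0 < R' \<and> R' \<le> R \<and> bnd a T' R' u)"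
    using existence_decay by blast
  have X: "germ (extend0 u) \<in> X1_germs a \<and> solves F T0 R0 \<rho>0 (extend0 u)" if a: "0 < a" "a < \<mu>" for a
  proof -
    obtain T' R' where T': "0 < T'" "T' \<le> T" "0 < R'" "R' \<le> R" "bnd a T' R' u" using b a by blast
    show ?thesis using sol_germ(1,2)[OF sol_subset[OF u T'(1-4)] T'(5) a(1)] by blast
  qed
  have "germ (extend0 u) \<in> X1_paren \<mu>" unfolding X1_paren_def using X by auto
  moreover have "solves F T0 R0 \<rho>0 (extend0 u)" using X[of "\<mu>/2"] \<mu> by simp
  ultimately show ?thesis unfolding solutions_def by blast
qed

lemma solutions_paren_plus: "solutions F T0 R0 \<rho>0 (X1_paren \<mu>) \<subseteq> solutions F T0 R0 \<rho>0 X1_plus"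
proof -
  have "X1_paren \<mu> \<subseteq> X1_germs (\<mu>/2)" unfolding X1_paren_def using \<mu> by auto
  also have "\<dots> \<subseteq> X1_plus" unfolding X1_plus_def by (rule UN_upper) (use \<mu> in simp)
  finally show ?thesis unfolding solutions_def by blast
qed

text \<open>The base point may be any solution in \<open>X1_plus\<close>: the construction uses only
  that it decays like some positive power of t.\<close>

lemma ex1_is_U:
  assumes u0: "u0 \<in> solutions F T0 R0 \<rho>0 X1_plus" and \<psi>: "\<psi> \<in> O0"
  shows "\<exists>!u. is_U F T0 R0 \<rho>0 u0 \<psi> u"
proof -
  obtain v d T R where v: "0 < d" "u0 = germ v" "sol T R v" "bnd d T R v" "\<forall>x\<in>ball 0 R. v 0 x = 0"
    using X1_plus_sol[OF u0] by blast
  obtain f r where f: "\<psi> = abs_xgerm f" "f holomorphic_on ball 0 r" "0 < r" using \<psi> unfolding O0_def by blast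
  note iff = is_U_iff[OF v(3,4,1,5), of f]
  obtain T' R' u d' where "0 < d'" "sol T' R' u" "bnd d' T' R' u"
    "uniform_limit (ball 0 R') (\<lambda>t x. tlam t x * (u t x - v t x)) f (at_right 0)"
    using existence_leading[OF v(3,4,1) f(2,3)] by blast
  then have "is_U F T0 R0 \<rho>0 u0 \<psi> (germ (extend0 u))" unfolding v(2) f(1) iff by blast
  moreover have "g = h" if g: "is_U F T0 R0 \<rho>0 u0 \<psi> g" and h: "is_U F T0 R0 \<rho>0 u0 \<psi> h" for g h
  proof -
    obtain u1 d1 T1 Q1 where 1: "0 < d1" "g = germ (extend0 u1)" "sol T1 Q1 u1" "bnd d1 T1 Q1 u1"
      "uniform_limit (ball 0 Q1) (\<lambda>t x. tlam t x * (u1 t x - v t x)) f (at_right 0)"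
      using g unfolding v(2) f(1) iff by blast
    obtain u2 d2 T2 Q2 where 2: "0 < d2" "h = germ (extend0 u2)" "sol T2 Q2 u2" "bnd d2 T2 Q2 u2"
      "uniform_limit (ball 0 Q2) (\<lambda>t x. tlam t x * (u2 t x - v t x)) f (at_right 0)"
      using h unfolding v(2) f(1) iff by blast
    show ?thesis unfolding 1(2) 2(2) by (rule leading_term_unique[OF 1(1) 2(1) 1(3) 2(3) 1(4) 2(4) 1(5) 2(5)])
  qed
  ultimately show ?thesis by blast
qed

lemma solution_is_U:
  assumes u0: "u0 \<in> solutions F T0 R0 \<rho>0 X1_plus" and g: "g \<in> solutions F T0 R0 \<rho>0 X1_plus"
  shows "\<exists>\<psi>\<in>O0. is_U F T0 R0 \<rho>0 u0 \<psi> g"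
proof -
  obtain v d T R where v: "0 < d" "u0 = germ v" "sol T R v" "bnd d T R v" "\<forall>x\<in>ball 0 R. v 0 x = 0"
    using X1_plus_sol[OF u0] by blast
  obtain u d' T' R' where u: "0 < d'" "g = germ u" "sol T' R' u" "bnd d' T' R' u" "\<forall>x\<in>ball 0 R'. u 0 x = 0"
    using X1_plus_sol[OF g] by blast
  have TR: "0 < T'" "0 < R'" "0 < T" "0 < R" "T \<le> T0" "T' \<le> T0" using u(3) v(3) by (auto simp: sol_def)
  define S where "S = min T T'"
  define Q where "Q = min R R'"
  define c where "c = min d d'"
  have S: "0 < S" "S \<le> T" "S \<le> T'" "0 < Q" "Q \<le> R" "Q \<le> R'" "0 < c" "c \<le> d" "c \<le> d'" "S \<le> T0"
    using TR u(1) v(1) by (auto simp: S_def Q_def c_def)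
  have bu: "bnd c S Q u" by (rule bnd_mono[OF bnd_subset[OF u(4) S(3,6)] S(10,9)])
  have bv: "bnd c S Q v" by (rule bnd_mono[OF bnd_subset[OF v(4) S(2,5)] S(10,8)])
  note su = sol_subset[OF u(3) S(1,3,4,6)]
  obtain P f where f: "0 < P" "f holomorphic_on ball 0 P" "uniform_limit (ball 0 P) (\<lambda>t x. tlam t x * (u t x - v t x)) f (at_right 0)"
    using leading_coefficient[OF su sol_subset[OF v(3) S(1,2,4,5)] bu bv S(7)] by blast
  have P: "0 < min P Q" "min P Q \<le> Q" using f S by auto
  have ge: "g = germ (extend0 u)" unfolding u(2) by (rule germ_extend0[symmetric, OF TR(1,2)]) (use u(5) in auto)
  have l: "uniform_limit (ball 0 (min P Q)) (\<lambda>t x. tlam t x * (u t x - v t x)) f (at_right 0)"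
    by (rule uniform_limit_on_subset[OF f(3)]) auto
  have "is_U F T0 R0 \<rho>0 u0 (abs_xgerm f) g"
    unfolding v(2) is_U_iff[OF v(3,4,1,5)]
    using S(7) ge sol_subset[OF su S(1) order_refl P] bnd_subset[OF bu order_refl P(2)] l by blast
  moreover have "abs_xgerm f \<in> O0" unfolding O0_def using f by blast
  ultimately show ?thesis by blast
qed

lemma solutions_plus_U:
  assumes u0: "u0 \<in> solutions F T0 R0 \<rho>0 X1_plus"
  shows "solutions F T0 R0 \<rho>0 X1_plus = {U F T0 R0 \<rho>0 u0 \<psi> |\<psi>. \<psi> \<in> O0}"
proof -
  have U: "is_U F T0 R0 \<rho>0 u0 \<psi> (U F T0 R0 \<rho>0 u0 \<psi>)" if "\<psi> \<in> O0" for \<psi>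
    unfolding U_def by (rule theI'[OF ex1_is_U[OF u0 that]])
  have "g \<in> {U F T0 R0 \<rho>0 u0 \<psi> |\<psi>. \<psi> \<in> O0}" if g: "g \<in> solutions F T0 R0 \<rho>0 X1_plus" for g
  proof -
    obtain \<psi> where \<psi>: "\<psi> \<in> O0" "is_U F T0 R0 \<rho>0 u0 \<psi> g" using solution_is_U[OF u0 g] by blast
    have "U F T0 R0 \<rho>0 u0 \<psi> = g" unfolding U_def by (rule the1_equality[OF ex1_is_U[OF u0 \<psi>(1)] \<psi>(2)])
    then show ?thesis using \<psi>(1) by blast
  qed
  moreover have "U F T0 R0 \<rho>0 u0 \<psi> \<in> solutions F T0 R0 \<rho>0 X1_plus" if "\<psi> \<in> O0" for \<psi>
    using U[OF that] by (simp add: is_U_def)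
  ultimately show ?thesis by blast
qed

end

theorem theorem2p3:
  fixes T0 R0 \<rho>0 A \<mu> \<Lambda> B :: real and F :: rhs and m :: "real \<Rightarrow> real"
  assumes "0 < T0" and "T0 < 1" and "0 < R0" and "0 < \<rho>0"
    and A1_cont: "continuous_on (Omega T0 R0 \<rho>0) (\<lambda>(t, x, z1, z2). F t x z1 z2)"
    and A1_hol: "\<And>t. t \<in> {0..T0} \<Longrightarrow> holomorphic3_on (F t) (ball 0 R0 \<times> ball 0 \<rho>0 \<times> ball 0 \<rho>0)"
    and A2: "\<And>x. x \<in> ball 0 R0 \<Longrightarrow> F 0 x 0 0 = 0"
    and A3: "\<And>x. x \<in> ball 0 R0 \<Longrightarrow> coeff_b F 0 x = 0"
    and Re_lambda: "0 < Re (coeff_lambda F 0 0)"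
    and "0 < A" and "0 < \<mu>" and "0 < \<Lambda>" and "0 < B"
    and weight: "weight_function T0 m"
    and c1: "\<And>t x. t \<in> {0<..T0} \<Longrightarrow> x \<in> ball 0 R0 \<Longrightarrow> cmod (coeff_a F t x) \<le> A * t powr \<mu>"
    and c2: "\<And>t x. t \<in> {0<..T0} \<Longrightarrow> x \<in> ball 0 R0 \<Longrightarrow>
               cmod (coeff_lambda F t x - coeff_lambda F 0 x) \<le> \<Lambda> * m t"
    and c3: "\<And>t x. t \<in> {0<..T0} \<Longrightarrow> x \<in> ball 0 R0 \<Longrightarrow>
               cmod (coeff_b F t x) \<le> B * m t / \<bar>ln t\<bar>"
  shows "solutions F T0 R0 \<rho>0 (X1_paren \<mu>) \<noteq> {} \<and>
    (\<forall>u0 \<in> solutions F T0 R0 \<rho>0 (X1_paren \<mu>).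
       (\<forall>\<psi>\<in>O0. \<exists>!u. is_U F T0 R0 \<rho>0 u0 \<psi> u) \<and>
       solutions F T0 R0 \<rho>0 scrX1_germs = solutions F T0 R0 \<rho>0 X1_plus \<and>
       solutions F T0 R0 \<rho>0 X1_plus = {U F T0 R0 \<rho>0 u0 \<psi> |\<psi>. \<psi> \<in> O0})"
proof -
  interpret briot_bouquet T0 R0 \<rho>0 A \<mu> \<Lambda> B F m
    by unfold_locales (use assms in auto)
  show ?thesis
    using solutions_paren_nonempty solutions_paren_plus ex1_is_U solutions_scrX1 solutions_plus_U by blast
qed

end
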